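(* Let $\rho\in\mathbb{T}^{\circ}$ and assume that the Schur measure $M_{s(\rho)}$ on $\Omega=\{0,1\}^{\mathbb{Z}+\frac12}$ is $\mathfrak{S}$-quasi-invariant. Then $M_{s(\rho)}$ is perfect.
   Context: Schur measures. $\mathfrak{X}=\mathbb{Z}+\frac12$ with its usual order, $\Omega=\{0,1\}^{\mathfrak{X}}$ with product topology and Borel $\sigma$-algebra $\Sigma$ (elements identified with subsets of $\mathfrak{X}$). $\mathbb{Y}$ is the set of partitions; $\mathbb{M}(\lambda)=\{\lambda_{i}-i+\frac12: i\in\mathbb{N}\}\in\Omega$ for $\lambda\in\mathbb{Y}$. $\mathbb{T}$ is the set of $\rho=(\alpha;\beta)$ with $\alpha_{1}\ge\alpha_{2}\ge\cdots\ge0$, $\beta_{1}\ge\beta_{2}\ge\cdots\ge0$, $\sum_{j}\alpha_{j}+\sum_{j}\beta_{j}\le1$; $\mathbb{T}^{\circ}$ is the subset with $\alpha_{1}<1$ and $\beta_{1}<1$. For a symmetric function $F\in\Lambda=\mathbb{C}[p_{1},p_{2},\dots]$ ($p_{n}$ the power sums), $F(\rho)$ is its image under the algebra homomorphism $p_{1}\mapsto1$, $p_{n}\mapsto\sum_{i}\alpha_{i}^{n}+(-1)^{n-1}\sum_{i}\beta_{i}^{n}$ for $n\ge2$. $M_{s(\rho)}$ is the probability measure with $M_{s(\rho)}(\{\mathbb{M}(\lambda)\})\propto s_{\lambda}(\rho)^{2}$ ($s_{\lambda}$ the Schur functions), and giving no mass to the complement of $\mathbb{M}(\mathbb{Y})$.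 CAR algebra. $e_{x}\in\ell^{2}(\mathfrak{X})$ is $e_{x}(y)=\delta_{x,y}$, $J$ the antilinear conjugation fixing each $e_{x}$, $\mathcal{K}=\ell^{2}(\mathfrak{X})\oplus\ell^{2}(\mathfrak{X})$, $\Gamma=\begin{pmatrix}0 & J\\ J & 0\end{pmatrix}$. $\mathcal{C}(\mathcal{K},\Gamma)$ is the C$^{\ast}$-completion (for its unique C$^{\ast}$-norm) of the $\ast$-algebra generated by $B(f)$, $f\in\mathcal{K}$, linear in $f$, with $B(f)^{\ast}=B(\Gamma f)$ and $B(f)^{\ast}B(g)+B(g)B(f)^{\ast}=(f,g)_{\mathcal{K}}$ (inner products linear in the second argument). Put $a_{x}=B((0,e_{x}))$, $a_{x}^{\ast}=B((e_{x},0))$. $\mathcal{A}(\mathcal{K},\Gamma)$ is the closed subalgebra generated by all $a_{x}^{\ast}a_{y}$, $x,y\in\mathfrak{X}$. A state $\varphi$ on $\mathcal{C}(\mathcal{K},\Gamma)$ is quasi-free if $\varphi(B(f_{1})\cdots B(f_{2n+1}))=0$ and $\varphi(B(f_{1})\cdots B(f_{2n}))=(-1)^{n(n-1)/2}\sum_{\sigma}\mathrm{sgn}(\sigma)\prod_{i=1}^{n}\varphi(B(f_{\sigma(i)})B(f_{\sigma(i+n)}))$, the sum over $\sigma\in\mathfrak{S}_{2n}$ with $\sigma(1)<\cdots<\sigma(n)$ and $\sigma(i)<\sigma(i+n)$ for $1\le i\le n$. Perfectness. $\mathfrak{S}$ is the group of finite permutations of $\mathfrak{X}$, acting on $\Omega$;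 ${}^{g}M(A)=M(g^{-1}(A))$. $M$ is $\mathfrak{S}$-quasi-invariant if ${}^{g}M$ and $M$ are mutually absolutely continuous for all $g\in\mathfrak{S}$. For such a probability measure $M$, $C(\Omega)\rtimes\mathfrak{S}$ is represented on $L^{2}(\Omega,M)$ by $\mathcal{T}^{M}(F)h=Fh$ for $F\in C(\Omega)$ and $(\mathcal{T}^{M}(g)h)(\omega)=h(g^{-1}(\omega))\big(\tfrac{d\,{}^{g}M}{dM}(\omega)\big)^{1/2}$ for $g\in\mathfrak{S}$. Let $d_{x}\in C(\Omega)$, $d_{x}(\omega)=1-2\omega(x)$. The wreath product $\mathfrak{S}\wr\mathbb{Z}_{2}$ is generated by $\mathfrak{S}$ and commuting involutions $\varepsilon_{x}$, $x\in\mathfrak{X}$, with $g\varepsilon_{x}g^{-1}=\varepsilon_{g(x)}$; $C(\Omega)\rtimes\mathfrak{S}\cong C^{\ast}[\mathfrak{S}\wr\mathbb{Z}_{2}]$ (C$^{\ast}$-completion of the group algebra) via $d_{x}\mapsto\varepsilon_{x}$ and the identity on $\mathfrak{S}$. With $\eta_{x}=1-2a_{x}^{\ast}a_{x}$, $\eta_{(x,y)}=\prod_{x<z<y}\eta_{z}$ and $s_{x,y}$ the transposition of $x,y$, there is a surjective morphism $p:C^{\ast}[\mathfrak{S}\wr\mathbb{Z}_{2}]\to\mathcal{A}(\mathcal{K},\Gamma)$ given by $p(\varepsilon_{x})=\eta_{x}$ and, for $x<y$, $$p(s_{x,y})=\tfrac{1+\eta_{x}\eta_{y}}{2}+\tfrac{1+\eta_{x}\eta_{y}+(1-\eta_{x}\eta_{y})\eta_{(x,y)}}{2}\,(a_{x}^{\ast}a_{y}+a_{y}^{\ast}a_{x}),$$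 and (known fact) $\mathcal{T}^{M}$ factors through $p$; thus $\mathcal{T}^{M}$ is viewed as a representation of $\mathcal{A}(\mathcal{K},\Gamma)$. Put $\varphi^{M}(A)=(\mathbb{I},\mathcal{T}^{M}(A)\mathbb{I})_{L^{2}(\Omega,M)}$, $A\in\mathcal{A}(\mathcal{K},\Gamma)$, with $\mathbb{I}$ the constant function $1$. $M$ is perfect if there is a quasi-free state $\varphi$ on $\mathcal{C}(\mathcal{K},\Gamma)$ with $\varphi^{M}=\varphi|_{\mathcal{A}(\mathcal{K},\Gamma)}$. *)

theory Defs
  imports
    "HOL-Analysis.Analysis"
    "HOL-Combinatorics.Permutations"
    "HOL-Library.Poly_Mapping"
    "Jordan_Normal_Form.Determinant"
begin

section \<open>The half-integers and the configuration space\<close>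

typedef half_int = "{x :: real. \<exists>k :: int. x = of_int k + 1/2}"
  morphisms real_of_half half_of_real
  by blast

instantiation half_int :: linorder
begin

definition less_eq_half_int :: "half_int \<Rightarrow> half_int \<Rightarrow> bool" where
  "less_eq_half_int x y \<longleftrightarrow> real_of_half x \<le> real_of_half y"

definition less_half_int :: "half_int \<Rightarrow> half_int \<Rightarrow> bool" where
  "less_half_int x y \<longleftrightarrow> real_of_half x < real_of_half y"

instance
  by standard (auto simp: less_eq_half_int_def less_half_int_def real_of_half_inject)

end

text \<open>
  A configuration is an element of \<open>{0,1}\<close> to the power \<open>\<int> + 1/2\<close>, with \<open>True\<close> for an occupied
  site. As a function type over the discrete space \<^typ>\<open>bool\<close> it carries the product topology of
  \<^theory>\<open>HOL-Analysis.Function_Topology\<close>, and \<^const>\<open>borel\<close> is the Borel sigma-algebra of that topology.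
\<close>

type_synonym config = "half_int \<Rightarrow> bool"

definition occ :: "config \<Rightarrow> half_int \<Rightarrow> complex" where
  "occ \<omega> x = (if \<omega> x then 1 else 0)"


section \<open>Partitions\<close>

text \<open>Partitions are indexed from 0: \<open>lam i\<close> is the part with number \<open>i + 1\<close>.\<close>

definition partitions :: "(nat \<Rightarrow> nat) set" where
  "partitions = {lam. decseq lam \<and> finite {i. lam i \<noteq> 0}}"

definition part_length :: "(nat \<Rightarrow> nat) \<Rightarrow> nat" where
  "part_length lam = card {i. lam i \<noteq> 0}"

definition maya :: "(nat \<Rightarrow> nat) \<Rightarrow> config" where
  "maya lam = (\<lambda>x. \<exists>i. real_of_half x = real (lam i) - real (i + 1) + 1/2)"


section \<open>Symmetric functions\<close>

text \<open>
  The algebra \<open>\<complex>[p\<^sub>1, p\<^sub>2, \<dots>]\<close>: exponent vectors are finitely supported functions on \<^typ>\<open>nat\<close>, and the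
  variable with index \<open>k\<close> is the power sum \<open>p\<close> with subscript \<open>k + 1\<close>.
\<close>

type_synonym symfun = "(nat \<Rightarrow>\<^sub>0 nat) \<Rightarrow>\<^sub>0 complex"

definition symfun_const :: "complex \<Rightarrow> symfun" where
  "symfun_const c = Poly_Mapping.single 0 c"

definition power_sum :: "nat \<Rightarrow> symfun" where
  "power_sum n = Poly_Mapping.single (Poly_Mapping.single (n - 1) 1) 1"

text \<open>
  Complete homogeneous symmetric functions, defined by
  \<open>(\<Sum>n. h\<^sub>n t\<^sup>n) = exp (\<Sum>n\<ge>1. p\<^sub>n t\<^sup>n / n)\<close>; comparing coefficients in the logarithmic derivative gives
  the recursion \<open>(n + 1) h\<^sub>n\<^sub>+\<^sub>1 = (\<Sum>k\<le>n. p\<^sub>k\<^sub>+\<^sub>1 h\<^sub>n\<^sub>-\<^sub>k)\<close>.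
\<close>

fun complete_hom :: "nat \<Rightarrow> symfun" where
  "complete_hom 0 = 1"
| "complete_hom (Suc n) =
     symfun_const (1 / of_nat (Suc n)) * (\<Sum>k\<le>n. power_sum (k + 1) * complete_hom (n - k))"

definition complete_hom_int :: "int \<Rightarrow> symfun" where
  "complete_hom_int k = (if k < 0 then 0 else complete_hom (nat k))"

text \<open>The Schur function \<open>s\<^bsub>lam\<^esub> = det (h\<^bsub>lam_i - i + j\<^esub>)\<close>.\<close>

definition schur :: "(nat \<Rightarrow> nat) \<Rightarrow> symfun" where
  "schur lam = Determinant.det (Matrix.mat (part_length lam) (part_length lam)
     (\<lambda>(i, j). complete_hom_int (int (lam i) - int i + int j)))"


section \<open>The Thoma simplex, specializations and Schur measures\<close>

text \<open>The sequences \<open>\<alpha>\<close> and \<open>\<beta>\<close> are indexed from 0 as well.\<close>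

definition thoma :: "((nat \<Rightarrow> real) \<times> (nat \<Rightarrow> real)) set" where
  "thoma = {(\<alpha>, \<beta>). decseq \<alpha> \<and> (\<forall>i. 0 \<le> \<alpha> i) \<and> decseq \<beta> \<and> (\<forall>i. 0 \<le> \<beta> i) \<and>
     summable \<alpha> \<and> summable \<beta> \<and> suminf \<alpha> + suminf \<beta> \<le> 1}"

definition thoma_open :: "((nat \<Rightarrow> real) \<times> (nat \<Rightarrow> real)) set" where
  "thoma_open = {(\<alpha>, \<beta>) \<in> thoma. \<alpha> 0 < 1 \<and> \<beta> 0 < 1}"

definition power_sum_value :: "(nat \<Rightarrow> real) \<times> (nat \<Rightarrow> real) \<Rightarrow> nat \<Rightarrow> complex" where
  "power_sum_value \<rho> n = (if n = 1 then 1 else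
     complex_of_real (suminf (\<lambda>i. fst \<rho> i ^ n) + (-1) ^ (n - 1) * suminf (\<lambda>i. snd \<rho> i ^ n)))"

text \<open>
  The algebra homomorphism \<open>F \<mapsto> F(\<rho>)\<close>: substitute \<open>power_sum_value \<rho> n\<close> for each power sum \<open>p\<^sub>n\<close>.
\<close>

definition specialize :: "(nat \<Rightarrow> real) \<times> (nat \<Rightarrow> real) \<Rightarrow> symfun \<Rightarrow> complex" where
  "specialize \<rho> F = (\<Sum>m\<in>Poly_Mapping.keys F. Poly_Mapping.lookup F m *
     (\<Prod>k\<in>Poly_Mapping.keys m. power_sum_value \<rho> (k + 1) ^ Poly_Mapping.lookup m k))"

text \<open>The numbers \<open>specialize \<rho> (schur lam)\<close> are real, so \<^const>\<open>Re\<close> only changes the type here.\<close>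

definition schur_weight :: "(nat \<Rightarrow> real) \<times> (nat \<Rightarrow> real) \<Rightarrow> (nat \<Rightarrow> nat) \<Rightarrow> real" where
  "schur_weight \<rho> lam = Re ((specialize \<rho> (schur lam))\<^sup>2)"

text \<open>
  The image under \<^const>\<open>maya\<close> of the normalized weights on the countable set of partitions.
\<close>

definition schur_measure :: "(nat \<Rightarrow> real) \<times> (nat \<Rightarrow> real) \<Rightarrow> config measure" where
  "schur_measure \<rho> =
     distr (density (count_space partitions)
              (\<lambda>lam. ennreal (schur_weight \<rho> lam / (\<Sum>\<^sub>\<infinity>\<mu>\<in>partitions. schur_weight \<rho> \<mu>))))
           borel maya"


section \<open>Unital C*-algebras\<close>

class cstar_algebra = real_normed_algebra_1 + banach +
  fixes scaleC :: "complex \<Rightarrow> 'a \<Rightarrow> 'a"  (infixr "*\<^sub>C" 75)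
    and adj :: "'a \<Rightarrow> 'a"
  assumes scaleC_add_right: "c *\<^sub>C (x + y) = c *\<^sub>C x + c *\<^sub>C y"
    and scaleC_add_left: "(c + d) *\<^sub>C x = c *\<^sub>C x + d *\<^sub>C x"
    and scaleC_scaleC: "c *\<^sub>C (d *\<^sub>C x) = (c * d) *\<^sub>C x"
    and scaleR_scaleC: "r *\<^sub>R x = complex_of_real r *\<^sub>C x"
    and mult_scaleC_left: "(c *\<^sub>C x) * y = c *\<^sub>C (x * y)"
    and mult_scaleC_right: "x * (c *\<^sub>C y) = c *\<^sub>C (x * y)"
    and norm_scaleC: "norm (c *\<^sub>C x) = cmod c * norm x"
    and adj_add: "adj (x + y) = adj x + adj y"
    and adj_scaleC: "adj (c *\<^sub>C x) = cnj c *\<^sub>C adj x"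
    and adj_mult: "adj (x * y) = adj y * adj x"
    and adj_adj: "adj (adj x) = x"
    and norm_adj_mult: "norm (adj x * x) = (norm x)\<^sup>2"

definition is_closed_subalgebra :: "'c::cstar_algebra set \<Rightarrow> bool" where
  "is_closed_subalgebra S \<longleftrightarrow> closed S \<and> 1 \<in> S \<and>
     (\<forall>a\<in>S. \<forall>b\<in>S. a + b \<in> S \<and> a * b \<in> S) \<and> (\<forall>a\<in>S. \<forall>c. c *\<^sub>C a \<in> S)"

definition closed_subalgebra_generated :: "'c::cstar_algebra set \<Rightarrow> 'c set" where
  "closed_subalgebra_generated G = \<Inter>{S. is_closed_subalgebra S \<and> G \<subseteq> S}"

definition state :: "('c::cstar_algebra \<Rightarrow> complex) \<Rightarrow> bool" where
  "state \<phi> \<longleftrightarrow> (\<forall>a b. \<phi> (a + b) = \<phi> a + \<phi> b) \<and> (\<forall>c a. \<phi> (c *\<^sub>C a) = c * \<phi> a) \<and>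
     (\<forall>a. \<phi> (adj a * a) \<in> \<real>\<^sub>\<ge>\<^sub>0) \<and> \<phi> 1 = 1"


section \<open>The self-dual CAR algebra\<close>

definition ell2 :: "(half_int \<Rightarrow> complex) set" where
  "ell2 = {f. (\<lambda>x. (cmod (f x))\<^sup>2) summable_on UNIV}"

definition ell2_inner :: "(half_int \<Rightarrow> complex) \<Rightarrow> (half_int \<Rightarrow> complex) \<Rightarrow> complex" where
  "ell2_inner f g = (\<Sum>\<^sub>\<infinity>x. cnj (f x) * g x)"

type_synonym kvec = "(half_int \<Rightarrow> complex) \<times> (half_int \<Rightarrow> complex)"

definition K_space :: "kvec set" where
  "K_space = ell2 \<times> ell2"

definition K_inner :: "kvec \<Rightarrow> kvec \<Rightarrow> complex" where
  "K_inner f g = ell2_inner (fst f) (fst g) + ell2_inner (snd f) (snd g)"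

definition K_lincomb :: "complex \<Rightarrow> kvec \<Rightarrow> complex \<Rightarrow> kvec \<Rightarrow> kvec" where
  "K_lincomb c f d g = ((\<lambda>x. c * fst f x + d * fst g x), (\<lambda>x. c * snd f x + d * snd g x))"

definition basis_vec :: "half_int \<Rightarrow> half_int \<Rightarrow> complex" where
  "basis_vec x = (\<lambda>y. if x = y then 1 else 0)"

definition conj_J :: "(half_int \<Rightarrow> complex) \<Rightarrow> half_int \<Rightarrow> complex" where
  "conj_J f = (\<lambda>x. cnj (f x))"

definition Gam :: "kvec \<Rightarrow> kvec" where
  "Gam f = (conj_J (snd f), conj_J (fst f))"

text \<open>
  \<open>car_algebra B\<close> says that the C*-algebra \<^typ>\<open>'c\<close> together with \<open>B\<close> is the CAR algebra
  \<open>\<C>(\<K>, \<Gamma>)\<close>. The *-algebra defined by the generators and relations below is simple, hence embeds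
  into \<^typ>\<open>'c\<close>, and it has exactly one C*-norm; so a C*-algebra in which elements satisfying the
  relations generate a dense subalgebra is its C*-completion, and the pair is determined up to
  isomorphism. The dense subalgebra is closed under \<^const>\<open>adj\<close> because its generators are permuted
  by \<^const>\<open>adj\<close>. Only the values of \<open>B\<close> on \<^const>\<open>K_space\<close> are relevant.
\<close>

definition car_algebra :: "(kvec \<Rightarrow> 'c::cstar_algebra) \<Rightarrow> bool" where
  "car_algebra B \<longleftrightarrow>
     (\<forall>f\<in>K_space. \<forall>g\<in>K_space. \<forall>c d. B (K_lincomb c f d g) = c *\<^sub>C B f + d *\<^sub>C B g) \<and>
     (\<forall>f\<in>K_space. adj (B f) = B (Gam f)) \<and>
     (\<forall>f\<in>K_space. \<forall>g\<in>K_space. adj (B f) * B g + B g * adj (B f) = K_inner f g *\<^sub>C 1) \<and>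
     closed_subalgebra_generated (B ` K_space) = UNIV"

definition ann :: "(kvec \<Rightarrow> 'c::cstar_algebra) \<Rightarrow> half_int \<Rightarrow> 'c" where
  "ann B x = B ((\<lambda>_. 0), basis_vec x)"

definition cre :: "(kvec \<Rightarrow> 'c::cstar_algebra) \<Rightarrow> half_int \<Rightarrow> 'c" where
  "cre B x = B (basis_vec x, (\<lambda>_. 0))"

text \<open>The unital closed subalgebra \<open>\<A>(\<K>, \<Gamma>)\<close>.\<close>

definition A_algebra :: "(kvec \<Rightarrow> 'c::cstar_algebra) \<Rightarrow> 'c set" where
  "A_algebra B = closed_subalgebra_generated {cre B x * ann B y | x y. True}"

definition pairing_perms :: "nat \<Rightarrow> (nat \<Rightarrow> nat) set" where
  "pairing_perms n = {\<sigma>. \<sigma> permutes {1..2*n} \<and> strict_mono_on {1..n} \<sigma> \<and>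
     (\<forall>i\<in>{1..n}. \<sigma> i < \<sigma> (i + n))}"

text \<open>Products of field operators are ordered, so they are written with \<^const>\<open>prod_list\<close>.\<close>

definition quasi_free_state :: "(kvec \<Rightarrow> 'c::cstar_algebra) \<Rightarrow> ('c \<Rightarrow> complex) \<Rightarrow> bool" where
  "quasi_free_state B \<phi> \<longleftrightarrow> state \<phi> \<and>
     (\<forall>n. \<forall>f :: nat \<Rightarrow> kvec. (\<forall>i. f i \<in> K_space) \<longrightarrow>
        \<phi> (prod_list (map (\<lambda>i. B (f i)) [1..<2*n+2])) = 0 \<and>
        \<phi> (prod_list (map (\<lambda>i. B (f i)) [1..<2*n+1])) =
          (-1) ^ (n * (n - 1) div 2) *
          (\<Sum>\<sigma>\<in>pairing_perms n. of_int (sign \<sigma>) *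
             (\<Prod>i=1..n. \<phi> (B (f (\<sigma> i)) * B (f (\<sigma> (i + n)))))))"


section \<open>Quasi-invariance and the action on square-integrable functions\<close>

definition finite_perms :: "(half_int \<Rightarrow> half_int) set" where
  "finite_perms = {g. bij g \<and> finite {x. g x \<noteq> x}}"

text \<open>On subsets of \<open>\<int> + 1/2\<close> this is \<open>\<omega> \<mapsto> g(\<omega>)\<close>.\<close>

definition act :: "(half_int \<Rightarrow> half_int) \<Rightarrow> config \<Rightarrow> config" where
  "act g \<omega> = (\<lambda>x. \<omega> (inv_into UNIV g x))"

definition translate :: "(half_int \<Rightarrow> half_int) \<Rightarrow> config measure \<Rightarrow> config measure" where
  "translate g M = distr M borel (act g)"

definition quasi_invariant :: "config measure \<Rightarrow> bool" where
  "quasi_invariant M \<longleftrightarrow> (\<forall>g\<in>finite_perms.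
     absolutely_continuous M (translate g M) \<and> absolutely_continuous (translate g M) M)"

text \<open>
  The Hilbert space \<open>L\<^sup>2(\<Omega>, M)\<close> is represented by square-integrable functions; two of them stand for
  the same vector iff they agree almost everywhere.
\<close>

definition L2 :: "config measure \<Rightarrow> (config \<Rightarrow> complex) set" where
  "L2 M = {h \<in> borel_measurable M. integrable M (\<lambda>\<omega>. (cmod (h \<omega>))\<^sup>2)}"

definition L2_inner :: "config measure \<Rightarrow> (config \<Rightarrow> complex) \<Rightarrow> (config \<Rightarrow> complex) \<Rightarrow> complex" where
  "L2_inner M h k = (LINT \<omega>|M. cnj (h \<omega>) * k \<omega>)"

definition L2_norm :: "config measure \<Rightarrow> (config \<Rightarrow> complex) \<Rightarrow> real" where
  "L2_norm M h = sqrt (LINT \<omega>|M. (cmod (h \<omega>))\<^sup>2)"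

definition L2_eq :: "config measure \<Rightarrow> (config \<Rightarrow> complex) \<Rightarrow> (config \<Rightarrow> complex) \<Rightarrow> bool" where
  "L2_eq M h k \<longleftrightarrow> (AE \<omega> in M. h \<omega> = k \<omega>)"

definition bounded_operator_L2 ::
    "config measure \<Rightarrow> ((config \<Rightarrow> complex) \<Rightarrow> config \<Rightarrow> complex) \<Rightarrow> bool" where
  "bounded_operator_L2 M P \<longleftrightarrow>
     (\<forall>h\<in>L2 M. P h \<in> L2 M) \<and>
     (\<forall>h\<in>L2 M. \<forall>k\<in>L2 M. L2_eq M h k \<longrightarrow> L2_eq M (P h) (P k)) \<and>
     (\<forall>h\<in>L2 M. \<forall>k\<in>L2 M. \<forall>c d.
        L2_eq M (P (\<lambda>\<omega>. c * h \<omega> + d * k \<omega>)) (\<lambda>\<omega>. c * P h \<omega> + d * P k \<omega>)) \<and>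
     (\<exists>C. \<forall>h\<in>L2 M. L2_norm M (P h) \<le> C * L2_norm M h)"

text \<open>Unital *-representations of a *-subalgebra \<open>S\<close> of a C*-algebra on \<open>L\<^sup>2(\<Omega>, M)\<close>.\<close>

definition representation_L2 :: "'c::cstar_algebra set \<Rightarrow> config measure \<Rightarrow>
    ('c \<Rightarrow> (config \<Rightarrow> complex) \<Rightarrow> config \<Rightarrow> complex) \<Rightarrow> bool" where
  "representation_L2 S M T \<longleftrightarrow>
     (\<forall>a\<in>S. bounded_operator_L2 M (T a)) \<and>
     (\<forall>h\<in>L2 M. L2_eq M (T 1 h) h) \<and>
     (\<forall>a\<in>S. \<forall>b\<in>S. \<forall>h\<in>L2 M. L2_eq M (T (a + b) h) (\<lambda>\<omega>. T a h \<omega> + T b h \<omega>)) \<and>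
     (\<forall>a\<in>S. \<forall>c. \<forall>h\<in>L2 M. L2_eq M (T (c *\<^sub>C a) h) (\<lambda>\<omega>. c * T a h \<omega>)) \<and>
     (\<forall>a\<in>S. \<forall>b\<in>S. \<forall>h\<in>L2 M. L2_eq M (T (a * b) h) (T a (T b h))) \<and>
     (\<forall>a\<in>S. \<forall>h\<in>L2 M. \<forall>k\<in>L2 M. L2_inner M h (T (adj a) k) = L2_inner M (T a h) k)"

definition TM_fun :: "(config \<Rightarrow> complex) \<Rightarrow> (config \<Rightarrow> complex) \<Rightarrow> config \<Rightarrow> complex" where
  "TM_fun F h = (\<lambda>\<omega>. F \<omega> * h \<omega>)"

definition TM_perm :: "config measure \<Rightarrow> (half_int \<Rightarrow> half_int) \<Rightarrow>
    (config \<Rightarrow> complex) \<Rightarrow> config \<Rightarrow> complex" where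
  "TM_perm M g h = (\<lambda>\<omega>. h (act (inv_into UNIV g) \<omega>) *
     complex_of_real (sqrt (enn2real (RN_deriv M (translate g M) \<omega>))))"

definition d_fun :: "half_int \<Rightarrow> config \<Rightarrow> complex" where
  "d_fun x = (\<lambda>\<omega>. 1 - 2 * occ \<omega> x)"


section \<open>Perfectness\<close>

definition eta :: "(kvec \<Rightarrow> 'c::cstar_algebra) \<Rightarrow> half_int \<Rightarrow> 'c" where
  "eta B x = 1 - 2 * (cre B x * ann B x)"

definition eta_between :: "(kvec \<Rightarrow> 'c::cstar_algebra) \<Rightarrow> half_int \<Rightarrow> half_int \<Rightarrow> 'c" where
  "eta_between B x y = prod_list (map (eta B) (sorted_list_of_set {x<..<y}))"

text \<open>The images \<open>p(\<epsilon>\<^sub>x)\<close> and, for \<open>x < y\<close>, \<open>p(s\<^bsub>x,y\<^esub>)\<close> of the generators of the wreath product.\<close>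

definition p_eps :: "(kvec \<Rightarrow> 'c::cstar_algebra) \<Rightarrow> half_int \<Rightarrow> 'c" where
  "p_eps B x = eta B x"

definition p_transp :: "(kvec \<Rightarrow> 'c::cstar_algebra) \<Rightarrow> half_int \<Rightarrow> half_int \<Rightarrow> 'c" where
  "p_transp B x y =
     (1/2) *\<^sub>R (1 + eta B x * eta B y) +
     (1/2) *\<^sub>R (1 + eta B x * eta B y + (1 - eta B x * eta B y) * eta_between B x y) *
       (cre B x * ann B y + cre B y * ann B x)"

text \<open>
  \<open>TM_factor B M T\<close>: \<open>T\<close> is the representation \<open>\<T>\<^sup>M\<close> viewed as a representation of \<open>\<A>(\<K>, \<Gamma>)\<close>, that
  is, \<open>T \<circ> p = \<T>\<^sup>M\<close>. Both sides are *-representations of the C*-algebra of the wreath product, so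
  they coincide iff they agree on its generators \<open>\<epsilon>\<^sub>x\<close>, which corresponds to \<^const>\<open>d_fun\<close>, and
  \<open>s\<^bsub>x,y\<^esub>\<close>. Since \<open>p\<close> is surjective, \<open>T\<close> is determined (almost everywhere) on \<^const>\<open>A_algebra\<close>.
\<close>

definition TM_factor :: "(kvec \<Rightarrow> 'c::cstar_algebra) \<Rightarrow> config measure \<Rightarrow>
    ('c \<Rightarrow> (config \<Rightarrow> complex) \<Rightarrow> config \<Rightarrow> complex) \<Rightarrow> bool" where
  "TM_factor B M T \<longleftrightarrow>
     representation_L2 (A_algebra B) M T \<and>
     (\<forall>x. \<forall>h\<in>L2 M. L2_eq M (T (p_eps B x) h) (TM_fun (d_fun x) h)) \<and>
     (\<forall>x y. x < y \<longrightarrow> (\<forall>h\<in>L2 M.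
        L2_eq M (T (p_transp B x y) h) (TM_perm M (Transposition.transpose x y) h)))"

definition phi_M :: "config measure \<Rightarrow> ('c \<Rightarrow> (config \<Rightarrow> complex) \<Rightarrow> config \<Rightarrow> complex) \<Rightarrow>
    'c \<Rightarrow> complex" where
  "phi_M M T a = L2_inner M (\<lambda>_. 1) (T a (\<lambda>_. 1))"

definition perfect :: "(kvec \<Rightarrow> 'c::cstar_algebra) \<Rightarrow> config measure \<Rightarrow> bool" where
  "perfect B M \<longleftrightarrow>
     (\<exists>T. TM_factor B M T \<and> (\<exists>\<phi>. quasi_free_state B \<phi> \<and> (\<forall>a\<in>A_algebra B. phi_M M T a = \<phi> a)))"

end

theory Submission
  imports Defs
begin

text \<open>
The masses of the Schur measure are the squared coefficients of a vector of the fermionic Fock space. That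
vector is annihilated by so many field operators that it is a vacuum for another choice of creation and
annihilation operators, and vacuum states are quasi-free.

Let \<open>\<Psi>\<close> be the vector whose coefficient at the configuration of a partition is its Schur value, divided
by the root of the normalizing constant Z of the measure. The Schur values are square-summable
(\<open>schur_value_summable\<close>) and nonnegative (\<open>schur_value_nonneg\<close>), so the coefficients of \<open>\<Psi>\<close> are the
roots of the masses of the Schur measure. By quasi-invariance all of them are positive
(\<open>root_mass_pos\<close>), and multiplication with \<open>\<Psi>\<close> identifies the square-integrable functions with the
charge 0 sector of the Fock space, and the constant function 1 with \<open>\<Psi>\<close>. In the Fock representation the
Jordan-Wigner signs cancel in \<open>p_transp\<close>, which therefore acts by exchanging two sites
(\<open>op_p_transp\<close>). Hence the representation of the group algebra on the functions is the Fock
representation of the charge-preserving subalgebra (\<open>rep_TM_factor\<close>), and the functional attached to the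
measure is the restriction of the vector state of \<open>\<Psi>\<close> (\<open>phi_M_rep\<close>).

It remains to see that the vector state of \<open>\<Psi>\<close> is quasi-free. Let H be the generating series of the
complete homogeneous functions at \<open>\<rho>\<close>, with coefficients h, and G = 1 / H, with coefficients g. The
Jacobi-Trudi determinants satisfy two families of linear relations, which say that \<open>\<Psi>\<close> is annihilated
by the combinations of creation operators with coefficients h, upwards from a negative site, and by the
combinations of annihilation operators with coefficients g, downwards from a positive site
(\<open>kernel_up\<close>, \<open>kernel_down\<close>). These operators together with their adjoints span a dense subspace of all
the \<open>B f\<close>. This is a Wiener-Hopf argument on bounded sequences (\<open>bounded_sequence_vanishes\<close>); it needs
summable coefficients for both H and G, which is the case because all \<open>\<alpha> i\<close> and \<open>\<beta> i\<close> are less than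
1 (\<open>coef_decay\<close>). An annihilator of \<open>\<Psi>\<close> can be anticommuted through any product to the right, its adjoint
vanishes at the left; by density this yields Wick's recursion for all \<open>B f\<close> (\<open>wick_step\<close>), which is the
expansion of a Pfaffian along its first row (\<open>pairing_sum_Suc\<close>, \<open>wick_pairing_sum\<close>).

The algebra is only given as an abstract C*-algebra generated by elements with the canonical
anticommutation relations, so the Fock representation is constructed from within. The projections
\<open>P X\<close> onto the emptiness of finitely many modes approximate the vacuum, expectations with respect to them
converge, and the C*-identity bounds the resulting matrix elements by the norm (\<open>vexp_lc_bound\<close>).
\<close>

section \<open>Complete homogeneous coefficients from power sums\<close>

text \<open>Newton's identities: if \<open>p k\<close> is the k-th power sum of some variables, the values
  are their complete homogeneous functions, that is, the coefficients of the exponential of the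
  series with coefficients \<open>p k / k\<close>.\<close>

fun newton :: "(nat \<Rightarrow> real) \<Rightarrow> nat \<Rightarrow> real" where
  "newton p 0 = 1"
| "newton p (Suc n) = (\<Sum>k\<le>n. p (k + 1) * newton p (n - k)) / real (Suc n)"

lemma newton_unique:
  assumes "f 0 = 1" and "\<And>n. real (Suc n) * f (Suc n) = (\<Sum>k\<le>n. p (k + 1) * f (n - k))"
  shows "f n = newton p n"
proof (induction n rule: less_induct)
  case (less n)
  show ?case
  proof (cases n)
    case (Suc m)
    have "(\<Sum>k\<le>m. p (k + 1) * f (m - k)) = (\<Sum>k\<le>m. p (k + 1) * newton p (m - k))"
      by (intro sum.cong refl) (simp add: less Suc)
    then show ?thesis using assms(2)[of m] Suc by (simp add: field_simps del: of_nat_Suc)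
  qed (simp add: assms(1))
qed

lemma newton_fps_deriv:
  "fps_deriv (Abs_fps (newton p)) = Abs_fps (\<lambda>k. p (k + 1)) * Abs_fps (newton p)"
proof (rule fps_ext)
  fix n
  show "fps_nth (fps_deriv (Abs_fps (newton p))) n
    = fps_nth (Abs_fps (\<lambda>k. p (k + 1)) * Abs_fps (newton p)) n"
    by (simp add: fps_mult_nth atLeast0AtMost del: of_nat_Suc)
qed

lemma newton_fps_unique:
  assumes "fps_deriv F = Abs_fps (\<lambda>k. p (k + 1)) * F" and "fps_nth F 0 = 1"
  shows "fps_nth F n = newton p n"
proof (rule newton_unique)
  fix n
  have "fps_nth (fps_deriv F) n = fps_nth (Abs_fps (\<lambda>k. p (k + 1)) * F) n" by (simp only: assms)
  then show "real (Suc n) * fps_nth F (Suc n) = (\<Sum>k\<le>n. p (k + 1) * fps_nth F (n - k))"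
    by (simp add: fps_mult_nth atLeast0AtMost)
qed (fact assms)

text \<open>The generating series F is the solution of F' = P F with F(0) = 1, where P is the series of the
  shifted power sums. Hence adding power sums multiplies generating series.\<close>

lemma newton_add:
  "newton (\<lambda>n. p n + q n) n = (\<Sum>k\<le>n. newton p k * newton q (n - k))"
proof -
  let ?F = "Abs_fps (newton p) * Abs_fps (newton q)"
  have P: "Abs_fps (\<lambda>k. p (k + 1) + q (k + 1)) = Abs_fps (\<lambda>k. p (k + 1)) + Abs_fps (\<lambda>k. q (k + 1))"
    by (rule fps_ext) simp
  have "fps_nth ?F n = newton (\<lambda>n. p n + q n) n"
  proof (rule newton_fps_unique)
    show "fps_deriv ?F = Abs_fps (\<lambda>k. p (k + 1) + q (k + 1)) * ?F"
      unfolding fps_deriv_mult newton_fps_deriv P by (simp only: ring_distribs mult_ac add_ac)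
  qed simp
  then show ?thesis by (simp add: fps_mult_nth atLeast0AtMost)
qed

lemma newton_zero: "newton (\<lambda>_. 0) n = (if n = 0 then 1 else 0)"
  by (cases n) auto

lemma newton_inverse: "(\<Sum>k\<le>n. newton p k * newton (\<lambda>j. - p j) (n - k)) = (if n = 0 then 1 else 0)"
  using newton_add[of p "\<lambda>j. - p j" n] by (simp add: newton_zero)

text \<open>One ordinary variable: the generating series is 1 / (1 - a z).\<close>

lemma newton_geometric: "newton (\<lambda>n. a ^ n) n = a ^ n"
proof (rule newton_unique[symmetric])
  fix n
  have "(\<Sum>k\<le>n. a ^ (k + 1) * a ^ (n - k)) = (\<Sum>k\<le>n. a ^ Suc n)"
    by (intro sum.cong refl) (simp flip: power_add)
  then show "real (Suc n) * a ^ Suc n = (\<Sum>k\<le>n. a ^ (k + 1) * a ^ (n - k))" by simp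
qed simp

text \<open>One dual variable: the generating series is 1 + b z.\<close>

lemma newton_linear:
  "newton (\<lambda>n. (-1) ^ (n - 1) * b ^ n) n = (if n = 0 then 1 else if n = 1 then b else 0)"
proof (rule newton_unique[symmetric])
  fix n :: nat
  show "real (Suc n) * (if Suc n = 0 then 1 else if Suc n = 1 then b else 0)
    = (\<Sum>k\<le>n. (-1) ^ (k + 1 - 1) * b ^ (k + 1) * (if n - k = 0 then 1 else if n - k = 1 then b else 0))"
  proof (cases n)
    case (Suc m)
    have "(\<Sum>k\<le>n. (-1) ^ (k + 1 - 1) * b ^ (k + 1) * (if n - k = 0 then 1 else if n - k = 1 then b else 0))
      = (\<Sum>k\<in>{n, m}. (-1) ^ k * b ^ (k + 1) * (if n - k = 0 then 1 else if n - k = 1 then b else 0))"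
      by (rule sum.mono_neutral_cong_right) (auto simp: Suc)
    then show ?thesis by (simp add: Suc)
  qed simp
qed simp

lemma newton_tendsto:
  assumes "\<And>k. k > 0 \<Longrightarrow> (\<lambda>N. P N k) \<longlonglongrightarrow> p k"
  shows "(\<lambda>N. newton (P N) n) \<longlonglongrightarrow> newton p n"
proof (induction n rule: less_induct)
  case (less n)
  show ?case
  proof (cases n)
    case (Suc m)
    show ?thesis unfolding Suc newton.simps
      by (intro tendsto_divide tendsto_sum tendsto_mult assms tendsto_const) (auto simp: less Suc)
  qed simp
qed

text \<open>Let \<open>A n\<close> be the convolution of the powers of r with the absolute values of the
  coefficients. Newton's identity bounds n times the n-th coefficient by \<open>A n\<close>, so
  that \<open>A (n + 1) \<le> (r + 1 / n) * A n\<close>, and the ratio test makes \<open>A\<close>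
  summable because \<open>r < 1\<close>.\<close>

lemma newton_decay:
  assumes r: "0 \<le> r" "r < 1" and p: "\<And>j. \<bar>p (Suc j)\<bar> \<le> r ^ j"
  shows "summable (\<lambda>k. real k * \<bar>newton p k\<bar>)"
proof -
  define A where "A n = (\<Sum>k<n. r ^ k * \<bar>newton p (n - 1 - k)\<bar>)" for n
  have A0: "0 \<le> A n" for n unfolding A_def using r by (intro sum_nonneg) auto
  have A_Suc: "A (Suc n) = \<bar>newton p n\<bar> + r * A n" for n
    unfolding A_def sum.lessThan_Suc_shift sum_distrib_left by (simp add: mult.assoc)
  have N: "real n * \<bar>newton p n\<bar> \<le> A n" for n
  proof (cases n)
    case (Suc m)
    have "real n * \<bar>newton p n\<bar> = \<bar>\<Sum>k\<le>m. p (k + 1) * newton p (m - k)\<bar>"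
      by (simp add: Suc abs_mult del: of_nat_Suc)
    also have "\<dots> \<le> (\<Sum>k\<le>m. \<bar>p (k + 1)\<bar> * \<bar>newton p (m - k)\<bar>)"
      by (rule order_trans[OF sum_abs]) (simp add: abs_mult)
    also have "\<dots> \<le> (\<Sum>k\<le>m. r ^ k * \<bar>newton p (m - k)\<bar>)"
      using p by (intro sum_mono mult_right_mono) auto
    finally show ?thesis unfolding A_def Suc by (simp add: lessThan_Suc_atMost)
  qed (simp add: A0)
  \<comment> \<open>From index M on the ratio r + 1 / n is at most (1 + r) / 2.\<close>
  obtain M :: nat where M: "M > 0" "1 / real M < (1 - r) / 2"
    using real_arch_inverse[of "(1 - r) / 2"] r by (auto simp: inverse_eq_divide)
  have "summable A"
  proof (rule summable_ratio_test[of "(1 + r) / 2" M])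
    show "(1 + r) / 2 < 1" using r by simp
    fix n assume n: "M \<le> n"
    have n0: "0 < n" using n M by simp
    have "1 / real n \<le> 1 / real M" using M n by (simp add: frac_le)
    then have q: "1 / real n + r \<le> (1 + r) / 2" using M by argo
    have "A (Suc n) \<le> A n / n + r * A n"
      using N[of n] n0 by (simp add: A_Suc field_simps)
    also have "\<dots> = (1 / real n + r) * A n" by (simp add: field_simps)
    also have "\<dots> \<le> (1 + r) / 2 * A n" using q A0 by (rule mult_right_mono)
    finally show "norm (A (Suc n)) \<le> (1 + r) / 2 * norm (A n)" using A0 by simp
  qed
  then show ?thesis by (rule summable_comparison_test') (use N in auto)
qed

lemma summable_of_summable_index:
  fixes f :: "nat \<Rightarrow> real"
  assumes "summable (\<lambda>k. real k * \<bar>f k\<bar>)"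
  shows "summable (\<lambda>k. \<bar>f k\<bar>)"
proof (rule summable_comparison_test'[OF assms, of 1])
  fix n :: nat assume "1 \<le> n"
  then show "norm \<bar>f n\<bar> \<le> real n * \<bar>f n\<bar>" by (simp add: mult_le_cancel_right1)
qed

section \<open>Determinants as functions of their rows\<close>

text \<open>The rows form a total function, so that a row is replaced by a function update.\<close>

definition detf :: "nat \<Rightarrow> (nat \<Rightarrow> nat \<Rightarrow> real) \<Rightarrow> real" where
  "detf n R = Determinant.det (Matrix.mat n n (\<lambda>(i, j). R i j))"

lemma detf_cong: "(\<And>i j. i < n \<Longrightarrow> j < n \<Longrightarrow> R i j = R' i j) \<Longrightarrow> detf n R = detf n R'"
  unfolding detf_def by (rule arg_cong[of _ _ Determinant.det]) (auto intro: cong_mat)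

lemma detf_leibniz:
  "detf n R = (\<Sum>p\<in>{p. p permutes {0..<n}}. of_int (sign p) * (\<Prod>i\<in>{0..<n}. R i (p i)))"
  unfolding detf_def by (subst det_def'[of _ n]) (auto intro!: sum.cong prod.cong dest: permutes_in_image)

lemma detf_expand_row:
  assumes "k < n"
  obtains c where "\<And>r. detf n (R(k := r)) = (\<Sum>j<n. r j * c j)"
proof
  fix r
  let ?A = "Matrix.mat n n (\<lambda>(i, j). (R(k := r)) i j)"
  let ?B = "Matrix.mat n n (\<lambda>(i, j). R i j)"
  have "mat_delete ?A k j = mat_delete ?B k j" for j
    unfolding mat_delete_def by (rule cong_mat) (use assms in auto)
  then have "cofactor ?A k j = cofactor ?B k j" for j by (simp add: cofactor_def)
  then show "detf n (R(k := r)) = (\<Sum>j<n. r j * cofactor ?B k j)"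
    unfolding detf_def by (subst laplace_expansion_row[of _ n k]) (use assms in \<open>auto simp del: fun_upd_apply\<close>, simp)
qed

lemma detf_row_sum:
  assumes "k < n" and "\<And>j. j < n \<Longrightarrow> R k j = (\<Sum>s\<in>S. a s * r s j)"
  shows "detf n R = (\<Sum>s\<in>S. a s * detf n (R(k := r s)))"
proof -
  obtain c where c: "\<And>r. detf n (R(k := r)) = (\<Sum>j<n. r j * c j)" using detf_expand_row[OF assms(1)] by blast
  have "detf n R = (\<Sum>j<n. R k j * c j)" using c[of "R k"] by simp
  also have "\<dots> = (\<Sum>j<n. \<Sum>s\<in>S. a s * (r s j * c j))"
    by (intro sum.cong refl) (simp add: assms(2) sum_distrib_right mult.assoc)
  also have "\<dots> = (\<Sum>s\<in>S. a s * detf n (R(k := r s)))"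
    unfolding c sum_distrib_left by (rule sum.swap)
  finally show ?thesis .
qed

lemma detf_row_add:
  assumes "k < n" and "\<And>j. j < n \<Longrightarrow> R k j = a j + c * b j"
  shows "detf n R = detf n (R(k := a)) + c * detf n (R(k := b))"
proof -
  have "detf n R = (\<Sum>s\<in>{False, True}. (if s then c else 1) * detf n (R(k := (if s then b else a))))"
    by (rule detf_row_sum) (use assms in auto)
  then show ?thesis by simp
qed

lemma detf_row_zero:
  assumes "k < n" and "\<And>j. j < n \<Longrightarrow> R k j = 0"
  shows "detf n R = 0"
  using detf_row_sum[of k n R "\<lambda>_. 0" "\<lambda>_ _. 0" "{}"] assms by simp

lemma detf_equal_rows:
  assumes "i < n" "k < n" "i \<noteq> k" "\<And>j. j < n \<Longrightarrow> R i j = R k j"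
  shows "detf n R = 0"
  unfolding detf_def by (rule det_identical_rows[of _ n i k]) (use assms in \<open>auto intro!: eq_vecI\<close>)

section \<open>Totally positive sequences\<close>

text \<open>Only the minors with strictly decreasing row positions and consecutive columns are required to
  be nonnegative. For \<open>x i = lam i - i - 1\<close> this minor is the Jacobi-Trudi
  determinant of the partition lam.\<close>

definition totally_positive :: "(int \<Rightarrow> real) \<Rightarrow> bool" where
  "totally_positive h \<longleftrightarrow> (\<forall>n x. (\<forall>i j. i < j \<and> j < n \<longrightarrow> x j < x i) \<longrightarrow>
     0 \<le> detf n (\<lambda>i j. h (x i + int j + 1)))"

text \<open>The generating series is multiplied by 1 + b z. The rows are changed from the old sequence to
  the new one beginning at the top. By linearity, the changed row at \<open>x k\<close> is an old
  row at \<open>x k\<close> plus b times an old row at \<open>x k - 1\<close>. Since row \<open>k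
  + 1\<close> is still old, either the positions stay strictly decreasing after this shift or two
  rows coincide.\<close>

lemma totally_positive_shift:
  assumes h: "totally_positive h" and b: "0 \<le> b" and h': "\<And>m. h' m = h m + b * h (m - 1)"
  shows "totally_positive h'"
  unfolding totally_positive_def
proof (intro allI impI)
  fix n and x :: "nat \<Rightarrow> int"
  \<comment> \<open>The hybrid matrix: the first k rows are new, the others old.\<close>
  define R where "R k x = (\<lambda>i j. (if i < k then h' else h) (x i + int j + 1))" for k and x :: "nat \<Rightarrow> int"
  have *: "0 \<le> detf n (R k x)" if "k \<le> n" "\<forall>i j. i < j \<and> j < n \<longrightarrow> x j < x i" for k x
    using that
  proof (induction k arbitrary: x)
    case 0
    then show ?case using h by (simp add: R_def totally_positive_def)
  next
    case (Suc k)
    have k: "k < n" using Suc by simp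
    have "detf n (R (Suc k) x) = detf n ((R (Suc k) x)(k := (\<lambda>j. h (x k + int j + 1))))
        + b * detf n ((R (Suc k) x)(k := (\<lambda>j. h (x k - 1 + int j + 1))))"
      by (rule detf_row_add[OF k]) (simp add: R_def h' algebra_simps)
    moreover have "(R (Suc k) x)(k := (\<lambda>j. h (x k + int j + 1))) = R k x"
      by (auto simp: R_def fun_eq_iff)
    moreover have "0 \<le> detf n ((R (Suc k) x)(k := (\<lambda>j. h (x k - 1 + int j + 1))))"
    proof (cases "Suc k < n \<and> x (Suc k) = x k - 1")
      case True
      then have "detf n ((R (Suc k) x)(k := (\<lambda>j. h (x k - 1 + int j + 1)))) = 0"
        by (intro detf_equal_rows[of k _ "Suc k"]) (auto simp: R_def)
      then show ?thesis by simp
    next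
      case False
      have "(R (Suc k) x)(k := (\<lambda>j. h (x k - 1 + int j + 1))) = R k (x(k := x k - 1))"
        by (auto simp: R_def fun_eq_iff)
      moreover have "\<forall>i j. i < j \<and> j < n \<longrightarrow> (x(k := x k - 1)) j < (x(k := x k - 1)) i"
      proof (intro allI impI)
        fix i j assume ij: "i < j \<and> j < n"
        have "x j < x k - 1" if "i = k"
        proof (cases "j = Suc k")
          case True
          then have "x j < x k" "x j \<noteq> x k - 1" using False Suc(3) ij that by auto
          then show ?thesis by simp
        next
          case j: False
          then have "x j < x (Suc k)" "x (Suc k) < x k" using Suc(3) ij that by auto
          then show ?thesis by simp
        qed
        moreover have "x j < x i" using Suc(3) ij by blast
        ultimately show "(x(k := x k - 1)) j < (x(k := x k - 1)) i" using ij by auto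
      qed
      ultimately show ?thesis using Suc.IH k by simp
    qed
    moreover have "0 \<le> detf n (R k x)" using Suc by simp
    ultimately show ?case using b by simp
  qed
  assume "\<forall>i j. i < j \<and> j < n \<longrightarrow> x j < x i"
  then have "0 \<le> detf n (R n x)" by (intro *) auto
  also have "detf n (R n x) = detf n (\<lambda>i j. h' (x i + int j + 1))" by (rule detf_cong) (simp add: R_def)
  finally show "0 \<le> detf n (\<lambda>i j. h' (x i + int j + 1))" .
qed

text \<open>The generating series is divided by 1 - a z. Now the shifted row produced by linearity is a new
  one, so the rows are changed from the bottom upwards: while row k is treated, row \<open>k +
  1\<close> is already new. The position \<open>x k\<close> then walks down, leaving behind a
  nonnegative determinant with an old row at each step, until row k either coincides with row
  \<open>k + 1\<close> or, at the bottom, leaves the support of the sequence.\<close>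

lemma totally_positive_geometric:
  assumes h: "totally_positive h" and a: "0 \<le> a" and h': "\<And>m. h' m = h m + a * h' (m - 1)"
    and neg: "\<And>m. m < 0 \<Longrightarrow> h' m = 0"
  shows "totally_positive h'"
  unfolding totally_positive_def
proof (intro allI impI)
  fix n and x :: "nat \<Rightarrow> int"
  \<comment> \<open>The hybrid matrix: the first k rows are old, the others new.\<close>
  define R where "R k x = (\<lambda>i j. (if i < k then h else h') (x i + int j + 1))" for k and x :: "nat \<Rightarrow> int"
  have *: "0 \<le> detf n (R (n - m) x)" if "m \<le> n" "\<forall>i j. i < j \<and> j < n \<longrightarrow> x j < x i" for m x
    using that
  proof (induction m arbitrary: x)
    case 0
    have "detf n (R n x) = detf n (\<lambda>i j. h (x i + int j + 1))" by (rule detf_cong) (simp add: R_def)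
    then show ?case using h 0 by (simp add: totally_positive_def)
  next
    case (Suc m)
    define k where "k = n - Suc m"
    have k: "k < n" and nm: "n - m = Suc k" using Suc.prems(1) by (auto simp: k_def)
    \<comment> \<open>The position at which row k vanishes or meets the row below it.\<close>
    define low where "low x = (if Suc k < n then x (Suc k) else - int n - 1)" for x :: "nat \<Rightarrow> int"
    have "0 \<le> detf n (R k x)" using Suc.prems(2)
    proof (induction "nat (x k - low x)" arbitrary: x rule: less_induct)
      case (less x)
      show ?case
      proof (cases "Suc k < n \<or> - int n - 1 < x k")
        case False
        then have "detf n (R k x) = 0"
          by (intro detf_row_zero[OF k]) (auto simp: R_def intro!: neg)
        then show ?thesis by simp
      next
        case True
        then have low: "low x < x k" using less.prems k by (auto simp: low_def)
        have "detf n (R k x) = detf n ((R k x)(k := (\<lambda>j. h (x k + int j + 1))))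
          + a * detf n ((R k x)(k := (\<lambda>j. h' (x k - 1 + int j + 1))))"
          by (rule detf_row_add[OF k]) (use h'[of "x k + int _ + 1"] in \<open>simp add: R_def algebra_simps\<close>)
        moreover have "(R k x)(k := (\<lambda>j. h (x k + int j + 1))) = R (Suc k) x"
          by (auto simp: R_def fun_eq_iff)
        moreover have "0 \<le> detf n ((R k x)(k := (\<lambda>j. h' (x k - 1 + int j + 1))))"
        proof (cases "Suc k < n \<and> x (Suc k) = x k - 1")
          case True
          then have "detf n ((R k x)(k := (\<lambda>j. h' (x k - 1 + int j + 1)))) = 0"
            by (intro detf_equal_rows[of k _ "Suc k"]) (auto simp: R_def)
          then show ?thesis by simp
        next
          case False
          have "(R k x)(k := (\<lambda>j. h' (x k - 1 + int j + 1))) = R k (x(k := x k - 1))"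
            by (auto simp: R_def fun_eq_iff)
          moreover have "\<forall>i j. i < j \<and> j < n \<longrightarrow> (x(k := x k - 1)) j < (x(k := x k - 1)) i"
          proof (intro allI impI)
            fix i j assume ij: "i < j \<and> j < n"
            have "x j < x k - 1" if "i = k"
            proof (cases "j = Suc k")
              case True
              then have "x j < x k" "x j \<noteq> x k - 1" using False less.prems ij that by auto
              then show ?thesis by simp
            next
              case j: False
              then have "x j < x (Suc k)" "x (Suc k) < x k" using less.prems ij that by auto
              then show ?thesis by simp
            qed
            moreover have "x j < x i" using less.prems ij by blast
            ultimately show "(x(k := x k - 1)) j < (x(k := x k - 1)) i" using ij by auto
          qed
          moreover have "nat ((x(k := x k - 1)) k - low (x(k := x k - 1))) < nat (x k - low x)"
            using low by (auto simp: low_def)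
          ultimately show ?thesis using less.hyps by simp
        qed
        moreover have "0 \<le> detf n (R (Suc k) x)" using Suc.IH Suc.prems(1) less.prems nm by simp
        ultimately show ?thesis using a by simp
      qed
    qed
    then show ?case by (simp add: k_def)
  qed
  assume "\<forall>i j. i < j \<and> j < n \<longrightarrow> x j < x i"
  then have "0 \<le> detf n (R (n - n) x)" by (intro *) auto
  then show "0 \<le> detf n (\<lambda>i j. h' (x i + int j + 1))" by (simp add: R_def)
qed

text \<open>Either some row is zero, or all positions lie in \<open>{- n..- 1}\<close>; being strictly
  decreasing they are then -1, ..., -n, and the matrix is the identity.\<close>

lemma totally_positive_delta: "totally_positive (\<lambda>m. if m = 0 then 1 else 0)"
  unfolding totally_positive_def
proof (intro allI impI)
  fix n and x :: "nat \<Rightarrow> int"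
  assume x: "\<forall>i j. i < j \<and> j < n \<longrightarrow> x j < x i"
  let ?R = "\<lambda>i j. if x i + int j + 1 = 0 then 1 else 0 :: real"
  show "0 \<le> detf n ?R"
  proof (cases "\<exists>i<n. \<forall>j<n. x i \<noteq> - int j - 1")
    case True
    then obtain i where "i < n" "\<forall>j<n. x i \<noteq> - int j - 1" by blast
    then have "detf n ?R = 0" by (intro detf_row_zero[of i]) force+
    then show ?thesis by simp
  next
    case False
    have up: "x i \<le> - int i - 1" if "i < n" for i using that
    proof (induction i)
      case 0
      then show ?case using False by force
    next
      case (Suc i)
      have "x (Suc i) < x i" using Suc x by auto
      then show ?case using Suc by simp
    qed
    have lo: "x (n - Suc i) \<ge> - int n + int i" if "i < n" for i using that
    proof (induction i)
      case 0
      then have "n - 1 < n" by simp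
      then obtain j where "j < n" "x (n - 1) = - int j - 1" using False by blast
      then show ?case by simp
    next
      case (Suc i)
      have "x (n - Suc i) < x (n - Suc (Suc i))" using Suc x by auto
      then show ?case using Suc by simp
    qed
    have eq: "x i = - int i - 1" if "i < n" for i
      using up[OF that] lo[of "n - Suc i"] that by (simp add: of_nat_diff)
    have "Matrix.mat n n (\<lambda>(i, j). ?R i j) = 1\<^sub>m n"
      by (rule eq_matI) (auto simp: eq)
    then show ?thesis by (simp add: detf_def)
  qed
qed

lemma totally_positive_tendsto:
  assumes "\<And>N. totally_positive (H N)" and "\<And>m. (\<lambda>N. H N m) \<longlonglongrightarrow> h m"
  shows "totally_positive h"
  unfolding totally_positive_def
proof (intro allI impI)
  fix n and x :: "nat \<Rightarrow> int"
  assume x: "\<forall>i j. i < j \<and> j < n \<longrightarrow> x j < x i"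
  have "(\<lambda>N. detf n (\<lambda>i j. H N (x i + int j + 1))) \<longlonglongrightarrow> detf n (\<lambda>i j. h (x i + int j + 1))"
    unfolding detf_leibniz by (intro tendsto_intros assms)
  then show "0 \<le> detf n (\<lambda>i j. h (x i + int j + 1))"
    by (rule LIMSEQ_le_const) (use assms(1) x in \<open>auto simp: totally_positive_def\<close>)
qed

declare newton.simps(2) [simp del]

lemma int_trichotomy: obtains "(m :: int) < 0" | "m = 0" | n where "m = int (Suc n)"
proof (cases "0 < m")
  case True
  then have "m = int (Suc (nat (m - 1)))" by simp
  then show ?thesis by (rule that(3))
next
  case False
  then have "m < 0 \<or> m = 0" by linarith
  then show ?thesis using that(1,2) by blast
qed

section \<open>Specializations and Schur values\<close>

lemma specialize_add: "specialize \<rho> (F + G) = specialize \<rho> F + specialize \<rho> G"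
  unfolding specialize_def by (rule setsum_keys_plus_distrib) (simp_all add: algebra_simps)

lemma specialize_single:
  "specialize \<rho> (Poly_Mapping.single m c) =
     c * (\<Prod>k\<in>Poly_Mapping.keys m. power_sum_value \<rho> (k + 1) ^ Poly_Mapping.lookup m k)"
  by (simp add: specialize_def)

lemma monomial_value_add:
  fixes v :: "nat \<Rightarrow> complex" and m l :: "nat \<Rightarrow>\<^sub>0 nat"
  shows "(\<Prod>k\<in>Poly_Mapping.keys (m + l). v k ^ Poly_Mapping.lookup (m + l) k) =
    (\<Prod>k\<in>Poly_Mapping.keys m. v k ^ Poly_Mapping.lookup m k) *
    (\<Prod>k\<in>Poly_Mapping.keys l. v k ^ Poly_Mapping.lookup l k)"
proof -
  let ?K = "Poly_Mapping.keys m \<union> Poly_Mapping.keys l"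
  have *: "(\<Prod>k\<in>Poly_Mapping.keys q. v k ^ Poly_Mapping.lookup q k) = (\<Prod>k\<in>?K. v k ^ Poly_Mapping.lookup q k)"
    if "Poly_Mapping.keys q \<subseteq> ?K" for q :: "nat \<Rightarrow>\<^sub>0 nat"
    using that by (intro prod.mono_neutral_left) (auto simp: in_keys_iff)
  have "Poly_Mapping.keys (m + l) \<subseteq> ?K" by (rule Poly_Mapping.keys_add)
  then show ?thesis
    unfolding *[of "m + l", OF \<open>_ \<subseteq> ?K\<close>] *[of m, OF Un_upper1] *[of l, OF Un_upper2]
    by (simp add: Poly_Mapping.lookup_add power_add prod.distrib)
qed

lemma specialize_zero [simp]: "specialize \<rho> 0 = 0"
  by (simp add: specialize_def)

lemma specialize_sum: "specialize \<rho> (sum f A) = (\<Sum>a\<in>A. specialize \<rho> (f a))"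
  by (induction A rule: infinite_finite_induct) (auto simp: specialize_add)

lemma sum_of_singles: "(\<Sum>m\<in>Poly_Mapping.keys F. Poly_Mapping.single m (Poly_Mapping.lookup F m)) = F"
  by (rule poly_mapping_eqI)
    (simp add: Poly_Mapping.lookup_sum lookup_single when_def in_keys_iff)

lemma specialize_mult: "specialize \<rho> (F * G) = specialize \<rho> F * specialize \<rho> G"
proof -
  have "F * G = (\<Sum>m\<in>Poly_Mapping.keys F. \<Sum>l\<in>Poly_Mapping.keys G.
      Poly_Mapping.single (m + l) (Poly_Mapping.lookup F m * Poly_Mapping.lookup G l))"
    by (simp only: sum_product[symmetric] mult_single[symmetric] sum_of_singles)
  also have "specialize \<rho> \<dots> = specialize \<rho> F * specialize \<rho> G"
    unfolding specialize_sum specialize_single monomial_value_add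
    by (simp add: specialize_def sum_product mult_ac)
  finally show ?thesis .
qed

lemma specialize_hom: "comm_ring_hom (specialize \<rho>)"
proof
  show "specialize \<rho> 1 = 1"
    unfolding single_one[symmetric] specialize_single by simp
qed (simp_all add: specialize_add specialize_mult)

definition rho_power :: "(nat \<Rightarrow> real) \<times> (nat \<Rightarrow> real) \<Rightarrow> nat \<Rightarrow> real" where
  "rho_power \<rho> n = (if n = 1 then 1 else
     suminf (\<lambda>i. fst \<rho> i ^ n) + (-1) ^ (n - 1) * suminf (\<lambda>i. snd \<rho> i ^ n))"

definition zero_ext :: "(nat \<Rightarrow> real) \<Rightarrow> int \<Rightarrow> real" where
  "zero_ext f m = (if m < 0 then 0 else f (nat m))"

text \<open>The complete homogeneous functions at \<rho>; the companion \<open>gcoef\<close>, with all power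
  sums negated, collects the coefficients of the reciprocal of their generating series.\<close>

definition hcoef :: "(nat \<Rightarrow> real) \<times> (nat \<Rightarrow> real) \<Rightarrow> nat \<Rightarrow> real" where
  "hcoef \<rho> = newton (rho_power \<rho>)"

definition gcoef :: "(nat \<Rightarrow> real) \<times> (nat \<Rightarrow> real) \<Rightarrow> nat \<Rightarrow> real" where
  "gcoef \<rho> = newton (\<lambda>n. - rho_power \<rho> n)"

lemma specialize_complete_hom: "specialize \<rho> (complete_hom n) = complex_of_real (hcoef \<rho> n)"
proof (induction n rule: less_induct)
  case (less n)
  interpret comm_ring_hom "specialize \<rho>" by (rule specialize_hom)
  have p: "specialize \<rho> (power_sum (k + 1)) = complex_of_real (rho_power \<rho> (k + 1))" for k
    by (simp add: power_sum_def specialize_single power_sum_value_def rho_power_def)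
  show ?case
  proof (cases n)
    case (Suc m)
    have "specialize \<rho> (complete_hom n) = (1 / of_nat (Suc m)) *
        (\<Sum>k\<le>m. specialize \<rho> (power_sum (k + 1)) * specialize \<rho> (complete_hom (m - k)))"
      by (simp add: Suc specialize_mult specialize_sum symfun_const_def specialize_single)
    also have "(\<Sum>k\<le>m. specialize \<rho> (power_sum (k + 1)) * specialize \<rho> (complete_hom (m - k)))
      = complex_of_real (\<Sum>k\<le>m. rho_power \<rho> (k + 1) * hcoef \<rho> (m - k))"
      unfolding of_real_sum by (intro sum.cong refl) (simp only: p of_real_mult, subst less, auto simp: Suc)
    finally show ?thesis by (simp add: Suc hcoef_def newton.simps del: of_nat_Suc)
  qed (simp add: hcoef_def)
qed

text \<open>The Jacobi-Trudi determinant with arbitrary size and arbitrary row positions, so that rows can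
  be inserted, deleted and repeated without leaving its domain.\<close>

definition sdet :: "(nat \<Rightarrow> real) \<times> (nat \<Rightarrow> real) \<Rightarrow> nat \<Rightarrow> (nat \<Rightarrow> int) \<Rightarrow> real" where
  "sdet \<rho> n x = detf n (\<lambda>i j. zero_ext (hcoef \<rho>) (x i + int j + 1))"

text \<open>The site m stands for the half-integer m + 1/2.\<close>

definition part_sites :: "(nat \<Rightarrow> nat) \<Rightarrow> nat \<Rightarrow> int" where
  "part_sites lam i = int (lam i) - int i - 1"

definition schur_value :: "(nat \<Rightarrow> real) \<times> (nat \<Rightarrow> real) \<Rightarrow> (nat \<Rightarrow> nat) \<Rightarrow> real" where
  "schur_value \<rho> lam = sdet \<rho> (part_length lam) (part_sites lam)"

lemma specialize_schur: "specialize \<rho> (schur lam) = complex_of_real (schur_value \<rho> lam)"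
proof -
  interpret comm_ring_hom "specialize \<rho>" by (rule specialize_hom)
  have "specialize \<rho> (complete_hom_int m) = complex_of_real (zero_ext (hcoef \<rho>) m)" for m
    by (simp add: complete_hom_int_def zero_ext_def specialize_complete_hom)
  then show ?thesis
    unfolding schur_def hom_det[symmetric] schur_value_def sdet_def detf_def of_real_hom.hom_det[symmetric]
    by (intro arg_cong[of _ _ Determinant.det] eq_matI) (auto simp: part_sites_def algebra_simps)
qed

lemma schur_weight_eq: "schur_weight \<rho> lam = (schur_value \<rho> lam)\<^sup>2"
  by (simp add: schur_weight_def specialize_schur flip: of_real_power)

lemma partition_support:
  assumes "lam \<in> partitions"
  shows "{i. lam i \<noteq> 0} = {..<part_length lam}"
proof -
  have d: "decseq lam" and f: "finite {i. lam i \<noteq> 0}" using assms by (auto simp: partitions_def)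
  have down: "lam i \<noteq> 0" if "lam j \<noteq> 0" "i \<le> j" for i j
    using d that by (metis decseqD le_zero_eq)
  define n where "n = (LEAST n. lam n = 0)"
  have "\<exists>n. lam n = 0"
  proof (rule ccontr)
    assume "\<nexists>n. lam n = 0"
    then have "{i. lam i \<noteq> 0} = UNIV" by auto
    then show False using f by simp
  qed
  then have ex: "lam n = 0" unfolding n_def by (rule LeastI_ex)
  have "lam i \<noteq> 0 \<longleftrightarrow> i < n" for i
    using ex down[of i n] not_less_Least[of i "\<lambda>n. lam n = 0", folded n_def] by (cases "i < n") auto
  then have "{i. lam i \<noteq> 0} = {..<n}" by auto
  then show ?thesis by (simp add: part_length_def)
qed

text \<open>If \<open>lam n = 0\<close>, the last row of the matrix of size \<open>n + 1\<close> is the last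
  unit vector, and expanding along it gives the matrix of size n.\<close>

lemma sdet_stable:
  assumes "lam \<in> partitions" "part_length lam \<le> n"
  shows "sdet \<rho> n (part_sites lam) = schur_value \<rho> lam"
  using assms(2)
proof (induction n rule: dec_induct)
  case (step n)
  let ?M = "Matrix.mat (Suc n) (Suc n) (\<lambda>(i, j). zero_ext (hcoef \<rho>) (part_sites lam i + int j + 1))"
  have "n \<notin> {i. lam i \<noteq> 0}" unfolding partition_support[OF assms(1)] using step(1) by simp
  then have l0: "lam n = 0" by simp
  have entry: "?M $$ (n, j) = (if j = n then 1 else 0)" if "j < Suc n" for j
    using that by (simp add: l0 part_sites_def zero_ext_def hcoef_def)
  have "Determinant.det ?M = (\<Sum>j<Suc n. ?M $$ (n, j) * cofactor ?M n j)"
    by (rule laplace_expansion_row) auto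
  also have "\<dots> = (\<Sum>j<Suc n. if n = j then cofactor ?M n n else 0)"
    by (intro sum.cong refl) (simp only: lessThan_iff entry, auto)
  also have "\<dots> = cofactor ?M n n" by (subst sum.delta') (simp_all only: finite_lessThan lessThan_iff lessI if_True)
  also have "\<dots> = Determinant.det (mat_delete ?M n n)" by (simp only: cofactor_def) simp
  also have "mat_delete ?M n n = Matrix.mat n n (\<lambda>(i, j). zero_ext (hcoef \<rho>) (part_sites lam i + int j + 1))"
    by (rule eq_matI) (auto simp: mat_delete_def)
  finally show ?case using step.IH by (simp add: sdet_def detf_def)
qed (simp only: schur_value_def)

lemma part_sites_strict:
  assumes "lam \<in> partitions" "i < j"
  shows "part_sites lam j < part_sites lam i"
proof -
  have "lam j \<le> lam i" using assms by (auto simp: partitions_def decseq_def)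
  then show ?thesis using assms(2) by (simp add: part_sites_def)
qed

section \<open>Nonnegativity of Schur values\<close>

lemma totally_positive_add_linear:
  assumes "totally_positive (zero_ext (newton p))" "0 \<le> b"
  shows "totally_positive (zero_ext (newton (\<lambda>n. p n + (-1) ^ (n - 1) * b ^ n)))"
proof (rule totally_positive_shift[OF assms])
  fix m :: int
  have eq: "newton (\<lambda>n. p n + (-1) ^ (n - 1) * b ^ n) n
    = (\<Sum>k\<le>n. newton (\<lambda>n. (-1) ^ (n - 1) * b ^ n) k * newton p (n - k))" for n
    using newton_add[of "\<lambda>n. (-1) ^ (n - 1) * b ^ n" p n] by (simp add: add.commute)
  have step: "newton (\<lambda>n. p n + (-1) ^ (n - 1) * b ^ n) (Suc n) = newton p (Suc n) + b * newton p n" for n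
    unfolding eq newton_linear sum.atMost_Suc_shift by (simp add: sum.atMost_shift)
  show "zero_ext (newton (\<lambda>n. p n + (-1) ^ (n - 1) * b ^ n)) m
    = zero_ext (newton p) m + b * zero_ext (newton p) (m - 1)"
  proof (cases m rule: int_trichotomy)
    case (3 n)
    then have "nat m = Suc n" "nat (m - 1) = n" "\<not> m < 0" "\<not> m - 1 < 0" by simp_all
    then show ?thesis using step[of n] by (simp add: zero_ext_def)
  qed (simp_all add: zero_ext_def)
qed

lemma totally_positive_add_geometric:
  assumes "totally_positive (zero_ext (newton p))" "0 \<le> a"
  shows "totally_positive (zero_ext (newton (\<lambda>n. p n + a ^ n)))"
proof (rule totally_positive_geometric[OF assms])
  fix m :: int
  have eq: "newton (\<lambda>n. p n + a ^ n) n = (\<Sum>k\<le>n. a ^ k * newton p (n - k))" for n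
    using newton_add[of "\<lambda>n. a ^ n" p n] by (simp add: add.commute newton_geometric)
  have step: "newton (\<lambda>n. p n + a ^ n) (Suc n) = newton p (Suc n) + a * newton (\<lambda>n. p n + a ^ n) n" for n
    unfolding eq sum.atMost_Suc_shift by (simp add: sum_distrib_left mult.assoc)
  show "zero_ext (newton (\<lambda>n. p n + a ^ n)) m
    = zero_ext (newton p) m + a * zero_ext (newton (\<lambda>n. p n + a ^ n)) (m - 1)"
  proof (cases m rule: int_trichotomy)
    case (3 n)
    then have "nat m = Suc n" "nat (m - 1) = n" "\<not> m < 0" "\<not> m - 1 < 0" by simp_all
    then show ?thesis using step[of n] by (simp add: zero_ext_def)
  qed (simp_all add: zero_ext_def)
qed (simp add: zero_ext_def)

lemma thoma_D:
  assumes "\<rho> \<in> thoma"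
  shows "decseq (fst \<rho>)" "decseq (snd \<rho>)" "\<And>i. 0 \<le> fst \<rho> i" "\<And>i. 0 \<le> snd \<rho> i"
    "summable (fst \<rho>)" "summable (snd \<rho>)" "suminf (fst \<rho>) + suminf (snd \<rho>) \<le> 1"
  using assms by (auto simp: thoma_def)

lemma power_suminf_bound:
  fixes a :: "nat \<Rightarrow> real"
  assumes "summable a" "\<And>i. 0 \<le> a i" "\<And>i. a i \<le> r" 
  shows "summable (\<lambda>i. a i ^ Suc n)" "suminf (\<lambda>i. a i ^ Suc n) \<le> r ^ n * suminf a"
proof -
  have le: "a i ^ Suc n \<le> r ^ n * a i" for i
    using mult_left_mono[OF power_mono[OF assms(3)[of i] assms(2)[of i], of n] assms(2)[of i]]
    by (simp add: mult.commute)
  have s: "summable (\<lambda>i. r ^ n * a i)" by (rule summable_mult[OF assms(1)])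
  show S: "summable (\<lambda>i. a i ^ Suc n)"
    by (rule summable_comparison_test'[OF s]) (use le assms(2) in simp)
  have "suminf (\<lambda>i. a i ^ Suc n) \<le> suminf (\<lambda>i. r ^ n * a i)" by (rule suminf_le[OF le S s])
  then show "suminf (\<lambda>i. a i ^ Suc n) \<le> r ^ n * suminf a" by (simp only: suminf_mult[OF assms(1)])
qed

text \<open>Let \<open>c \<ge> 0\<close> be the defect of the sum of all \<open>\<alpha>\<close> and
  \<open>\<beta>\<close> from 1. The generating series is the limit of the products of the factors
  1 / (1 - \<open>\<alpha> i\<close> z) and 1 + \<open>\<beta> i\<close> z for \<open>i <
  N\<close> and of N factors 1 + (c / N) z. Each factor preserves total positivity. The last ones
  contribute c to the first power sum and, in the limit, nothing to the others; this accounts for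
  the convention that the first power sum is 1.\<close>

lemma totally_positive_hcoef:
  assumes \<rho>: "\<rho> \<in> thoma"
  shows "totally_positive (zero_ext (hcoef \<rho>))"
proof -
  note T = thoma_D[OF \<rho>]
  define c where "c = 1 - (suminf (fst \<rho>) + suminf (snd \<rho>))"
  have c: "0 \<le> c" using T by (simp add: c_def)
  \<comment> \<open>The power sums belonging to the N-th product.\<close>
  define P where "P N n = (\<Sum>i<N. fst \<rho> i ^ n) + (\<Sum>i<N. (-1) ^ (n - 1) * snd \<rho> i ^ n)
    + (\<Sum>i<N. (-1) ^ (n - 1) * (c / real N) ^ n)" for N n :: nat
  have "totally_positive (zero_ext (newton (\<lambda>n. \<Sum>i<M. fst \<rho> i ^ n)))" for M
  proof (induction M)
    case 0
    have "zero_ext (newton (\<lambda>n. 0)) = (\<lambda>m. if m = 0 then 1 else 0)"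
      by (auto simp: zero_ext_def newton_zero fun_eq_iff)
    then show ?case using totally_positive_delta by simp
  next
    case (Suc M)
    then show ?case using totally_positive_add_geometric[of "\<lambda>n. \<Sum>i<M. fst \<rho> i ^ n" "fst \<rho> M"] T by simp
  qed
  then have a: "totally_positive (zero_ext (newton (\<lambda>n. \<Sum>i<N. fst \<rho> i ^ n)))" for N .
  have b: "totally_positive (zero_ext (newton (\<lambda>n. (\<Sum>i<N. fst \<rho> i ^ n) +
     (\<Sum>i<M. (-1) ^ (n - 1) * snd \<rho> i ^ n))))" for N M
  proof (induction M)
    case (Suc M)
    have "totally_positive (zero_ext (newton (\<lambda>n. (\<Sum>i<N. fst \<rho> i ^ n) +
        (\<Sum>i<M. (-1) ^ (n - 1) * snd \<rho> i ^ n) + (-1) ^ (n - 1) * snd \<rho> M ^ n)))"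
      by (rule totally_positive_add_linear[OF Suc T(4)])
    then show ?case by (simp only: sum.lessThan_Suc add.assoc)
  qed (simp add: a)
  have "totally_positive (zero_ext (newton (\<lambda>n. (\<Sum>i<N. fst \<rho> i ^ n) +
     (\<Sum>i<N. (-1) ^ (n - 1) * snd \<rho> i ^ n) + (\<Sum>i<M. (-1) ^ (n - 1) * (c / real N) ^ n))))" for N M :: nat
  proof (induction M)
    case (Suc M)
    have "totally_positive (zero_ext (newton (\<lambda>n. (\<Sum>i<N. fst \<rho> i ^ n) +
        (\<Sum>i<N. (-1) ^ (n - 1) * snd \<rho> i ^ n) + (\<Sum>i<M. (-1) ^ (n - 1) * (c / real N) ^ n) +
        (-1) ^ (n - 1) * (c / real N) ^ n)))"
      by (rule totally_positive_add_linear[OF Suc]) (use c in simp)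
    then show ?case by (simp only: sum.lessThan_Suc add.assoc)
  qed (use b in simp)
  then have tp: "totally_positive (zero_ext (newton (P N)))" for N
    unfolding P_def .
  have "(\<lambda>N. P N k) \<longlonglongrightarrow> rho_power \<rho> k" if "k > 0" for k
  proof -
    have le: "fst \<rho> i \<le> fst \<rho> 0" "snd \<rho> i \<le> snd \<rho> 0" for i using T(1,2) by (auto simp: decseq_def)
    define j where "j = k - 1"
    have k: "k = Suc j" using that by (simp add: j_def)
    have 1: "(\<lambda>N. \<Sum>i<N. fst \<rho> i ^ k) \<longlonglongrightarrow> suminf (\<lambda>i. fst \<rho> i ^ k)"
      unfolding k by (intro summable_LIMSEQ power_suminf_bound(1)) (use T le in auto)
    have 2: "(\<lambda>N. \<Sum>i<N. snd \<rho> i ^ k) \<longlonglongrightarrow> suminf (\<lambda>i. snd \<rho> i ^ k)"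
      unfolding k by (intro summable_LIMSEQ power_suminf_bound(1)) (use T le in auto)
    have 3: "(\<lambda>N. real N * (c / real N) ^ k) \<longlonglongrightarrow> (if k = 1 then c else 0)"
    proof (cases "j = 0")
      case True
      have "\<forall>\<^sub>F N in sequentially. real N * (c / real N) ^ k = c"
        using eventually_gt_at_top[of 0] by eventually_elim (simp add: k True)
      then have "(\<lambda>N. real N * (c / real N) ^ k) \<longlonglongrightarrow> c" by (rule tendsto_eventually)
      then show ?thesis using k True by simp
    next
      case False
      have "(\<lambda>N. c * (c / real N) ^ j) \<longlonglongrightarrow> c * 0 ^ j"
        by (intro tendsto_intros)
      moreover have "\<forall>\<^sub>F N in sequentially. c * (c / real N) ^ j = real N * (c / real N) ^ k"
        using eventually_gt_at_top[of 0] by eventually_elim (simp add: k)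
      ultimately have "(\<lambda>N. real N * (c / real N) ^ k) \<longlonglongrightarrow> c * 0 ^ j"
        by (rule Lim_transform_eventually)
      then show ?thesis using False k by (simp add: zero_power)
    qed
    have "(\<lambda>N. (\<Sum>i<N. fst \<rho> i ^ k) + (-1) ^ (k - 1) * (\<Sum>i<N. snd \<rho> i ^ k)
        + (-1) ^ (k - 1) * (real N * (c / real N) ^ k))
      \<longlonglongrightarrow> suminf (\<lambda>i. fst \<rho> i ^ k) + (-1) ^ (k - 1) * suminf (\<lambda>i. snd \<rho> i ^ k)
        + (-1) ^ (k - 1) * (if k = 1 then c else 0)"
      by (intro tendsto_intros 1 2 3)
    moreover have "P N k = (\<Sum>i<N. fst \<rho> i ^ k) + (-1) ^ (k - 1) * (\<Sum>i<N. snd \<rho> i ^ k)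
        + (-1) ^ (k - 1) * (real N * (c / real N) ^ k)" for N
      by (simp add: P_def flip: sum_distrib_left)
    ultimately show ?thesis by (auto simp: rho_power_def c_def)
  qed
  then have "(\<lambda>N. zero_ext (newton (P N)) m) \<longlonglongrightarrow> zero_ext (hcoef \<rho>) m" for m
    unfolding zero_ext_def hcoef_def by (auto intro: newton_tendsto)
  then show ?thesis by (rule totally_positive_tendsto[OF tp])
qed

text \<open>This sign is what makes the square root of the Schur weight equal to the Schur value itself, and
  hence a linear object.\<close>

lemma schur_value_nonneg: "\<rho> \<in> thoma \<Longrightarrow> lam \<in> partitions \<Longrightarrow> 0 \<le> schur_value \<rho> lam"
  using totally_positive_hcoef[of \<rho>] part_sites_strict
  unfolding totally_positive_def schur_value_def sdet_def by blast

section \<open>Decay of the coefficients\<close>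

text \<open>All entries are at most \<open>r = max (\<alpha> 0) (\<beta> 0)\<close> and their sum is at most
  1. That r is less than 1 is the condition that distinguishes \<open>thoma_open\<close> from
  \<open>thoma\<close>.\<close>

lemma rho_power_bound:
  assumes "\<rho> \<in> thoma_open"
  obtains r where "0 \<le> r" "r < 1" "\<And>j. \<bar>rho_power \<rho> (Suc j)\<bar> \<le> r ^ j"
proof
  have "\<rho> \<in> thoma" and lt: "fst \<rho> 0 < 1" "snd \<rho> 0 < 1" using assms by (auto simp: thoma_open_def)
  note T = thoma_D[OF this(1)]
  let ?r = "max (fst \<rho> 0) (snd \<rho> 0)"
  show r: "0 \<le> ?r" "?r < 1" using T(3)[of 0] lt by auto
  have le: "fst \<rho> i \<le> ?r" "snd \<rho> i \<le> ?r" for i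
    using decseqD[OF T(1), of 0 i] decseqD[OF T(2), of 0 i] by auto
  fix j
  show "\<bar>rho_power \<rho> (Suc j)\<bar> \<le> ?r ^ j"
  proof (cases j)
    case (Suc i)
    let ?A = "suminf (\<lambda>i. fst \<rho> i ^ Suc j)" and ?B = "suminf (\<lambda>i. snd \<rho> i ^ Suc j)"
    have 0: "0 \<le> ?A" "0 \<le> ?B"
      using power_suminf_bound(1)[of "fst \<rho>" _ j] power_suminf_bound(1)[of "snd \<rho>" _ j] T le
      by (auto intro!: suminf_nonneg simp del: power_Suc)
    have "\<bar>rho_power \<rho> (Suc j)\<bar> \<le> \<bar>?A\<bar> + \<bar>(-1) ^ j * ?B\<bar>"
      by (simp add: rho_power_def Suc abs_triangle_ineq)
    also have "\<dots> = ?A + ?B" using 0 by (simp add: abs_mult)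
    also have "\<dots> \<le> ?r ^ j * suminf (fst \<rho>) + ?r ^ j * suminf (snd \<rho>)"
      using power_suminf_bound(2)[of "fst \<rho>" ?r j] power_suminf_bound(2)[of "snd \<rho>" ?r j] T le
      by (intro add_mono) auto
    also have "\<dots> = ?r ^ j * (suminf (fst \<rho>) + suminf (snd \<rho>))" by (simp add: distrib_left)
    also have "\<dots> \<le> ?r ^ j * 1" using T(7) r by (intro mult_left_mono) auto
    finally show ?thesis by simp
  qed (simp add: rho_power_def)
qed

text \<open>The bound on power sums is insensitive to their sign, so it serves the generating series and its
  reciprocal alike.\<close>

lemma coef_decay:
  assumes "\<rho> \<in> thoma_open"
  shows "summable (\<lambda>k. real k * \<bar>hcoef \<rho> k\<bar>)" "summable (\<lambda>k. real k * \<bar>gcoef \<rho> k\<bar>)"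
proof -
  obtain r where r: "0 \<le> r" "r < 1" "\<And>j. \<bar>rho_power \<rho> (Suc j)\<bar> \<le> r ^ j"
    using rho_power_bound[OF assms] by blast
  show "summable (\<lambda>k. real k * \<bar>hcoef \<rho> k\<bar>)" "summable (\<lambda>k. real k * \<bar>gcoef \<rho> k\<bar>)"
    unfolding hcoef_def gcoef_def by (rule newton_decay[OF r(1,2)]; simp add: r(3))+
qed

lemma hg_inverse: "(\<Sum>k\<le>n. hcoef \<rho> k * gcoef \<rho> (n - k)) = (if n = 0 then 1 else 0)"
  unfolding hcoef_def gcoef_def by (rule newton_inverse)

section \<open>Summability of Schur values\<close>

text \<open>An index k is hit as \<open>x + 1 + j\<close> at most once for each \<open>x < k\<close>.\<close>

lemma sum_shifted_le:
  fixes f :: "nat \<Rightarrow> real"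
  assumes f: "\<And>k. 0 \<le> f k" and s: "summable (\<lambda>k. real k * f k)"
  shows "(\<Sum>x<m. \<Sum>j<n. f (x + 1 + j)) \<le> suminf (\<lambda>k. real k * f k)"
proof -
  let ?S = "Sigma {..<m + n + 1} (\<lambda>k. {..<k})"
  have "(\<Sum>x<m. \<Sum>j<n. f (x + 1 + j)) = (\<Sum>(x, j)\<in>{..<m} \<times> {..<n}. f (x + 1 + j))"
    by (simp add: sum.cartesian_product)
  also have "\<dots> = (\<Sum>(k, x)\<in>(\<lambda>(x, j). (x + 1 + j, x)) ` ({..<m} \<times> {..<n}). f k)"
    by (subst sum.reindex) (auto simp: inj_on_def case_prod_unfold)
  also have "\<dots> \<le> (\<Sum>(k, x)\<in>?S. f k)"
    by (rule sum_mono2) (auto simp: f)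
  also have "\<dots> = (\<Sum>k<m + n + 1. \<Sum>x<k. f k)" by (subst sum.Sigma) auto
  also have "\<dots> = (\<Sum>k<m + n + 1. real k * f k)" by simp
  also have "\<dots> \<le> suminf (\<lambda>k. real k * f k)" by (rule sum_le_suminf[OF s]) (use f in auto)
  finally show ?thesis .
qed

lemma strict_sequence_inj:
  fixes x :: "nat \<Rightarrow> int"
  assumes x: "\<And>i j. i < j \<Longrightarrow> j < n \<Longrightarrow> x j < x i"
  shows "inj_on x {0..<n}"
proof (rule inj_onI)
  fix i j assume "i \<in> {0..<n}" "j \<in> {0..<n}" "x i = x j"
  then show "i = j" using x[of i j] x[of j i] by (cases i j rule: linorder_cases) auto
qed

lemma strict_sequence_rank:
  fixes x :: "nat \<Rightarrow> int"
  assumes x: "\<And>i j. i < j \<Longrightarrow> j < n \<Longrightarrow> x j < x i" and i: "i < n"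
  shows "card {e \<in> x ` {..<n}. x i < e} = i"
proof -
  have *: "x i < x k \<longleftrightarrow> k < i" if "k < n" for k
    using x[of k i] x[of i k] i that by (cases i k rule: linorder_cases) auto
  have "{e \<in> x ` {..<n}. x i < e} = x ` {k. k < n \<and> x i < x k}" by blast
  also have "{k. k < n \<and> x i < x k} = {..<i}"
  proof (rule Set.set_eqI, rule iffI)
    fix k assume "k \<in> {k. k < n \<and> x i < x k}"
    then show "k \<in> {..<i}" using *[of k] by simp
  next
    fix k assume "k \<in> {..<i}"
    then show "k \<in> {k. k < n \<and> x i < x k}" using *[of k] i by simp
  qed
  finally have "{e \<in> x ` {..<n}. x i < e} = x ` {..<i}" .
  moreover have "inj_on x {..<i}"
    by (rule inj_on_subset[OF strict_sequence_inj[OF x]]) (use i in auto)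
  ultimately show ?thesis by (simp add: card_image)
qed

lemma strict_sequence_eqI:
  fixes x y :: "nat \<Rightarrow> int"
  assumes x: "\<And>i j. i < j \<Longrightarrow> j < n \<Longrightarrow> x j < x i" and y: "\<And>i j. i < j \<Longrightarrow> j < n \<Longrightarrow> y j < y i"
    and eq: "x ` {..<n} = y ` {..<n}" and i: "i < n"
  shows "x i = y i"
proof -
  have "x i \<in> y ` {..<n}" using eq i by blast
  then obtain k where k: "k < n" "x i = y k" by auto
  have "i = k"
    using strict_sequence_rank[of n x i] strict_sequence_rank[of n y k] x y i k eq by metis
  then show ?thesis using k by simp
qed

text \<open>The entries of the Jacobi-Trudi matrix times the unitriangular Toeplitz matrix of the reciprocal
  series. This keeps the determinant and turns the rows at negative sites into unit vectors, as
  \<open>reduced_entry_negative\<close> shows.\<close>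

definition reduced_entry :: "(nat \<Rightarrow> real) \<times> (nat \<Rightarrow> real) \<Rightarrow> int \<Rightarrow> nat \<Rightarrow> real" where
  "reduced_entry \<rho> x l = (\<Sum>j\<le>l. zero_ext (hcoef \<rho>) (x + int j + 1) * gcoef \<rho> (l - j))"

lemma sdet_reduced: "sdet \<rho> n x = detf n (\<lambda>i l. reduced_entry \<rho> (x i) l)"
proof -
  let ?A = "Matrix.mat n n (\<lambda>(i, j). zero_ext (hcoef \<rho>) (x i + int j + 1))"
  let ?G = "Matrix.mat n n (\<lambda>(j, l). if j \<le> l then gcoef \<rho> (l - j) else 0)"
  have "Determinant.det ?G = prod_list (diag_mat ?G)"
    by (rule det_upper_triangular[of _ n]) auto
  also have "diag_mat ?G = map (\<lambda>_. 1) [0..<n]"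
    by (auto simp: diag_mat_def gcoef_def)
  also have "prod_list \<dots> = (1 :: real)" by (induction n) auto
  finally have G: "Determinant.det ?G = 1" .
  have "sdet \<rho> n x = Determinant.det (?A * ?G)"
    by (subst det_mult[of _ n]) (auto simp: G sdet_def detf_def)
  also have "?A * ?G = Matrix.mat n n (\<lambda>(i, l). reduced_entry \<rho> (x i) l)"
  proof (rule eq_matI)
    fix i l assume "i < dim_row (Matrix.mat n n (\<lambda>(i, l). reduced_entry \<rho> (x i) l))"
      "l < dim_col (Matrix.mat n n (\<lambda>(i, l). reduced_entry \<rho> (x i) l))"
    then have i: "i < n" "l < n" by auto
    have "(?A * ?G) $$ (i, l) = (\<Sum>j\<in>{0..<n}. zero_ext (hcoef \<rho>) (x i + int j + 1) *
        (if j \<le> l then gcoef \<rho> (l - j) else 0))"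
      using i by (simp add: scalar_prod_def)
    also have "\<dots> = (\<Sum>j\<le>l. zero_ext (hcoef \<rho>) (x i + int j + 1) * gcoef \<rho> (l - j))"
      using i by (intro sum.mono_neutral_cong_right) auto
    finally show "(?A * ?G) $$ (i, l) = Matrix.mat n n (\<lambda>(i, l). reduced_entry \<rho> (x i) l) $$ (i, l)"
      using i by (simp add: reduced_entry_def)
  qed auto
  finally show ?thesis by (simp add: detf_def)
qed

lemma zero_ext_diff: "zero_ext f (int j - int i) = (if j < i then 0 else f (j - i))"
  by (simp add: zero_ext_def nat_minus_as_int)

lemma reduced_entry_negative: "reduced_entry \<rho> (- int i - 1) l = (if i = l then 1 else 0)"
proof -
  have h: "zero_ext (hcoef \<rho>) (- int i - 1 + int j + 1) = (if j < i then 0 else hcoef \<rho> (j - i))" for j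
    using zero_ext_diff[of "hcoef \<rho>" j i] by (simp add: algebra_simps)
  show ?thesis
  proof (cases "i \<le> l")
    case True
    have "reduced_entry \<rho> (- int i - 1) l = (\<Sum>j\<in>{i..l}. hcoef \<rho> (j - i) * gcoef \<rho> (l - j))"
      unfolding reduced_entry_def h by (rule sum.mono_neutral_cong_right) auto
    also have "\<dots> = (\<Sum>k\<le>l - i. hcoef \<rho> k * gcoef \<rho> (l - i - k))"
      by (rule sum.reindex_bij_witness[of _ "\<lambda>k. k + i" "\<lambda>j. j - i"]) (use True in \<open>auto\<close>)
    finally have "reduced_entry \<rho> (- int i - 1) l = (if l - i = 0 then 1 else 0)"
      by (simp only: hg_inverse)
    then show ?thesis using True by auto
  next
    case False
    then show ?thesis unfolding reduced_entry_def h by (simp add: sum.neutral)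
  qed
qed

text \<open>Write V for the reduced matrix. The Leibniz formula bounds each Schur value by the sum over
  permutations p of the products of \<open>\<bar>V (x (p l)) l\<bar>\<close> over the columns l. A
  partition and a permutation are determined by the function \<open>l \<mapsto> x (p l)\<close>,
  so all these sums together are at most the sum over all functions, that is, the product of the
  column sums of \<open>\<bar>V\<bar>\<close>. The negative sites contribute exactly 1 to each
  column sum; by \<open>1 + y \<le> exp y\<close> the product is at most the exponential of the
  sum of all entries at nonnegative sites, which is finite by \<open>coef_decay\<close>.\<close>

lemma schur_value_summable:
  assumes \<rho>: "\<rho> \<in> thoma_open"
  obtains C where "\<And>L. finite L \<Longrightarrow> L \<subseteq> partitions \<Longrightarrow> (\<Sum>lam\<in>L. \<bar>schur_value \<rho> lam\<bar>) \<le> C"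
proof
  define c where "c = suminf (\<lambda>k. real k * \<bar>hcoef \<rho> k\<bar>)"
  define d where "d = suminf (\<lambda>k. \<bar>gcoef \<rho> k\<bar>)"
  have sg: "summable (\<lambda>k. \<bar>gcoef \<rho> k\<bar>)"
    by (rule summable_of_summable_index) (rule coef_decay[OF \<rho>])
  have d0: "0 \<le> d" unfolding d_def by (rule suminf_nonneg[OF sg]) simp
  have c0: "0 \<le> c" unfolding c_def by (rule suminf_nonneg[OF coef_decay(1)[OF \<rho>]]) simp
  fix L :: "(nat \<Rightarrow> nat) set" assume L: "finite L" "L \<subseteq> partitions"
  obtain n where n: "\<And>lam. lam \<in> L \<Longrightarrow> part_length lam \<le> n"
    using L(1) finite_imageI[of L part_length] by (meson Max_ge imageI)
  obtain m where m: "\<And>lam. lam \<in> L \<Longrightarrow> lam 0 \<le> m"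
    using L(1) finite_imageI[of L "\<lambda>lam. lam 0"] by (metis Max_ge imageI)
  let ?V = "reduced_entry \<rho>"
  let ?x = part_sites
  have strict: "\<And>i j. i < j \<Longrightarrow> j < n \<Longrightarrow> ?x lam j < ?x lam i" if "lam \<in> L" for lam
    using that L part_sites_strict by blast
  have range: "?x lam i \<in> {- int n..<int m}" if "lam \<in> L" "i < n" for lam i
  proof -
    have "lam i \<le> lam 0" using that L by (auto simp: partitions_def decseq_def)
    then show ?thesis using m[OF that(1)] that(2) by (auto simp: part_sites_def)
  qed
  \<comment> \<open>The Leibniz formula, with each product arranged by columns.\<close>
  have bound: "\<bar>schur_value \<rho> lam\<bar> \<le> (\<Sum>p\<in>{p. p permutes {0..<n}}. \<Prod>l\<in>{0..<n}. \<bar>?V (?x lam (p l)) l\<bar>)"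
    if "lam \<in> L" for lam
  proof -
    have "schur_value \<rho> lam = detf n (\<lambda>i l. ?V (?x lam i) l)"
      using sdet_stable[of lam n \<rho>] n that L by (auto simp: sdet_reduced)
    also have "\<bar>\<dots>\<bar> \<le> (\<Sum>p\<in>{p. p permutes {0..<n}}. \<bar>of_int (sign p) * (\<Prod>i\<in>{0..<n}. ?V (?x lam i) (p i))\<bar>)"
      unfolding detf_leibniz by (rule sum_abs)
    also have "\<dots> = (\<Sum>p\<in>{p. p permutes {0..<n}}. \<Prod>i\<in>{0..<n}. \<bar>?V (?x lam i) (p i)\<bar>)"
      by (intro sum.cong refl) (simp add: abs_mult abs_prod sign_def)
    also have "\<dots> = (\<Sum>p\<in>{p. p permutes {0..<n}}. \<Prod>i\<in>{0..<n}. \<bar>?V (?x lam i) (inv_into UNIV p i)\<bar>)"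
      by (rule sum.reindex_bij_witness[of _ "inv_into UNIV" "inv_into UNIV"])
        (auto simp: permutes_inv permutes_inv_inv)
    also have "\<dots> = (\<Sum>p\<in>{p. p permutes {0..<n}}. \<Prod>l\<in>{0..<n}. \<bar>?V (?x lam (p l)) l\<bar>)"
    proof (intro sum.cong refl)
      fix p :: "nat \<Rightarrow> nat" assume "p \<in> {p. p permutes {0..<n}}"
      then have p: "p permutes {0..<n}" by simp
      have "(\<Prod>i\<in>{0..<n}. \<bar>?V (?x lam i) (inv_into UNIV p i)\<bar>)
        = (\<Prod>l\<in>{0..<n}. (\<lambda>i. \<bar>?V (?x lam i) (inv_into UNIV p i)\<bar>) (p l))"
        by (rule prod.permute[OF p, unfolded o_def])
      then show "(\<Prod>i\<in>{0..<n}. \<bar>?V (?x lam i) (inv_into UNIV p i)\<bar>) = (\<Prod>l\<in>{0..<n}. \<bar>?V (?x lam (p l)) l\<bar>)"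
        using p by (simp add: permutes_inverses)
    qed
    finally show ?thesis .
  qed
  \<comment> \<open>The restriction to the columns makes different pairs different functions.\<close>
  define pick where "pick = (\<lambda>(lam, p). restrict (\<lambda>l. ?x lam (p l)) {0..<n})"
  have inj: "inj_on pick (L \<times> {p. p permutes {0..<n}})"
  proof (rule inj_onI, clarify)
    fix lam mu p q
    assume lam: "lam \<in> L" and mu: "mu \<in> L" and p: "p permutes {0..<n}" and q: "q permutes {0..<n}"
      and eq: "pick (lam, p) = pick (mu, q)"
    have eq': "?x lam (p l) = ?x mu (q l)" if "l < n" for l
      using fun_cong[OF eq, of l] that by (simp add: pick_def)
    have "?x lam ` {0..<n} = (\<lambda>l. ?x lam (p l)) ` {0..<n}"
      using permutes_image[OF p] by (metis image_image)
    also have "\<dots> = (\<lambda>l. ?x mu (q l)) ` {0..<n}" by (rule image_cong) (simp_all add: eq')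
    also have "\<dots> = ?x mu ` {0..<n}" using permutes_image[OF q] by (metis image_image)
    finally have same: "?x lam i = ?x mu i" if "i < n" for i
      using strict_sequence_eqI[of n "?x lam" "?x mu" i] strict lam mu that by (simp add: lessThan_atLeast0)
    have "lam i = mu i" for i
    proof (cases "i < n")
      case True
      then show ?thesis using same[of i] by (simp add: part_sites_def)
    next
      case False
      then have "\<not> i < part_length lam" "\<not> i < part_length mu" using n[OF lam] n[OF mu] by auto
      then have "i \<notin> {i. lam i \<noteq> 0}" "i \<notin> {i. mu i \<noteq> 0}"
        using partition_support lam mu L by blast+
      then show ?thesis by simp
    qed
    then have lm: "lam = mu" by blast
    have "p l = q l" for l
    proof (cases "l < n")
      case True
      then have "p l \<in> {0..<n}" "q l \<in> {0..<n}" using p q by (simp_all add: permutes_in_image)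
      then show ?thesis using strict_sequence_inj[of n "?x mu"] strict[OF mu] eq'[OF True] lm
        by (auto dest: inj_onD)
    next
      case False
      then show ?thesis using p q by (simp add: permutes_not_in)
    qed
    then show "lam = mu \<and> p = q" using lm by blast
  qed
  have fin: "finite {p. p permutes {0..<n}}" by (simp add: finite_permutations)
  have "(\<Sum>lam\<in>L. \<bar>schur_value \<rho> lam\<bar>) \<le>
      (\<Sum>lam\<in>L. \<Sum>p\<in>{p. p permutes {0..<n}}. \<Prod>l\<in>{0..<n}. \<bar>?V (?x lam (p l)) l\<bar>)"
    by (rule sum_mono) (rule bound)
  also have "\<dots> = (\<Sum>z\<in>L \<times> {p. p permutes {0..<n}}. \<Prod>l\<in>{0..<n}. \<bar>?V (pick z l) l\<bar>)"
    by (simp add: sum.cartesian_product case_prod_unfold pick_def)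
  also have "\<dots> = (\<Sum>f\<in>pick ` (L \<times> {p. p permutes {0..<n}}). \<Prod>l\<in>{0..<n}. \<bar>?V (f l) l\<bar>)"
    by (simp add: sum.reindex[OF inj])
  also have "\<dots> \<le> (\<Sum>f\<in>PiE {0..<n} (\<lambda>_. {- int n..<int m}). \<Prod>l\<in>{0..<n}. \<bar>?V (f l) l\<bar>)"
  proof (rule sum_mono2)
    show "pick ` (L \<times> {p. p permutes {0..<n}}) \<subseteq> PiE {0..<n} (\<lambda>_. {- int n..<int m})"
    proof (clarify, rule PiE_I)
      fix lam p l assume "lam \<in> L" "p permutes {0..<n}" "l \<in> {0..<n}"
      then show "pick (lam, p) l \<in> {- int n..<int m}"
        using range[of lam "p l"] permutes_in_image[of p "{0..<n}" l] by (simp add: pick_def)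
    qed (auto simp: pick_def)
  qed (auto intro: finite_PiE prod_nonneg)
  also have "\<dots> = (\<Prod>l\<in>{0..<n}. \<Sum>y\<in>{- int n..<int m}. \<bar>?V y l\<bar>)"
    by (rule prod_sum_PiE[symmetric]) auto
  also have "\<dots> \<le> (\<Prod>l\<in>{0..<n}. exp (\<Sum>x<m. \<bar>?V (int x) l\<bar>))"
  proof (rule prod_mono, rule conjI)
    fix l assume l: "l \<in> {0..<n}"
    show "0 \<le> (\<Sum>y\<in>{- int n..<int m}. \<bar>?V y l\<bar>)" by (rule sum_nonneg) simp
    have split: "{- int n..<int m} = (\<lambda>i. - int i - 1) ` {..<n} \<union> int ` {..<m}"
    proof (rule Set.set_eqI, rule iffI)
      fix y :: int assume y: "y \<in> {- int n..<int m}"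
      show "y \<in> (\<lambda>i. - int i - 1) ` {..<n} \<union> int ` {..<m}"
      proof (cases "y < 0")
        case True
        then have "y = - int (nat (- y - 1)) - 1" "nat (- y - 1) < n" using y by auto
        then show ?thesis by blast
      next
        case False
        then have "y = int (nat y)" "nat y < m" using y by auto
        then show ?thesis by blast
      qed
    qed auto
    have "(\<Sum>y\<in>{- int n..<int m}. \<bar>?V y l\<bar>) =
       (\<Sum>y\<in>(\<lambda>i. - int i - 1) ` {..<n}. \<bar>?V y l\<bar>) + (\<Sum>y\<in>int ` {..<m}. \<bar>?V y l\<bar>)"
      unfolding split by (rule sum.union_disjoint) auto
    also have "(\<Sum>y\<in>(\<lambda>i. - int i - 1) ` {..<n}. \<bar>?V y l\<bar>) = (\<Sum>i<n. \<bar>?V (- int i - 1) l\<bar>)"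
      by (subst sum.reindex) (auto simp: inj_on_def)
    also have "\<dots> = 1" using l by (simp add: reduced_entry_negative if_distrib cong: if_cong)
    also have "(\<Sum>y\<in>int ` {..<m}. \<bar>?V y l\<bar>) = (\<Sum>x<m. \<bar>?V (int x) l\<bar>)"
      by (subst sum.reindex) (auto simp: inj_on_def)
    finally show "(\<Sum>y\<in>{- int n..<int m}. \<bar>?V y l\<bar>) \<le> exp (\<Sum>x<m. \<bar>?V (int x) l\<bar>)"
      using exp_ge_add_one_self[of "\<Sum>x<m. \<bar>?V (int x) l\<bar>"] by simp
  qed
  also have "\<dots> = exp (\<Sum>l\<in>{0..<n}. \<Sum>x<m. \<bar>?V (int x) l\<bar>)" by (simp add: exp_sum)
  also have "\<dots> \<le> exp (c * d)"
  proof (subst exp_le_cancel_iff)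
    have V: "\<bar>?V (int x) l\<bar> \<le> (\<Sum>j<n. \<bar>hcoef \<rho> (x + 1 + j)\<bar> * (if j \<le> l then \<bar>gcoef \<rho> (l - j)\<bar> else 0))"
      if "l < n" for x l
    proof -
      have z: "zero_ext (hcoef \<rho>) (int x + int j + 1) = hcoef \<rho> (x + 1 + j)" for j
        by (simp add: zero_ext_def nat_add_distrib nat_int_add add_ac)
      have "\<bar>?V (int x) l\<bar> \<le> (\<Sum>j\<le>l. \<bar>hcoef \<rho> (x + 1 + j)\<bar> * \<bar>gcoef \<rho> (l - j)\<bar>)"
        unfolding reduced_entry_def z by (rule order_trans[OF sum_abs]) (simp add: abs_mult)
      also have "\<dots> = (\<Sum>j<n. \<bar>hcoef \<rho> (x + 1 + j)\<bar> * (if j \<le> l then \<bar>gcoef \<rho> (l - j)\<bar> else 0))"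
        using that by (intro sum.mono_neutral_cong_left) auto
      finally show ?thesis .
    qed
    have g: "(\<Sum>l\<in>{0..<n}. if j \<le> l then \<bar>gcoef \<rho> (l - j)\<bar> else 0) \<le> d" if "j < n" for j
    proof -
      have "(\<Sum>l\<in>{0..<n}. if j \<le> l then \<bar>gcoef \<rho> (l - j)\<bar> else 0) = (\<Sum>l\<in>{j..<n}. \<bar>gcoef \<rho> (l - j)\<bar>)"
        by (rule sum.mono_neutral_cong_right) auto
      also have "\<dots> = (\<Sum>k<n - j. \<bar>gcoef \<rho> k\<bar>)"
        by (rule sum.reindex_bij_witness[of _ "\<lambda>k. k + j" "\<lambda>l. l - j"]) auto
      also have "\<dots> \<le> d" unfolding d_def by (rule sum_le_suminf[OF sg]) auto
      finally show ?thesis .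
    qed
    have "(\<Sum>l\<in>{0..<n}. \<Sum>x<m. \<bar>?V (int x) l\<bar>) \<le> (\<Sum>l\<in>{0..<n}. \<Sum>x<m. \<Sum>j<n.
        \<bar>hcoef \<rho> (x + 1 + j)\<bar> * (if j \<le> l then \<bar>gcoef \<rho> (l - j)\<bar> else 0))"
      by (intro sum_mono V) auto
    also have "\<dots> = (\<Sum>x<m. \<Sum>l\<in>{0..<n}. \<Sum>j<n.
        \<bar>hcoef \<rho> (x + 1 + j)\<bar> * (if j \<le> l then \<bar>gcoef \<rho> (l - j)\<bar> else 0))"
      by (rule sum.swap)
    also have "\<dots> = (\<Sum>x<m. \<Sum>j<n. \<Sum>l\<in>{0..<n}.
        \<bar>hcoef \<rho> (x + 1 + j)\<bar> * (if j \<le> l then \<bar>gcoef \<rho> (l - j)\<bar> else 0))"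
      by (rule sum.cong[OF refl sum.swap])
    also have "\<dots> \<le> (\<Sum>x<m. \<Sum>j<n. \<bar>hcoef \<rho> (x + 1 + j)\<bar> * d)"
      unfolding sum_distrib_left[symmetric] by (intro sum_mono mult_left_mono g) auto
    also have "\<dots> = (\<Sum>x<m. \<Sum>j<n. \<bar>hcoef \<rho> (x + 1 + j)\<bar>) * d" by (simp add: sum_distrib_right)
    also have "\<dots> \<le> c * d"
      unfolding c_def by (intro mult_right_mono d0 sum_shifted_le coef_decay(1)[OF \<rho>]) auto
    finally show "(\<Sum>l\<in>{0..<n}. \<Sum>x<m. \<bar>?V (int x) l\<bar>) \<le> c * d" .
  qed
  finally show "(\<Sum>lam\<in>L. \<bar>schur_value \<rho> lam\<bar>) \<le> exp (c * d)" .
qed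

section \<open>Linear relations between Schur determinants\<close>

text \<open>Expansion along column 0 of a determinant of size \<open>n + 1\<close> in which column 0 repeats
  column \<open>- u\<close>; the minors of column 0 are the Schur determinants with one row
  omitted.\<close>

lemma sdet_column_relation:
  assumes u: "u < 0" "- int n \<le> u"
  shows "(\<Sum>i<Suc n. (-1) ^ i * zero_ext (hcoef \<rho>) (x i - u) * sdet \<rho> n (\<lambda>k. x (insert_index i k))) = 0"
proof -
  let ?h = "zero_ext (hcoef \<rho>)"
  let ?M = "Matrix.mat (Suc n) (Suc n) (\<lambda>(i, j). if j = 0 then ?h (x i - u) else ?h (x i + int j))"
  let ?j = "nat (- u)"
  have j: "?j < Suc n" "?j \<noteq> 0" using u by auto
  have "Determinant.det ?M = 0"
    by (rule det_identical_columns[of _ "Suc n" 0 ?j]) (use j u in \<open>auto intro!: eq_vecI\<close>)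
  moreover have "Determinant.det ?M = (\<Sum>i<Suc n. ?M $$ (i, 0) * cofactor ?M i 0)"
    by (rule laplace_expansion_column) auto
  moreover have "cofactor ?M i 0 = (-1) ^ i * sdet \<rho> n (\<lambda>k. x (insert_index i k))" for i
    unfolding cofactor_def sdet_def detf_def
    by (auto simp: mat_delete_def insert_index_def add_ac intro!: arg_cong[of _ _ Determinant.det] eq_matI)
  ultimately show ?thesis by (simp add: mult_ac)
qed

text \<open>The combination of the top rows is a coefficient of positive degree of the generating series
  times its reciprocal, hence a zero row. Positions below \<open>- n - 1\<close> are absent
  because their rows vanish.\<close>

lemma sdet_row_relation:
  assumes v: "0 \<le> v"
  shows "(\<Sum>m\<in>{- int (Suc n)..v}. gcoef \<rho> (nat (v - m)) * sdet \<rho> (Suc n) (case_nat m y)) = 0"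
proof -
  let ?h = "zero_ext (hcoef \<rho>)"
  let ?R = "\<lambda>i j. if i = 0 then 0 else ?h (case_nat 0 y i + int j + 1)"
  have "detf (Suc n) ?R = (\<Sum>m\<in>{- int (Suc n)..v}. gcoef \<rho> (nat (v - m)) *
      detf (Suc n) (?R(0 := (\<lambda>j. ?h (m + int j + 1)))))"
  proof (rule detf_row_sum)
    fix j assume j: "j < Suc n"
    have "(\<Sum>m\<in>{- int (Suc n)..v}. gcoef \<rho> (nat (v - m)) * ?h (m + int j + 1))
      = (\<Sum>k\<le>nat v + j + 1. hcoef \<rho> k * gcoef \<rho> (nat v + j + 1 - k))"
    proof -
      have "(\<Sum>m\<in>{- int (Suc n)..v}. gcoef \<rho> (nat (v - m)) * ?h (m + int j + 1))
        = (\<Sum>m\<in>{- int j - 1..v}. gcoef \<rho> (nat (v - m)) * hcoef \<rho> (nat (m + int j + 1)))"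
        by (rule sum.mono_neutral_cong_right) (use j in \<open>auto simp: zero_ext_def\<close>)
      also have "\<dots> = (\<Sum>k\<le>nat v + j + 1. hcoef \<rho> k * gcoef \<rho> (nat v + j + 1 - k))"
        by (rule sum.reindex_bij_witness[of _ "\<lambda>k. int k - int j - 1" "\<lambda>m. nat (m + int j + 1)"])
          (use v in \<open>auto simp: nat_diff_distrib algebra_simps intro!: arg_cong2[of _ _ _ _ "(*)"] arg_cong[of _ _ "gcoef \<rho>"]\<close>)
      finally show ?thesis .
    qed
    then show "?R 0 j = (\<Sum>m\<in>{- int (Suc n)..v}. gcoef \<rho> (nat (v - m)) * ?h (m + int j + 1))"
      by (simp add: hg_inverse)
  qed auto
  moreover have "detf (Suc n) ?R = 0" by (rule detf_row_zero[of 0]) auto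
  moreover have "detf (Suc n) (?R(0 := (\<lambda>j. ?h (m + int j + 1)))) = sdet \<rho> (Suc n) (case_nat m y)" for m
    unfolding sdet_def by (rule detf_cong) (auto split: nat.split)
  ultimately show ?thesis by simp
qed

section \<open>Convolution operators on bounded sequences\<close>

definition conv_up :: "(nat \<Rightarrow> real) \<Rightarrow> (int \<Rightarrow> complex) \<Rightarrow> int \<Rightarrow> complex" where
  "conv_up a l y = (\<Sum>\<^sub>\<infinity>k. complex_of_real (a k) * l (y + int k))"

definition conv_down :: "(nat \<Rightarrow> real) \<Rightarrow> (int \<Rightarrow> complex) \<Rightarrow> int \<Rightarrow> complex" where
  "conv_down a l y = (\<Sum>\<^sub>\<infinity>k. complex_of_real (a k) * l (y - int k))"

lemma conv_down_reflect: "conv_down a l y = conv_up a (\<lambda>z. l (- z)) (- y)"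
  by (simp add: conv_down_def conv_up_def)

lemma bounded_family_norm_summable:
  assumes a: "summable (\<lambda>k. \<bar>a k\<bar>)" and F: "\<And>k. cmod (F k) \<le> M"
  shows "(\<lambda>k. norm (complex_of_real (a k) * F k)) summable_on UNIV"
proof (rule Infinite_Sum.abs_summable_on_comparison_test')
  have "(\<lambda>k. \<bar>a k\<bar>) summable_on UNIV"
    using a by (intro norm_summable_imp_summable_on) simp
  then show "(\<lambda>k. \<bar>a k\<bar> * M) summable_on UNIV" by (rule summable_on_cmult_left)
  fix k
  show "norm (complex_of_real (a k) * F k) \<le> \<bar>a k\<bar> * M"
    using F[of k] by (simp add: norm_mult mult_left_mono)
qed

lemma bounded_conv_up:
  assumes a: "summable (\<lambda>k. \<bar>a k\<bar>)" and l: "\<And>y. cmod (l y) \<le> M"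
  shows "cmod (conv_up a l y) \<le> (\<Sum>\<^sub>\<infinity>k. \<bar>a k\<bar>) * M"
proof -
  have s: "(\<lambda>k. \<bar>a k\<bar>) summable_on UNIV"
    using a by (intro norm_summable_imp_summable_on) simp
  have n: "(\<lambda>k. norm (complex_of_real (a k) * l (y + int k))) summable_on UNIV"
    by (rule bounded_family_norm_summable[OF a l])
  have "cmod (conv_up a l y) \<le> (\<Sum>\<^sub>\<infinity>k. norm (complex_of_real (a k) * l (y + int k)))"
    unfolding conv_up_def by (rule norm_infsum_bound) (rule n)
  also have "\<dots> \<le> (\<Sum>\<^sub>\<infinity>k. \<bar>a k\<bar> * M)"
    by (rule infsum_mono[OF n summable_on_cmult_left[OF s]]) (use l in \<open>simp add: norm_mult mult_left_mono\<close>)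
  also have "\<dots> = (\<Sum>\<^sub>\<infinity>k. \<bar>a k\<bar>) * M" by (rule infsum_cmult_left) (rule s)
  finally show ?thesis .
qed

lemma double_family_summable:
  assumes a: "summable (\<lambda>k. \<bar>a k\<bar>)" and c: "summable (\<lambda>k. \<bar>c k\<bar>)" and F: "\<And>k j. cmod (F k j) \<le> M"
  shows "(\<lambda>(k, j). complex_of_real (a k) * (complex_of_real (c j) * F k j)) summable_on UNIV \<times> UNIV"
proof -
  have sa: "(\<lambda>k. \<bar>a k\<bar>) summable_on UNIV" and sc: "(\<lambda>k. \<bar>c k\<bar>) summable_on UNIV"
    using a c by (auto intro: norm_summable_imp_summable_on)
  let ?f = "\<lambda>(k, j). complex_of_real (a k) * (complex_of_real (c j) * F k j)"
  have inner: "(\<lambda>j. norm (?f (k, j))) summable_on UNIV" for k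
    using summable_on_cmult_right[OF bounded_family_norm_summable[of c "F k" M, OF c F], of "\<bar>a k\<bar>"]
    by (simp add: norm_mult)
  have "Infinite_Sum.abs_summable_on ?f (UNIV \<times> UNIV)"
    unfolding Infinite_Sum.abs_summable_on_Sigma_iff
  proof (intro conjI ballI)
    fix k show "Infinite_Sum.abs_summable_on (\<lambda>y. ?f (k, y)) UNIV" by (rule inner)
    have "(\<Sum>\<^sub>\<infinity>j. norm (?f (k, j))) \<le> \<bar>a k\<bar> * ((\<Sum>\<^sub>\<infinity>j. \<bar>c j\<bar>) * M)" for k
    proof -
      have "(\<Sum>\<^sub>\<infinity>j. norm (?f (k, j))) \<le> (\<Sum>\<^sub>\<infinity>j. \<bar>a k\<bar> * (\<bar>c j\<bar> * M))"
        by (rule infsum_mono[OF inner])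
          (use F sc in \<open>auto simp: norm_mult intro!: mult_left_mono summable_on_cmult_right summable_on_cmult_left\<close>)
      also have "\<dots> = \<bar>a k\<bar> * ((\<Sum>\<^sub>\<infinity>j. \<bar>c j\<bar>) * M)"
        by (simp add: infsum_cmult_right infsum_cmult_left summable_on_cmult_left sc)
      finally show ?thesis .
    qed
    then show "Infinite_Sum.abs_summable_on (\<lambda>x. \<Sum>\<^sub>\<infinity>y. norm (?f (x, y))) UNIV"
      by (intro Infinite_Sum.abs_summable_on_comparison_test'[OF summable_on_cmult_left[OF sa]])
        (simp add: infsum_nonneg del: case_prod_conv)
  qed
  then show ?thesis by (rule abs_summable_summable)
qed

lemma conv_up_inverse:
  assumes a: "summable (\<lambda>k. \<bar>a k\<bar>)" and c: "summable (\<lambda>k. \<bar>c k\<bar>)" and l: "\<And>y. cmod (l y) \<le> M"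
    and inv: "\<And>n. (\<Sum>k\<le>n. a k * c (n - k)) = (if n = 0 then 1 else 0)"
  shows "conv_up a (conv_up c l) y = l y"
proof -
  let ?f = "\<lambda>(k, j). complex_of_real (a k) * (complex_of_real (c j) * l (y + int k + int j))"
  have s: "?f summable_on UNIV \<times> UNIV" by (rule double_family_summable[OF a c l])
  have "conv_up a (conv_up c l) y = (\<Sum>\<^sub>\<infinity>k. \<Sum>\<^sub>\<infinity>j. ?f (k, j))"
    unfolding conv_up_def
    by (simp add: infsum_cmult_right abs_summable_summable[OF bounded_family_norm_summable[OF c l]])
  also have "\<dots> = infsum ?f (UNIV \<times> UNIV)"
    using infsum_Sigma'_banach[of "\<lambda>k j. ?f (k, j)" UNIV "\<lambda>_. UNIV"] s by simp
  also have "\<dots> = (\<Sum>\<^sub>\<infinity>(n, k)\<in>Sigma UNIV (\<lambda>n. {..n}). complex_of_real (a k * c (n - k)) * l (y + int n))"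
    by (rule infsum_reindex_bij_witness[of _ "\<lambda>(n, k). (k, n - k)" "\<lambda>(k, j). (k + j, k)"])
      (auto simp: add.assoc)
  also have "\<dots> = (\<Sum>\<^sub>\<infinity>n. \<Sum>\<^sub>\<infinity>k\<in>{..n}. complex_of_real (a k * c (n - k)) * l (y + int n))"
  proof (rule infsum_Sigma'_banach[symmetric])
    show "(\<lambda>(n, k). complex_of_real (a k * c (n - k)) * l (y + int n)) summable_on Sigma UNIV (\<lambda>n. {..n})"
      using s by (subst summable_on_reindex_bij_witness[of _ "\<lambda>(k, j). (k + j, k)" "\<lambda>(n, k). (k, n - k)" "UNIV \<times> UNIV" ?f])
        (auto simp: add.assoc)
  qed
  also have "\<dots> = (\<Sum>\<^sub>\<infinity>n. complex_of_real (\<Sum>k\<le>n. a k * c (n - k)) * l (y + int n))"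
    by (simp add: sum_distrib_right)
  also have "\<dots> = (\<Sum>\<^sub>\<infinity>n\<in>{0}. l (y + int n))"
    unfolding inv by (rule infsum_cong_neutral) auto
  finally show ?thesis by simp
qed

lemma conv_down_inverse:
  assumes "summable (\<lambda>k. \<bar>a k\<bar>)" and "summable (\<lambda>k. \<bar>c k\<bar>)" and "\<And>y. cmod (l y) \<le> M"
    and "\<And>n. (\<Sum>k\<le>n. a k * c (n - k)) = (if n = 0 then 1 else 0)"
  shows "conv_down a (conv_down c l) y = l y"
  using conv_up_inverse[of a c "\<lambda>z. l (- z)" M "- y"] assms by (simp add: conv_down_reflect)

lemma conv_down_up_commute:
  assumes a: "summable (\<lambda>k. \<bar>a k\<bar>)" and c: "summable (\<lambda>k. \<bar>c k\<bar>)" and l: "\<And>y. cmod (l y) \<le> M"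
  shows "conv_down a (conv_up c l) y = conv_up c (conv_down a l) y"
proof -
  let ?f = "\<lambda>k j. complex_of_real (a k) * (complex_of_real (c j) * l (y - int k + int j))"
  have s: "(\<lambda>(k, j). ?f k j) summable_on UNIV \<times> UNIV" by (rule double_family_summable[OF a c l])
  have "conv_down a (conv_up c l) y = (\<Sum>\<^sub>\<infinity>k. \<Sum>\<^sub>\<infinity>j. ?f k j)"
    unfolding conv_up_def conv_down_def
    by (simp add: infsum_cmult_right abs_summable_summable[OF bounded_family_norm_summable[OF c l]])
  also have "\<dots> = (\<Sum>\<^sub>\<infinity>j. \<Sum>\<^sub>\<infinity>k. ?f k j)" by (rule infsum_swap_banach) (rule s)
  also have "\<dots> = (\<Sum>\<^sub>\<infinity>j. \<Sum>\<^sub>\<infinity>k. complex_of_real (c j) * (complex_of_real (a k) * l (y + int j - int k)))"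
    by (simp add: algebra_simps)
  also have "\<dots> = conv_up c (conv_down a l) y"
    unfolding conv_up_def conv_down_def
    by (simp add: infsum_cmult_right abs_summable_summable[OF bounded_family_norm_summable[OF a l]])
  finally show ?thesis .
qed

text \<open>A Wiener-Hopf argument. Let S be the shift \<open>l \<mapsto> (\<lambda>y. l (y + 1))\<close>, H
  and G the two power series, and \<open>q = G(S^-1) H(S) l\<close>. Since \<open>G(S^-1)\<close>
  looks only to the left, q vanishes on the negative half-line together with \<open>H(S)
  l\<close>; since the operators commute and \<open>H(S)\<close> looks only to the right, q
  vanishes on the other half-line together with \<open>G(S^-1) l\<close>. Both operators are
  invertible on bounded sequences because G and H are reciprocal with summable coefficients.\<close>

lemma bounded_sequence_vanishes:
  assumes h: "summable (\<lambda>k. \<bar>h k\<bar>)" and g: "summable (\<lambda>k. \<bar>g k\<bar>)" and l: "\<And>y. cmod (l y) \<le> M"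
    and hg: "\<And>n. (\<Sum>k\<le>n. h k * g (n - k)) = (if n = 0 then 1 else 0)"
    and up: "\<And>y. y < 0 \<Longrightarrow> conv_up h l y = 0" and down: "\<And>y. 0 \<le> y \<Longrightarrow> conv_down g l y = 0"
  shows "l y = 0"
proof -
  have gh: "(\<Sum>k\<le>n. g k * h (n - k)) = (if n = 0 then 1 else 0)" for n
    using sum.nat_diff_reindex[of "\<lambda>k. h k * g (n - k)" "Suc n"] hg[of n]
    by (simp add: lessThan_Suc_atMost mult.commute)
  define m where "m = conv_up h l"
  have m: "\<And>y. cmod (m y) \<le> (\<Sum>\<^sub>\<infinity>k. \<bar>h k\<bar>) * M" unfolding m_def by (rule bounded_conv_up[OF h l])
  define q where "q = conv_down g m"
  have "q y = 0" for y
  proof (cases "y < 0")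
    case True
    then show ?thesis by (simp add: q_def conv_down_def m_def up)
  next
    case False
    have "q y = conv_up h (conv_down g l) y"
      unfolding q_def m_def by (rule conv_down_up_commute[OF g h l])
    also have "\<dots> = 0" using False by (simp add: conv_up_def down)
    finally show ?thesis .
  qed
  then have "m y = 0" for y
    using conv_down_inverse[of h g m, OF h g m hg, where y = y] by (simp add: q_def[symmetric] conv_down_def[of h])
  then show ?thesis
    using conv_up_inverse[of g h l, OF g h l gh, where y = y] by (simp add: m_def[symmetric] conv_up_def[of g])
qed

section \<open>Bounded matrices on square-summable families\<close>

text \<open>Square-summable families over an arbitrary index type, which is needed both for one-particle
  vectors and for vectors of the Fock space.\<close>

definition sqs :: "('i \<Rightarrow> complex) \<Rightarrow> bool" where
  "sqs k \<longleftrightarrow> (\<lambda>i. (cmod (k i))\<^sup>2) summable_on UNIV"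

definition sqnorm :: "('i \<Rightarrow> complex) \<Rightarrow> real" where
  "sqnorm k = (\<Sum>\<^sub>\<infinity>i. (cmod (k i))\<^sup>2)"

definition ip :: "('i \<Rightarrow> complex) \<Rightarrow> ('i \<Rightarrow> complex) \<Rightarrow> complex" where
  "ip l k = (\<Sum>\<^sub>\<infinity>i. cnj (l i) * k i)"

text \<open>Boundedness is formulated by the sesquilinear form on finite families, which is the estimate
  that a C*-norm provides; the constructions below extend the matrix to all square-summable
  families.\<close>

definition bmat :: "real \<Rightarrow> ('i \<Rightarrow> 'i \<Rightarrow> complex) \<Rightarrow> bool" where
  "bmat C m \<longleftrightarrow> 0 \<le> C \<and> (\<forall>S k l. finite S \<longrightarrow>
     cmod (\<Sum>i\<in>S. \<Sum>j\<in>S. cnj (k i) * m i j * l j)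
       \<le> C * sqrt (\<Sum>i\<in>S. (cmod (k i))\<^sup>2) * sqrt (\<Sum>i\<in>S. (cmod (l i))\<^sup>2))"

definition mop :: "('i \<Rightarrow> 'i \<Rightarrow> complex) \<Rightarrow> ('i \<Rightarrow> complex) \<Rightarrow> 'i \<Rightarrow> complex" where
  "mop m k i = (\<Sum>\<^sub>\<infinity>j. m i j * k j)"

lemma sqnorm_nonneg: "0 \<le> sqnorm k"
  unfolding sqnorm_def by (rule infsum_nonneg) simp

lemma sum_le_sqnorm: "sqs k \<Longrightarrow> finite S \<Longrightarrow> (\<Sum>i\<in>S. (cmod (k i))\<^sup>2) \<le> sqnorm k"
  unfolding sqnorm_def sqs_def by (rule finite_sum_le_infsum) auto

lemma sqsI:
  assumes "\<And>S. finite S \<Longrightarrow> (\<Sum>i\<in>S. (cmod (k i))\<^sup>2) \<le> B"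
  shows "sqs k" "sqnorm k \<le> B"
proof -
  show s: "sqs k" unfolding sqs_def
    by (rule nonneg_bdd_above_summable_on) (use assms in \<open>auto intro!: bdd_aboveI2\<close>)
  show "sqnorm k \<le> B" unfolding sqnorm_def
    by (rule infsum_le_finite_sums) (use assms s in \<open>auto simp: sqs_def\<close>)
qed

lemma sqs_finite_support: "finite S \<Longrightarrow> (\<And>i. i \<notin> S \<Longrightarrow> k i = 0) \<Longrightarrow> sqs k"
  unfolding sqs_def by (rule summable_on_cong_neutral[THEN iffD1, of UNIV S "\<lambda>i. (cmod (k i))\<^sup>2"])
    (auto intro: summable_on_finite)

lemma cnj_mult_self: "cnj z * z = complex_of_real ((cmod z)\<^sup>2)"
  using complex_norm_square[of z] by (simp add: mult.commute)

lemma cmod_mult_le: "cmod (a * b) \<le> (cmod a)\<^sup>2 + (cmod b)\<^sup>2"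
proof -
  have "0 \<le> (cmod a - cmod b)\<^sup>2" "0 \<le> cmod a * cmod b" by simp_all
  then have "cmod a * cmod b \<le> (cmod a)\<^sup>2 + (cmod b)\<^sup>2" unfolding power2_diff by linarith
  then show ?thesis by (simp add: norm_mult)
qed

lemma sqs_mult_summable:
  assumes "sqs k" "sqs l"
  shows "(\<lambda>i. norm (k i * l i)) summable_on UNIV"
proof (rule Infinite_Sum.abs_summable_on_comparison_test')
  show "(\<lambda>i. (cmod (k i))\<^sup>2 + (cmod (l i))\<^sup>2) summable_on UNIV"
    using assms by (intro summable_on_add) (auto simp: sqs_def)
qed (rule cmod_mult_le)

lemma sqs_cnj [simp]: "sqs (\<lambda>i. cnj (k i)) \<longleftrightarrow> sqs k"
  by (simp add: sqs_def)

lemma sqnorm_cnj [simp]: "sqnorm (\<lambda>i. cnj (k i)) = sqnorm k"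
  by (simp add: sqnorm_def)

lemma sqs_restrict: "sqs k \<Longrightarrow> sqs (\<lambda>i. if P i then k i else 0)"
  unfolding sqs_def by (erule summable_on_comparison_test) auto

lemma ip_bound:
  assumes "sqs l" "sqs k"
  shows "cmod (ip l k) \<le> sqrt (sqnorm l) * sqrt (sqnorm k)"
proof -
  have s: "(\<lambda>i. norm (cnj (l i) * k i)) summable_on UNIV"
    by (rule sqs_mult_summable) (use assms in simp_all)
  have "cmod (ip l k) \<le> (\<Sum>\<^sub>\<infinity>i. cmod (cnj (l i) * k i))"
    unfolding ip_def by (rule norm_infsum_bound) (use s in simp)
  also have "\<dots> \<le> sqrt (sqnorm l) * sqrt (sqnorm k)"
  proof (rule infsum_le_finite_sums)
    fix S :: "'a set" assume S: "finite S"
    have "(\<Sum>i\<in>S. cmod (cnj (l i) * k i)) = (\<Sum>i\<in>S. \<bar>cmod (l i)\<bar> * \<bar>cmod (k i)\<bar>)"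
      by (simp add: norm_mult)
    also have "\<dots> \<le> sqrt (\<Sum>i\<in>S. (cmod (l i))\<^sup>2) * sqrt (\<Sum>i\<in>S. (cmod (k i))\<^sup>2)"
      using L2_set_mult_ineq[of "\<lambda>i. cmod (l i)" "\<lambda>i. cmod (k i)" S] by (simp add: L2_set_def)
    also have "\<dots> \<le> sqrt (sqnorm l) * sqrt (sqnorm k)"
      using S assms by (intro mult_mono real_sqrt_le_mono sum_le_sqnorm) (auto intro: sum_nonneg simp: sqnorm_nonneg)
    finally show "(\<Sum>i\<in>S. cmod (cnj (l i) * k i)) \<le> sqrt (sqnorm l) * sqrt (sqnorm k)" .
  qed (use s in auto)
  finally show ?thesis .
qed

lemma bmat_rect:
  assumes "bmat C m" "finite S" "finite T"
  shows "cmod (\<Sum>i\<in>S. \<Sum>j\<in>T. cnj (k i) * m i j * l j)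
    \<le> C * sqrt (\<Sum>i\<in>S. (cmod (k i))\<^sup>2) * sqrt (\<Sum>i\<in>T. (cmod (l i))\<^sup>2)"
proof -
  let ?k = "\<lambda>i. if i \<in> S then k i else 0" and ?l = "\<lambda>i. if i \<in> T then l i else 0"
  let ?U = "S \<union> T"
  have U: "finite ?U" using assms by simp
  have "(\<Sum>i\<in>S. \<Sum>j\<in>T. cnj (k i) * m i j * l j) = (\<Sum>i\<in>S. \<Sum>j\<in>?U. cnj (k i) * m i j * ?l j)"
    by (rule sum.cong[OF refl], rule sum.mono_neutral_cong_left[OF U]) auto
  also have "\<dots> = (\<Sum>i\<in>?U. \<Sum>j\<in>?U. cnj (?k i) * m i j * ?l j)"
    by (rule sum.mono_neutral_cong_left[OF U]) (auto intro: sum.neutral)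
  also have "cmod \<dots> \<le> C * sqrt (\<Sum>i\<in>?U. (cmod (?k i))\<^sup>2) * sqrt (\<Sum>i\<in>?U. (cmod (?l i))\<^sup>2)"
    by (rule assms(1)[unfolded bmat_def, THEN conjunct2, rule_format, OF U])
  also have "(\<Sum>i\<in>?U. (cmod (?k i))\<^sup>2) = (\<Sum>i\<in>S. (cmod (k i))\<^sup>2)"
    by (rule sum.mono_neutral_cong_right[OF U]) auto
  also have "(\<Sum>i\<in>?U. (cmod (?l i))\<^sup>2) = (\<Sum>i\<in>T. (cmod (l i))\<^sup>2)"
    by (rule sum.mono_neutral_cong_right[OF U]) auto
  finally show ?thesis .
qed

text \<open>Test the form against the image vector itself: with X its norm and N the norm of k this gives
  \<open>X\<^sup>2 \<le> C * X * N\<close>.\<close>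

lemma bmat_finite_image:
  assumes m: "bmat C m" and S: "finite S" and T: "finite T"
  shows "(\<Sum>i\<in>S. (cmod (\<Sum>j\<in>T. m i j * k j))\<^sup>2) \<le> C\<^sup>2 * (\<Sum>j\<in>T. (cmod (k j))\<^sup>2)"
proof -
  let ?v = "\<lambda>i. \<Sum>j\<in>T. m i j * k j"
  define X where "X = sqrt (\<Sum>i\<in>S. (cmod (?v i))\<^sup>2)"
  define N where "N = sqrt (\<Sum>j\<in>T. (cmod (k j))\<^sup>2)"
  have C: "0 \<le> C" using m by (simp add: bmat_def)
  have pos: "0 \<le> X" "0 \<le> N" by (auto simp: X_def N_def intro: sum_nonneg)
  have X2: "X\<^sup>2 = (\<Sum>i\<in>S. (cmod (?v i))\<^sup>2)" by (simp add: X_def sum_nonneg)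
  have "(\<Sum>i\<in>S. \<Sum>j\<in>T. cnj (?v i) * m i j * k j) = (\<Sum>i\<in>S. cnj (?v i) * ?v i)"
    by (simp only: sum_distrib_left mult.assoc)
  also have "\<dots> = complex_of_real (\<Sum>i\<in>S. (cmod (?v i))\<^sup>2)"
    unfolding of_real_sum by (intro sum.cong refl cnj_mult_self)
  finally have "cmod (\<Sum>i\<in>S. \<Sum>j\<in>T. cnj (?v i) * m i j * k j) = X\<^sup>2"
    by (simp only: X2 norm_of_real) (simp add: sum_nonneg)
  then have "X\<^sup>2 \<le> C * X * N"
    using bmat_rect[OF m S T, of ?v k] by (simp add: X_def N_def)
  then have le: "X * X \<le> X * (C * N)" by (simp only: power2_eq_square mult.assoc mult.left_commute)
  have "X \<le> C * N"
  proof (cases "X = 0")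
    case False
    then have "0 < X" using pos by simp
    then show ?thesis using le by (simp only: mult_le_cancel_left_pos)
  qed (use pos C in simp)
  then have "X\<^sup>2 \<le> (C * N)\<^sup>2" by (rule power_mono) (fact pos)
  then show ?thesis by (simp add: X2 N_def power_mult_distrib sum_nonneg)
qed

lemma bmat_adjoint: "bmat C m \<Longrightarrow> bmat C (\<lambda>i j. cnj (m j i))"
  unfolding bmat_def
proof (intro conjI allI impI)
  fix S :: "'a set" and k l :: "'a \<Rightarrow> complex"
  assume m: "0 \<le> C \<and> (\<forall>S k l. finite S \<longrightarrow> cmod (\<Sum>i\<in>S. \<Sum>j\<in>S. cnj (k i) * m i j * l j)
    \<le> C * sqrt (\<Sum>i\<in>S. (cmod (k i))\<^sup>2) * sqrt (\<Sum>i\<in>S. (cmod (l i))\<^sup>2))" and S: "finite S"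
  have "(\<Sum>i\<in>S. \<Sum>j\<in>S. cnj (k i) * cnj (m j i) * l j) = (\<Sum>j\<in>S. \<Sum>i\<in>S. cnj (k i) * cnj (m j i) * l j)"
    by (rule sum.swap)
  also have "\<dots> = cnj (\<Sum>j\<in>S. \<Sum>i\<in>S. cnj (l j) * m j i * k i)"
    by (simp add: mult_ac)
  also have "cmod \<dots> = cmod (\<Sum>j\<in>S. \<Sum>i\<in>S. cnj (l j) * m j i * k i)" by (rule complex_mod_cnj)
  also have "\<dots> \<le> C * sqrt (\<Sum>i\<in>S. (cmod (l i))\<^sup>2) * sqrt (\<Sum>i\<in>S. (cmod (k i))\<^sup>2)"
    by (rule m[THEN conjunct2, rule_format, OF S])
  finally show "cmod (\<Sum>i\<in>S. \<Sum>j\<in>S. cnj (k i) * cnj (m j i) * l j)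
    \<le> C * sqrt (\<Sum>i\<in>S. (cmod (k i))\<^sup>2) * sqrt (\<Sum>i\<in>S. (cmod (l i))\<^sup>2)" by (simp add: mult_ac)
qed simp

lemma bmat_col:
  assumes "bmat C m"
  shows "sqs (\<lambda>i. m i j)" "sqnorm (\<lambda>i. m i j) \<le> C\<^sup>2"
  using bmat_finite_image[OF assms, of _ "{j}" "\<lambda>_. 1"] by (auto intro: sqsI)

lemma bmat_row:
  assumes "bmat C m"
  shows "sqs (\<lambda>j. m i j)" "sqnorm (\<lambda>j. m i j) \<le> C\<^sup>2"
  using bmat_col[OF bmat_adjoint[OF assms], of i] by simp_all

lemma mop_summable:
  assumes "bmat C m" "sqs k"
  shows "(\<lambda>j. m i j * k j) summable_on UNIV"
  using sqs_mult_summable[OF bmat_row(1)[OF assms(1)] assms(2)] by (rule abs_summable_summable)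

lemma mop_bound:
  assumes m: "bmat C m" and k: "sqs k"
  shows "sqs (mop m k)" "sqnorm (mop m k) \<le> C\<^sup>2 * sqnorm k"
proof -
  have "(\<Sum>i\<in>S. (cmod (mop m k i))\<^sup>2) \<le> C\<^sup>2 * sqnorm k" if S: "finite S" for S
  proof (rule tendsto_le)
    show "((\<lambda>T. \<Sum>i\<in>S. (cmod (\<Sum>j\<in>T. m i j * k j))\<^sup>2) \<longlongrightarrow> (\<Sum>i\<in>S. (cmod (mop m k i))\<^sup>2)) (finite_subsets_at_top UNIV)"
      unfolding mop_def by (intro tendsto_intros infsum_tendsto mop_summable[OF m k])
    show "((\<lambda>_. C\<^sup>2 * sqnorm k) \<longlongrightarrow> C\<^sup>2 * sqnorm k) (finite_subsets_at_top UNIV)" by (rule tendsto_const)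
    show "\<forall>\<^sub>F T in finite_subsets_at_top UNIV. (\<Sum>i\<in>S. (cmod (\<Sum>j\<in>T. m i j * k j))\<^sup>2) \<le> C\<^sup>2 * sqnorm k"
    proof (rule eventually_finite_subsets_at_top_weakI)
      fix T :: "'a set" assume T: "finite T"
      have "(\<Sum>i\<in>S. (cmod (\<Sum>j\<in>T. m i j * k j))\<^sup>2) \<le> C\<^sup>2 * (\<Sum>j\<in>T. (cmod (k j))\<^sup>2)"
        by (rule bmat_finite_image[OF m S T])
      also have "\<dots> \<le> C\<^sup>2 * sqnorm k" by (intro mult_left_mono sum_le_sqnorm k T) simp
      finally show "(\<Sum>i\<in>S. (cmod (\<Sum>j\<in>T. m i j * k j))\<^sup>2) \<le> C\<^sup>2 * sqnorm k" .
    qed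
  qed simp
  then show "sqs (mop m k)" "sqnorm (mop m k) \<le> C\<^sup>2 * sqnorm k" by (auto intro: sqsI)
qed

lemma mop_linear:
  assumes "bmat C m" "sqs k" "sqs l"
  shows "mop m (\<lambda>i. c * k i + d * l i) i = c * mop m k i + d * mop m l i"
proof -
  have "mop m (\<lambda>i. c * k i + d * l i) i = (\<Sum>\<^sub>\<infinity>j. c * (m i j * k j) + d * (m i j * l j))"
    unfolding mop_def by (simp add: algebra_simps)
  also have "\<dots> = (\<Sum>\<^sub>\<infinity>j. c * (m i j * k j)) + (\<Sum>\<^sub>\<infinity>j. d * (m i j * l j))"
    using assms by (intro infsum_add summable_on_cmult_right mop_summable)
  finally show ?thesis unfolding mop_def using assms by (simp add: infsum_cmult_right mop_summable)
qed

lemma ip_linear_right: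
  assumes "sqs l" "sqs k" "sqs k'"
  shows "ip l (\<lambda>i. c * k i + d * k' i) = c * ip l k + d * ip l k'"
proof -
  have s: "(\<lambda>i. cnj (l i) * f i) summable_on UNIV" if "sqs f" for f
    using sqs_mult_summable[of "\<lambda>i. cnj (l i)" f] assms(1) that by (auto intro: abs_summable_summable)
  have "ip l (\<lambda>i. c * k i + d * k' i) = (\<Sum>\<^sub>\<infinity>i. c * (cnj (l i) * k i) + d * (cnj (l i) * k' i))"
    unfolding ip_def by (simp add: algebra_simps)
  also have "\<dots> = (\<Sum>\<^sub>\<infinity>i. c * (cnj (l i) * k i)) + (\<Sum>\<^sub>\<infinity>i. d * (cnj (l i) * k' i))"
    using assms by (intro infsum_add summable_on_cmult_right s)
  finally show ?thesis unfolding ip_def using assms by (simp add: infsum_cmult_right s)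
qed

lemma ip_cnj: "cnj (ip l k) = ip k l"
  by (simp add: ip_def flip: infsum_cnj) (simp add: mult.commute)

lemma ip_self_sqs: "sqs k \<Longrightarrow> ip k k = complex_of_real (sqnorm k)"
  unfolding ip_def sqnorm_def cnj_mult_self sqs_def
  by (rule infsumI) (simp only: has_sum_of_real_iff has_sum_infsum)

lemma sqs_tail:
  assumes "sqs k"
  shows "((\<lambda>T. sqnorm (\<lambda>j. if j \<in> T then 0 else k j)) \<longlongrightarrow> 0) (finite_subsets_at_top UNIV)"
proof -
  have "sqnorm (\<lambda>j. if j \<in> T then 0 else k j) = sqnorm k - (\<Sum>j\<in>T. (cmod (k j))\<^sup>2)" if "finite T" for T
  proof -
    have "sqnorm k = (\<Sum>\<^sub>\<infinity>j\<in>T \<union> - T. (cmod (k j))\<^sup>2)" by (simp add: sqnorm_def)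
    also have "\<dots> = (\<Sum>\<^sub>\<infinity>j\<in>T. (cmod (k j))\<^sup>2) + (\<Sum>\<^sub>\<infinity>j\<in>- T. (cmod (k j))\<^sup>2)"
      using assms that by (intro infsum_Un_disjoint) (auto simp: sqs_def intro: summable_on_subset_banach)
    also have "(\<Sum>\<^sub>\<infinity>j\<in>- T. (cmod (k j))\<^sup>2) = sqnorm (\<lambda>j. if j \<in> T then 0 else k j)"
      unfolding sqnorm_def by (rule infsum_cong_neutral) auto
    finally show ?thesis using that by simp
  qed
  then have ev: "\<forall>\<^sub>F T in finite_subsets_at_top UNIV.
     sqnorm k - (\<Sum>j\<in>T. (cmod (k j))\<^sup>2) = sqnorm (\<lambda>j. if j \<in> T then 0 else k j)"
    by (intro eventually_finite_subsets_at_top_weakI) simp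
  have "((\<lambda>T. sqnorm k - (\<Sum>j\<in>T. (cmod (k j))\<^sup>2)) \<longlongrightarrow> sqnorm k - sqnorm k) (finite_subsets_at_top UNIV)"
    unfolding sqnorm_def using assms by (intro tendsto_diff tendsto_const infsum_tendsto) (simp add: sqs_def)
  then show ?thesis using Lim_transform_eventually[OF _ ev] by simp
qed

lemma mop_finite:
  assumes "finite T"
  shows "mop m (\<lambda>j. if j \<in> T then k j else 0) i = (\<Sum>j\<in>T. m i j * k j)"
proof -
  have "mop m (\<lambda>j. if j \<in> T then k j else 0) i = (\<Sum>\<^sub>\<infinity>j\<in>T. m i j * k j)"
    unfolding mop_def by (rule infsum_cong_neutral) auto
  then show ?thesis using assms by simp
qed

lemma if_not_swap: "(if \<not> Q then x else y) = (if Q then y else x)"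
  by simp

lemma infsum_finite_sum:
  fixes f :: "'a \<Rightarrow> 'b \<Rightarrow> complex"
  assumes "finite T" "\<And>j. j \<in> T \<Longrightarrow> f j summable_on A"
  shows "(\<Sum>\<^sub>\<infinity>i\<in>A. \<Sum>j\<in>T. f j i) = (\<Sum>j\<in>T. infsum (f j) A)"
proof -
  have "(\<lambda>i. \<Sum>j\<in>T. f j i) summable_on A \<and> (\<Sum>\<^sub>\<infinity>i\<in>A. \<Sum>j\<in>T. f j i) = (\<Sum>j\<in>T. infsum (f j) A)"
    using assms by (induction T rule: finite_induct) (auto simp: infsum_add summable_on_add)
  then show ?thesis ..
qed

text \<open>For k of finite support, the inner product is a finite sum of infinite ones. The remaining tail
  of k contributes little because the operator is bounded.\<close>

lemma mop_adjoint:
  assumes m: "bmat C m" and k: "sqs k" and l: "sqs l"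
  shows "ip l (mop m k) = ip (mop (\<lambda>i j. cnj (m j i)) l) k"
proof -
  let ?n = "\<lambda>i j. cnj (m j i)"
  let ?F = "finite_subsets_at_top (UNIV :: 'a set)"
  have n: "bmat C ?n" by (rule bmat_adjoint[OF m])
  have C: "0 \<le> C" using m by (simp add: bmat_def)
  have s: "(\<lambda>i. cnj (l i) * f i) summable_on UNIV" if "sqs f" for f
    using sqs_mult_summable[of "\<lambda>i. cnj (l i)" f] l that by (auto intro: abs_summable_summable)
  let ?in = "\<lambda>T j. if j \<in> T then k j else 0" and ?out = "\<lambda>T j. if j \<in> T then 0 else k j"
  have kin: "sqs (?in T)" and kout: "sqs (?out T)" for T
    using sqs_restrict[OF k, of "\<lambda>j. j \<in> T"] sqs_restrict[OF k, of "\<lambda>j. j \<notin> T"] by (simp_all only: if_not_swap)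
  have 1: "ip l (mop m (?in T)) = (\<Sum>j\<in>T. cnj (mop ?n l j) * k j)" if T: "finite T" for T
  proof -
    have "ip l (mop m (?in T)) = (\<Sum>\<^sub>\<infinity>i. \<Sum>j\<in>T. k j * (cnj (l i) * m i j))"
      unfolding ip_def mop_finite[OF T] by (simp add: sum_distrib_left mult_ac)
    also have "\<dots> = (\<Sum>j\<in>T. \<Sum>\<^sub>\<infinity>i. k j * (cnj (l i) * m i j))"
      by (rule infsum_finite_sum[OF T]) (intro summable_on_cmult_right s bmat_col(1)[OF m])
    also have "\<dots> = (\<Sum>j\<in>T. k j * (\<Sum>\<^sub>\<infinity>i. cnj (l i) * m i j))"
      by (intro sum.cong refl infsum_cmult_right s bmat_col(1)[OF m])
    also have "(\<lambda>j. \<Sum>\<^sub>\<infinity>i. cnj (l i) * m i j) = (\<lambda>j. cnj (mop ?n l j))"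
      by (simp add: mop_def mult.commute flip: infsum_cnj)
    finally show ?thesis by (simp add: mult.commute)
  qed
  have split: "ip l (mop m k) = ip l (mop m (?in T)) + ip l (mop m (?out T))" for T
  proof -
    have "mop m k i = 1 * mop m (?in T) i + 1 * mop m (?out T) i" for i
      by (subst mop_linear[OF m kin kout, symmetric]) (rule arg_cong[of _ _ "\<lambda>k. mop m k i"], auto)
    then have "ip l (mop m k) = ip l (\<lambda>i. 1 * mop m (?in T) i + 1 * mop m (?out T) i)" by (simp add: ip_def)
    also have "\<dots> = 1 * ip l (mop m (?in T)) + 1 * ip l (mop m (?out T))"
      by (rule ip_linear_right[OF l mop_bound(1)[OF m kin] mop_bound(1)[OF m kout]])
    finally show ?thesis by simp
  qed
  have "((\<lambda>T. ip l (mop m (?out T))) \<longlongrightarrow> 0) ?F"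
  proof (rule Lim_null_comparison)
    show "\<forall>\<^sub>F T in ?F. cmod (ip l (mop m (?out T))) \<le> sqrt (sqnorm l) * sqrt (C\<^sup>2 * sqnorm (?out T))"
    proof (rule always_eventually, rule allI)
      fix T
      have "cmod (ip l (mop m (?out T))) \<le> sqrt (sqnorm l) * sqrt (sqnorm (mop m (?out T)))"
        by (rule ip_bound[OF l mop_bound(1)[OF m kout]])
      also have "\<dots> \<le> sqrt (sqnorm l) * sqrt (C\<^sup>2 * sqnorm (?out T))"
        by (intro mult_left_mono real_sqrt_le_mono mop_bound(2)[OF m kout]) (simp add: sqnorm_nonneg)
      finally show "cmod (ip l (mop m (?out T))) \<le> sqrt (sqnorm l) * sqrt (C\<^sup>2 * sqnorm (?out T))" .
    qed
    have "((\<lambda>T. sqrt (sqnorm l) * sqrt (C\<^sup>2 * sqnorm (?out T))) \<longlongrightarrow> sqrt (sqnorm l) * sqrt (C\<^sup>2 * 0)) ?F"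
      by (intro tendsto_intros sqs_tail[OF k])
    then show "((\<lambda>T. sqrt (sqnorm l) * sqrt (C\<^sup>2 * sqnorm (?out T))) \<longlongrightarrow> 0) ?F" by simp
  qed
  then have "((\<lambda>T. ip l (mop m k) - ip l (mop m (?out T))) \<longlongrightarrow> ip l (mop m k) - 0) ?F"
    by (intro tendsto_intros)
  moreover have "\<forall>\<^sub>F T in ?F. ip l (mop m k) - ip l (mop m (?out T)) = (\<Sum>j\<in>T. cnj (mop ?n l j) * k j)"
  proof (rule eventually_finite_subsets_at_top_weakI)
    fix T :: "'a set" assume T: "finite T"
    show "ip l (mop m k) - ip l (mop m (?out T)) = (\<Sum>j\<in>T. cnj (mop ?n l j) * k j)"
      by (subst split[of T]) (simp add: 1[OF T])
  qed
  ultimately have "((\<lambda>T. \<Sum>j\<in>T. cnj (mop ?n l j) * k j) \<longlongrightarrow> ip l (mop m k)) ?F"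
    by (auto intro: Lim_transform_eventually)
  moreover have "((\<lambda>T. \<Sum>j\<in>T. cnj (mop ?n l j) * k j) \<longlongrightarrow> ip (mop ?n l) k) ?F"
    unfolding ip_def
    by (rule infsum_tendsto) (use sqs_mult_summable[of "\<lambda>i. cnj (mop ?n l i)" k] k mop_bound(1)[OF n l]
        in \<open>auto intro: abs_summable_summable\<close>)
  ultimately show ?thesis by (rule tendsto_unique[rotated 1]) simp
qed

text \<open>Each row of m is square-summable, so applying m after n amounts to an inner product, to which
  \<open>mop_adjoint\<close> applies.\<close>

lemma mop_compose:
  assumes m: "bmat C m" and n: "bmat D n" and k: "sqs k"
    and p: "\<And>j. p i j = (\<Sum>\<^sub>\<infinity>r. m i r * n r j)"
  shows "mop p k i = mop m (mop n k) i"
proof -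
  let ?l = "\<lambda>r. cnj (m i r)"
  have l: "sqs ?l" using bmat_row(1)[OF m] by simp
  have "mop m (mop n k) i = ip ?l (mop n k)" by (simp add: mop_def ip_def)
  also have "\<dots> = ip (mop (\<lambda>i j. cnj (n j i)) ?l) k" by (rule mop_adjoint[OF n k l])
  also have "\<dots> = (\<Sum>\<^sub>\<infinity>j. (\<Sum>\<^sub>\<infinity>r. n r j * m i r) * k j)"
    unfolding ip_def by (simp add: mop_def flip: infsum_cnj)
  finally show ?thesis by (simp add: p mop_def[of p] mult.commute)
qed

section \<open>Elementary C*-algebra\<close>

lemma scaleC_one [simp]: "1 *\<^sub>C x = (x :: 'c::cstar_algebra)"
  using scaleR_scaleC[of 1 x] by simp

lemma scaleC_zero_left [simp]: "0 *\<^sub>C x = (0 :: 'c::cstar_algebra)"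
  using scaleR_scaleC[of 0 x] by simp

lemma scaleC_zero_right [simp]: "c *\<^sub>C 0 = (0 :: 'c::cstar_algebra)"
  using scaleC_add_right[of c 0 "0 :: 'c"] by simp

lemma scaleC_minus_right: "c *\<^sub>C (- x) = - (c *\<^sub>C (x :: 'c::cstar_algebra))"
  using scaleC_add_right[of c x "- x"] by (simp add: eq_neg_iff_add_eq_0 add.commute)

lemma scaleC_minus_left: "(- c) *\<^sub>C x = - (c *\<^sub>C (x :: 'c::cstar_algebra))"
  using scaleC_add_left[of c "- c" x] by (simp add: eq_neg_iff_add_eq_0 add.commute)

lemma scaleC_diff_right: "c *\<^sub>C (x - y) = c *\<^sub>C x - c *\<^sub>C (y :: 'c::cstar_algebra)"
  using scaleC_add_right[of c x "- y"] by (simp add: scaleC_minus_right)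

lemma scaleC_diff_left: "(c - d) *\<^sub>C x = c *\<^sub>C x - d *\<^sub>C (x :: 'c::cstar_algebra)"
  using scaleC_add_left[of c "- d" x] by (simp add: scaleC_minus_left)

lemma scaleC_sum_right: "c *\<^sub>C (sum f A) = (\<Sum>a\<in>A. c *\<^sub>C (f a :: 'c::cstar_algebra))"
  by (induction A rule: infinite_finite_induct) (simp_all add: scaleC_add_right)

lemma scaleC_sum_left: "(sum f A) *\<^sub>C x = (\<Sum>a\<in>A. f a *\<^sub>C (x :: 'c::cstar_algebra))"
  by (induction A rule: infinite_finite_induct) (simp_all add: scaleC_add_left)

lemma adj_zero [simp]: "adj (0 :: 'c::cstar_algebra) = 0"
  using adj_add[of 0 "0 :: 'c"] by simp

lemma adj_minus: "adj (- x) = - adj (x :: 'c::cstar_algebra)"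
  using adj_add[of x "- x"] by (simp add: eq_neg_iff_add_eq_0 add.commute)

lemma adj_diff: "adj (x - y) = adj x - adj (y :: 'c::cstar_algebra)"
  using adj_add[of x "- y"] by (simp add: adj_minus)

lemma adj_one [simp]: "adj (1 :: 'c::cstar_algebra) = 1"
  using adj_mult[of "adj 1" "1 :: 'c"] by (simp add: adj_adj)

lemma adj_sum: "adj (sum f A) = (\<Sum>a\<in>A. adj (f a :: 'c::cstar_algebra))"
  by (induction A rule: infinite_finite_induct) (simp_all add: adj_add)

lemma norm_adj: "norm (adj x) = norm (x :: 'c::cstar_algebra)"
proof -
  have *: "norm y \<le> norm (adj y)" for y :: 'c
  proof (cases "y = 0")
    case False
    have "norm y * norm y \<le> norm (adj y) * norm y"
      using norm_mult_ineq[of "adj y" y] norm_adj_mult[of y] by (simp only: power2_eq_square)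
    then show ?thesis using False by simp
  qed simp
  show ?thesis using *[of x] *[of "adj x"] by (simp add: adj_adj)
qed

lemma tendsto_scaleC:
  assumes "(f \<longlongrightarrow> a) F" and "(g \<longlongrightarrow> x) F"
  shows "((\<lambda>n. f n *\<^sub>C g n) \<longlongrightarrow> a *\<^sub>C (x :: 'c::cstar_algebra)) F"
proof -
  have "((\<lambda>n. norm (f n) * norm (g n - x) + norm (f n - a) * norm x) \<longlongrightarrow> norm a * norm (x - x) + norm (a - a) * norm x) F"
    using assms by (intro tendsto_intros)
  then have "((\<lambda>n. norm (f n) * norm (g n - x) + norm (f n - a) * norm x) \<longlongrightarrow> 0) F" by simp
  then have "((\<lambda>n. f n *\<^sub>C g n - a *\<^sub>C x) \<longlongrightarrow> 0) F"
  proof (rule Lim_null_comparison[rotated], intro always_eventually allI)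
    fix n
    have "f n *\<^sub>C g n - a *\<^sub>C x = f n *\<^sub>C (g n - x) + (f n - a) *\<^sub>C x"
      by (simp add: scaleC_diff_left scaleC_diff_right)
    then show "norm (f n *\<^sub>C g n - a *\<^sub>C x) \<le> norm (f n) * norm (g n - x) + norm (f n - a) * norm x"
      by (metis norm_triangle_ineq norm_scaleC)
  qed
  then show ?thesis by (simp add: LIM_zero_iff)
qed

section \<open>Fermion modes\<close>

text \<open>Canonical anticommutation relations in an arbitrary C*-algebra. Here \<open>b x\<close> creates:
  the vacuum considered below is the one annihilated by every \<open>adj (b x)\<close>.\<close>

locale fermion_modes =
  fixes b :: "'x::linorder \<Rightarrow> 'c::cstar_algebra"
  assumes bb: "b x * b y + b y * b x = 0"
    and ab: "adj (b x) * b y + b y * adj (b x) = (if x = y then 1 else 0)"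
begin

lemma bb_swap: "b x * b y = - (b y * b x)"
  using bb[of x y] by (simp add: eq_neg_iff_add_eq_0)

lemma aa_swap: "adj (b x) * adj (b y) = - (adj (b y) * adj (b x))"
  using arg_cong[OF bb_swap[of y x], of adj] by (simp add: adj_mult adj_minus)

lemma ab_swap: "x \<noteq> y \<Longrightarrow> adj (b x) * b y = - (b y * adj (b x))"
  using ab[of x y] by (simp add: eq_neg_iff_add_eq_0)

lemma ba_swap: "x \<noteq> y \<Longrightarrow> b y * adj (b x) = - (adj (b x) * b y)"
  by (simp add: ab_swap)

lemma double_zero: "z = - z \<Longrightarrow> z = (0 :: 'c)"
proof -
  assume "z = - z"
  then have "z + z = 0" by (simp add: eq_neg_iff_add_eq_0)
  then have "2 *\<^sub>R z = 0" by (simp add: scaleR_2)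
  then show "z = 0" by simp
qed

lemma b_square: "b x * b x = 0"
  by (rule double_zero) (rule bb_swap)

lemma a_square: "adj (b x) * adj (b x) = 0"
  by (rule double_zero) (rule aa_swap)

text \<open>In the Fock representation this is the projection onto the vectors in which mode x is empty.\<close>

definition vac :: "'x \<Rightarrow> 'c" where "vac x = adj (b x) * b x"

lemma adj_vac: "adj (vac x) = vac x"
  by (simp add: vac_def adj_mult adj_adj)

lemma vac_idem: "vac x * vac x = vac x"
proof -
  have "vac x * vac x = adj (b x) * (b x * adj (b x)) * b x" by (simp add: vac_def mult.assoc)
  also have "b x * adj (b x) = 1 - adj (b x) * b x" using ab[of x x] by (simp add: algebra_simps)
  also have "adj (b x) * (1 - adj (b x) * b x) * b x = vac x - (adj (b x) * adj (b x)) * (b x * b x)"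
    by (simp add: vac_def algebra_simps)
  finally show ?thesis by (simp add: b_square)
qed

lemma b_vac_comm: "x \<noteq> y \<Longrightarrow> b y * vac x = vac x * b y"
proof -
  assume xy: "x \<noteq> y"
  have "b y * vac x = (b y * adj (b x)) * b x" by (simp add: vac_def mult.assoc)
  also have "\<dots> = - (adj (b x) * (b y * b x))" by (simp add: ba_swap[OF xy] mult.assoc)
  also have "\<dots> = vac x * b y" by (subst bb_swap) (simp add: vac_def mult.assoc)
  finally show ?thesis .
qed

lemma a_vac_comm: "x \<noteq> y \<Longrightarrow> adj (b y) * vac x = vac x * adj (b y)"
  using arg_cong[OF b_vac_comm[of x y], of adj] by (simp add: adj_mult adj_vac)

lemma vac_comm: "vac x * vac y = vac y * vac x"
proof (cases "x = y")
  case False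
  have "vac x * vac y = (vac x * adj (b y)) * b y" by (simp add: vac_def[of y] mult.assoc)
  also have "\<dots> = adj (b y) * (vac x * b y)" by (simp add: a_vac_comm[OF False, symmetric] mult.assoc)
  also have "\<dots> = vac y * vac x" by (simp add: b_vac_comm[OF False, symmetric] vac_def[of y] mult.assoc)
  finally show ?thesis .
qed simp

text \<open>The projection onto the vectors in which all modes of X are empty. The vacuum projection itself
  is the limit of these for growing X and need not belong to the algebra.\<close>

definition P :: "'x set \<Rightarrow> 'c" where "P X = Finite_Set.fold (\<lambda>x p. vac x * p) 1 X"

lemma P_empty [simp]: "P {} = 1" by (simp add: P_def)

lemma P_insert: "finite X \<Longrightarrow> x \<notin> X \<Longrightarrow> P (insert x X) = vac x * P X"
proof -
  interpret comp_fun_commute "\<lambda>x p. vac x * p"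
    by standard (auto simp: fun_eq_iff vac_comm simp flip: mult.assoc)
  show "finite X \<Longrightarrow> x \<notin> X \<Longrightarrow> P (insert x X) = vac x * P X" by (simp add: P_def)
qed

lemma b_P_comm: "finite X \<Longrightarrow> y \<notin> X \<Longrightarrow> b y * P X = P X * b y"
proof (induction X rule: finite_induct)
  case (insert x X)
  then have "x \<noteq> y" by auto
  have "b y * P (insert x X) = (b y * vac x) * P X" using insert by (simp add: P_insert mult.assoc)
  also have "\<dots> = vac x * (b y * P X)" by (simp add: b_vac_comm[OF \<open>x \<noteq> y\<close>] mult.assoc)
  also have "\<dots> = P (insert x X) * b y" using insert by (simp add: P_insert mult.assoc)
  finally show ?case .
qed simp

lemma vac_P_comm: "finite X \<Longrightarrow> vac y * P X = P X * vac y"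
proof (induction X rule: finite_induct)
  case (insert x X)
  have "vac y * P (insert x X) = (vac y * vac x) * P X" using insert by (simp add: P_insert mult.assoc)
  also have "\<dots> = vac x * (vac y * P X)" by (simp add: vac_comm[of y x] mult.assoc)
  also have "\<dots> = P (insert x X) * vac y" using insert by (simp add: P_insert mult.assoc)
  finally show ?case .
qed simp

lemma adj_P: "finite X \<Longrightarrow> adj (P X) = P X"
  by (induction X rule: finite_induct) (simp_all add: P_insert adj_mult adj_vac vac_P_comm)

lemma P_idem: "finite X \<Longrightarrow> P X * P X = P X"
proof (induction X rule: finite_induct)
  case (insert x X)
  have "P (insert x X) * P (insert x X) = vac x * (P X * vac x) * P X"
    using insert by (simp add: P_insert mult.assoc)
  also have "\<dots> = (vac x * vac x) * (P X * P X)"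
    using insert by (simp add: vac_P_comm[symmetric] mult.assoc)
  finally show ?case using insert by (simp add: P_insert vac_idem)
qed simp

lemma a_P_zero: "finite X \<Longrightarrow> x \<in> X \<Longrightarrow> adj (b x) * P X = 0"
proof -
  assume X: "finite X" "x \<in> X"
  then have "P X = vac x * P (X - {x})" using P_insert[of "X - {x}" x] by (simp add: insert_absorb)
  then have "adj (b x) * P X = (adj (b x) * adj (b x)) * (b x * P (X - {x}))" by (simp add: vac_def mult.assoc)
  then show ?thesis by (simp add: a_square)
qed

text \<open>If \<open>P X * vac x\<close> were 0, conjugation with \<open>b x\<close>, which commutes with
  \<open>P X\<close>, would give \<open>P X * (b x * adj (b x)) = 0\<close>; but the two products
  add up to \<open>P X\<close>.\<close>

lemma P_nonzero: "finite X \<Longrightarrow> P X \<noteq> 0"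
proof (induction X rule: finite_induct)
  case (insert x X)
  show ?case
  proof
    assume "P (insert x X) = 0"
    then have z: "P X * vac x = 0" using insert by (simp add: P_insert vac_P_comm)
    have "P X * (b x * adj (b x)) = P X * b x * (adj (b x) * b x + b x * adj (b x)) * adj (b x)"
      by (simp add: ab mult.assoc)
    also have "\<dots> = P X * b x * vac x * adj (b x)"
      by (simp add: algebra_simps vac_def a_square)
    also have "\<dots> = b x * (P X * vac x) * adj (b x)"
      using insert by (simp add: b_P_comm[symmetric] mult.assoc)
    finally have z2: "P X * (b x * adj (b x)) = 0" by (simp add: z)
    have "P X = P X * (vac x + b x * adj (b x))" by (simp add: vac_def ab)
    then show False using z z2 insert by (simp add: distrib_left)
  qed
qed simp

lemma norm_P: "finite X \<Longrightarrow> norm (P X) = 1"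
proof -
  assume X: "finite X"
  have "norm (P X) * norm (P X) = norm (P X)"
    using norm_adj_mult[of "P X"] X by (simp add: adj_P P_idem power2_eq_square)
  then show ?thesis using P_nonzero[OF X] by simp
qed

text \<open>Applied to the vacuum, these words give the orthonormal basis of the Fock space. The largest
  mode stands leftmost, so the sign \<open>eps\<close> of a creation counts the larger modes.\<close>

definition u :: "'x set \<Rightarrow> 'c" where "u S = prod_list (map b (rev (sorted_list_of_set S)))"

lemma u_empty [simp]: "u {} = 1" by (simp add: u_def)

lemma u_insert_max:
  assumes "finite A" "\<And>a. a \<in> A \<Longrightarrow> a < m"
  shows "u (insert m A) = b m * u A"
proof -
  have "sorted_list_of_set (insert m A) = sorted_list_of_set A @ [m]"
    by (rule sorted_distinct_set_unique)
      (use assms in \<open>auto simp: sorted_append less_imp_le simp del: sorted_list_of_set_insert_remove\<close>)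
  then show ?thesis by (simp add: u_def)
qed

definition eps :: "'x \<Rightarrow> 'x set \<Rightarrow> complex" where "eps x S = (-1) ^ card {z \<in> S. x < z}"

lemma eps_square: "eps x S * eps x S = 1"
  by (simp add: eps_def flip: power_mult_distrib)

lemma eps_insert:
  assumes "finite A" "m \<notin> A"
  shows "eps x (insert m A) = (if x < m then - eps x A else eps x A)"
proof -
  have "{z \<in> insert m A. x < z} = (if x < m then insert m {z \<in> A. x < z} else {z \<in> A. x < z})" by auto
  then show ?thesis using assms by (auto simp: eps_def)
qed

lemma b_u: "finite S \<Longrightarrow> b x * u S = (if x \<in> S then 0 else eps x S *\<^sub>C u (insert x S))"
proof (induction S rule: finite_linorder_max_induct)
  case empty
  have "u {x} = b x" using u_insert_max[of "{}" x] by simp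
  then show ?case by (simp add: eps_def)
next
  case (insert m A)
  have mA: "m \<notin> A" using insert by auto
  have um: "u (insert m A) = b m * u A" using insert by (intro u_insert_max) auto
  consider "m < x" | "x = m" | "x < m" by force
  then show ?case
  proof cases
    case 1
    have "u (insert x (insert m A)) = b x * u (insert m A)"
      using insert 1 by (intro u_insert_max) auto
    moreover have "{z \<in> insert m A. x < z} = {}" using insert(2) 1 by force
    then have "eps x (insert m A) = 1" by (simp only: eps_def card.empty power_0)
    moreover have "x \<notin> insert m A" using insert(2) 1 by force
    ultimately show ?thesis by simp
  next
    case 2
    then show ?thesis by (simp add: um b_square flip: mult.assoc)
  next
    case 3
    have "b x * u (insert m A) = - (b m * (b x * u A))"
      unfolding um by (simp add: bb_swap[of x m] flip: mult.assoc)
    also have "\<dots> = (if x \<in> A then 0 else (- eps x A) *\<^sub>C (b m * u (insert x A)))"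
      by (simp add: insert.IH mult_scaleC_right scaleC_minus_left)
    also have "b m * u (insert x A) = u (insert m (insert x A))"
      using insert 3 by (intro u_insert_max[symmetric]) auto
    finally show ?thesis using 3 mA insert by (auto simp: eps_insert insert_commute)
  qed
qed

lemma a_u_absent:
  "finite S \<Longrightarrow> x \<notin> S \<Longrightarrow> adj (b x) * u S = (-1) ^ card S *\<^sub>C (u S * adj (b x))"
proof (induction S rule: finite_linorder_max_induct)
  case (insert m A)
  have mA: "m \<notin> A" using insert by auto
  have um: "u (insert m A) = b m * u A" using insert by (intro u_insert_max) auto
  have "adj (b x) * u (insert m A) = - (b m * (adj (b x) * u A))"
    unfolding um using insert.prems by (simp add: ab_swap flip: mult.assoc)
  then show ?case using insert mA by (simp add: um scaleC_minus_left mult_scaleC_right mult.assoc)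
qed simp

text \<open>The annihilator passes through the word until it meets its own mode or reaches \<open>P
  X\<close>, which it kills.\<close>

lemma a_u:
  assumes X: "finite X" "S \<subseteq> X" "x \<in> X"
  shows "adj (b x) * (u S * P X) = (if x \<in> S then eps x (S - {x}) *\<^sub>C (u (S - {x}) * P X) else 0)"
proof -
  have absent: "adj (b x) * (u T * P X) = 0" if "T \<subseteq> X" "x \<notin> T" for T
  proof -
    have "adj (b x) * (u T * P X) = (-1) ^ card T *\<^sub>C (u T * (adj (b x) * P X))"
      using a_u_absent[of T x] finite_subset[OF that(1) X(1)] that(2)
      by (simp add: mult_scaleC_left flip: mult.assoc)
    then show ?thesis using X by (simp add: a_P_zero)
  qed
  show ?thesis
  proof (cases "x \<in> S")
    case True
    define T where "T = S - {x}"
    have T: "finite T" "x \<notin> T" "S = insert x T" "T \<subseteq> X"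
      using True X finite_subset[OF X(2,1)] by (auto simp: T_def)
    have "eps x T *\<^sub>C (b x * u T) = u S" using T by (simp add: b_u scaleC_scaleC eps_square)
    then have "adj (b x) * (u S * P X) = eps x T *\<^sub>C ((adj (b x) * b x) * (u T * P X))"
      by (metis mult.assoc mult_scaleC_left mult_scaleC_right)
    also have "adj (b x) * b x = 1 - b x * adj (b x)" using ab[of x x] by (simp add: algebra_simps)
    also have "(1 - b x * adj (b x)) * (u T * P X) = u T * P X"
      using absent[of T] T by (simp add: left_diff_distrib mult.assoc)
    finally show ?thesis using True by (simp add: T_def)
  qed (use absent X in simp)
qed

text \<open>Induction on the largest mode of S, whose annihilator is moved into \<open>u T\<close>.\<close>

lemma u_ortho:
  assumes "finite X" "S \<subseteq> X" "T \<subseteq> X"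
  shows "P X * (adj (u S) * (u T * P X)) = (if S = T then P X else 0)"
proof -
  have "finite S" using assms finite_subset by blast
  then show ?thesis using assms(2,3)
  proof (induction S arbitrary: T rule: finite_linorder_max_induct)
    case empty
    show ?case
    proof (cases "T = {}")
      case False
      then obtain m where m: "m \<in> T" "\<And>a. a \<in> T - {m} \<Longrightarrow> a < m"
        using finite_subset[OF empty(2) assms(1)] Max_in[of T] Max_ge[of T]
        by (metis DiffE insertI1 order_less_le)
      then have "u T = b m * u (T - {m})"
        using u_insert_max[of "T - {m}" m] finite_subset[OF empty(2) assms(1)] by (simp add: insert_absorb)
      moreover have "P X * b m = 0"
      proof -
        have "adj (P X * b m) = 0" using a_P_zero[OF assms(1), of m] m empty assms by (auto simp: adj_mult adj_P)
        then show ?thesis by (metis adj_adj adj_zero)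
      qed
      ultimately show ?thesis using False by (simp flip: mult.assoc)
    qed (simp add: P_idem assms)
  next
    case (insert m A)
    have mA: "m \<notin> A" using insert by auto
    have "adj (u (insert m A)) = adj (u A) * adj (b m)"
      using insert by (subst u_insert_max) (auto simp: adj_mult)
    then have "P X * (adj (u (insert m A)) * (u T * P X)) = P X * (adj (u A) * (adj (b m) * (u T * P X)))"
      by (simp add: mult.assoc)
    also have "\<dots> = (if m \<in> T then eps m (T - {m}) *\<^sub>C (P X * (adj (u A) * (u (T - {m}) * P X))) else 0)"
      using insert.prems by (subst a_u[OF assms(1)]) (auto simp: mult_scaleC_right)
    also have "P X * (adj (u A) * (u (T - {m}) * P X)) = (if A = T - {m} then P X else 0)"
      using insert.prems by (intro insert.IH) auto
    finally have eq: "P X * (adj (u (insert m A)) * (u T * P X))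
      = (if m \<in> T then eps m (T - {m}) *\<^sub>C (if A = T - {m} then P X else 0) else 0)" .
    have "insert m A = T \<longleftrightarrow> m \<in> T \<and> A = T - {m}" using mA by auto
    moreover have "{z \<in> A. m < z} = {}" using insert(2) by fastforce
    then have "eps m A = 1" by (simp add: eps_def del: Collect_empty_eq)
    ultimately show ?case unfolding eq by auto
  qed
qed

end

section \<open>The Fock representation\<close>

context fermion_modes
begin

abbreviation FS :: "'x set filter" where "FS \<equiv> finite_subsets_at_top UNIV"

lemma eventually_FS_superset: "finite Y \<Longrightarrow> \<forall>\<^sub>F X in FS. finite X \<and> Y \<subseteq> X"
  unfolding eventually_finite_subsets_at_top by (intro exI[of _ Y]) auto

text \<open>Equality of v and w on the vacuum, detected by all large enough finite sets of modes.\<close>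

definition veq :: "'c \<Rightarrow> 'c \<Rightarrow> bool" where
  "veq v w \<longleftrightarrow> (\<forall>\<^sub>F X in FS. v * P X = w * P X)"

lemma veq_refl [simp]: "veq v v" by (simp add: veq_def)

lemma veq_sym: "veq v w \<Longrightarrow> veq w v"
  unfolding veq_def by (erule eventually_mono) simp

lemma veq_trans: "veq v w \<Longrightarrow> veq w z \<Longrightarrow> veq v z"
  unfolding veq_def by (erule (1) eventually_elim2) simp

lemma veq_mult_left: "veq v w \<Longrightarrow> veq (a * v) (a * w)"
  unfolding veq_def by (erule eventually_mono) (simp add: mult.assoc)

lemma veq_add: "veq v w \<Longrightarrow> veq v' w' \<Longrightarrow> veq (v + v') (w + w')"
  unfolding veq_def by (erule (1) eventually_elim2) (simp add: distrib_right)

lemma veq_scaleC: "veq v w \<Longrightarrow> veq (c *\<^sub>C v) (c *\<^sub>C w)"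
  unfolding veq_def by (erule eventually_mono) (simp add: mult_scaleC_left)

lemma veqI: "finite Y \<Longrightarrow> (\<And>X. finite X \<Longrightarrow> Y \<subseteq> X \<Longrightarrow> v * P X = w * P X) \<Longrightarrow> veq v w"
  unfolding veq_def by (rule eventually_mono[OF eventually_FS_superset[of Y]]) blast+

lemma veq_a_u:
  assumes "finite S"
  shows "veq (adj (b x) * u S) (if x \<in> S then eps x (S - {x}) *\<^sub>C u (S - {x}) else 0)"
proof (rule veqI[of "insert x S"])
  fix X assume "finite X" "insert x S \<subseteq> X"
  then show "adj (b x) * u S * P X = (if x \<in> S then eps x (S - {x}) *\<^sub>C u (S - {x}) else 0) * P X"
    using a_u[of X S x] by (simp add: mult.assoc mult_scaleC_left)
qed (use assms in simp)

definition lc :: "'x set set \<Rightarrow> ('x set \<Rightarrow> complex) \<Rightarrow> 'c" where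
  "lc Q k = (\<Sum>T\<in>Q. k T *\<^sub>C u T)"

text \<open>The elements whose action on the vacuum gives a finite linear combination of basis vectors.\<close>

definition vectors :: "'c set" where
  "vectors = {v. \<exists>Q k. finite Q \<and> (\<forall>T\<in>Q. finite T) \<and> veq v (lc Q k)}"

lemma vectors_cong: "v \<in> vectors \<Longrightarrow> veq w v \<Longrightarrow> w \<in> vectors"
  unfolding vectors_def using veq_trans by blast

lemma vectors_add:
  assumes "v \<in> vectors" "w \<in> vectors"
  shows "v + w \<in> vectors"
proof -
  obtain Q k where Q: "finite Q" "\<forall>T\<in>Q. finite T" "veq v (lc Q k)" using assms by (auto simp: vectors_def)
  obtain R l where R: "finite R" "\<forall>T\<in>R. finite T" "veq w (lc R l)" using assms by (auto simp: vectors_def)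
  have 1: "lc Q k = (\<Sum>T\<in>Q \<union> R. (if T \<in> Q then k T else 0) *\<^sub>C u T)"
    unfolding lc_def by (rule sum.mono_neutral_cong_left) (use Q R in auto)
  have 2: "lc R l = (\<Sum>T\<in>Q \<union> R. (if T \<in> R then l T else 0) *\<^sub>C u T)"
    unfolding lc_def by (rule sum.mono_neutral_cong_left) (use Q R in auto)
  have "lc Q k + lc R l = lc (Q \<union> R) (\<lambda>T. (if T \<in> Q then k T else 0) + (if T \<in> R then l T else 0))"
    unfolding 1 2 by (simp only: lc_def scaleC_add_left sum.distrib)
  then have "veq (v + w) (lc (Q \<union> R) (\<lambda>T. (if T \<in> Q then k T else 0) + (if T \<in> R then l T else 0)))"
    using veq_add[OF Q(3) R(3)] by simp
  then show ?thesis unfolding vectors_def using Q R by blast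
qed

lemma vectors_scaleC:
  assumes "v \<in> vectors"
  shows "c *\<^sub>C v \<in> vectors"
proof -
  obtain Q k where Q: "finite Q" "\<forall>T\<in>Q. finite T" "veq v (lc Q k)" using assms by (auto simp: vectors_def)
  have "c *\<^sub>C lc Q k = lc Q (\<lambda>T. c * k T)" by (simp add: lc_def scaleC_sum_right scaleC_scaleC)
  then have "veq (c *\<^sub>C v) (lc Q (\<lambda>T. c * k T))" using veq_scaleC[OF Q(3), of c] by simp
  then show ?thesis unfolding vectors_def using Q by blast
qed

lemma u_vectors: "finite S \<Longrightarrow> u S \<in> vectors"
proof -
  assume "finite S"
  moreover have "veq (u S) (lc {S} (\<lambda>_. 1))" by (simp add: lc_def)
  ultimately show ?thesis unfolding vectors_def by blast
qed

lemma zero_vectors: "0 \<in> vectors"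
  using vectors_scaleC[OF u_vectors[of "{}"], of 0] by simp

lemma vectors_sum: "(\<And>i. i \<in> I \<Longrightarrow> f i \<in> vectors) \<Longrightarrow> sum f I \<in> vectors"
  by (induction I rule: infinite_finite_induct) (simp_all add: vectors_add zero_vectors)

lemma vectors_stable:
  assumes "\<And>S. finite S \<Longrightarrow> a * u S \<in> vectors" and "v \<in> vectors"
  shows "a * v \<in> vectors"
proof -
  obtain Q k where Q: "finite Q" "\<forall>T\<in>Q. finite T" "veq v (lc Q k)" using assms(2) by (auto simp: vectors_def)
  have "a * lc Q k = (\<Sum>T\<in>Q. k T *\<^sub>C (a * u T))" by (simp add: lc_def sum_distrib_left mult_scaleC_right)
  then have "a * lc Q k \<in> vectors" using assms(1) Q(2) by (simp add: vectors_sum vectors_scaleC)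
  then show ?thesis using veq_mult_left[OF Q(3)] by (rule vectors_cong)
qed

text \<open>A subalgebra on which matrix elements are computed by finite sums. It contains the modes and
  their adjoints, so it is dense when these generate the algebra.\<close>

definition column_finite :: "'c set" where
  "column_finite = {a. \<forall>v\<in>vectors. a * v \<in> vectors}"

lemma b_column_finite: "b x \<in> column_finite"
  unfolding column_finite_def
  by (clarify, rule vectors_stable) (simp_all add: b_u vectors_scaleC u_vectors zero_vectors)

lemma a_column_finite: "adj (b x) \<in> column_finite"
  unfolding column_finite_def
proof (clarify, rule vectors_stable)
  fix S :: "'x set" assume S: "finite S"
  have "(if x \<in> S then eps x (S - {x}) *\<^sub>C u (S - {x}) else 0) \<in> vectors"
    using S by (simp add: vectors_scaleC u_vectors zero_vectors)
  then show "adj (b x) * u S \<in> vectors" by (rule vectors_cong) (rule veq_a_u[OF S])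
qed

lemma column_finite_algebra:
  "1 \<in> column_finite" "a \<in> column_finite \<Longrightarrow> c \<in> column_finite \<Longrightarrow> a + c \<in> column_finite"
  "a \<in> column_finite \<Longrightarrow> c \<in> column_finite \<Longrightarrow> a * c \<in> column_finite"
  "a \<in> column_finite \<Longrightarrow> z *\<^sub>C a \<in> column_finite"
  by (auto simp: column_finite_def distrib_right mult_scaleC_left mult.assoc vectors_add vectors_scaleC)

lemma lc_inner:
  assumes X: "finite X" "\<And>T. T \<in> Q \<Longrightarrow> T \<subseteq> X" and Q: "finite Q"
  shows "adj (lc Q k * P X) * (lc Q l * P X) = (\<Sum>T\<in>Q. cnj (k T) * l T) *\<^sub>C P X"
proof -
  have "adj (lc Q k * P X) * (lc Q l * P X)
    = (\<Sum>S\<in>Q. \<Sum>T\<in>Q. (cnj (k S) * l T) *\<^sub>C (P X * (adj (u S) * (u T * P X))))"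
  proof -
    have 1: "lc Q l * P X = (\<Sum>T\<in>Q. l T *\<^sub>C (u T * P X))" for l
      by (simp add: lc_def sum_distrib_right mult_scaleC_left)
    have 2: "adj (lc Q k * P X) = (\<Sum>S\<in>Q. cnj (k S) *\<^sub>C (P X * adj (u S)))"
      by (simp add: 1 adj_sum adj_scaleC adj_mult adj_P[OF X(1)])
    show ?thesis unfolding 2 1[of l] sum_product
      by (simp add: mult_scaleC_left mult_scaleC_right scaleC_scaleC mult.assoc mult.commute)
  qed
  also have "\<dots> = (\<Sum>S\<in>Q. \<Sum>T\<in>Q. if S = T then (cnj (k S) * l S) *\<^sub>C P X else 0)"
    by (intro sum.cong refl) (simp add: u_ortho[OF X(1)] X(2))
  also have "\<dots> = (\<Sum>S\<in>Q. (cnj (k S) * l S) *\<^sub>C P X)" using Q by simp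
  finally show ?thesis by (simp add: scaleC_sum_left)
qed

text \<open>By the C*-identity and orthogonality, the abstract norm restricted to vectors is the norm of the
  Fock space.\<close>

lemma norm_lc:
  assumes X: "finite X" "\<And>T. T \<in> Q \<Longrightarrow> T \<subseteq> X" and Q: "finite Q"
  shows "norm (lc Q k * P X) = sqrt (\<Sum>T\<in>Q. (cmod (k T))\<^sup>2)"
proof -
  have "(norm (lc Q k * P X))\<^sup>2 = norm ((\<Sum>T\<in>Q. cnj (k T) * k T) *\<^sub>C P X)"
    by (simp only: norm_adj_mult[symmetric] lc_inner[OF assms])
  also have "(\<Sum>T\<in>Q. cnj (k T) * k T) = complex_of_real (\<Sum>T\<in>Q. (cmod (k T))\<^sup>2)"
    by (simp only: cnj_mult_self of_real_sum)
  also have "norm (complex_of_real (\<Sum>T\<in>Q. (cmod (k T))\<^sup>2) *\<^sub>C P X) = (\<Sum>T\<in>Q. (cmod (k T))\<^sup>2)"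
    by (simp only: norm_scaleC norm_P[OF X(1)] norm_of_real) (simp add: sum_nonneg)
  finally show ?thesis by (metis norm_ge_zero real_sqrt_pow2_iff real_sqrt_unique)
qed

text \<open>The vacuum expectation of a is c: the vacuum projection compresses a to a multiple of itself,
  and \<open>P X\<close> does so in the limit.\<close>

definition vlim :: "'c \<Rightarrow> complex \<Rightarrow> bool" where
  "vlim a c \<longleftrightarrow> ((\<lambda>X. P X * a * P X - c *\<^sub>C P X) \<longlongrightarrow> 0) FS"

lemma eventually_finite_FS: "\<forall>\<^sub>F X in FS. finite X"
  using eventually_FS_superset[of "{}"] by simp

lemma vlim_bound:
  assumes "vlim a c" and "\<forall>\<^sub>F X in FS. norm (P X * a * P X) \<le> B"
  shows "cmod c \<le> B"
proof -
  have "((\<lambda>X. B + norm (P X * a * P X - c *\<^sub>C P X)) \<longlongrightarrow> B + norm (0::'c)) FS"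
    using assms(1) unfolding vlim_def by (intro tendsto_intros)
  then have "((\<lambda>X. B + norm (P X * a * P X - c *\<^sub>C P X)) \<longlongrightarrow> B) FS" by simp
  moreover have "\<forall>\<^sub>F X in FS. cmod c \<le> B + norm (P X * a * P X - c *\<^sub>C P X)"
    using assms(2) eventually_finite_FS
  proof eventually_elim
    fix X assume X: "norm (P X * a * P X) \<le> B" "finite X"
    have "cmod c = norm (c *\<^sub>C P X)" by (simp add: norm_scaleC norm_P[OF X(2)])
    also have "\<dots> \<le> norm (P X * a * P X) + norm (P X * a * P X - c *\<^sub>C P X)"
      by (metis add_diff_cancel_left' diff_add_cancel norm_triangle_ineq4)
    finally show "cmod c \<le> B + norm (P X * a * P X - c *\<^sub>C P X)" using X(1) by simp
  qed
  ultimately show ?thesis by (rule tendsto_lowerbound) simp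
qed

lemma norm_compress: "finite X \<Longrightarrow> norm (P X * a * P X) \<le> norm a"
proof -
  assume X: "finite X"
  have "norm (P X * a * P X) \<le> norm (P X) * norm a * norm (P X)"
    by (meson mult_right_mono norm_ge_zero norm_mult_ineq order_trans)
  then show ?thesis using X by (simp add: norm_P)
qed

lemma vlim_norm: "vlim a c \<Longrightarrow> cmod c \<le> norm a"
  by (erule vlim_bound) (rule eventually_mono[OF eventually_finite_FS norm_compress])

lemma vlim_add: "vlim a c \<Longrightarrow> vlim a' c' \<Longrightarrow> vlim (a + a') (c + c')"
  unfolding vlim_def by (drule (1) tendsto_add) (simp add: algebra_simps scaleC_add_left)

lemma vlim_scaleC: "vlim a c \<Longrightarrow> vlim (z *\<^sub>C a) (z * c)"
  unfolding vlim_def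
  by (drule tendsto_scaleC[OF tendsto_const[of z]])
    (simp add: mult_scaleC_left mult_scaleC_right scaleC_diff_right scaleC_scaleC)

lemma vlim_diff: "vlim a c \<Longrightarrow> vlim a' c' \<Longrightarrow> vlim (a - a') (c - c')"
  using vlim_add[of a c "(-1) *\<^sub>C a'" "(-1) * c'"] vlim_scaleC[of a' c' "-1"] by (simp add: scaleC_minus_left)

lemma vlim_unique: "vlim a c \<Longrightarrow> vlim a c' \<Longrightarrow> c = c'"
  using vlim_norm[of "a - a" "c - c'"] vlim_diff[of a c a c'] by simp

lemma vlim_adj:
  assumes "vlim a c"
  shows "vlim (adj a) (cnj c)"
  unfolding vlim_def
proof (rule tendsto_norm_zero_cancel)
  have "((\<lambda>X. norm (P X * a * P X - c *\<^sub>C P X)) \<longlongrightarrow> 0) FS"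
    using assms unfolding vlim_def by (rule tendsto_norm_zero)
  moreover have "\<forall>\<^sub>F X in FS. norm (P X * a * P X - c *\<^sub>C P X) = norm (P X * adj a * P X - cnj c *\<^sub>C P X)"
    using eventually_finite_FS
  proof eventually_elim
    fix X :: "'x set" assume X: "finite X"
    have "adj (P X * a * P X - c *\<^sub>C P X) = P X * adj a * P X - cnj c *\<^sub>C P X"
      by (simp add: adj_diff adj_mult adj_scaleC adj_P[OF X] mult.assoc)
    then show "norm (P X * a * P X - c *\<^sub>C P X) = norm (P X * adj a * P X - cnj c *\<^sub>C P X)"
      by (metis norm_adj)
  qed
  ultimately show "((\<lambda>X. norm (P X * adj a * P X - cnj c *\<^sub>C P X)) \<longlongrightarrow> 0) FS"
    by (rule Lim_transform_eventually)
qed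

lemma vlim_vectors:
  assumes "v \<in> vectors"
  shows "\<exists>c. vlim v c"
proof -
  obtain Q k where Q: "finite Q" "\<forall>T\<in>Q. finite T" "veq v (lc Q k)" using assms by (auto simp: vectors_def)
  let ?c = "if {} \<in> Q then k {} else 0"
  have UQ: "finite (\<Union>Q)" using Q by auto
  have "\<forall>\<^sub>F X in FS. P X * v * P X - ?c *\<^sub>C P X = 0"
    using eventually_FS_superset[OF UQ] Q(3)[unfolded veq_def]
  proof eventually_elim
    fix X :: "'x set" assume X: "finite X \<and> \<Union>Q \<subseteq> X" and eq: "v * P X = lc Q k * P X"
    have "P X * v * P X = (\<Sum>T\<in>Q. k T *\<^sub>C (P X * (adj (u {}) * (u T * P X))))"
      using eq by (simp add: mult.assoc lc_def sum_distrib_left sum_distrib_right mult_scaleC_left mult_scaleC_right)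
    also have "\<dots> = (\<Sum>T\<in>Q. if {} = T then k T *\<^sub>C P X else 0)"
    proof (intro sum.cong refl)
      fix T assume "T \<in> Q"
      then have "P X * (adj (u {}) * (u T * P X)) = (if {} = T then P X else 0)"
        using X by (intro u_ortho) auto
      then show "k T *\<^sub>C (P X * (adj (u {}) * (u T * P X))) = (if {} = T then k T *\<^sub>C P X else 0)"
        by (simp del: u_empty)
    qed
    also have "\<dots> = ?c *\<^sub>C P X" using Q(1) by (simp add: sum.delta)
    finally show "P X * v * P X - ?c *\<^sub>C P X = 0" by simp
  qed
  then have "vlim v ?c" unfolding vlim_def by (rule tendsto_eventually)
  then show ?thesis ..
qed

lemma one_vectors: "1 \<in> vectors" using u_vectors[of "{}"] by simp

lemma vlim_column_finite: "a \<in> column_finite \<Longrightarrow> \<exists>c. vlim a c"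
  using one_vectors vlim_vectors[of "a * 1"] by (auto simp: column_finite_def)

lemma vlim_veq:
  assumes "veq v w" "vlim (y * v) c"
  shows "vlim (y * w) c"
proof -
  have "\<forall>\<^sub>F X in FS. P X * (y * v) * P X - c *\<^sub>C P X = P X * (y * w) * P X - c *\<^sub>C P X"
    using assms(1)[unfolded veq_def] by eventually_elim (simp add: mult.assoc)
  then show ?thesis using assms(2) unfolding vlim_def by (rule Lim_transform_eventually[rotated])
qed

text \<open>Vacuum expectations are contractive, so those of a convergent sequence converge.\<close>

lemma vlim_closure:
  assumes "a \<in> closure column_finite"
  shows "\<exists>c. vlim a c"
proof -
  obtain s where s: "\<And>n. s n \<in> column_finite" "s \<longlonglongrightarrow> a"
    using assms unfolding closure_sequential by blast
  have "\<forall>n. \<exists>c. vlim (s n) c" by (rule allI, rule vlim_column_finite[OF s(1)])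
  from choice[OF this] obtain c where c: "\<And>n. vlim (s n) (c n)" by blast
  have "Cauchy c"
  proof (rule metric_CauchyI)
    fix e :: real assume "e > 0"
    then obtain M where M: "\<forall>m\<ge>M. \<forall>n\<ge>M. dist (s m) (s n) < e"
      using metric_CauchyD[OF LIMSEQ_imp_Cauchy[OF s(2)]] by blast
    have "dist (c m) (c n) \<le> dist (s m) (s n)" for m n
      unfolding dist_norm by (rule vlim_norm[OF vlim_diff[OF c c]])
    then show "\<exists>M. \<forall>m\<ge>M. \<forall>n\<ge>M. dist (c m) (c n) < e"
      using M le_less_trans by blast
  qed
  then obtain z where z: "c \<longlonglongrightarrow> z" unfolding Cauchy_convergent_iff convergent_def by blast
  have "vlim a z"
    unfolding vlim_def
  proof (rule tendstoI)
    fix e :: real assume e: "e > 0"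
    have "\<forall>\<^sub>F n in sequentially. dist (s n) a < e / 3 \<and> dist (c n) z < e / 3"
      using tendstoD[OF s(2), of "e / 3"] tendstoD[OF z, of "e / 3"] e by (intro eventually_conj) auto
    then obtain n where n: "norm (s n - a) < e / 3" "norm (c n - z) < e / 3"
      unfolding dist_norm eventually_sequentially by blast
    have "\<forall>\<^sub>F X in FS. dist (P X * s n * P X - c n *\<^sub>C P X) 0 < e / 3"
      using tendstoD[OF c[of n, unfolded vlim_def], of "e / 3"] e by simp
    then show "\<forall>\<^sub>F X in FS. dist (P X * a * P X - z *\<^sub>C P X) 0 < e"
      using eventually_finite_FS
    proof eventually_elim
      fix X :: "'x set" assume X: "finite X" and d: "dist (P X * s n * P X - c n *\<^sub>C P X) 0 < e / 3"
      have eq: "P X * a * P X - z *\<^sub>C P X =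
         (P X * s n * P X - c n *\<^sub>C P X) + ((c n - z) *\<^sub>C P X - P X * (s n - a) * P X)"
        by (simp add: algebra_simps scaleC_diff_left)
      have "norm (P X * a * P X - z *\<^sub>C P X) \<le>
         norm (P X * s n * P X - c n *\<^sub>C P X) + (norm ((c n - z) *\<^sub>C P X) + norm (P X * (s n - a) * P X))"
        unfolding eq by (rule order_trans[OF norm_triangle_ineq add_left_mono[OF norm_triangle_ineq4]])
      then show "dist (P X * a * P X - z *\<^sub>C P X) 0 < e"
        using d n norm_compress[OF X, of "s n - a"] by (simp add: norm_scaleC norm_P[OF X])
    qed
  qed
  then show ?thesis ..
qed

lemma column_finite_closure: "is_closed_subalgebra (closure column_finite)"
  unfolding is_closed_subalgebra_def
proof (intro conjI ballI allI)
  show "1 \<in> closure column_finite" using column_finite_algebra(1) closure_subset by blast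
  fix a c assume "a \<in> closure column_finite" "c \<in> closure column_finite"
  then obtain s t where s: "\<And>n. s n \<in> column_finite" "s \<longlonglongrightarrow> a" and t: "\<And>n. t n \<in> column_finite" "t \<longlonglongrightarrow> c"
    unfolding closure_sequential by blast
  have "\<And>n. s n + t n \<in> column_finite" "(\<lambda>n. s n + t n) \<longlonglongrightarrow> a + c"
    by (rule column_finite_algebra(2)[OF s(1) t(1)], rule tendsto_add[OF s(2) t(2)])
  then show "a + c \<in> closure column_finite"
    unfolding closure_sequential by (intro exI[of _ "\<lambda>n. s n + t n"]) simp
  have "\<And>n. s n * t n \<in> column_finite" "(\<lambda>n. s n * t n) \<longlonglongrightarrow> a * c"
    by (rule column_finite_algebra(3)[OF s(1) t(1)], rule tendsto_mult[OF s(2) t(2)])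
  then show "a * c \<in> closure column_finite"
    unfolding closure_sequential by (intro exI[of _ "\<lambda>n. s n * t n"]) simp
next
  fix a z assume "a \<in> closure column_finite"
  then obtain s where s: "\<And>n. s n \<in> column_finite" "s \<longlonglongrightarrow> a"
    unfolding closure_sequential by blast
  have "\<And>n. z *\<^sub>C s n \<in> column_finite" "(\<lambda>n. z *\<^sub>C s n) \<longlonglongrightarrow> z *\<^sub>C a"
    by (rule column_finite_algebra(4)[OF s(1)], rule tendsto_scaleC[OF tendsto_const s(2)])
  then show "z *\<^sub>C a \<in> closure column_finite"
    unfolding closure_sequential by (intro exI[of _ "\<lambda>n. z *\<^sub>C s n"]) simp
qed simp

end

locale fermion_algebra = fermion_modes b for b :: "'x::linorder \<Rightarrow> 'c::cstar_algebra" +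
  assumes generated: "closed_subalgebra_generated (range b \<union> range (\<lambda>x. adj (b x))) = UNIV"
begin

lemma column_finite_dense: "closure column_finite = UNIV"
proof -
  have "range b \<union> range (\<lambda>x. adj (b x)) \<subseteq> closure column_finite"
    using b_column_finite a_column_finite closure_subset by blast
  then have "closed_subalgebra_generated (range b \<union> range (\<lambda>x. adj (b x))) \<subseteq> closure column_finite"
    unfolding closed_subalgebra_generated_def using column_finite_closure by blast
  then show ?thesis using generated by blast
qed

definition vexp :: "'c \<Rightarrow> complex" where "vexp a = (THE c. vlim a c)"

lemma vlim_vexp: "vlim a (vexp a)"
proof -
  have "\<exists>c. vlim a c" by (rule vlim_closure) (simp add: column_finite_dense)
  then show ?thesis unfolding vexp_def using vlim_unique by (blast intro: theI2)
qed

lemma vexp_eq: "vlim a c \<Longrightarrow> vexp a = c" using vlim_vexp vlim_unique by blast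

lemma vexp_add: "vexp (a + c) = vexp a + vexp c" by (rule vexp_eq) (intro vlim_add vlim_vexp)

lemma vexp_scaleC: "vexp (z *\<^sub>C a) = z * vexp a" by (rule vexp_eq) (intro vlim_scaleC vlim_vexp)

lemma vexp_zero [simp]: "vexp 0 = 0" using vexp_scaleC[of 0 0] by simp

lemma vexp_sum: "vexp (sum f I) = (\<Sum>i\<in>I. vexp (f i))"
  by (induction I rule: infinite_finite_induct) (simp_all add: vexp_add)

lemma vexp_adj: "vexp (adj a) = cnj (vexp a)" by (rule vexp_eq) (intro vlim_adj vlim_vexp)

lemma vexp_veq: "veq v w \<Longrightarrow> vexp (y * v) = vexp (y * w)"
  by (rule vexp_eq) (rule vlim_veq[OF veq_sym vlim_vexp])

lemma vexp_ortho: "finite S \<Longrightarrow> finite T \<Longrightarrow> vexp (adj (u S) * u T) = (if S = T then 1 else 0)"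
proof (rule vexp_eq)
  assume fin: "finite S" "finite T"
  have "\<forall>\<^sub>F X in FS. P X * (adj (u S) * u T) * P X - (if S = T then 1 else 0) *\<^sub>C P X = 0"
    by (rule eventually_mono[OF eventually_FS_superset[of "S \<union> T"]])
      (use fin u_ortho[of _ S T] in \<open>auto simp: mult.assoc\<close>)
  then show "vlim (adj (u S) * u T) (if S = T then 1 else 0)"
    unfolding vlim_def by (rule tendsto_eventually)
qed

text \<open>Cut down by \<open>P X\<close>, the left-hand side is a product of three elements of the
  algebra; the outer two have the norm given by \<open>norm_lc\<close>. Thus the C*-norm controls
  the matrix of a.\<close>

lemma vexp_lc_bound:
  assumes Q: "finite Q" "\<And>T. T \<in> Q \<Longrightarrow> finite T"
  shows "cmod (vexp (adj (lc Q k) * a * lc Q l))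
    \<le> norm a * sqrt (\<Sum>T\<in>Q. (cmod (k T))\<^sup>2) * sqrt (\<Sum>T\<in>Q. (cmod (l T))\<^sup>2)"
proof (rule vlim_bound[OF vlim_vexp])
  show "\<forall>\<^sub>F X in FS. norm (P X * (adj (lc Q k) * a * lc Q l) * P X)
    \<le> norm a * sqrt (\<Sum>T\<in>Q. (cmod (k T))\<^sup>2) * sqrt (\<Sum>T\<in>Q. (cmod (l T))\<^sup>2)"
    using eventually_FS_superset[of "\<Union>Q", OF finite_Union[OF Q]]
  proof (rule eventually_mono)
    fix X assume X: "finite X \<and> \<Union>Q \<subseteq> X"
    have n: "norm (lc Q f * P X) = sqrt (\<Sum>T\<in>Q. (cmod (f T))\<^sup>2)" for f
      using X Q(1) by (intro norm_lc) auto
    have "P X * (adj (lc Q k) * a * lc Q l) * P X = adj (lc Q k * P X) * a * (lc Q l * P X)"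
      using X by (simp add: adj_mult adj_P mult.assoc)
    also have "norm \<dots> \<le> norm (adj (lc Q k * P X)) * norm a * norm (lc Q l * P X)"
      by (meson mult_right_mono norm_ge_zero norm_mult_ineq order_trans)
    finally show "norm (P X * (adj (lc Q k) * a * lc Q l) * P X)
      \<le> norm a * sqrt (\<Sum>T\<in>Q. (cmod (k T))\<^sup>2) * sqrt (\<Sum>T\<in>Q. (cmod (l T))\<^sup>2)"
      by (simp add: norm_adj n mult_ac)
  qed
qed

text \<open>Matrix elements of the Fock representation. Rows and columns are indexed by all sets of modes
  and vanish at the infinite ones.\<close>

definition melem :: "'c \<Rightarrow> 'x set \<Rightarrow> 'x set \<Rightarrow> complex" where
  "melem a S T = (if finite S \<and> finite T then vexp (adj (u S) * a * u T) else 0)"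

lemma bmat_melem: "bmat (norm a) (melem a)"
  unfolding bmat_def
proof (intro conjI allI impI)
  fix Q :: "'x set set" and k l :: "'x set \<Rightarrow> complex" assume Q: "finite Q"
  let ?R = "{T \<in> Q. finite T}"
  have R: "finite ?R" using Q by simp
  have "(\<Sum>S\<in>Q. \<Sum>T\<in>Q. cnj (k S) * melem a S T * l T) = (\<Sum>S\<in>?R. \<Sum>T\<in>Q. cnj (k S) * melem a S T * l T)"
    by (rule sum.mono_neutral_right[OF Q]) (auto simp: melem_def)
  also have "\<dots> = (\<Sum>S\<in>?R. \<Sum>T\<in>?R. cnj (k S) * melem a S T * l T)"
    by (rule sum.cong[OF refl], rule sum.mono_neutral_right[OF Q]) (auto simp: melem_def)
  also have "\<dots> = vexp (adj (lc ?R k) * a * lc ?R l)"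
    by (simp add: lc_def adj_sum adj_scaleC sum_product sum_distrib_right vexp_sum mult_scaleC_left
        mult_scaleC_right vexp_scaleC melem_def mult_ac) (simp add: sum_distrib_left vexp_sum mult_scaleC_left
        mult_scaleC_right vexp_scaleC mult_ac)
  also have "cmod \<dots> \<le> norm a * sqrt (\<Sum>T\<in>?R. (cmod (k T))\<^sup>2) * sqrt (\<Sum>T\<in>?R. (cmod (l T))\<^sup>2)"
    by (rule vexp_lc_bound) (use R in auto)
  also have "\<dots> \<le> norm a * sqrt (\<Sum>T\<in>Q. (cmod (k T))\<^sup>2) * sqrt (\<Sum>T\<in>Q. (cmod (l T))\<^sup>2)"
    by (intro mult_mono mult_left_mono real_sqrt_le_mono sum_mono2 Q) (auto simp: sum_nonneg)
  finally show "cmod (\<Sum>S\<in>Q. \<Sum>T\<in>Q. cnj (k S) * melem a S T * l T)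
    \<le> norm a * sqrt (\<Sum>T\<in>Q. (cmod (k T))\<^sup>2) * sqrt (\<Sum>T\<in>Q. (cmod (l T))\<^sup>2)" .
qed simp

lemma melem_add: "melem (a + c) S T = melem a S T + melem c S T"
  by (simp add: melem_def distrib_left distrib_right vexp_add)

lemma melem_scaleC: "melem (z *\<^sub>C a) S T = z * melem a S T"
  by (simp add: melem_def mult_scaleC_left mult_scaleC_right vexp_scaleC)

lemma melem_adj: "melem (adj a) S T = cnj (melem a T S)"
  using vexp_adj[of "adj (u T) * a * u S"] by (simp add: melem_def adj_mult adj_adj mult.assoc)

lemma melem_diff: "melem (a - c) S T = melem a S T - melem c S T"
  using melem_add[of a "(-1) *\<^sub>C c" S T] melem_scaleC[of "-1" c S T] by (simp add: scaleC_minus_left)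

lemma melem_bound: "cmod (melem a S T) \<le> norm a"
  using bmat_rect[OF bmat_melem[of a], of "{S}" "{T}" "\<lambda>_. 1" "\<lambda>_. 1"] by simp

lemma melem_column:
  assumes "finite T" "finite T'" "veq (a * u T) (z *\<^sub>C u T')"
  shows "melem a S T = (if S = T' then z else 0)"
proof (cases "finite S")
  case True
  have "melem a S T = vexp (adj (u S) * (z *\<^sub>C u T'))"
    using True assms vexp_veq[OF assms(3), of "adj (u S)"] by (simp add: melem_def mult.assoc)
  then show ?thesis using vexp_ortho[OF True assms(2)] by (simp add: mult_scaleC_right vexp_scaleC)
qed (use assms in \<open>auto simp: melem_def\<close>)

lemma melem_one: "finite T \<Longrightarrow> melem 1 S T = (if S = T then 1 else 0)"
  by (rule melem_column) simp_all

lemma melem_b: "melem (b x) S T = (if finite T \<and> x \<notin> T \<and> S = insert x T then eps x T else 0)"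
proof (cases "finite T \<and> x \<notin> T")
  case True
  then have "melem (b x) S T = (if S = insert x T then eps x T else 0)"
    by (intro melem_column) (auto simp: b_u)
  then show ?thesis using True by simp
next
  case False
  then show ?thesis using melem_column[of T T "b x" 0 S] by (cases "finite T") (auto simp: b_u melem_def)
qed

lemma melem_a: "melem (adj (b x)) S T = (if finite S \<and> x \<notin> S \<and> T = insert x S then eps x S else 0)"
  by (auto simp: melem_adj melem_b eps_def)

text \<open>If c is column-finite, only finitely many terms are nonzero. Both sides are continuous in c by
  the bounds on rows and columns, and column-finite elements are dense.\<close>

lemma melem_mult: "melem (a * c) S T = (\<Sum>\<^sub>\<infinity>R. melem a S R * melem c R T)"
proof -
  let ?g = "\<lambda>c. ip (\<lambda>R. cnj (melem a S R)) (\<lambda>R. melem c R T)"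
  have row: "sqs (\<lambda>R. cnj (melem a S R))" using bmat_row(1)[OF bmat_melem] by simp
  have col: "sqs (\<lambda>R. melem c R T)" for c by (rule bmat_col(1)[OF bmat_melem])
  have fin: "melem (a * c) S T = ?g c" if c: "c \<in> column_finite" for c
  proof (cases "finite S \<and> finite T")
    case True
    then have "c * u T \<in> vectors" using c u_vectors by (auto simp: column_finite_def)
    then obtain Q k where Q: "finite Q" "\<forall>T\<in>Q. finite T" "veq (c * u T) (lc Q k)"
      by (auto simp: vectors_def)
    have coord: "melem c R T = (\<Sum>R'\<in>Q. if R = R' then k R' else 0)" if R: "finite R" for R
    proof -
      have "melem c R T = vexp (adj (u R) * lc Q k)"
        using True R vexp_veq[OF Q(3), of "adj (u R)"] by (simp add: melem_def mult.assoc)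
      also have "\<dots> = (\<Sum>R'\<in>Q. if R = R' then k R' else 0)"
        unfolding lc_def sum_distrib_left vexp_sum
        by (intro sum.cong refl) (use R Q(2) in \<open>simp add: mult_scaleC_right vexp_scaleC vexp_ortho\<close>)
      finally show ?thesis .
    qed
    have "melem (a * c) S T = vexp (adj (u S) * a * lc Q k)"
      using True vexp_veq[OF Q(3), of "adj (u S) * a"] by (simp add: melem_def mult.assoc)
    also have "\<dots> = (\<Sum>R\<in>Q. melem a S R * k R)"
      unfolding lc_def sum_distrib_left vexp_sum
      by (intro sum.cong refl) (use True Q(2) in \<open>simp add: melem_def mult_scaleC_right vexp_scaleC\<close>)
    also have "\<dots> = (\<Sum>R\<in>Q. melem a S R * melem c R T)"
      by (intro sum.cong refl arg_cong2[of _ _ _ _ "(*)"]) (use coord Q in simp)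
    also have "\<dots> = (\<Sum>\<^sub>\<infinity>R\<in>Q. melem a S R * melem c R T)" using Q(1) by simp
    also have "\<dots> = (\<Sum>\<^sub>\<infinity>R. melem a S R * melem c R T)"
    proof (rule infsum_cong_neutral)
      fix R assume "R \<in> UNIV - Q"
      then have "melem c R T = 0"
        using coord[of R] by (cases "finite R") (auto simp: melem_def intro!: sum.neutral)
      then show "melem a S R * melem c R T = 0" by simp
    qed auto
    finally show ?thesis by (simp add: ip_def)
  next
    case False
    then have "melem (a * c) S T = 0" "\<And>R. melem a S R * melem c R T = 0" by (auto simp: melem_def)
    then show ?thesis by (simp only: ip_def complex_cnj_cnj infsum_0_simp)
  qed
  have "cmod (melem (a * c) S T - ?g c) \<le> 0"
  proof (rule field_le_epsilon)
    fix e :: real assume e: "0 < e"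
    \<comment> \<open>The summand 1 covers a = 0.\<close>
    define d where "d = e / (2 * norm a + 1)"
    have d: "0 < d" "2 * norm a * d \<le> e"
      using e by (auto simp: d_def field_simps add_pos_nonneg)
    have "c \<in> closure column_finite" by (simp add: column_finite_dense)
    then obtain c' where c': "c' \<in> column_finite" "dist c' c < d" using d(1) unfolding closure_approachable by blast
    have 1: "melem (a * c) S T = melem (a * c') S T + melem (a * (c - c')) S T"
      by (simp flip: melem_add distrib_left)
    have "?g c = ip (\<lambda>R. cnj (melem a S R)) (\<lambda>R. 1 * melem c' R T + 1 * melem (c - c') R T)"
      by (simp add: melem_diff)
    also have "\<dots> = 1 * ?g c' + 1 * ?g (c - c')" by (rule ip_linear_right[OF row col col])
    finally have 2: "?g c = ?g c' + ?g (c - c')" by simp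
    have "cmod (melem (a * c) S T - ?g c) = cmod (melem (a * (c - c')) S T - ?g (c - c'))"
      unfolding 1 2 fin[OF c'(1)] by simp
    also have "\<dots> \<le> cmod (melem (a * (c - c')) S T) + cmod (?g (c - c'))" by (rule norm_triangle_ineq4)
    also have "\<dots> \<le> norm a * norm (c - c') + norm a * norm (c - c')"
    proof (rule add_mono)
      show "cmod (melem (a * (c - c')) S T) \<le> norm a * norm (c - c')"
        by (rule order_trans[OF melem_bound norm_mult_ineq])
      have "cmod (?g (c - c')) \<le> sqrt (sqnorm (\<lambda>R. cnj (melem a S R))) * sqrt (sqnorm (\<lambda>R. melem (c - c') R T))"
        by (rule ip_bound[OF row col])
      also have "\<dots> \<le> sqrt ((norm a)\<^sup>2) * sqrt ((norm (c - c'))\<^sup>2)"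
        using bmat_row(2)[OF bmat_melem, of a S] bmat_col(2)[OF bmat_melem, of "c - c'" T]
        by (intro mult_mono real_sqrt_le_mono) (simp_all add: sqnorm_nonneg)
      finally show "cmod (?g (c - c')) \<le> norm a * norm (c - c')" by simp
    qed
    also have "\<dots> \<le> 2 * norm a * d"
      using c'(2) mult_left_mono[of "norm (c - c')" d "norm a"] by (simp add: dist_norm norm_minus_commute)
    finally show "cmod (melem (a * c) S T - ?g c) \<le> 0 + e" using d(2) by simp
  qed
  then show ?thesis by (simp add: ip_def)
qed

abbreviation op :: "'c \<Rightarrow> ('x set \<Rightarrow> complex) \<Rightarrow> 'x set \<Rightarrow> complex" where
  "op a \<equiv> mop (melem a)"

lemma op_sqs: "sqs k \<Longrightarrow> sqs (op a k)"
  by (rule mop_bound(1)[OF bmat_melem])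

lemma op_bound: "sqs k \<Longrightarrow> sqnorm (op a k) \<le> (norm a)\<^sup>2 * sqnorm k"
  by (rule mop_bound(2)[OF bmat_melem])

lemma op_mult: "sqs k \<Longrightarrow> op (a * c) k = op a (op c k)"
  by (rule ext) (rule mop_compose[OF bmat_melem bmat_melem _ melem_mult])

lemma op_add: "sqs k \<Longrightarrow> op (a + c) k S = op a k S + op c k S"
  unfolding mop_def melem_add distrib_right
  by (rule infsum_add) (rule mop_summable[OF bmat_melem], assumption)+

lemma op_scaleC: "sqs k \<Longrightarrow> op (z *\<^sub>C a) k S = z * op a k S"
  unfolding mop_def melem_scaleC mult.assoc
  by (rule infsum_cmult_right) (rule mop_summable[OF bmat_melem])

lemma op_one: "op 1 k S = (if finite S then k S else 0)"
proof -
  have "melem 1 S T * k T = (if S = T then (if finite S then k S else 0) else 0)" for T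
  proof (cases "finite T")
    case True
    then show ?thesis by (auto simp: melem_one)
  next
    case False
    then show ?thesis by (auto simp: melem_def)
  qed
  then have "op 1 k S = (\<Sum>\<^sub>\<infinity>T\<in>{S}. if finite S then k S else 0)"
    unfolding mop_def by (intro infsum_cong_neutral) auto
  then show ?thesis by simp
qed

lemma op_adj: "sqs k \<Longrightarrow> sqs l \<Longrightarrow> ip l (op a k) = ip (op (adj a) l) k"
proof -
  assume "sqs k" "sqs l"
  then have "ip l (op a k) = ip (mop (\<lambda>S T. cnj (melem a T S)) l) k" by (rule mop_adjoint[OF bmat_melem])
  also have "(\<lambda>S T. cnj (melem a T S)) = melem (adj a)" by (simp add: melem_adj fun_eq_iff)
  finally show ?thesis .
qed

definition vstate :: "('x set \<Rightarrow> complex) \<Rightarrow> 'c \<Rightarrow> complex" where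
  "vstate k a = ip k (op a k)"

lemma vstate_add: "sqs k \<Longrightarrow> vstate k (a + c) = vstate k a + vstate k c"
proof -
  assume k: "sqs k"
  have "vstate k (a + c) = ip k (\<lambda>S. 1 * op a k S + 1 * op c k S)"
    unfolding vstate_def by (rule arg_cong[of _ _ "ip k"]) (simp add: op_add[OF k] fun_eq_iff)
  also have "\<dots> = 1 * ip k (op a k) + 1 * ip k (op c k)"
    by (rule ip_linear_right[OF k op_sqs[OF k] op_sqs[OF k]])
  finally show ?thesis by (simp add: vstate_def)
qed

lemma vstate_scaleC: "sqs k \<Longrightarrow> vstate k (z *\<^sub>C a) = z * vstate k a"
proof -
  assume k: "sqs k"
  have "vstate k (z *\<^sub>C a) = ip k (\<lambda>S. z * op a k S + 0 * op a k S)"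
    unfolding vstate_def by (rule arg_cong[of _ _ "ip k"]) (simp add: op_scaleC[OF k] fun_eq_iff)
  also have "\<dots> = z * ip k (op a k) + 0 * ip k (op a k)"
    by (rule ip_linear_right[OF k op_sqs[OF k] op_sqs[OF k]])
  finally show ?thesis by (simp add: vstate_def)
qed

lemma vstate_bound: "sqs k \<Longrightarrow> cmod (vstate k a) \<le> norm a * sqnorm k"
proof -
  assume k: "sqs k"
  have "cmod (vstate k a) \<le> sqrt (sqnorm k) * sqrt (sqnorm (op a k))"
    unfolding vstate_def by (rule ip_bound[OF k op_sqs[OF k]])
  also have "\<dots> \<le> sqrt (sqnorm k) * sqrt ((norm a)\<^sup>2 * sqnorm k)"
    by (intro mult_left_mono real_sqrt_le_mono op_bound k) (simp add: sqnorm_nonneg)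
  also have "\<dots> = norm a * sqnorm k"
    using sqnorm_nonneg[of k] by (simp add: real_sqrt_mult)
  finally show ?thesis .
qed

lemma vstate_adj: "sqs k \<Longrightarrow> vstate k (adj a) = cnj (vstate k a)"
proof -
  assume k: "sqs k"
  have "vstate k (adj a) = ip (op a k) k"
    unfolding vstate_def by (subst op_adj[OF k k]) (simp add: adj_adj)
  then show ?thesis by (simp add: vstate_def ip_cnj)
qed

lemma vstate_square: "sqs k \<Longrightarrow> vstate k (adj a * a) = complex_of_real (sqnorm (op a k))"
proof -
  assume k: "sqs k"
  have "vstate k (adj a * a) = ip (op a k) (op a k)"
    unfolding vstate_def op_mult[OF k] by (subst op_adj[OF op_sqs[OF k] k]) (simp add: adj_adj)
  then show ?thesis by (simp add: ip_self_sqs op_sqs k)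
qed

lemma vstate_state:
  assumes k: "sqs k" "sqnorm k = 1" and fin: "\<And>S. infinite S \<Longrightarrow> k S = 0"
  shows "state (vstate k)"
proof -
  have "op 1 k = k" using fin by (auto simp: op_one fun_eq_iff)
  then have "vstate k 1 = 1" by (simp add: vstate_def ip_self_sqs k)
  then show ?thesis
    by (simp add: state_def vstate_add vstate_scaleC vstate_square k sqnorm_nonneg)
qed

lemma vstate_kernel: "sqs k \<Longrightarrow> (\<And>S. op a k S = 0) \<Longrightarrow> vstate k (c * a) = 0"
  by (simp add: vstate_def op_mult mop_def[of "melem c"] ip_def)

end

section \<open>Pfaffians\<close>

text \<open>For \<open>a \<ge> 1\<close> and \<open>j \<ge> 2\<close>, the a-th of the positions 2, 3, ...
  other than j.\<close>

definition skip :: "nat \<Rightarrow> nat \<Rightarrow> nat" where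
  "skip j a = insert_index j (Suc a)"

lemma skip_strict: "skip j a < skip j b \<longleftrightarrow> a < b"
  by (auto simp: skip_def insert_index_def)

lemma skip_inj: "skip j a = skip j b \<longleftrightarrow> a = b"
  by (auto simp: skip_def insert_index_def)

text \<open>Adds the pair (1, j) to a pairing of 2n points. The left end 1 comes first, its partner j is the
  value at \<open>n + 2\<close>, the place opposite to 1 among \<open>2 * (n + 1)\<close> places,
  and \<open>skip\<close> renumbers the points of the given pairing. Places and values are counted
  from 1, and 0 is kept as a fixed point because \<open>permutation_insert\<close> acts on
  permutations of \<open>{0..<m}\<close>.\<close>

definition pairing_insert :: "nat \<Rightarrow> nat \<Rightarrow> (nat \<Rightarrow> nat) \<Rightarrow> nat \<Rightarrow> nat" where
  "pairing_insert n j \<tau> = permutation_insert (n + 2) j (permutation_insert 1 1 \<tau>)"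

lemma permutes_from_one: "p permutes {1..m} \<longleftrightarrow> p permutes {0..<Suc m} \<and> p 0 = 0"
proof
  assume p: "p permutes {1..m}"
  then show "p permutes {0..<Suc m} \<and> p 0 = 0"
    by (intro conjI permutes_subset[OF p] permutes_not_in[OF p]) auto
next
  assume p: "p permutes {0..<Suc m} \<and> p 0 = 0"
  have "p x = x" if "x \<in> {0..<Suc m} - {1..m}" for x
  proof -
    have "x = 0" using that by (cases x) auto
    then show ?thesis using p by simp
  qed
  then show "p permutes {1..m}"
    by (rule permutes_superset[OF p[THEN conjunct1]])
qed

context
  fixes n j :: nat and \<tau> :: "nat \<Rightarrow> nat"
  assumes \<tau>: "\<tau> permutes {1..2 * n}" and j: "j \<in> {2..2 * n + 2}"
begin

lemma pairing_insert_pos: "1 \<le> i \<Longrightarrow> i \<le> 2 * n \<Longrightarrow> 1 \<le> \<tau> i \<and> \<tau> i \<le> 2 * n"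
  using permutes_in_image[OF \<tau>, of i] by auto

lemma pairing_insert_apply:
  "pairing_insert n j \<tau> 0 = 0" "pairing_insert n j \<tau> 1 = 1" "pairing_insert n j \<tau> (n + 2) = j"
  "1 \<le> i \<Longrightarrow> i \<le> n \<Longrightarrow> pairing_insert n j \<tau> (i + 1) = skip j (\<tau> i)"
  "n < i \<Longrightarrow> i \<le> 2 * n \<Longrightarrow> pairing_insert n j \<tau> (i + 2) = skip j (\<tau> i)"
proof -
  have \<tau>0: "\<tau> 0 = 0" using \<tau> by (simp add: permutes_not_in)
  show "pairing_insert n j \<tau> 0 = 0" "pairing_insert n j \<tau> 1 = 1" "pairing_insert n j \<tau> (n + 2) = j"
    using j \<tau>0 by (simp_all add: pairing_insert_def permutation_insert_expand)
  show "1 \<le> i \<Longrightarrow> i \<le> n \<Longrightarrow> pairing_insert n j \<tau> (i + 1) = skip j (\<tau> i)"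
    using pairing_insert_pos[of i]
    by (auto simp: pairing_insert_def permutation_insert_expand skip_def insert_index_def)
  show "n < i \<Longrightarrow> i \<le> 2 * n \<Longrightarrow> pairing_insert n j \<tau> (i + 2) = skip j (\<tau> i)"
    using pairing_insert_pos[of i]
    by (auto simp: pairing_insert_def permutation_insert_expand skip_def insert_index_def)
qed

lemma pairing_insert_permutes: "pairing_insert n j \<tau> permutes {1..2 * Suc n}"
proof -
  have "\<tau> permutes {0..<2 * n + 1}" using \<tau> permutes_from_one[of \<tau> "2 * n"] by simp
  then have "permutation_insert 1 1 \<tau> permutes {0..<Suc (2 * n + 1)}"
    by (rule permutation_insert_permutes) (use j in auto)
  then have "pairing_insert n j \<tau> permutes {0..<Suc (Suc (2 * n + 1))}"
    unfolding pairing_insert_def by (rule permutation_insert_permutes) (use j in auto)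
  then show ?thesis using pairing_insert_apply(1) permutes_from_one[of _ "2 * Suc n"] by simp
qed

text \<open>Inserting 1 at place 1 is even; inserting j at place \<open>n + 2\<close> has the parity of
  \<open>n + 2 + j\<close>.\<close>

lemma pairing_insert_sign:
  "of_int (sign (pairing_insert n j \<tau>)) = ((-1) ^ (n + j) * of_int (sign \<tau>) :: complex)"
proof -
  have 0: "\<tau> permutes {0..<2 * n + 1}" using \<tau> permutes_from_one[of \<tau> "2 * n"] by simp
  then have 1: "permutation_insert 1 1 \<tau> permutes {0..<Suc (2 * n + 1)}"
    by (rule permutation_insert_permutes) (use j in auto)
  have "(signof (pairing_insert n j \<tau>) :: complex) = (-1) ^ (n + 2 + j) * signof (permutation_insert 1 1 \<tau>)"
    unfolding pairing_insert_def by (rule signof_permutation_insert[OF 1]) (use j in auto)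
  also have "(signof (permutation_insert 1 1 \<tau>) :: complex) = (-1) ^ (1 + 1) * signof \<tau>"
    by (rule signof_permutation_insert[OF 0]) auto
  finally show ?thesis by (simp add: power_add)
qed

lemma pairing_insert_order:
  assumes m: "strict_mono_on {1..n} \<tau>" and lt: "\<forall>i\<in>{1..n}. \<tau> i < \<tau> (i + n)"
  shows "pairing_insert n j \<tau> \<in> pairing_perms (Suc n)"
proof -
  let ?\<sigma> = "pairing_insert n j \<tau>"
  have up: "?\<sigma> i < ?\<sigma> k" if "i \<in> {1..Suc n}" "k \<in> {1..Suc n}" "i < k" for i k
  proof -
    have "k = (k - 1) + 1" "1 \<le> k - 1" "k - 1 \<le> n" using that by auto
    then obtain k' where k: "k = k' + 1" "1 \<le> k'" "k' \<le> n" by blast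
    show ?thesis
    proof (cases "i = 1")
      case True
      have "1 < skip j (\<tau> k')" using pairing_insert_pos[of k'] k by (auto simp: skip_def insert_index_def)
      then show ?thesis using True k by (simp add: pairing_insert_apply(2,4) del: One_nat_def)
    next
      case False
      then have "i = (i - 1) + 1" "1 \<le> i - 1" "i - 1 \<le> n" using that by auto
      then obtain i' where i: "i = i' + 1" "1 \<le> i'" "i' \<le> n" by blast
      have "\<tau> i' < \<tau> k'" using m i k that by (auto simp: strict_mono_on_def)
      then show ?thesis using i k by (simp only: pairing_insert_apply(4) skip_strict)
    qed
  qed
  have pair: "?\<sigma> i < ?\<sigma> (i + Suc n)" if "i \<in> {1..Suc n}" for i
  proof (cases "i = 1")
    case True
    then have "?\<sigma> i = 1" "?\<sigma> (i + Suc n) = j" using pairing_insert_apply(2,3) by simp_all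
    then show ?thesis using j by simp
  next
    case False
    then have "i = (i - 1) + 1" "1 \<le> i - 1" "i - 1 \<le> n" using that by auto
    then obtain i' where i: "i = i' + 1" "1 \<le> i'" "i' \<le> n" by blast
    have "i + Suc n = (i' + n) + 2" using i by simp
    then have "?\<sigma> (i + Suc n) = skip j (\<tau> (i' + n))" using i pairing_insert_apply(5)[of "i' + n"] by simp
    moreover have "?\<sigma> i = skip j (\<tau> i')" using i pairing_insert_apply(4)[of i'] by simp
    ultimately show ?thesis using lt i by (simp add: skip_strict)
  qed
  show ?thesis
    unfolding pairing_perms_def
    using pairing_insert_permutes up pair by (auto simp: strict_mono_on_def)
qed

lemma pairing_insert_prod:
  fixes w :: "nat \<Rightarrow> nat \<Rightarrow> complex"
  shows "(\<Prod>i=1..Suc n. w (pairing_insert n j \<tau> i) (pairing_insert n j \<tau> (i + Suc n)))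
    = w 1 j * (\<Prod>i=1..n. w (skip j (\<tau> i)) (skip j (\<tau> (i + n))))"
proof -
  let ?\<sigma> = "pairing_insert n j \<tau>"
  have "(\<Prod>i=1..Suc n. w (?\<sigma> i) (?\<sigma> (i + Suc n)))
    = w (?\<sigma> 1) (?\<sigma> (1 + Suc n)) * (\<Prod>i=Suc 1..Suc n. w (?\<sigma> i) (?\<sigma> (i + Suc n)))"
    by (rule prod.atLeast_Suc_atMost) simp
  also have "(\<Prod>i=Suc 1..Suc n. w (?\<sigma> i) (?\<sigma> (i + Suc n))) = (\<Prod>i=1..n. w (?\<sigma> (Suc i)) (?\<sigma> (Suc i + Suc n)))"
    by (rule prod.shift_bounds_cl_Suc_ivl)
  also have "\<dots> = (\<Prod>i=1..n. w (skip j (\<tau> i)) (skip j (\<tau> (i + n))))"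
  proof (intro prod.cong refl)
    fix i assume i: "i \<in> {1..n}"
    have e: "Suc i + Suc n = (i + n) + 2" "Suc i = i + 1" by simp_all
    show "w (?\<sigma> (Suc i)) (?\<sigma> (Suc i + Suc n)) = w (skip j (\<tau> i)) (skip j (\<tau> (i + n)))"
      unfolding e using i pairing_insert_apply(4)[of i] pairing_insert_apply(5)[of "i + n"] by simp
  qed
  also have "?\<sigma> 1 = 1" by (rule pairing_insert_apply)
  also have "?\<sigma> (1 + Suc n) = j" using pairing_insert_apply(3) by simp
  finally show ?thesis .
qed

end

text \<open>The smallest point is the first left end, since left ends increase and lie left of their
  partners. Its partner j is arbitrary, and deleting the pair leaves a pairing of the remaining
  points.\<close>

lemma pairing_perms_Suc:
  "bij_betw (\<lambda>(j, \<tau>). pairing_insert n j \<tau>) ({2..2 * n + 2} \<times> pairing_perms n) (pairing_perms (Suc n))"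
proof (rule bij_betwI')
  fix x y assume x: "x \<in> {2..2 * n + 2} \<times> pairing_perms n" and y: "y \<in> {2..2 * n + 2} \<times> pairing_perms n"
  obtain j \<tau> where jx: "x = (j, \<tau>)" "j \<in> {2..2 * n + 2}" "\<tau> permutes {1..2 * n}"
    using x by (auto simp: pairing_perms_def)
  obtain k \<mu> where ky: "y = (k, \<mu>)" "k \<in> {2..2 * n + 2}" "\<mu> permutes {1..2 * n}"
    using y by (auto simp: pairing_perms_def)
  show "((case x of (j, \<tau>) \<Rightarrow> pairing_insert n j \<tau>) = (case y of (j, \<tau>) \<Rightarrow> pairing_insert n j \<tau>)) = (x = y)"
  proof
    assume "(case x of (j, \<tau>) \<Rightarrow> pairing_insert n j \<tau>) = (case y of (j, \<tau>) \<Rightarrow> pairing_insert n j \<tau>)"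
    then have eq: "pairing_insert n j \<tau> = pairing_insert n k \<mu>" by (simp add: jx ky)
    have jk: "j = k"
      using fun_cong[OF eq, of "n + 2"] pairing_insert_apply(3)[OF jx(3,2)] pairing_insert_apply(3)[OF ky(3,2)] by simp
    have "\<tau> i = \<mu> i" for i
    proof -
      consider "i = 0 \<or> i > 2 * n" | "1 \<le> i" "i \<le> n" | "n < i" "i \<le> 2 * n" by linarith
      then show ?thesis
      proof cases
        case 1
        then show ?thesis using jx(3) ky(3) by (auto simp: permutes_not_in)
      next
        case 2
        then show ?thesis
          using fun_cong[OF eq, of "i + 1"] pairing_insert_apply(4)[OF jx(3,2), of i]
            pairing_insert_apply(4)[OF ky(3,2), of i] jk by (simp add: skip_inj)
      next
        case 3
        then show ?thesis
          using fun_cong[OF eq, of "i + 2"] pairing_insert_apply(5)[OF jx(3,2), of i]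
            pairing_insert_apply(5)[OF ky(3,2), of i] jk by (simp add: skip_inj)
      qed
    qed
    then show "x = y" using jk jx ky by auto
  qed simp
next
  fix x assume "x \<in> {2..2 * n + 2} \<times> pairing_perms n"
  then obtain j \<tau> where x: "x = (j, \<tau>)" "j \<in> {2..2 * n + 2}" "\<tau> \<in> pairing_perms n" by blast
  then have "\<tau> permutes {1..2 * n}" "strict_mono_on {1..n} \<tau>" "\<forall>i\<in>{1..n}. \<tau> i < \<tau> (i + n)"
    by (simp_all add: pairing_perms_def)
  then show "(case x of (j, \<tau>) \<Rightarrow> pairing_insert n j \<tau>) \<in> pairing_perms (Suc n)"
    unfolding x(1) prod.case by (intro pairing_insert_order x(2))
next
  fix \<sigma> assume \<sigma>: "\<sigma> \<in> pairing_perms (Suc n)"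
  then have p: "\<sigma> permutes {1..2 * Suc n}" and mono: "strict_mono_on {1..Suc n} \<sigma>"
    and lt: "\<And>i. i \<in> {1..Suc n} \<Longrightarrow> \<sigma> i < \<sigma> (i + Suc n)" by (auto simp: pairing_perms_def)
  have range: "\<sigma> i \<in> {1..2 * Suc n} \<longleftrightarrow> i \<in> {1..2 * Suc n}" for i by (rule permutes_in_image[OF p])
  have "1 \<in> \<sigma> ` {1..2 * Suc n}" unfolding permutes_image[OF p] by simp
  then obtain k where k: "k \<in> {1..2 * Suc n}" "\<sigma> k = 1" by (auto simp only: image_iff)
  \<comment> \<open>The value at any other place exceeds the value at the first place or at its own left end.\<close>
  have "k = 1"
  proof (rule ccontr)
    assume "k \<noteq> 1"
    have "\<exists>i\<in>{1..2 * Suc n}. \<sigma> i < \<sigma> k"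
    proof (cases "k \<le> Suc n")
      case True
      then have "\<sigma> 1 < \<sigma> k" using mono k(1) \<open>k \<noteq> 1\<close> by (auto simp: strict_mono_on_def)
      then show ?thesis by (intro bexI[of _ 1]) auto
    next
      case False
      then have "\<sigma> (k - Suc n) < \<sigma> (k - Suc n + Suc n)" using k(1) by (intro lt) auto
      then show ?thesis using False k(1) by (intro bexI[of _ "k - Suc n"]) auto
    qed
    then obtain i where "i \<in> {1..2 * Suc n}" "\<sigma> i < 1" using k(2) by auto
    then show False using range[of i] by auto
  qed
  then have \<sigma>1: "\<sigma> 1 = 1" using k by simp
  define j where "j = \<sigma> (n + 2)"
  have jr: "j \<in> {1..2 * Suc n}" using range[of "n + 2"] by (simp add: j_def)
  have "j \<noteq> 1"
  proof
    assume "j = 1"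
    then have "n + 2 = 1" using \<sigma>1 injD[OF permutes_inj[OF p], of "n + 2" 1] by (simp only: j_def)
    then show False by simp
  qed
  then have j: "j \<in> {2..2 * n + 2}" using jr by auto
  have p0: "\<sigma> permutes {0..<Suc (2 * n + 2)}" and \<sigma>0: "\<sigma> 0 = 0"
    using p permutes_from_one[of \<sigma> "2 * Suc n"] by simp_all
  define \<tau>1 where "\<tau>1 = permutation_delete \<sigma> (n + 2)"
  have \<tau>1p: "\<tau>1 permutes {0..<2 * n + 2}"
    unfolding \<tau>1_def by (rule permutation_delete_permutes[OF p0]) simp
  have ins1: "permutation_insert (n + 2) j \<tau>1 = \<sigma>"
    unfolding \<tau>1_def j_def by (rule permutation_insert_delete[OF p0]) simp
  have \<tau>1: "\<tau>1 0 = 0" "\<tau>1 1 = 1"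
    using \<sigma>0 \<sigma>1 j unfolding j_def by (simp_all add: \<tau>1_def permutation_delete_expand)
  define \<tau> where "\<tau> = permutation_delete \<tau>1 1"
  have \<tau>1p': "\<tau>1 permutes {0..<Suc (2 * n + 1)}" using \<tau>1p by simp
  have "\<tau> permutes {0..<2 * n + 1}"
    unfolding \<tau>_def by (rule permutation_delete_permutes[OF \<tau>1p']) simp
  moreover have "\<tau> 0 = 0" using \<tau>1 by (simp add: \<tau>_def permutation_delete_expand)
  ultimately have \<tau>p: "\<tau> permutes {1..2 * n}" using permutes_from_one[of \<tau> "2 * n"] by simp
  have "permutation_insert 1 (\<tau>1 1) \<tau> = \<tau>1"
    unfolding \<tau>_def by (rule permutation_insert_delete[OF \<tau>1p']) simp
  then have ins: "pairing_insert n j \<tau> = \<sigma>" using ins1 \<tau>1 by (simp add: pairing_insert_def)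
  have "strict_mono_on {1..n} \<tau>"
  proof (rule strict_mono_onI)
    fix r s assume rs: "r \<in> {1..n}" "s \<in> {1..n}" "r < s"
    then have "\<sigma> (r + 1) < \<sigma> (s + 1)" using mono by (auto simp: strict_mono_on_def)
    then show "\<tau> r < \<tau> s"
      using rs pairing_insert_apply(4)[OF \<tau>p j, of r] pairing_insert_apply(4)[OF \<tau>p j, of s] ins
      by (simp add: skip_strict)
  qed
  moreover have "\<tau> i < \<tau> (i + n)" if i: "i \<in> {1..n}" for i
  proof -
    have "\<sigma> (i + 1) < \<sigma> (i + 1 + Suc n)" using i by (intro lt) auto
    moreover have "i + 1 + Suc n = i + n + 2" by simp
    ultimately show ?thesis
      using i pairing_insert_apply(4)[OF \<tau>p j, of i] pairing_insert_apply(5)[OF \<tau>p j, of "i + n"] ins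
      by (simp add: skip_strict)
  qed
  ultimately have "\<tau> \<in> pairing_perms n" using \<tau>p by (simp add: pairing_perms_def)
  then show "\<exists>x\<in>{2..2 * n + 2} \<times> pairing_perms n. \<sigma> = (case x of (j, \<tau>) \<Rightarrow> pairing_insert n j \<tau>)"
    using j ins by (intro bexI[of _ "(j, \<tau>)"]) auto
qed

text \<open>The Pfaffian of the upper triangular array w, as a signed sum over pairings.\<close>

definition pairing_sum :: "nat \<Rightarrow> (nat \<Rightarrow> nat \<Rightarrow> complex) \<Rightarrow> complex" where
  "pairing_sum n w = (-1) ^ (n * (n - 1) div 2) *
     (\<Sum>\<sigma>\<in>pairing_perms n. of_int (sign \<sigma>) * (\<Prod>i=1..n. w (\<sigma> i) (\<sigma> (i + n))))"

lemma pairing_sum_0: "pairing_sum 0 w = 1"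
proof -
  have "pairing_perms 0 = {id}" by (auto simp: pairing_perms_def)
  then show ?thesis by (simp add: pairing_sum_def)
qed

text \<open>Expansion of the Pfaffian along its first row. The factor \<open>(-1)^n\<close> in the sign of
  \<open>pairing_insert\<close> is the quotient of the two prefactors.\<close>

lemma pairing_sum_Suc:
  "pairing_sum (Suc n) w =
     (\<Sum>j=2..2 * n + 2. (-1) ^ j * w 1 j * pairing_sum n (\<lambda>a b. w (skip j a) (skip j b)))"
proof -
  have e: "Suc n * (Suc n - 1) div 2 = n * (n - 1) div 2 + n"
  proof -
    have "Suc n * n = n * (n - 1) + 2 * n" by (cases n) auto
    then show ?thesis by simp
  qed
  have "pairing_sum (Suc n) w = (-1) ^ (n * (n - 1) div 2 + n) *
     (\<Sum>(j, \<tau>)\<in>{2..2 * n + 2} \<times> pairing_perms n. of_int (sign (pairing_insert n j \<tau>)) *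
        (\<Prod>i=1..Suc n. w (pairing_insert n j \<tau> i) (pairing_insert n j \<tau> (i + Suc n))))"
    unfolding pairing_sum_def e
    by (subst sum.reindex_bij_betw[OF pairing_perms_Suc, symmetric]) (simp add: case_prod_unfold)
  also have "\<dots> = (-1) ^ (n * (n - 1) div 2 + n) *
     (\<Sum>(j, \<tau>)\<in>{2..2 * n + 2} \<times> pairing_perms n. ((-1) ^ (n + j) * of_int (sign \<tau>)) *
        (w 1 j * (\<Prod>i=1..n. w (skip j (\<tau> i)) (skip j (\<tau> (i + n))))))"
  proof (intro arg_cong2[of _ _ _ _ "(*)"] sum.cong refl, clarify)
    fix j \<tau> assume j: "j \<in> {2..2 * n + 2}" and "\<tau> \<in> pairing_perms n"
    then have \<tau>: "\<tau> permutes {1..2 * n}" by (simp add: pairing_perms_def)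
    show "of_int (sign (pairing_insert n j \<tau>)) *
        (\<Prod>i=1..Suc n. w (pairing_insert n j \<tau> i) (pairing_insert n j \<tau> (i + Suc n)))
      = ((-1) ^ (n + j) * of_int (sign \<tau>)) * (w 1 j * (\<Prod>i=1..n. w (skip j (\<tau> i)) (skip j (\<tau> (i + n)))))"
      by (simp only: pairing_insert_sign[OF \<tau> j] pairing_insert_prod[OF \<tau> j])
  qed
  also have "\<dots> = (\<Sum>j=2..2 * n + 2. \<Sum>\<tau>\<in>pairing_perms n. (-1) ^ (n * (n - 1) div 2 + n) *
      (((-1) ^ (n + j) * of_int (sign \<tau>)) * (w 1 j * (\<Prod>i=1..n. w (skip j (\<tau> i)) (skip j (\<tau> (i + n)))))))"
    by (simp only: sum.cartesian_product[symmetric] sum_distrib_left)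
  also have "\<dots> = (\<Sum>j=2..2 * n + 2. (-1) ^ j * w 1 j * pairing_sum n (\<lambda>a b. w (skip j a) (skip j b)))"
  proof (intro sum.cong refl)
    fix j
    have sgn: "(-1) ^ (n * (n - 1) div 2 + n) * (-1) ^ (n + j) = ((-1) ^ j * (-1) ^ (n * (n - 1) div 2) :: complex)"
      by (simp add: power_add flip: power_mult_distrib)
    have "(\<Sum>\<tau>\<in>pairing_perms n. (-1) ^ (n * (n - 1) div 2 + n) *
      (((-1) ^ (n + j) * of_int (sign \<tau>)) * (w 1 j * (\<Prod>i=1..n. w (skip j (\<tau> i)) (skip j (\<tau> (i + n)))))))
      = (\<Sum>\<tau>\<in>pairing_perms n. ((-1) ^ (n * (n - 1) div 2 + n) * (-1) ^ (n + j)) * w 1 j *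
        (of_int (sign \<tau>) * (\<Prod>i=1..n. w (skip j (\<tau> i)) (skip j (\<tau> (i + n))))))"
      by (intro sum.cong refl) (simp only: mult_ac)
    then show "(\<Sum>\<tau>\<in>pairing_perms n. (-1) ^ (n * (n - 1) div 2 + n) *
      (((-1) ^ (n + j) * of_int (sign \<tau>)) * (w 1 j * (\<Prod>i=1..n. w (skip j (\<tau> i)) (skip j (\<tau> (i + n)))))))
      = (-1) ^ j * w 1 j * pairing_sum n (\<lambda>a b. w (skip j a) (skip j b))"
      unfolding sgn by (simp add: pairing_sum_def sum_distrib_left mult_ac)
  qed
  finally show ?thesis .
qed

section \<open>Wick's theorem\<close>

definition omit :: "nat \<Rightarrow> 'a list \<Rightarrow> 'a list" where
  "omit j xs = take j xs @ drop (Suc j) xs"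

lemma omit_Cons [simp]: "omit 0 (x # xs) = xs" "omit (Suc j) (x # xs) = x # omit j xs"
  by (simp_all add: omit_def)

text \<open>Each step to the right past a factor x leaves a scalar \<open>s x\<close> behind and changes the
  sign of the remaining product.\<close>

lemma anticommute_through:
  fixes c :: "'c::cstar_algebra"
  assumes "\<And>x. x \<in> set xs \<Longrightarrow> c * x + x * c = s x *\<^sub>C 1"
  shows "c * prod_list xs = (\<Sum>j<length xs. ((-1) ^ j * s (xs ! j)) *\<^sub>C prod_list (omit j xs))
    + (-1) ^ length xs *\<^sub>C (prod_list xs * c)"
  using assms
proof (induction xs)
  case (Cons x xs)
  have x: "c * x = s x *\<^sub>C 1 - x * c" using Cons.prems[of x] by (simp add: eq_diff_eq)
  have "c * prod_list (x # xs) = s x *\<^sub>C prod_list xs - x * (c * prod_list xs)"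
    by (simp add: x left_diff_distrib mult_scaleC_left mult.assoc flip: mult.assoc[of c x])
  also have "c * prod_list xs = (\<Sum>j<length xs. ((-1) ^ j * s (xs ! j)) *\<^sub>C prod_list (omit j xs))
    + (-1) ^ length xs *\<^sub>C (prod_list xs * c)"
    by (rule Cons.IH) (use Cons.prems in simp)
  finally show ?case
    by (simp add: sum.lessThan_Suc_shift distrib_left sum_distrib_left mult_scaleC_right scaleC_minus_left
        sum_negf mult.assoc del: sum.lessThan_Suc)
qed simp

lemma length_omit: "j < length xs \<Longrightarrow> length (omit j xs) = length xs - 1"
  by (simp add: omit_def)

lemma omit_nth:
  assumes "j < length xs" "i < length xs - 1"
  shows "omit j xs ! i = xs ! (if i < j then i else Suc i)"
  using assms by (simp add: omit_def nth_append min_def)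

lemma length_map_upt_two: "length (map f [2..<m + 2]) = m"
  unfolding length_map length_upt by (rule add_diff_cancel_right')

lemma nth_map_upt_two: "k < m \<Longrightarrow> map f [2..<m + 2] ! k = f (2 + k)"
  by (subst nth_map)
    (simp_all only: length_upt nth_upt add_diff_cancel_right' less_diff_conv add.commute add_less_cancel_left)

lemma omit_map_upt:
  assumes j: "j < m"
  shows "omit j (map f [2..<m + 2]) = map (\<lambda>a. f (skip (j + 2) a)) [1..<m]"
proof -
  define xs where "xs = map f [2..<m + 2]"
  have len: "length xs = m" unfolding xs_def by (rule length_map_upt_two)
  have nth: "xs ! k = f (2 + k)" if "k < m" for k unfolding xs_def by (rule nth_map_upt_two[OF that])
  show ?thesis unfolding xs_def[symmetric]
  proof (rule nth_equalityI)
    show "length (omit j xs) = length (map (\<lambda>a. f (skip (j + 2) a)) [1..<m])"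
      using j len by (simp add: length_omit)
    fix i assume "i < length (omit j xs)"
    then have i: "i < m - 1" using j len by (simp add: length_omit)
    have "omit j xs ! i = xs ! (if i < j then i else Suc i)" by (rule omit_nth) (use i j len in auto)
    also have "\<dots> = f (2 + (if i < j then i else Suc i))" by (rule nth) (use i in auto)
    also have "2 + (if i < j then i else Suc i) = skip (j + 2) (1 + i)"
      by (simp add: skip_def insert_index_def)
    finally show "omit j xs ! i = map (\<lambda>a. f (skip (j + 2) a)) [1..<m] ! i"
      using i by simp
  qed
qed

text \<open>The rule for extracting the first factor is the expansion of a Pfaffian along its first row.
  With an odd number of factors the recursion ends in a single factor, on which the rule gives the
  empty sum.\<close>

lemma wick_pairing_sum:
  fixes \<phi> :: "'c::cstar_algebra \<Rightarrow> complex" and V :: "'c set"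
  assumes one: "\<phi> 1 = 1"
    and step: "\<And>x xs. x \<in> V \<Longrightarrow> set xs \<subseteq> V \<Longrightarrow>
      \<phi> (x * prod_list xs) = (\<Sum>j<length xs. (-1) ^ j * \<phi> (x * xs ! j) * \<phi> (prod_list (omit j xs)))"
  shows "(\<And>i. F i \<in> V) \<Longrightarrow> \<phi> (prod_list (map F [1..<2 * n + 2])) = 0 \<and>
    \<phi> (prod_list (map F [1..<2 * n + 1])) = pairing_sum n (\<lambda>i k. \<phi> (F i * F k))"
proof (induction n arbitrary: F)
  case 0
  then show ?case using step[of "F 1" "[]"] by (simp add: one pairing_sum_0)
next
  case (Suc n)
  have rec: "\<phi> (prod_list (map F [1..<m + 2])) =
      (\<Sum>j<m. (-1) ^ j * \<phi> (F 1 * F (j + 2)) * \<phi> (prod_list (map (\<lambda>a. F (skip (j + 2) a)) [1..<m])))" for m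
  proof -
    have "map F [1..<m + 2] = F 1 # map F [2..<m + 2]" by (subst upt_conv_Cons) (simp_all add: numeral_2_eq_2)
    then have "\<phi> (prod_list (map F [1..<m + 2])) = \<phi> (F 1 * prod_list (map F [2..<m + 2]))"
      by (simp only: prod_list.Cons)
    also have "\<dots> = (\<Sum>j<m. (-1) ^ j * \<phi> (F 1 * map F [2..<m + 2] ! j) * \<phi> (prod_list (omit j (map F [2..<m + 2]))))"
    proof -
      have "set (map F [2..<m + 2]) \<subseteq> V" unfolding set_map using Suc.prems by blast
      from step[OF Suc.prems[of 1] this] show ?thesis by (simp only: length_map_upt_two)
    qed
    also have "\<dots> = (\<Sum>j<m. (-1) ^ j * \<phi> (F 1 * F (j + 2)) * \<phi> (prod_list (map (\<lambda>a. F (skip (j + 2) a)) [1..<m])))"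
      by (intro sum.cong refl) (simp only: omit_map_upt nth_map_upt_two lessThan_iff add.commute[of 2])
    finally show ?thesis .
  qed
  have odd: "\<phi> (prod_list (map F [1..<2 * Suc n + 2])) = 0"
    unfolding rec using Suc.IH[of "\<lambda>a. F (skip _ a)"] Suc.prems by (intro sum.neutral) simp
  have "\<phi> (prod_list (map F [1..<2 * Suc n + 1])) = (\<Sum>j<2 * n + 1. (-1) ^ j * \<phi> (F 1 * F (j + 2)) *
      \<phi> (prod_list (map (\<lambda>a. F (skip (j + 2) a)) [1..<2 * n + 1])))"
    using rec[of "2 * n + 1"] by simp
  also have "\<dots> = (\<Sum>j<2 * n + 1. (-1) ^ (j + 2) * \<phi> (F 1 * F (j + 2)) *
      pairing_sum n (\<lambda>i k. \<phi> (F (skip (j + 2) i) * F (skip (j + 2) k))))"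
    using Suc.IH[of "\<lambda>a. F (skip _ a)"] Suc.prems by (intro sum.cong refl) simp
  also have "\<dots> = (\<Sum>j=2..2 * n + 2. (-1) ^ j * \<phi> (F 1 * F j) *
      pairing_sum n (\<lambda>i k. \<phi> (F (skip j i) * F (skip j k))))"
    by (rule sum.reindex_bij_witness[of _ "\<lambda>j. j - 2" "\<lambda>j. j + 2"]) auto
  finally show ?case using odd by (simp only: pairing_sum_Suc)
qed

section \<open>Half-integers as shifted integers\<close>

definition hi :: "int \<Rightarrow> half_int" where "hi m = half_of_real (of_int m + 1/2)"

lemma real_of_half_hi: "real_of_half (hi m) = of_int m + 1/2"
  unfolding hi_def by (rule half_of_real_inverse) auto

lemma hi_eq_iff [simp]: "hi m = hi n \<longleftrightarrow> m = n"
  by (metis add_right_cancel of_int_eq_iff real_of_half_hi)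

lemma hi_less_iff [simp]: "hi m < hi n \<longleftrightarrow> m < n"
  by (simp add: less_half_int_def real_of_half_hi)

lemma half_int_cases: obtains m where "x = hi m"
proof -
  obtain m :: int where "real_of_half x = of_int m + 1/2" using real_of_half[of x] by auto
  then have "x = hi m" by (simp add: real_of_half_hi flip: real_of_half_inject)
  then show ?thesis by (rule that)
qed

lemma surj_hi: "surj hi"
proof -
  have "\<exists>m. x = hi m" for x by (rule half_int_cases[of x]) blast
  then show ?thesis by (simp add: surj_def)
qed

lemma half_int_interval_finite: "finite {z :: half_int. x < z \<and> z < y}"
proof -
  obtain m n where mn: "x = hi m" "y = hi n" by (metis half_int_cases)
  have "{z. x < z \<and> z < y} \<subseteq> hi ` {m<..<n}"
  proof
    fix z assume z: "z \<in> {z. x < z \<and> z < y}"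
    obtain k where "z = hi k" by (rule half_int_cases)
    then show "z \<in> hi ` {m<..<n}" using z mn by auto
  qed
  then show ?thesis by (rule finite_subset) simp
qed

section \<open>The CAR algebra as an algebra of fermion modes\<close>

lemma ell2_sqs: "f \<in> ell2 \<longleftrightarrow> sqs f"
  by (simp add: ell2_def sqs_def)

lemma ell2_inner_ip: "ell2_inner f g = ip f g"
  by (simp add: ell2_inner_def ip_def)

lemma basis_sqs: "sqs (basis_vec x)"
  by (rule sqs_finite_support[of "{x}"]) (auto simp: basis_vec_def)

lemma zero_sqs: "sqs (\<lambda>_. 0)"
  by (rule sqs_finite_support[of "{}"]) auto

lemma ip_zero [simp]: "ip (\<lambda>_. 0) g = 0" "ip g (\<lambda>_. 0) = 0"
  by (simp_all add: ip_def)

lemma ip_basis: "ip (basis_vec x) (basis_vec y) = (if x = y then 1 else 0)"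
proof -
  have "ip (basis_vec x) (basis_vec y) = (\<Sum>\<^sub>\<infinity>z\<in>{x}. if x = y then 1 else 0)"
    unfolding ip_def by (rule infsum_cong_neutral) (auto simp: basis_vec_def)
  then show ?thesis by simp
qed

lemma conj_J_sqs: "sqs f \<Longrightarrow> sqs (conj_J f)"
  by (simp add: conj_J_def)

lemma conj_J_simps [simp]: "conj_J (basis_vec x) = basis_vec x" "conj_J (\<lambda>_. 0) = (\<lambda>_. 0)" "conj_J (conj_J f) = f"
  by (auto simp: conj_J_def basis_vec_def fun_eq_iff)

lemma bounded_linear_adj: "bounded_linear (adj :: 'c::cstar_algebra \<Rightarrow> 'c)"
  by (rule bounded_linear_intro[of _ 1]) (simp_all add: adj_add scaleR_scaleC adj_scaleC norm_adj)

locale car =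
  fixes B :: "(half_int \<Rightarrow> complex) \<times> (half_int \<Rightarrow> complex) \<Rightarrow> 'c::cstar_algebra"
  assumes car: "car_algebra B"
begin

lemma B_lincomb: "f \<in> K_space \<Longrightarrow> g \<in> K_space \<Longrightarrow> B (K_lincomb c f d g) = c *\<^sub>C B f + d *\<^sub>C B g"
  using car by (simp add: car_algebra_def)

lemma adj_B: "f \<in> K_space \<Longrightarrow> adj (B f) = B (Gam f)"
  using car by (simp add: car_algebra_def)

lemma B_car: "f \<in> K_space \<Longrightarrow> g \<in> K_space \<Longrightarrow> adj (B f) * B g + B g * adj (B f) = K_inner f g *\<^sub>C 1"
  using car unfolding car_algebra_def by blast

lemma K_pair: "(p, q) \<in> K_space \<longleftrightarrow> sqs p \<and> sqs q"
  by (simp add: K_space_def ell2_sqs)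

lemma Gam_K: "f \<in> K_space \<Longrightarrow> Gam f \<in> K_space"
  by (cases f) (simp add: K_pair Gam_def conj_J_sqs)

lemma Gam_Gam: "Gam (Gam f) = f"
  by (simp add: Gam_def)

lemma B_anticommute:
  assumes "f \<in> K_space" "g \<in> K_space"
  shows "B f * B g + B g * B f = K_inner (Gam f) g *\<^sub>C 1"
  using B_car[OF Gam_K[OF assms(1)] assms(2)] adj_B[OF Gam_K[OF assms(1)]] by (simp add: Gam_Gam)

lemma adj_cre: "adj (cre B x) = ann B x"
  by (simp add: cre_def ann_def adj_B K_pair basis_sqs zero_sqs Gam_def)

lemma adj_ann: "adj (ann B x) = cre B x"
  by (simp add: adj_adj flip: adj_cre)

lemma cre_cre: "cre B x * cre B y + cre B y * cre B x = 0"
  unfolding cre_def by (subst B_anticommute)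
    (simp_all add: K_pair basis_sqs zero_sqs Gam_def K_inner_def ell2_inner_ip)

lemma ann_ann: "ann B x * ann B y + ann B y * ann B x = 0"
  unfolding ann_def by (subst B_anticommute)
    (simp_all add: K_pair basis_sqs zero_sqs Gam_def K_inner_def ell2_inner_ip)

lemma ann_cre: "ann B x * cre B y + cre B y * ann B x = (if x = y then 1 else 0)"
  unfolding ann_def cre_def by (subst B_anticommute)
    (simp_all add: K_pair basis_sqs zero_sqs Gam_def K_inner_def ell2_inner_ip ip_basis)

text \<open>The element \<open>B (p, 0)\<close> has square 0, so \<open>x = adj (B (p, 0)) * B (p,
  0)\<close> satisfies \<open>x * x = c x\<close> with c the squared norm of p, and the
  C*-identity bounds the norm of x by c.\<close>

lemma norm_B_left:
  assumes p: "sqs p"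
  shows "norm (B (p, \<lambda>_. 0)) \<le> sqrt (sqnorm p)"
proof -
  let ?f = "(p, \<lambda>_. 0)"
  have K: "?f \<in> K_space" using p by (simp add: K_pair zero_sqs)
  have "B ?f * B ?f + B ?f * B ?f = 0"
    by (subst B_anticommute[OF K K]) (simp add: Gam_def K_inner_def ell2_inner_ip)
  then have "2 *\<^sub>R (B ?f * B ?f) = 0" by (simp add: scaleR_2)
  then have sq: "B ?f * B ?f = 0" by simp
  have ip: "K_inner ?f ?f = complex_of_real (sqnorm p)"
    by (simp add: K_inner_def ell2_inner_ip ip_self_sqs p)
  define x where "x = adj (B ?f) * B ?f"
  have "x * x = adj (B ?f) * (B ?f * adj (B ?f)) * B ?f" by (simp add: x_def mult.assoc)
  also have "B ?f * adj (B ?f) = complex_of_real (sqnorm p) *\<^sub>C 1 - adj (B ?f) * B ?f"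
    using B_car[OF K K] by (simp add: ip eq_diff_eq add.commute)
  also have "adj (B ?f) * (complex_of_real (sqnorm p) *\<^sub>C 1 - adj (B ?f) * B ?f) * B ?f
    = complex_of_real (sqnorm p) *\<^sub>C x - adj (B ?f) * adj (B ?f) * (B ?f * B ?f)"
    by (simp add: x_def algebra_simps mult_scaleC_left mult_scaleC_right)
  finally have "x * x = complex_of_real (sqnorm p) *\<^sub>C x" by (simp add: sq)
  moreover have "(norm x)\<^sup>2 = norm (x * x)"
    using norm_adj_mult[of x] by (simp add: x_def adj_mult adj_adj)
  ultimately have "norm x * norm x = sqnorm p * norm x"
    by (simp add: norm_scaleC power2_eq_square sqnorm_nonneg)
  then have "norm x \<le> sqnorm p" using sqnorm_nonneg[of p] by auto
  moreover have "norm x = (norm (B ?f))\<^sup>2" by (simp add: x_def norm_adj_mult)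
  ultimately show ?thesis by (simp add: real_le_rsqrt)
qed

lemma B_left_sum:
  assumes "finite S"
  shows "(\<Sum>x\<in>S. p x *\<^sub>C cre B x) = B ((\<lambda>x. if x \<in> S then p x else 0), \<lambda>_. 0)"
  using assms
proof (induction S rule: finite_induct)
  case empty
  have "B (K_lincomb 0 (basis_vec (hi 0), \<lambda>_. 0) 0 (basis_vec (hi 0), \<lambda>_. 0)) = 0"
    by (subst B_lincomb) (simp_all add: K_pair basis_sqs zero_sqs)
  then show ?case by (simp add: K_lincomb_def)
next
  case (insert y S)
  let ?f = "((\<lambda>x. if x \<in> S then p x else 0), \<lambda>_. 0)"
  have K: "?f \<in> K_space" "(basis_vec y, \<lambda>_. 0) \<in> K_space"
    using insert(1) by (auto simp: K_pair basis_sqs zero_sqs intro: sqs_finite_support[of S])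
  have "((\<lambda>x. if x \<in> insert y S then p x else 0), \<lambda>_. 0) = K_lincomb (p y) (basis_vec y, \<lambda>_. 0) 1 ?f"
    using insert(2) by (auto simp: K_lincomb_def basis_vec_def fun_eq_iff)
  then show ?case using insert B_lincomb[OF K(2,1), of "p y" 1] by (simp add: cre_def)
qed

text \<open>The error of a partial sum is \<open>B\<close> at the remaining tail of p.\<close>

lemma B_left_has_sum:
  assumes p: "sqs p"
  shows "((\<lambda>x. p x *\<^sub>C cre B x) has_sum B (p, \<lambda>_. 0)) UNIV"
  unfolding has_sum_def
proof (rule LIM_zero_cancel, rule Lim_null_comparison)
  have "((\<lambda>S. sqrt (sqnorm (\<lambda>x. if x \<in> S then 0 else p x))) \<longlongrightarrow> sqrt 0) (finite_subsets_at_top UNIV)"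
    by (intro tendsto_real_sqrt sqs_tail p)
  then show "((\<lambda>S. sqrt (sqnorm (\<lambda>x. if x \<in> S then 0 else p x))) \<longlongrightarrow> 0) (finite_subsets_at_top UNIV)" by simp
  show "\<forall>\<^sub>F S in finite_subsets_at_top UNIV. norm ((\<Sum>x\<in>S. p x *\<^sub>C cre B x) - B (p, \<lambda>_. 0))
    \<le> sqrt (sqnorm (\<lambda>x. if x \<in> S then 0 else p x))"
  proof (rule eventually_finite_subsets_at_top_weakI)
    fix S :: "half_int set" assume S: "finite S"
    let ?in = "\<lambda>x. if x \<in> S then p x else 0" and ?out = "\<lambda>x. if x \<in> S then 0 else p x"
    have o: "sqs ?out" using sqs_restrict[OF p, of "\<lambda>x. x \<notin> S"] by (simp only: if_not_swap)
    have i: "sqs ?in" by (rule sqs_restrict[OF p])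
    have "(?out, \<lambda>_. 0) = K_lincomb 1 (p, \<lambda>_. 0) (- 1) (?in, \<lambda>_. 0)"
      by (auto simp: K_lincomb_def fun_eq_iff)
    then have "B (?out, \<lambda>_. 0) = B (p, \<lambda>_. 0) - B (?in, \<lambda>_. 0)"
      using B_lincomb[of "(p, \<lambda>_. 0)" "(?in, \<lambda>_. 0)" 1 "- 1"] p i by (simp add: K_pair zero_sqs scaleC_minus_left)
    then have "norm ((\<Sum>x\<in>S. p x *\<^sub>C cre B x) - B (p, \<lambda>_. 0)) = norm (B (?out, \<lambda>_. 0))"
      by (simp add: B_left_sum[OF S] norm_minus_commute)
    then show "norm ((\<Sum>x\<in>S. p x *\<^sub>C cre B x) - B (p, \<lambda>_. 0)) \<le> sqrt (sqnorm ?out)"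
      using norm_B_left[OF o] by simp
  qed
qed

lemma B_right_has_sum:
  assumes q: "sqs q"
  shows "((\<lambda>x. q x *\<^sub>C ann B x) has_sum B (\<lambda>_. 0, q)) UNIV"
proof -
  have "((\<lambda>x. adj (cnj (q x) *\<^sub>C cre B x)) has_sum adj (B (conj_J q, \<lambda>_. 0))) UNIV"
    using has_sum_bounded_linear[OF bounded_linear_adj B_left_has_sum[OF conj_J_sqs[OF q]]]
    by (simp add: conj_J_def o_def)
  moreover have "adj (B (conj_J q, \<lambda>_. 0)) = B (\<lambda>_. 0, q)"
    by (subst adj_B) (simp_all add: K_pair conj_J_sqs q zero_sqs Gam_def)
  ultimately show ?thesis by (simp add: adj_scaleC adj_cre)
qed

lemma B_split: "sqs p \<Longrightarrow> sqs q \<Longrightarrow> B (p, q) = B (p, \<lambda>_. 0) + B (\<lambda>_. 0, q)"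
  using B_lincomb[of "(p, \<lambda>_. 0)" "(\<lambda>_. 0, q)" 1 1] by (simp add: K_pair zero_sqs K_lincomb_def)

text \<open>The parity of the number of sites between x and the origin.\<close>

definition jw :: "half_int \<Rightarrow> complex" where
  "jw x = (-1) ^ card {z. x < z \<and> z < hi 0}"

text \<open>Particles above and holes below the origin are the excitations of the Dirac sea. The phase on
  holes turns signs that count excitations into signs that count occupied sites, see
  \<open>above_eps\<close>.\<close>

definition mode :: "half_int \<Rightarrow> 'c" where
  "mode x = (if hi 0 \<le> x then cre B x else jw x *\<^sub>C ann B x)"

lemma jw_square [simp]: "jw x * jw x = 1"
  by (simp add: jw_def flip: power_mult_distrib)

lemma cnj_jw [simp]: "cnj (jw x) = jw x"
  by (simp add: jw_def)

lemma adj_mode: "adj (mode x) = (if hi 0 \<le> x then ann B x else jw x *\<^sub>C cre B x)"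
  by (simp add: mode_def adj_cre adj_ann adj_scaleC)

lemma cre_mode: "cre B x = (if hi 0 \<le> x then mode x else jw x *\<^sub>C adj (mode x))"
  by (cases "hi 0 \<le> x") (simp add: mode_def, simp add: adj_mode scaleC_scaleC)

lemma ann_mode: "ann B x = (if hi 0 \<le> x then adj (mode x) else jw x *\<^sub>C mode x)"
  by (cases "hi 0 \<le> x") (simp add: adj_mode, simp add: mode_def scaleC_scaleC)

lemma modes: "fermion_modes mode"
proof
  note cre_cre [simp] ann_ann [simp]
  have swap: "cre B y * ann B x + ann B x * cre B y = (if x = y then 1 else 0)" for x y
    using ann_cre[of x y] by (simp add: add.commute)
  have s: "(z * w) *\<^sub>C (a * c) + (z * w) *\<^sub>C (c * a) = (z * w) *\<^sub>C (a * c + c * a)" for z w and a c :: 'c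
    by (simp add: scaleC_add_right)
  fix x y
  show "mode x * mode y + mode y * mode x = 0"
    unfolding mode_def using ann_cre[of x y] swap[of x y] ann_cre[of y x] swap[of y x]
    by (auto simp: mult_scaleC_left mult_scaleC_right scaleC_scaleC mult.commute[of "jw y"] simp flip: scaleC_add_right)
  show "adj (mode x) * mode y + mode y * adj (mode x) = (if x = y then 1 else 0)"
    unfolding adj_mode unfolding mode_def using ann_cre[of x y] swap[of x y] ann_cre[of y x] swap[of y x]
    by (auto simp: mult_scaleC_left mult_scaleC_right scaleC_scaleC mult.commute[of "jw y"] simp flip: scaleC_add_right)
qed

text \<open>Every \<open>B f\<close> is a limit of linear combinations of modes and their adjoints.\<close>

lemma mode_generates: "closed_subalgebra_generated (range mode \<union> range (\<lambda>x. adj (mode x))) = UNIV"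
proof -
  have "R = UNIV" if R: "is_closed_subalgebra R" and sub: "range mode \<union> range (\<lambda>x. adj (mode x)) \<subseteq> R" for R
  proof -
    have cl: "closed R" and add: "\<And>a c. a \<in> R \<Longrightarrow> c \<in> R \<Longrightarrow> a + c \<in> R"
      and sc: "\<And>a z. a \<in> R \<Longrightarrow> z *\<^sub>C a \<in> R"
      using R by (auto simp: is_closed_subalgebra_def)
    have "mode x \<in> R" "adj (mode x) \<in> R" for x using sub by auto
    then have *: "cre B x \<in> R \<and> ann B x \<in> R" for x
      unfolding cre_mode ann_mode by (simp add: sc)
    have zero: "0 \<in> R" using sc[of "cre B (hi 0)" 0] * by simp
    have sum: "(\<Sum>x\<in>S. f x) \<in> R" if "\<And>x. f x \<in> R" for S :: "half_int set" and f
      by (induction S rule: infinite_finite_induct) (auto simp: zero that intro: add)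
    have lim: "v \<in> R" if "(f has_sum v) UNIV" "\<And>x. f x \<in> R" for f :: "half_int \<Rightarrow> 'c" and v
      using that(1) unfolding has_sum_def
      by (rule Lim_in_closed_set[OF cl always_eventually, rotated 2]) (simp_all add: sum that(2))
    have "B f \<in> R" if "f \<in> K_space" for f
    proof -
      obtain p q where "f = (p, q)" by (cases f)
      with that have f: "f = (p, q)" "sqs p" "sqs q" by (simp_all add: K_pair)
      have "B (p, \<lambda>_. 0) \<in> R" by (rule lim[OF B_left_has_sum[OF f(2)]]) (simp add: sc *)
      moreover have "B (\<lambda>_. 0, q) \<in> R" by (rule lim[OF B_right_has_sum[OF f(3)]]) (simp add: sc *)
      ultimately show ?thesis using f by (simp add: B_split add)
    qed
    then have "closed_subalgebra_generated (B ` K_space) \<subseteq> R"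
      using R unfolding closed_subalgebra_generated_def by blast
    then show ?thesis using car by (auto simp: car_algebra_def)
  qed
  then show ?thesis unfolding closed_subalgebra_generated_def by blast
qed

sublocale fermion_algebra mode
  by (rule fermion_algebra.intro[OF modes]) (simp add: fermion_algebra_axioms_def mode_generates)

end

section \<open>Creation and annihilation operators on configurations\<close>

text \<open>The finite sets S correspond to the configurations that differ from the Dirac sea at the sites
  of S only.\<close>

definition cfg :: "half_int set \<Rightarrow> config" where
  "cfg S = (\<lambda>x. (x < hi 0) \<noteq> (x \<in> S))"

text \<open>The Jordan-Wigner sign at x.\<close>

definition above :: "half_int \<Rightarrow> config \<Rightarrow> complex" where
  "above x \<omega> = (-1) ^ card {z. x < z \<and> \<omega> z}"

definition flip :: "half_int set \<Rightarrow> half_int \<Rightarrow> half_int set" where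
  "flip S x = (if x \<in> S then S - {x} else insert x S)"

lemma flip_flip [simp]: "flip (flip S x) x = S"
  by (auto simp: flip_def)

lemma finite_flip [simp]: "finite (flip S x) = finite S"
  by (simp add: flip_def)

lemma cfg_flip: "cfg (flip S x) = (cfg S)(x := \<not> cfg S x)"
  by (auto simp: cfg_def flip_def fun_eq_iff)

lemma above_flip: "above x (cfg (flip S x)) = above x (cfg S)"
proof -
  have "{z. x < z \<and> cfg (flip S x) z} = {z. x < z \<and> cfg S z}" by (auto simp: cfg_flip)
  then show ?thesis by (simp add: above_def)
qed

lemma cnj_above [simp]: "cnj (above x \<omega>) = above x \<omega>"
  by (simp add: above_def)

lemma finite_above: "finite S \<Longrightarrow> finite {z. x < z \<and> cfg S z}"
  by (rule finite_subset[of _ "S \<union> {z. x < z \<and> z < hi 0}"]) (auto simp: cfg_def half_int_interval_finite)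

context car
begin

text \<open>On the sites between x and the origin, \<open>eps\<close> counts the holes and
  \<open>above\<close> counts the others; the two numbers differ in parity by \<open>jw x\<close>.\<close>

lemma above_eps: "finite S \<Longrightarrow> above x (cfg S) = (if hi 0 \<le> x then eps x S else jw x * eps x S)"
proof (cases "hi 0 \<le> x")
  case True
  then have "{z. x < z \<and> cfg S z} = {z \<in> S. x < z}" by (auto simp: cfg_def)
  then show ?thesis using True by (simp add: above_def eps_def)
next
  case False
  assume S: "finite S"
  let ?P = "{z \<in> S. hi 0 \<le> z}" and ?Q = "{z. x < z \<and> z < hi 0 \<and> z \<in> S}" and ?R = "{z. x < z \<and> z < hi 0 \<and> z \<notin> S}"
  have fin: "finite ?P" "finite ?Q" "finite ?R"
    using S half_int_interval_finite[of x "hi 0"] by (auto intro: finite_subset[of _ "{z. x < z \<and> z < hi 0}"])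
  have "{z. x < z \<and> cfg S z} = ?P \<union> ?R" using False by (auto simp: cfg_def)
  then have 1: "card {z. x < z \<and> cfg S z} = card ?P + card ?R"
    using fin by (simp add: card_Un_disjoint disjoint_iff not_less)
  have "{z \<in> S. x < z} = ?P \<union> ?Q" using False by auto
  then have 2: "card {z \<in> S. x < z} = card ?P + card ?Q"
    using fin by (simp add: card_Un_disjoint disjoint_iff not_less)
  have "{z. x < z \<and> z < hi 0} = ?Q \<union> ?R" by auto
  then have 3: "card {z. x < z \<and> z < hi 0} = card ?Q + card ?R"
    using fin by (simp add: card_Un_disjoint disjoint_iff)
  have "(-1 :: complex) ^ card ?Q * (-1) ^ card ?Q = 1" by (simp flip: power_mult_distrib)
  then show ?thesis using False
    by (simp add: above_def jw_def eps_def 1 2 3 power_add)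
qed

text \<open>Uniformly for particles and holes: a creation operator fills an empty site with the
  Jordan-Wigner sign of the configuration.\<close>

lemma melem_cre:
  "melem (cre B x) S T = (if finite T \<and> \<not> cfg T x \<and> S = flip T x then above x (cfg T) else 0)"
proof (cases "hi 0 \<le> x")
  case True
  then have "cre B x = mode x" by (simp add: mode_def)
  moreover have "cfg T x \<longleftrightarrow> x \<in> T" using True by (simp add: cfg_def leD)
  ultimately show ?thesis using True
    by (cases "finite T"; cases "x \<in> T") (simp_all add: melem_b above_eps flip_def)
next
  case False
  then have "cre B x = jw x *\<^sub>C adj (mode x)" by (simp add: adj_mode scaleC_scaleC)
  then have *: "melem (cre B x) S T = jw x * (if finite S \<and> x \<notin> S \<and> T = insert x S then eps x S else 0)"
    by (simp add: melem_scaleC melem_a)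
  show ?thesis
  proof (cases "finite S \<and> x \<notin> S \<and> T = insert x S")
    case t: True
    then have "S = flip T x" "\<not> cfg T x" "finite T" using False by (auto simp: flip_def cfg_def)
    moreover have "above x (cfg T) = jw x * eps x S"
      using above_flip[of x S] above_eps[of S x] t False by (simp add: flip_def)
    ultimately show ?thesis unfolding * by (simp only: t simp_thms if_True)
  next
    case f: False
    have "\<not> (finite T \<and> \<not> cfg T x \<and> S = flip T x)"
      using f False by (auto simp: flip_def cfg_def)
    then show ?thesis unfolding * using f by (simp only: if_False mult_zero_right)
  qed
qed

lemma melem_ann:
  "melem (ann B x) S T = (if finite T \<and> cfg T x \<and> S = flip T x then above x (cfg T) else 0)"
proof -
  have "melem (ann B x) S T = cnj (melem (cre B x) T S)" by (simp add: melem_adj flip: adj_cre)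
  moreover have "(finite S \<and> \<not> cfg S x \<and> T = flip S x) = (finite T \<and> cfg T x \<and> S = flip T x)"
    by (auto simp: cfg_flip)
  moreover have "S = flip T x \<Longrightarrow> above x (cfg S) = above x (cfg T)" by (simp add: above_flip)
  ultimately show ?thesis unfolding melem_cre by auto
qed

lemma op_cre: "op (cre B x) k S = (if finite S \<and> cfg S x then above x (cfg S) * k (flip S x) else 0)"
proof -
  have "melem (cre B x) S T * k T = (if T = flip S x then (if finite S \<and> cfg S x then above x (cfg S) * k (flip S x) else 0) else 0)" for T
  proof (cases "T = flip S x")
    case True
    have "cfg (flip S x) x = (\<not> cfg S x)" by (simp add: cfg_flip)
    then show ?thesis unfolding melem_cre True by (simp add: above_flip)
  qed (auto simp: melem_cre)
  then have "op (cre B x) k S = (\<Sum>\<^sub>\<infinity>T\<in>{flip S x}. if finite S \<and> cfg S x then above x (cfg S) * k (flip S x) else 0)"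
    unfolding mop_def by (intro infsum_cong_neutral) auto
  then show ?thesis by simp
qed

lemma op_ann: "op (ann B x) k S = (if finite S \<and> \<not> cfg S x then above x (cfg S) * k (flip S x) else 0)"
proof -
  have "melem (ann B x) S T * k T = (if T = flip S x then (if finite S \<and> \<not> cfg S x then above x (cfg S) * k (flip S x) else 0) else 0)" for T
  proof (cases "T = flip S x")
    case True
    have "cfg (flip S x) x = (\<not> cfg S x)" by (simp add: cfg_flip)
    then show ?thesis unfolding melem_ann True by (simp add: above_flip)
  qed (auto simp: melem_ann)
  then have "op (ann B x) k S = (\<Sum>\<^sub>\<infinity>T\<in>{flip S x}. if finite S \<and> \<not> cfg S x then above x (cfg S) * k (flip S x) else 0)"
    unfolding mop_def by (intro infsum_cong_neutral) auto
  then show ?thesis by simp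
qed

end

section \<open>Schur values as amplitudes of configurations\<close>

definition occ_from :: "nat \<Rightarrow> config \<Rightarrow> int set" where
  "occ_from n \<sigma> = {m. - int n \<le> m \<and> \<sigma> (hi m)}"

text \<open>All sites below -n are filled and N of the other sites are. The configurations with \<open>N =
  n\<close> have charge 0; the linear relations concern those with one particle more or fewer.\<close>

definition window :: "nat \<Rightarrow> nat \<Rightarrow> config \<Rightarrow> bool" where
  "window n N \<sigma> \<longleftrightarrow> (\<forall>m. m < - int n \<longrightarrow> \<sigma> (hi m)) \<and> finite (occ_from n \<sigma>) \<and> card (occ_from n \<sigma>) = N"

text \<open>The elements of a finite set in decreasing order, which is the order of the rows of a
  Jacobi-Trudi matrix.\<close>

definition desc :: "int set \<Rightarrow> nat \<Rightarrow> int" where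
  "desc A i = rev (sorted_list_of_set A) ! i"

lemma desc_strict:
  assumes "finite A" "i < j" "j < card A"
  shows "desc A j < desc A i"
proof -
  let ?l = "sorted_list_of_set A"
  have l: "length ?l = card A" "sorted_wrt (<) ?l" using assms(1) by simp_all
  have "?l ! (card A - Suc j) < ?l ! (card A - Suc i)"
    by (rule sorted_wrt_nth_less[OF l(2)]) (use assms in auto)
  then show ?thesis using assms l by (simp add: desc_def rev_nth)
qed

lemma desc_image: "finite A \<Longrightarrow> desc A ` {..<card A} = A"
proof -
  assume A: "finite A"
  let ?r = "rev (sorted_list_of_set A)"
  have "desc A ` {..<card A} = (!) ?r ` {..<length ?r}" using A by (simp add: desc_def image_def)
  also have "\<dots> = set ?r" by (auto simp only: in_set_conv_nth image_iff lessThan_iff)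
  finally show ?thesis using A by simp
qed

lemma desc_unique:
  assumes x: "\<And>i j. i < j \<Longrightarrow> j < n \<Longrightarrow> x j < x i" and A: "x ` {..<n} = A" and i: "i < n"
  shows "desc A i = x i"
proof -
  have fin: "finite A" using A by auto
  have c: "card A = n"
    using card_image[OF strict_sequence_inj[of n x]] x A by (simp add: lessThan_atLeast0)
  show ?thesis
    by (rule strict_sequence_eqI[of n]) (use desc_strict[OF fin] desc_image[OF fin] c x A i in auto)
qed

lemma desc_rank:
  assumes "finite A" "a \<in> A"
  shows "card {e \<in> A. a < e} < card A" "desc A (card {e \<in> A. a < e}) = a"
proof -
  obtain i where i: "i < card A" "a = desc A i" using desc_image[OF assms(1)] assms(2) by (auto simp: image_iff)
  have "card {e \<in> A. a < e} = i"
    using strict_sequence_rank[of "card A" "desc A" i] desc_strict[OF assms(1)] i desc_image[OF assms(1)] by simp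
  then show "card {e \<in> A. a < e} < card A" "desc A (card {e \<in> A. a < e}) = a" using i by simp_all
qed

lemma desc_remove:
  assumes A: "finite A" "card A = Suc n" and p: "p < Suc n" and k: "k < n"
  shows "desc (A - {desc A p}) k = desc A (insert_index p k)"
proof (rule desc_unique[of n])
  fix i j assume "i < j" "j < n"
  then show "desc A (insert_index p j) < desc A (insert_index p i)"
    by (intro desc_strict A(1)) (auto simp: insert_index_def A(2))
next
  have inj: "inj_on (desc A) {0..<Suc n}"
    by (rule strict_sequence_inj) (use desc_strict[OF A(1)] A(2) in auto)
  have "insert_index p ` {..<n} = {..<Suc n} - {p}"
    using insert_index_image[of p n] p by (simp add: lessThan_atLeast0)
  then have "(\<lambda>k. desc A (insert_index p k)) ` {..<n} = desc A ` ({..<Suc n} - {p})"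
    by (metis image_image)
  also have "\<dots> = desc A ` {..<Suc n} - desc A ` {p}"
    by (rule inj_on_image_set_diff[of _ "{0..<Suc n}"]) (use inj p in auto)
  finally show "(\<lambda>k. desc A (insert_index p k)) ` {..<n} = A - {desc A p}"
    using desc_image[OF A(1)] A(2) by simp
qed (fact k)

lemma sdet_cong: "(\<And>i. i < n \<Longrightarrow> x i = y i) \<Longrightarrow> sdet \<rho> n x = sdet \<rho> n y"
  unfolding sdet_def by (rule detf_cong) simp

lemma maya_hi: "maya lam (hi m) \<longleftrightarrow> (\<exists>i. m = part_sites lam i)"
proof -
  have "(of_int m + 1/2 = real (lam i) - real (i + 1) + 1/2) \<longleftrightarrow> m = part_sites lam i" for i
  proof -
    have "real (lam i) - real (i + 1) = real_of_int (part_sites lam i)" by (simp add: part_sites_def)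
    then show ?thesis by simp
  qed
  then show ?thesis by (simp add: maya_def real_of_half_hi)
qed

lemma part_sites_tail:
  assumes "lam \<in> partitions" "part_length lam \<le> i"
  shows "part_sites lam i = - int i - 1"
proof -
  have "i \<notin> {i. lam i \<noteq> 0}" unfolding partition_support[OF assms(1)] using assms(2) by simp
  then show ?thesis by (simp add: part_sites_def)
qed

lemma maya_window:
  assumes lam: "lam \<in> partitions" "part_length lam \<le> n"
  shows "window n n (maya lam)" "occ_from n (maya lam) = part_sites lam ` {..<n}"
proof -
  show o: "occ_from n (maya lam) = part_sites lam ` {..<n}"
  proof (rule Set.set_eqI, rule iffI)
    fix m assume "m \<in> occ_from n (maya lam)"
    then obtain i where i: "- int n \<le> m" "m = part_sites lam i" by (auto simp: occ_from_def maya_hi)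
    have "i < n"
    proof (rule ccontr)
      assume "\<not> i < n"
      then show False using part_sites_tail[of lam i] lam i by simp
    qed
    then show "m \<in> part_sites lam ` {..<n}" using i by blast
  next
    fix m assume "m \<in> part_sites lam ` {..<n}"
    then obtain i where "i < n" "m = part_sites lam i" by blast
    then show "m \<in> occ_from n (maya lam)" unfolding occ_from_def mem_Collect_eq maya_hi by (auto simp: part_sites_def)
  qed
  have "maya lam (hi m)" if "m < - int n" for m
  proof -
    have "m = part_sites lam (nat (- m - 1))" using that lam by (subst part_sites_tail) auto
    then show ?thesis unfolding maya_hi by blast
  qed
  moreover have "card (part_sites lam ` {..<n}) = n"
    using card_image[OF strict_sequence_inj[of n "part_sites lam"]] part_sites_strict[OF lam(1)]
    by (simp add: lessThan_atLeast0)
  ultimately show "window n n (maya lam)" by (simp add: window_def o)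
qed

lemma maya_inj: "inj_on maya partitions"
proof (rule inj_onI)
  fix lam mu assume lam: "lam \<in> partitions" and mu: "mu \<in> partitions" and eq: "maya lam = maya mu"
  show "lam = mu"
  proof
    fix i
    define n where "n = Suc i + part_length lam + part_length mu"
    have "part_sites lam ` {..<n} = part_sites mu ` {..<n}"
      using maya_window(2)[OF lam, of n] maya_window(2)[OF mu, of n] eq by (simp add: n_def)
    then have "part_sites lam i = part_sites mu i"
      by (intro strict_sequence_eqI[of n]) (use part_sites_strict lam mu in \<open>auto simp: n_def\<close>)
    then show "lam i = mu i" by (simp add: part_sites_def)
  qed
qed

text \<open>Since n sites from -n on are filled, the i-th largest lies at or above -i - 1; its excess over
  -i - 1 is the i-th part.\<close>

lemma window_maya:
  assumes "window n n \<sigma>"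
  obtains lam where "lam \<in> partitions" "part_length lam \<le> n" "\<sigma> = maya lam"
proof -
  let ?A = "occ_from n \<sigma>"
  have A: "finite ?A" "card ?A = n" and low: "\<And>m. m < - int n \<Longrightarrow> \<sigma> (hi m)"
    using assms by (auto simp: window_def)
  have ge: "- int i - 1 \<le> desc ?A i" if "i < n" for i
  proof -
    have "- int n + int k \<le> desc ?A (n - Suc k)" if "k < n" for k using that
    proof (induction k)
      case 0
      then have "desc ?A (n - 1) \<in> ?A" using desc_image[OF A(1)] A(2) by auto
      then show ?case by (simp add: occ_from_def)
    next
      case (Suc k)
      have "desc ?A (n - Suc k) < desc ?A (n - Suc (Suc k))"
        using Suc A by (intro desc_strict) auto
      then show ?case using Suc by simp
    qed
    from this[of "n - Suc i"] that show ?thesis by (simp add: of_nat_diff)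
  qed
  define lam where "lam i = (if i < n then nat (desc ?A i + int i + 1) else 0)" for i
  have sites: "part_sites lam i = (if i < n then desc ?A i else - int i - 1)" for i
    using ge[of i] by (cases "i < n") (simp_all add: part_sites_def lam_def)
  have fin: "finite {i. lam i \<noteq> 0}" by (rule finite_subset[of _ "{..<n}"]) (auto simp: lam_def)
  have dec: "lam (Suc i) \<le> lam i" for i
  proof (cases "Suc i < n")
    case True
    then have "desc ?A (Suc i) < desc ?A i" using A by (intro desc_strict) auto
    then show ?thesis using True by (simp add: lam_def)
  qed (simp add: lam_def)
  have part: "lam \<in> partitions" using fin dec by (auto simp: partitions_def decseq_Suc_iff)
  have "{i. lam i \<noteq> 0} \<subseteq> {..<n}" by (auto simp: lam_def)
  then have len: "part_length lam \<le> n"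
    unfolding part_length_def using card_mono[of "{..<n}"] by simp
  have "\<sigma> x = maya lam x" for x
  proof -
    obtain m where x: "x = hi m" by (rule half_int_cases)
    show ?thesis
    proof (cases "m < - int n")
      case True
      then have "\<not> nat (- m - 1) < n" by linarith
      then have "m = part_sites lam (nat (- m - 1))" using True by (simp add: sites)
      then show ?thesis using low[OF True] unfolding x maya_hi by blast
    next
      case False
      then have "\<sigma> x \<longleftrightarrow> m \<in> ?A" by (simp add: occ_from_def x)
      also have "\<dots> \<longleftrightarrow> (\<exists>i<n. m = desc ?A i)" by (subst desc_image[OF A(1), symmetric]) (auto simp: A(2))
      also have "\<dots> \<longleftrightarrow> (\<exists>i. m = part_sites lam i)" using False by (auto simp: sites)
      finally show ?thesis by (simp add: x maya_hi)
    qed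
  qed
  then show ?thesis using that[OF part len] by blast
qed

text \<open>The coefficients of the Fock space vector in which the basis vector of each partition has its
  Schur value as coefficient.\<close>

definition amp :: "(nat \<Rightarrow> real) \<times> (nat \<Rightarrow> real) \<Rightarrow> config \<Rightarrow> real" where
  "amp \<rho> \<sigma> = (if \<sigma> \<in> maya ` partitions then schur_value \<rho> (the_inv_into partitions maya \<sigma>) else 0)"

lemma amp_maya: "lam \<in> partitions \<Longrightarrow> amp \<rho> (maya lam) = schur_value \<rho> lam"
  by (simp add: amp_def the_inv_into_f_f[OF maya_inj])

lemma amp_window:
  assumes "window n n \<sigma>"
  shows "amp \<rho> \<sigma> = sdet \<rho> n (desc (occ_from n \<sigma>))"
proof -
  obtain lam where lam: "lam \<in> partitions" "part_length lam \<le> n" "\<sigma> = maya lam"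
    using window_maya assms by blast
  have "desc (occ_from n \<sigma>) i = part_sites lam i" if "i < n" for i
    unfolding lam(3) maya_window(2)[OF lam(1,2)]
    by (rule desc_unique[OF _ refl that]) (rule part_sites_strict[OF lam(1)])
  then have "sdet \<rho> n (desc (occ_from n \<sigma>)) = sdet \<rho> n (part_sites lam)" by (rule sdet_cong)
  then show ?thesis using sdet_stable[OF lam(1,2)] lam by (simp add: amp_maya)
qed

lemma amp_nonzero_window:
  assumes "amp \<rho> \<sigma> \<noteq> 0"
  shows "\<exists>n0. \<forall>n\<ge>n0. window n n \<sigma>"
proof -
  have "\<sigma> \<in> maya ` partitions" using assms by (auto simp: amp_def split: if_splits)
  then obtain lam where "lam \<in> partitions" "\<sigma> = maya lam" by blast
  then show ?thesis using maya_window(1) by blast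
qed

lemma occ_from_remove: "occ_from n (\<sigma>(hi y := False)) = occ_from n \<sigma> - {y}"
  by (auto simp: occ_from_def)

lemma occ_from_insert: "- int n \<le> y \<Longrightarrow> occ_from n (\<sigma>(hi y := True)) = insert y (occ_from n \<sigma>)"
  by (auto simp: occ_from_def)

lemma above_occ_from:
  assumes "- int n \<le> y"
  shows "above (hi y) \<sigma> = (-1) ^ card {e \<in> occ_from n \<sigma>. y < e}"
proof -
  have "{z. hi y < z \<and> \<sigma> z} = hi ` {e \<in> occ_from n \<sigma>. y < e}"
  proof (rule Set.set_eqI, rule iffI)
    fix z assume z: "z \<in> {z. hi y < z \<and> \<sigma> z}"
    obtain m where "z = hi m" by (rule half_int_cases)
    then show "z \<in> hi ` {e \<in> occ_from n \<sigma>. y < e}" using z assms by (auto simp: occ_from_def)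
  qed (auto simp: occ_from_def)
  moreover have "inj_on hi {e \<in> occ_from n \<sigma>. y < e}" by (rule inj_onI) simp
  ultimately show ?thesis by (simp add: above_def card_image)
qed

text \<open>The left-hand side is the component, at a configuration with one particle too many, of a
  combination of creation operators applied to the vector with coefficients \<open>amp\<close>.
  Emptying the i-th largest site omits row i of a Jacobi-Trudi matrix and has Jordan-Wigner sign
  \<open>(-1)^i\<close>, so that \<open>sdet_column_relation\<close> applies. A window that is
  large enough exists as soon as one term is nonzero.\<close>

lemma amp_creation_relation:
  assumes u: "u < 0"
  shows "(\<Sum>\<^sub>\<infinity>k. complex_of_real (hcoef \<rho> k) * (if \<sigma> (hi (u + int k))
    then above (hi (u + int k)) \<sigma> * complex_of_real (amp \<rho> (\<sigma>(hi (u + int k) := False))) else 0)) = 0"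
    (is "(\<Sum>\<^sub>\<infinity>k. ?F k) = 0")
proof (cases "\<exists>k. ?F k \<noteq> 0")
  case False
  then show ?thesis by (simp only: simp_thms not_ex infsum_0_simp)
next
  case True
  then obtain k0 where k0: "\<sigma> (hi (u + int k0))" "amp \<rho> (\<sigma>(hi (u + int k0) := False)) \<noteq> 0"
    by (auto split: if_splits)
  define y where "y = u + int k0"
  obtain n0 where n0: "\<forall>n\<ge>n0. window n n (\<sigma>(hi y := False))"
    using amp_nonzero_window[OF k0(2)] unfolding y_def by blast
  \<comment> \<open>The window has to contain u and thereby all sites that occur in the sum.\<close>
  define n where "n = max n0 (nat (- u))"
  have nu: "- int n \<le> u" using u by (simp add: n_def)
  then have ny: "- int n \<le> y" by (simp add: y_def)
  let ?A = "occ_from n \<sigma>"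
  have w: "window n n (\<sigma>(hi y := False))" using n0 by (simp add: n_def)
  have yA: "y \<in> ?A" using k0(1) ny by (simp add: occ_from_def y_def)
  have fin: "finite (?A - {y})" "card (?A - {y}) = n"
    using w unfolding window_def occ_from_remove by blast+
  then have A1: "finite ?A" by simp
  have A: "finite ?A" "card ?A = Suc n" using A1 fin(2) card.remove[OF A1 yA] by simp_all
  have low: "\<sigma> (hi m)" if "m < - int n" for m
  proof -
    have "(\<sigma>(hi y := False)) (hi m)" using w that unfolding window_def by blast
    then show ?thesis using that ny by simp
  qed
  let ?x = "desc ?A"
  have entry: "above (hi (?x i)) \<sigma> * complex_of_real (amp \<rho> (\<sigma>(hi (?x i) := False)))
     = (-1) ^ i * complex_of_real (sdet \<rho> n (\<lambda>k. ?x (insert_index i k)))" if i: "i < Suc n" for i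
  proof -
    have xA: "?x i \<in> ?A" using desc_image[OF A(1)] A(2) i by auto
    then have ge: "- int n \<le> ?x i" by (simp add: occ_from_def)
    have "card {e \<in> ?A. ?x i < e} = i"
      using strict_sequence_rank[of "Suc n" ?x i] desc_strict[OF A(1)] desc_image[OF A(1)] A(2) i by simp
    then have 1: "above (hi (?x i)) \<sigma> = (-1) ^ i" using above_occ_from[OF ge, of \<sigma>] by simp
    have "window n n (\<sigma>(hi (?x i) := False))"
      unfolding window_def occ_from_remove
    proof (intro conjI allI impI)
      show "(\<sigma>(hi (?x i) := False)) (hi m)" if "m < - int n" for m using low[OF that] ge that by simp
      show "finite (?A - {?x i})" using A by simp
      show "card (?A - {?x i}) = n" using A xA by simp
    qed
    then have "amp \<rho> (\<sigma>(hi (?x i) := False)) = sdet \<rho> n (desc (?A - {?x i}))"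
      by (simp only: amp_window occ_from_remove)
    also have "\<dots> = sdet \<rho> n (\<lambda>k. ?x (insert_index i k))"
      by (rule sdet_cong) (rule desc_remove[OF A i])
    finally show ?thesis using 1 by simp
  qed
  let ?K = "{k. u + int k \<in> ?A}"
  have "finite ?K"
  proof (rule finite_subset)
    show "?K \<subseteq> (\<lambda>a. nat (a - u)) ` ?A"
    proof
      fix k assume "k \<in> ?K"
      moreover have "k = nat (u + int k - u)" by simp
      ultimately show "k \<in> (\<lambda>a. nat (a - u)) ` ?A" by blast
    qed
  qed (use A in simp)
  have "(\<Sum>\<^sub>\<infinity>k. ?F k) = (\<Sum>\<^sub>\<infinity>k\<in>?K. ?F k)"
    by (rule infsum_cong_neutral) (use nu in \<open>auto simp: occ_from_def\<close>)
  also have "\<dots> = (\<Sum>k\<in>?K. ?F k)" using \<open>finite ?K\<close> by simp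
  also have "\<dots> = (\<Sum>i\<in>{i. i < Suc n \<and> u \<le> ?x i}. complex_of_real (hcoef \<rho> (nat (?x i - u))) *
     (above (hi (?x i)) \<sigma> * complex_of_real (amp \<rho> (\<sigma>(hi (?x i) := False)))))"
  proof (rule sum.reindex_bij_witness[of _ "\<lambda>i. nat (?x i - u)" "\<lambda>k. card {e \<in> ?A. u + int k < e}"])
    fix k assume "k \<in> ?K"
    then have k: "u + int k \<in> ?A" by simp
    note r = desc_rank[OF A(1) k]
    show "nat (?x (card {e \<in> ?A. u + int k < e}) - u) = k" using r by simp
    show "card {e \<in> ?A. u + int k < e} \<in> {i. i < Suc n \<and> u \<le> ?x i}" using r A(2) by simp
    show "complex_of_real (hcoef \<rho> (nat (?x (card {e \<in> ?A. u + int k < e}) - u))) *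
      (above (hi (?x (card {e \<in> ?A. u + int k < e}))) \<sigma> *
       complex_of_real (amp \<rho> (\<sigma>(hi (?x (card {e \<in> ?A. u + int k < e})) := False)))) = ?F k"
      unfolding r(2) using k by (simp add: occ_from_def)
  next
    fix i assume "i \<in> {i. i < Suc n \<and> u \<le> ?x i}"
    then have i: "i < Suc n" "u \<le> ?x i" by auto
    have xA: "?x i \<in> ?A" using desc_image[OF A(1)] A(2) i by auto
    show "nat (?x i - u) \<in> ?K" using xA i by simp
    show "card {e \<in> ?A. u + int (nat (?x i - u)) < e} = i"
      using strict_sequence_rank[of "Suc n" ?x i] desc_strict[OF A(1)] desc_image[OF A(1)] A(2) i by simp
  qed
  also have "\<dots> = (\<Sum>i<Suc n. complex_of_real (zero_ext (hcoef \<rho>) (?x i - u)) *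
     (above (hi (?x i)) \<sigma> * complex_of_real (amp \<rho> (\<sigma>(hi (?x i) := False)))))"
    by (rule sum.mono_neutral_cong_left) (auto simp: zero_ext_def)
  also have "\<dots> = complex_of_real (\<Sum>i<Suc n. (-1) ^ i * zero_ext (hcoef \<rho>) (?x i - u) * sdet \<rho> n (\<lambda>k. ?x (insert_index i k)))"
    unfolding of_real_sum by (intro sum.cong refl) (simp add: entry)
  also have "\<dots> = 0" using sdet_column_relation[OF u nu, of \<rho> ?x] by simp
  finally show ?thesis .
qed

text \<open>Moving row p to the top crosses p rows.\<close>

lemma sdet_move_row:
  assumes p: "p < Suc n"
  shows "sdet \<rho> (Suc n) (case_nat (x p) (\<lambda>k. x (insert_index p k))) = (-1) ^ p * sdet \<rho> (Suc n) x"
proof -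
  let ?h = "zero_ext (hcoef \<rho>)"
  let ?M = "Matrix.mat (Suc n) (Suc n) (\<lambda>(i, j). ?h (case_nat (x p) (\<lambda>k. x (insert_index p k)) i + int j + 1))"
  let ?N = "Matrix.mat (Suc n) (Suc n) (\<lambda>(i, j). ?h (x i + int j + 1))"
  have minor: "mat_delete ?M 0 j = mat_delete ?N p j" for j
    by (rule eq_matI) (auto simp: mat_delete_def insert_index_def)
  have "Determinant.det ?M = (\<Sum>j<Suc n. ?M $$ (0, j) * cofactor ?M 0 j)"
    by (rule laplace_expansion_row) auto
  also have "\<dots> = (\<Sum>j<Suc n. (-1) ^ p * (?N $$ (p, j) * cofactor ?N p j))"
  proof (intro sum.cong refl)
    fix j assume "j \<in> {..<Suc n}"
    then have j: "j < Suc n" by simp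
    have "?M $$ (0, j) = ?N $$ (p, j)" using j p by simp
    moreover have "cofactor ?M 0 j = (-1) ^ p * cofactor ?N p j"
      by (simp add: cofactor_def minor power_add flip: power_mult_distrib mult.assoc)
    ultimately show "?M $$ (0, j) * cofactor ?M 0 j = (-1) ^ p * (?N $$ (p, j) * cofactor ?N p j)"
      by (simp only: mult.left_commute)
  qed
  also have "\<dots> = (-1) ^ p * Determinant.det ?N"
    unfolding sum_distrib_left[symmetric] by (subst laplace_expansion_row[of ?N "Suc n" p]) (use p in auto)
  finally show ?thesis by (simp add: sdet_def detf_def)
qed

text \<open>The companion relation at a configuration with one particle too few. Filling site m adds a row
  at m; putting that row on top costs exactly the Jordan-Wigner sign, and for a site that is
  already filled the determinant has two equal rows. Thus \<open>sdet_row_relation\<close>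
  applies.\<close>

lemma amp_annihilation_relation:
  assumes v: "0 \<le> v"
  shows "(\<Sum>\<^sub>\<infinity>k. complex_of_real (gcoef \<rho> k) * (if \<not> \<sigma> (hi (v - int k))
    then above (hi (v - int k)) \<sigma> * complex_of_real (amp \<rho> (\<sigma>(hi (v - int k) := True))) else 0)) = 0"
    (is "(\<Sum>\<^sub>\<infinity>k. ?F k) = 0")
proof (cases "\<exists>k. ?F k \<noteq> 0")
  case False
  then show ?thesis by (simp only: simp_thms not_ex infsum_0_simp)
next
  case True
  then obtain k0 where k0: "\<not> \<sigma> (hi (v - int k0))" "amp \<rho> (\<sigma>(hi (v - int k0) := True)) \<noteq> 0"
    by (auto split: if_splits)
  define y where "y = v - int k0"
  obtain n0 where n0: "\<forall>n\<ge>n0. window n n (\<sigma>(hi y := True))"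
    using amp_nonzero_window[OF k0(2)] unfolding y_def by blast
  \<comment> \<open>The window of size n + 1 has to contain y.\<close>
  define n where "n = max n0 (nat (- y))"
  have ny: "- int (Suc n) < y" by (simp add: n_def)
  let ?A = "occ_from (Suc n) \<sigma>"
  have w: "window (Suc n) (Suc n) (\<sigma>(hi y := True))" using n0 by (simp add: n_def)
  have yA: "y \<notin> ?A" using k0(1) by (simp add: occ_from_def y_def)
  have "occ_from (Suc n) (\<sigma>(hi y := True)) = insert y ?A" by (rule occ_from_insert) (use ny in simp)
  then have "finite (insert y ?A)" "card (insert y ?A) = Suc n"
    using w unfolding window_def by simp_all
  then have A: "finite ?A" "card ?A = n" using yA by simp_all
  have low: "\<sigma> (hi m)" if "m < - int (Suc n)" for m
  proof -
    have "(\<sigma>(hi y := True)) (hi m)" using w that unfolding window_def by blast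
    moreover have "m \<noteq> y" using that ny by simp
    ultimately show ?thesis by simp
  qed
  have entry: "(if \<not> \<sigma> (hi m) then above (hi m) \<sigma> * complex_of_real (amp \<rho> (\<sigma>(hi m := True))) else 0)
     = complex_of_real (sdet \<rho> (Suc n) (case_nat m (desc ?A)))" if m: "- int (Suc n) \<le> m" for m
  proof (cases "\<sigma> (hi m)")
    case True
    then have "m \<in> ?A" using m by (simp add: occ_from_def)
    then obtain i where i: "i < n" "m = desc ?A i" using desc_image[OF A(1)] A(2) by (auto simp: image_iff)
    have "sdet \<rho> (Suc n) (case_nat m (desc ?A)) = 0"
      unfolding sdet_def by (rule detf_equal_rows[of 0 _ "Suc i"]) (use i in auto)
    then show ?thesis using True by simp
  next
    case False
    let ?A' = "insert m ?A"
    have mA: "m \<notin> ?A" using False by (simp add: occ_from_def)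
    have A': "finite ?A'" "card ?A' = Suc n" using A mA by simp_all
    let ?p = "card {e \<in> ?A'. m < e}"
    have p: "?p < Suc n" "desc ?A' ?p = m" using desc_rank[of ?A' m] A' by simp_all
    have "{e \<in> ?A'. m < e} = {e \<in> ?A. m < e}" by auto
    then have 1: "above (hi m) \<sigma> = (-1) ^ ?p" using above_occ_from[OF m, of \<sigma>] by simp
    have o: "occ_from (Suc n) (\<sigma>(hi m := True)) = ?A'" by (rule occ_from_insert[OF m])
    have "window (Suc n) (Suc n) (\<sigma>(hi m := True))"
      unfolding window_def o
    proof (intro conjI allI impI)
      show "(\<sigma>(hi m := True)) (hi k)" if "k < - int (Suc n)" for k using low[OF that] by simp
    qed (use A' in simp_all)
    then have 2: "amp \<rho> (\<sigma>(hi m := True)) = sdet \<rho> (Suc n) (desc ?A')" by (simp only: amp_window o)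
    have "sdet \<rho> (Suc n) (case_nat m (desc ?A)) = sdet \<rho> (Suc n) (case_nat (desc ?A' ?p) (\<lambda>k. desc ?A' (insert_index ?p k)))"
    proof (rule sdet_cong)
      fix i assume i: "i < Suc n"
      have "?A' - {desc ?A' ?p} = ?A" using p mA by simp
      then show "case_nat m (desc ?A) i = case_nat (desc ?A' ?p) (\<lambda>k. desc ?A' (insert_index ?p k)) i"
        using desc_remove[OF A' p(1)] p(2) i by (cases i) simp_all
    qed
    also have "\<dots> = (-1) ^ ?p * sdet \<rho> (Suc n) (desc ?A')" by (rule sdet_move_row[OF p(1)])
    finally show ?thesis using False 1 2 by simp
  qed
  let ?K = "{..nat (v + int (Suc n))}"
  have "(\<Sum>\<^sub>\<infinity>k. ?F k) = (\<Sum>\<^sub>\<infinity>k\<in>?K. ?F k)"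
    by (rule infsum_cong_neutral) (use low v in auto)
  also have "\<dots> = (\<Sum>k\<in>?K. ?F k)" by simp
  also have "\<dots> = (\<Sum>m\<in>{- int (Suc n)..v}. complex_of_real (gcoef \<rho> (nat (v - m))) *
     (if \<not> \<sigma> (hi m) then above (hi m) \<sigma> * complex_of_real (amp \<rho> (\<sigma>(hi m := True))) else 0))"
    by (rule sum.reindex_bij_witness[of _ "\<lambda>m. nat (v - m)" "\<lambda>k. v - int k"]) (use v in auto)
  also have "\<dots> = complex_of_real (\<Sum>m\<in>{- int (Suc n)..v}. gcoef \<rho> (nat (v - m)) * sdet \<rho> (Suc n) (case_nat m (desc ?A)))"
    unfolding of_real_sum by (intro sum.cong refl) (simp only: of_real_mult entry atLeastAtMost_iff)
  also have "\<dots> = 0" using sdet_row_relation[OF v, of \<rho> n "desc ?A"] by simp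
  finally show ?thesis .
qed

section \<open>Schur measures\<close>

definition schur_norm :: "(nat \<Rightarrow> real) \<times> (nat \<Rightarrow> real) \<Rightarrow> real" where
  "schur_norm \<rho> = (\<Sum>\<^sub>\<infinity>\<mu>\<in>partitions. schur_weight \<rho> \<mu>)"

text \<open>Schur values are summable, hence bounded, hence square-summable.\<close>

lemma schur_weight_summable:
  assumes \<rho>: "\<rho> \<in> thoma_open"
  shows "schur_weight \<rho> summable_on partitions"
proof -
  obtain C where C: "\<And>L. finite L \<Longrightarrow> L \<subseteq> partitions \<Longrightarrow> (\<Sum>lam\<in>L. \<bar>schur_value \<rho> lam\<bar>) \<le> C"
    using schur_value_summable[OF \<rho>] by blast
  have le: "\<bar>schur_value \<rho> lam\<bar> \<le> C" if "lam \<in> partitions" for lam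
    using C[of "{lam}"] that by simp
  have "(\<Sum>lam\<in>L. schur_weight \<rho> lam) \<le> C * C" if L: "finite L" "L \<subseteq> partitions" for L
  proof -
    have "(\<Sum>lam\<in>L. schur_weight \<rho> lam) = (\<Sum>lam\<in>L. \<bar>schur_value \<rho> lam\<bar> * \<bar>schur_value \<rho> lam\<bar>)"
      by (intro sum.cong refl) (simp add: schur_weight_eq power2_eq_square)
    also have "\<dots> \<le> (\<Sum>lam\<in>L. C * \<bar>schur_value \<rho> lam\<bar>)"
      using L le by (intro sum_mono mult_right_mono) auto
    also have "\<dots> = C * (\<Sum>lam\<in>L. \<bar>schur_value \<rho> lam\<bar>)" by (simp add: sum_distrib_left)
    also have "\<dots> \<le> C * C" using C[OF L] C[of "{}"] by (intro mult_left_mono) auto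
    finally show ?thesis .
  qed
  then show ?thesis
    by (intro nonneg_bdd_above_summable_on bdd_aboveI2[of _ _ "C * C"]) (auto simp: schur_weight_eq)
qed

lemma empty_partition: "(\<lambda>_. 0) \<in> partitions" "schur_value \<rho> (\<lambda>_. 0) = 1"
proof -
  show "(\<lambda>_. 0) \<in> partitions" by (simp add: partitions_def decseq_def)
  show "schur_value \<rho> (\<lambda>_. 0) = 1"
    by (simp add: schur_value_def part_length_def sdet_def detf_def)
qed

lemma schur_norm_pos:
  assumes \<rho>: "\<rho> \<in> thoma_open"
  shows "1 \<le> schur_norm \<rho>"
proof -
  have "(\<Sum>lam\<in>{\<lambda>_. 0}. schur_weight \<rho> lam) \<le> schur_norm \<rho>"
    unfolding schur_norm_def
    by (rule finite_sum_le_infsum[OF schur_weight_summable[OF \<rho>]])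
      (auto simp: empty_partition schur_weight_eq)
  then show ?thesis by (simp add: schur_weight_eq empty_partition)
qed

definition decfg :: "config \<Rightarrow> half_int set" where
  "decfg \<sigma> = {x. (x < hi 0) \<noteq> \<sigma> x}"

lemma cfg_decfg [simp]: "cfg (decfg \<sigma>) = \<sigma>" "decfg (cfg S) = S"
  by (auto simp: cfg_def decfg_def fun_eq_iff)

text \<open>The square root of the mass of \<open>cfg S\<close>, linear in the Schur value because the
  latter is nonnegative.\<close>

definition root_mass :: "(nat \<Rightarrow> real) \<times> (nat \<Rightarrow> real) \<Rightarrow> half_int set \<Rightarrow> real" where
  "root_mass \<rho> S = amp \<rho> (cfg S) / sqrt (schur_norm \<rho>)"

text \<open>The configurations of charge 0.\<close>

abbreviation neutral :: "config set" where "neutral \<equiv> maya ` partitions"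

lemma root_mass_outside: "cfg S \<notin> neutral \<Longrightarrow> root_mass \<rho> S = 0"
  by (simp add: root_mass_def amp_def)

lemma bij_betw_decfg_maya: "bij_betw (\<lambda>lam. decfg (maya lam)) partitions (decfg ` neutral)"
  unfolding bij_betw_def
proof
  show "inj_on (\<lambda>lam. decfg (maya lam)) partitions"
    using maya_inj unfolding inj_on_def by (metis cfg_decfg(1))
qed (simp add: image_image)

lemma root_mass_nonneg: "\<rho> \<in> thoma_open \<Longrightarrow> 0 \<le> root_mass \<rho> S"
proof -
  assume \<rho>: "\<rho> \<in> thoma_open"
  then have T: "\<rho> \<in> thoma" by (auto simp: thoma_open_def)
  have "0 \<le> amp \<rho> (cfg S)"
  proof (cases "cfg S \<in> neutral")
    case True
    then obtain lam where "lam \<in> partitions" "cfg S = maya lam" by blast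
    then show ?thesis using schur_value_nonneg[OF T] by (simp add: amp_maya)
  qed (simp add: amp_def)
  then show ?thesis using schur_norm_pos[OF \<rho>] by (simp add: root_mass_def)
qed

lemma root_mass_maya:
  assumes "\<rho> \<in> thoma_open" "lam \<in> partitions"
  shows "(root_mass \<rho> (decfg (maya lam)))\<^sup>2 = schur_weight \<rho> lam / schur_norm \<rho>"
  using schur_norm_pos[OF assms(1)] assms(2)
  by (simp add: root_mass_def amp_maya power_divide schur_weight_eq)

lemma maya_measurable: "maya \<in> density (count_space partitions) f \<rightarrow>\<^sub>M borel"
  by (simp add: measurable_def)

lemma sets_schur_measure [simp]: "sets (schur_measure \<rho>) = sets borel" "space (schur_measure \<rho>) = UNIV"
  by (simp_all add: schur_measure_def)

lemma countable_half_int: "countable (UNIV :: half_int set)"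
  using countable_image[of "UNIV :: int set" hi] surj_hi by simp

lemma neutral_decfg_finite:
  assumes "\<sigma> \<in> neutral"
  shows "finite (decfg \<sigma>)"
proof -
  obtain lam where lam: "lam \<in> partitions" "\<sigma> = maya lam" using assms by blast
  have w: "window (part_length lam) (part_length lam) \<sigma>" unfolding lam(2) by (rule maya_window(1)[OF lam(1) order_refl])
  let ?n = "part_length lam"
  have "decfg \<sigma> \<subseteq> hi ` (occ_from ?n \<sigma> \<union> {- int ?n..<0})"
  proof
    fix x assume x: "x \<in> decfg \<sigma>"
    obtain m where m: "x = hi m" by (rule half_int_cases)
    have "\<not> m < - int ?n"
    proof
      assume "m < - int ?n"
      then have "\<sigma> (hi m)" "m < 0" using w by (auto simp: window_def)
      then show False using x m by (simp add: decfg_def)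
    qed
    then have "m \<in> occ_from ?n \<sigma> \<union> {- int ?n..<0}" using x m by (auto simp: decfg_def occ_from_def)
    then show "x \<in> hi ` (occ_from ?n \<sigma> \<union> {- int ?n..<0})" using m by blast
  qed
  then show ?thesis by (rule finite_subset) (use w in \<open>simp add: window_def\<close>)
qed

lemma countable_neutral: "countable neutral"
proof -
  have "neutral \<subseteq> cfg ` {S. finite S}"
  proof
    fix \<sigma> assume "\<sigma> \<in> neutral"
    then have "finite (decfg \<sigma>)" by (rule neutral_decfg_finite)
    then show "\<sigma> \<in> cfg ` {S. finite S}" by (intro image_eqI[of _ _ "decfg \<sigma>"]) simp_all
  qed
  moreover have "countable {S :: half_int set. finite S}"
    using countable_Collect_finite_subset[OF countable_half_int] by simp
  ultimately show ?thesis by (meson countable_image countable_subset)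
qed

lemma singleton_borel [simp]: "{\<sigma> :: config} \<in> sets borel"
proof -
  have "(\<lambda>\<tau> :: config. \<tau> x) -` {\<sigma> x} \<in> sets borel" for x
    by (intro borel_open open_vimage open_discrete continuous_on_product_coordinates)
  then have "(\<Inter>x. (\<lambda>\<tau> :: config. \<tau> x) -` {\<sigma> x}) \<in> sets borel"
    by (intro sets.countable_INT' countable_half_int) auto
  also have "(\<Inter>x. (\<lambda>\<tau> :: config. \<tau> x) -` {\<sigma> x}) = {\<sigma>}" by (auto simp: fun_eq_iff)
  finally show ?thesis .
qed

lemma emeasure_maya:
  assumes \<rho>: "\<rho> \<in> thoma_open" and lam: "lam \<in> partitions"
  shows "emeasure (schur_measure \<rho>) {maya lam} = ennreal ((root_mass \<rho> (decfg (maya lam)))\<^sup>2)"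
proof -
  let ?f = "\<lambda>lam. ennreal (schur_weight \<rho> lam / (\<Sum>\<^sub>\<infinity>\<mu>\<in>partitions. schur_weight \<rho> \<mu>))"
  have "emeasure (schur_measure \<rho>) {maya lam} = emeasure (density (count_space partitions) ?f) (maya -` {maya lam} \<inter> partitions)"
    unfolding schur_measure_def by (subst emeasure_distr[OF maya_measurable]) simp_all
  also have "maya -` {maya lam} \<inter> partitions = {lam}"
    using lam maya_inj by (auto dest: inj_onD)
  also have "emeasure (density (count_space partitions) ?f) {lam} = (\<integral>\<^sup>+ x. ?f x * indicator {lam} x \<partial>count_space partitions)"
    by (rule emeasure_density) (use lam in auto)
  also have "\<dots> = ?f lam * emeasure (count_space partitions) {lam}"
    by (rule nn_integral_indicator_singleton) (use lam in auto)
  also have "\<dots> = ?f lam" using lam by simp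
  finally show ?thesis using root_mass_maya[OF assms] by (simp add: schur_norm_def)
qed

lemma emeasure_outside:
  assumes \<rho>: "\<rho> \<in> thoma_open"
  shows "emeasure (schur_measure \<rho>) (- neutral) = 0"
proof -
  have "- neutral \<in> sets borel"
    using sets.countable[OF singleton_borel countable_neutral] by simp
  then have "emeasure (schur_measure \<rho>) (- neutral) =
    emeasure (density (count_space partitions) (\<lambda>lam. ennreal (schur_weight \<rho> lam / (\<Sum>\<^sub>\<infinity>\<mu>\<in>partitions. schur_weight \<rho> \<mu>)))) (maya -` (- neutral) \<inter> partitions)"
    unfolding schur_measure_def by (subst emeasure_distr[OF maya_measurable]) simp_all
  also have "maya -` (- neutral) \<inter> partitions = {}" by blast
  finally show ?thesis by simp
qed

lemma emeasure_config:
  assumes \<rho>: "\<rho> \<in> thoma_open"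
  shows "emeasure (schur_measure \<rho>) {\<sigma>} = ennreal ((root_mass \<rho> (decfg \<sigma>))\<^sup>2)"
proof (cases "\<sigma> \<in> neutral")
  case True
  then show ?thesis using emeasure_maya[OF \<rho>] by blast
next
  case False
  have "emeasure (schur_measure \<rho>) {\<sigma>} \<le> emeasure (schur_measure \<rho>) (- neutral)"
    by (rule emeasure_mono) (use False sets.countable[OF singleton_borel countable_neutral] in auto)
  then show ?thesis using emeasure_outside[OF \<rho>] root_mass_outside[of "decfg \<sigma>" \<rho>] False by simp
qed

lemma AE_schur_measure_iff:
  assumes \<rho>: "\<rho> \<in> thoma_open"
  shows "(AE \<sigma> in schur_measure \<rho>. Q \<sigma>) \<longleftrightarrow> (\<forall>S. root_mass \<rho> S \<noteq> 0 \<longrightarrow> Q (cfg S))"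
proof
  assume "AE \<sigma> in schur_measure \<rho>. Q \<sigma>"
  then obtain N where N: "{\<sigma>. \<not> Q \<sigma>} \<subseteq> N" "emeasure (schur_measure \<rho>) N = 0" "N \<in> sets (schur_measure \<rho>)"
    by (auto elim: AE_E)
  show "\<forall>S. root_mass \<rho> S \<noteq> 0 \<longrightarrow> Q (cfg S)"
  proof (intro allI impI, rule ccontr)
    fix S assume S: "root_mass \<rho> S \<noteq> 0" "\<not> Q (cfg S)"
    then have "{cfg S} \<subseteq> N" using N by blast
    then have "emeasure (schur_measure \<rho>) {cfg S} \<le> 0" using emeasure_mono[OF _ N(3)] N(2) by metis
    then show False using S emeasure_config[OF \<rho>, of "cfg S"] by simp
  qed
next
  assume Q: "\<forall>S. root_mass \<rho> S \<noteq> 0 \<longrightarrow> Q (cfg S)"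
  let ?N = "- neutral \<union> {\<sigma> \<in> neutral. root_mass \<rho> (decfg \<sigma>) = 0}"
  have 1: "- neutral \<in> null_sets (schur_measure \<rho>)"
    using emeasure_outside[OF \<rho>] sets.countable[OF singleton_borel countable_neutral] by auto
  have 2: "{\<sigma> \<in> neutral. root_mass \<rho> (decfg \<sigma>) = 0} \<in> null_sets (schur_measure \<rho>)"
  proof -
    have "(\<Union>\<sigma>\<in>{\<sigma> \<in> neutral. root_mass \<rho> (decfg \<sigma>) = 0}. {\<sigma>}) \<in> null_sets (schur_measure \<rho>)"
    proof (rule null_sets_UN')
      show "countable {\<sigma> \<in> neutral. root_mass \<rho> (decfg \<sigma>) = 0}"
        by (rule countable_subset[OF _ countable_neutral]) blast
      show "{\<sigma>} \<in> null_sets (schur_measure \<rho>)" if "\<sigma> \<in> {\<sigma> \<in> neutral. root_mass \<rho> (decfg \<sigma>) = 0}" for \<sigma>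
        using that emeasure_config[OF \<rho>, of \<sigma>] by (simp add: null_sets_def)
    qed
    then show ?thesis by simp
  qed
  show "AE \<sigma> in schur_measure \<rho>. Q \<sigma>"
  proof (rule AE_I'[OF null_sets.Un[OF 1 2]])
    show "{\<sigma> \<in> space (schur_measure \<rho>). \<not> Q \<sigma>} \<subseteq> ?N"
    proof
      fix \<sigma> assume "\<sigma> \<in> {\<sigma> \<in> space (schur_measure \<rho>). \<not> Q \<sigma>}"
      then have "root_mass \<rho> (decfg \<sigma>) = 0" using Q[rule_format, of "decfg \<sigma>"] by auto
      then show "\<sigma> \<in> ?N" by simp
    qed
  qed
qed

lemma integral_schur_measure:
  fixes f :: "config \<Rightarrow> 'b::{banach, second_countable_topology}"
  assumes \<rho>: "\<rho> \<in> thoma_open" and f: "f \<in> borel_measurable borel"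
  shows "integrable (schur_measure \<rho>) f \<longleftrightarrow> (\<lambda>S. norm ((root_mass \<rho> S)\<^sup>2 *\<^sub>R f (cfg S))) summable_on UNIV"
    and "integrable (schur_measure \<rho>) f \<Longrightarrow>
      integral\<^sup>L (schur_measure \<rho>) f = (\<Sum>\<^sub>\<infinity>S. (root_mass \<rho> S)\<^sup>2 *\<^sub>R f (cfg S))"
proof -
  let ?p = "\<lambda>lam. schur_weight \<rho> lam / (\<Sum>\<^sub>\<infinity>\<mu>\<in>partitions. schur_weight \<rho> \<mu>)"
  let ?g = "\<lambda>lam. ?p lam *\<^sub>R f (maya lam)"
  let ?G = "\<lambda>S. (root_mass \<rho> S)\<^sup>2 *\<^sub>R f (cfg S)"
  have p: "AE lam in count_space partitions. 0 \<le> ?p lam"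
    using schur_norm_pos[OF \<rho>] by (auto simp: AE_count_space schur_weight_eq schur_norm_def)
  have i1: "integrable (schur_measure \<rho>) f \<longleftrightarrow> integrable (count_space partitions) ?g"
    unfolding schur_measure_def
    by (subst integrable_distr_eq[OF maya_measurable f], subst integrable_density) (use p in auto)
  have i2: "integral\<^sup>L (schur_measure \<rho>) f = integral\<^sup>L (count_space partitions) ?g"
    unfolding schur_measure_def
    by (subst integral_distr[OF maya_measurable f], subst integral_density) (use p in auto)
  note bij = bij_betw_decfg_maya
  have G: "?g lam = ?G (decfg (maya lam))" if "lam \<in> partitions" for lam
    using root_mass_maya[OF \<rho> that] by (simp add: schur_norm_def)
  have out: "?G S = 0" if "S \<notin> decfg ` neutral" for S
    using that root_mass_outside[of S] by (metis cfg_decfg(2) image_eqI power_zero_numeral scaleR_zero_left)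
  have "Infinite_Set_Sum.abs_summable_on ?g partitions \<longleftrightarrow> (\<lambda>lam. norm (?g lam)) summable_on partitions"
    by (rule abs_summable_equivalent[symmetric])
  also have "\<dots> \<longleftrightarrow> (\<lambda>lam. norm (?G (decfg (maya lam)))) summable_on partitions"
    by (rule summable_on_cong) (simp only: G)
  also have "\<dots> \<longleftrightarrow> (\<lambda>S. norm (?G S)) summable_on decfg ` neutral"
    by (rule summable_on_reindex_bij_betw[OF bij])
  also have "\<dots> \<longleftrightarrow> (\<lambda>S. norm (?G S)) summable_on UNIV"
    by (rule summable_on_cong_neutral) (use out in auto)
  finally have s: "Infinite_Set_Sum.abs_summable_on ?g partitions \<longleftrightarrow> (\<lambda>S. norm (?G S)) summable_on UNIV" .
  then show "integrable (schur_measure \<rho>) f \<longleftrightarrow> (\<lambda>S. norm (?G S)) summable_on UNIV"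
    unfolding i1 by (simp only: Infinite_Set_Sum.abs_summable_on_def)
  assume "integrable (schur_measure \<rho>) f"
  then have a: "Infinite_Set_Sum.abs_summable_on ?g partitions"
    unfolding i1 by (simp only: Infinite_Set_Sum.abs_summable_on_def)
  have "integral\<^sup>L (schur_measure \<rho>) f = infsetsum ?g partitions" unfolding i2 infsetsum_def ..
  also have "\<dots> = (\<Sum>\<^sub>\<infinity>lam\<in>partitions. ?g lam)" by (rule infsetsum_infsum[OF a])
  also have "\<dots> = (\<Sum>\<^sub>\<infinity>lam\<in>partitions. ?G (decfg (maya lam)))" by (rule infsum_cong) (rule G)
  also have "\<dots> = infsum ?G (decfg ` neutral)" by (rule infsum_reindex_bij_betw[OF bij])
  also have "\<dots> = infsum ?G UNIV" by (rule infsum_cong_neutral) (use out in auto)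
  finally show "integral\<^sup>L (schur_measure \<rho>) f = infsum ?G UNIV" .
qed

lemma root_mass_unit_vector:
  assumes \<rho>: "\<rho> \<in> thoma_open"
  shows "sqs (\<lambda>S. complex_of_real (root_mass \<rho> S))" "sqnorm (\<lambda>S. complex_of_real (root_mass \<rho> S)) = 1"
proof -
  let ?G = "\<lambda>S. (root_mass \<rho> S)\<^sup>2"
  note bij = bij_betw_decfg_maya
  have out: "?G S = 0" if "S \<notin> decfg ` neutral" for S
    using that root_mass_outside[of S] by (metis cfg_decfg(2) image_eqI power_zero_numeral)
  have s: "(\<lambda>lam. schur_weight \<rho> lam / schur_norm \<rho>) summable_on partitions"
    using summable_on_cmult_left[OF schur_weight_summable[OF \<rho>], of "1 / schur_norm \<rho>"] by simp
  have "(\<lambda>lam. schur_weight \<rho> lam / schur_norm \<rho>) summable_on partitions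
      \<longleftrightarrow> (\<lambda>lam. ?G (decfg (maya lam))) summable_on partitions"
    by (rule summable_on_cong) (simp only: root_mass_maya[OF \<rho>])
  also have "\<dots> \<longleftrightarrow> ?G summable_on decfg ` neutral" by (rule summable_on_reindex_bij_betw[OF bij])
  also have "\<dots> \<longleftrightarrow> ?G summable_on UNIV" by (rule summable_on_cong_neutral) (use out in auto)
  finally show "sqs (\<lambda>S. complex_of_real (root_mass \<rho> S))" using s by (simp add: sqs_def)
  have "1 = schur_norm \<rho> / schur_norm \<rho>" using schur_norm_pos[OF \<rho>] by simp
  also have "\<dots> = (\<Sum>\<^sub>\<infinity>lam\<in>partitions. schur_weight \<rho> lam * (1 / schur_norm \<rho>))"
    by (subst infsum_cmult_left) (simp_all add: schur_weight_summable[OF \<rho>] schur_norm_def)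
  also have "\<dots> = (\<Sum>\<^sub>\<infinity>lam\<in>partitions. ?G (decfg (maya lam)))"
    by (rule infsum_cong) (simp add: root_mass_maya[OF \<rho>])
  also have "\<dots> = infsum ?G (decfg ` neutral)" by (rule infsum_reindex_bij_betw[OF bij])
  also have "\<dots> = infsum ?G UNIV" by (rule infsum_cong_neutral) (use out in auto)
  finally show "sqnorm (\<lambda>S. complex_of_real (root_mass \<rho> S)) = 1" by (simp add: sqnorm_def)
qed

lemma sigma_finite_schur_measure:
  assumes \<rho>: "\<rho> \<in> thoma_open"
  shows "sigma_finite_measure (schur_measure \<rho>)"
proof -
  have "integrable (schur_measure \<rho>) (\<lambda>_. 1 :: real)"
    using root_mass_unit_vector(1)[OF \<rho>]
    by (subst integral_schur_measure(1)[OF \<rho>]) (simp_all add: sqs_def)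
  then have "emeasure (schur_measure \<rho>) (space (schur_measure \<rho>)) < \<infinity>"
    by (simp add: integrable_iff_bounded)
  then have "finite_measure (schur_measure \<rho>)" by (intro finite_measureI) auto
  then show ?thesis by (simp add: finite_measure_def)
qed

section \<open>Quasi-invariance\<close>

abbreviation swap :: "half_int \<Rightarrow> half_int \<Rightarrow> half_int \<Rightarrow> half_int" where
  "swap x y \<equiv> Transposition.transpose x y"

lemma act_swap: "act (swap x y) \<sigma> = (\<lambda>z. \<sigma> (swap x y z))"
  by (simp add: act_def)

lemma act_swap_involution [simp]: "act (swap x y) (act (swap x y) \<sigma>) = \<sigma>"
  by (simp add: act_swap)

lemma swap_finite_perms: "swap x y \<in> finite_perms"
proof -
  have "{z. swap x y z \<noteq> z} \<subseteq> {x, y}" by (auto simp: Transposition.transpose_def split: if_splits)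
  then show ?thesis by (auto simp: finite_perms_def intro: finite_subset)
qed

lemma act_measurable: "act g \<in> borel \<rightarrow>\<^sub>M borel"
proof (rule borel_measurable_continuous_onI)
  show "continuous_on UNIV (act g)"
    unfolding act_def
    by (rule continuous_on_coordinatewise_then_product) (rule continuous_on_product_coordinates)
qed

lemma emeasure_translate:
  "emeasure (translate (swap x y) (schur_measure \<rho>)) {\<sigma>} = emeasure (schur_measure \<rho>) {act (swap x y) \<sigma>}"
proof -
  have "act (swap x y) \<in> schur_measure \<rho> \<rightarrow>\<^sub>M borel"
    using act_measurable[of "swap x y"] by (simp add: measurable_def)
  moreover have "act (swap x y) -` {\<sigma>} = {act (swap x y) \<sigma>}" by force
  ultimately show ?thesis unfolding translate_def by (simp add: emeasure_distr)
qed

lemma root_mass_swap_pos: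
  assumes \<rho>: "\<rho> \<in> thoma_open" and q: "quasi_invariant (schur_measure \<rho>)"
    and pos: "root_mass \<rho> (decfg (act (swap x y) \<sigma>)) \<noteq> 0"
  shows "root_mass \<rho> (decfg \<sigma>) \<noteq> 0"
proof
  assume "root_mass \<rho> (decfg \<sigma>) = 0"
  then have "emeasure (schur_measure \<rho>) {\<sigma>} = 0" by (simp add: emeasure_config[OF \<rho>])
  then have "{\<sigma>} \<in> null_sets (schur_measure \<rho>)" by (simp add: null_sets_def)
  then have "{\<sigma>} \<in> null_sets (translate (swap x y) (schur_measure \<rho>))"
    using q swap_finite_perms unfolding quasi_invariant_def absolutely_continuous_def by blast
  then have "emeasure (schur_measure \<rho>) {act (swap x y) \<sigma>} = 0"
    using emeasure_translate[of x y \<rho> \<sigma>] by (simp add: null_sets_def)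
  then show False using pos by (simp add: emeasure_config[OF \<rho>])
qed

text \<open>Quasi-invariance transports positivity of mass along transpositions. Exchanging a filled site
  outside \<open>{- n..<0}\<close> with an empty site inside reduces the number of the former, and
  the Dirac sea, in which there is none, has positive mass.\<close>

lemma root_mass_pos:
  assumes \<rho>: "\<rho> \<in> thoma_open" and q: "quasi_invariant (schur_measure \<rho>)" and "\<sigma> \<in> neutral"
  shows "root_mass \<rho> (decfg \<sigma>) \<noteq> 0"
proof -
  obtain lam where lam: "lam \<in> partitions" "\<sigma> = maya lam" using assms(3) by blast
  define n where "n = part_length lam"
  let ?V = "{- int n..<0}"
  have "root_mass \<rho> (decfg \<tau>) \<noteq> 0" if "window n n \<tau>" for \<tau>
    using that
  proof (induction "card (occ_from n \<tau> - ?V)" arbitrary: \<tau> rule: less_induct)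
    case (less \<tau>)
    let ?A = "occ_from n \<tau>"
    have A: "finite ?A" "card ?A = n" using less.prems by (auto simp: window_def)
    have V: "card ?V = n" by simp
    show ?case
    proof (cases "?A = ?V")
      case True
      have "\<tau> = maya (\<lambda>_. 0)"
      proof
        fix x
        obtain m where x: "x = hi m" by (rule half_int_cases)
        have "\<tau> (hi m) \<longleftrightarrow> m < 0"
        proof (cases "m < - int n")
          case True
          then have "\<tau> (hi m)" "m < 0" using less.prems unfolding window_def by simp_all
          then show ?thesis by simp
        next
          case False
          then have "\<tau> (hi m) \<longleftrightarrow> m \<in> ?A" by (simp add: occ_from_def)
          then show ?thesis using \<open>?A = ?V\<close> False by simp
        qed
        also have "m < 0 \<longleftrightarrow> (\<exists>i. m = part_sites (\<lambda>_. 0) i)"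
        proof
          assume "m < 0"
          then have "m = part_sites (\<lambda>_. 0) (nat (- m - 1))" by (simp add: part_sites_def)
          then show "\<exists>i. m = part_sites (\<lambda>_. 0) i" ..
        qed (auto simp: part_sites_def)
        finally show "\<tau> x = maya (\<lambda>_. 0) x" by (simp add: x maya_hi)
      qed
      then have "(root_mass \<rho> (decfg \<tau>))\<^sup>2 = 1 / schur_norm \<rho>"
        using root_mass_maya[OF \<rho> empty_partition(1)] by (simp add: schur_weight_eq empty_partition)
      moreover have "1 / schur_norm \<rho> \<noteq> 0" using schur_norm_pos[OF \<rho>] by simp
      ultimately show ?thesis by (metis zero_power2)
    next
      case False
      have "\<not> ?A \<subseteq> ?V"
      proof
        assume "?A \<subseteq> ?V"
        then have "?A = ?V" by (rule card_subset_eq[rotated]) (simp_all only: finite_atLeastLessThan_int A(2) V)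
        then show False using False by blast
      qed
      then obtain a where a: "a \<in> ?A" "a \<notin> ?V" by blast
      have "\<not> ?V \<subseteq> ?A"
      proof
        assume "?V \<subseteq> ?A"
        then have "?V = ?A" by (rule card_subset_eq[OF A(1)]) (simp only: A(2) V)
        then show False using False by blast
      qed
      then obtain c where c: "c \<in> ?V" "c \<notin> ?A" by blast
      let ?\<tau>' = "act (swap (hi a) (hi c)) \<tau>"
      have ac: "\<tau> (hi a)" "\<not> \<tau> (hi c)" "- int n \<le> a" "- int n \<le> c" "a \<noteq> c"
        using a c by (auto simp: occ_from_def)
      have val: "?\<tau>' (hi m) = (if m = a then False else if m = c then True else \<tau> (hi m))" for m
        using ac by (simp add: act_swap Transposition.transpose_def)
      have o: "occ_from n ?\<tau>' = insert c (?A - {a})"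
        using ac by (auto simp: occ_from_def val split: if_splits)
      have "Suc (card (?A - {a})) = n" using card.remove[OF A(1) a(1)] A(2) by simp
      then have card: "card (insert c (?A - {a})) = n" using A(1) c(2) by simp
      have w: "window n n ?\<tau>'"
        unfolding window_def o
      proof (intro conjI allI impI)
        show "?\<tau>' (hi m)" if m: "m < - int n" for m
        proof -
          have "m \<noteq> a" "\<tau> (hi m)" using m ac(3) less.prems unfolding window_def by auto
          then show ?thesis by (simp add: val)
        qed
      qed (use A card in simp_all)
      have sub: "occ_from n ?\<tau>' - ?V \<subset> ?A - ?V" 
      proof (rule psubsetI)
        show "occ_from n ?\<tau>' - ?V \<subseteq> ?A - ?V" unfolding o using c(1) by auto
        have "a \<in> ?A - ?V" "a \<notin> occ_from n ?\<tau>' - ?V" unfolding o using a ac(5) by auto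
        then show "occ_from n ?\<tau>' - ?V \<noteq> ?A - ?V" by metis
      qed
      have "card (occ_from n ?\<tau>' - ?V) < card (?A - ?V)"
        by (rule psubset_card_mono[OF _ sub]) (use A in simp)
      then have "root_mass \<rho> (decfg ?\<tau>') \<noteq> 0" using w by (rule less.hyps)
      then show ?thesis by (rule root_mass_swap_pos[OF \<rho> q])
    qed
  qed
  then show ?thesis using maya_window(1)[OF lam(1), of n] lam by (simp add: n_def)
qed

text \<open>At an atom, the density of one measure with respect to another is the quotient of masses.\<close>

lemma RN_deriv_swap:
  assumes \<rho>: "\<rho> \<in> thoma_open" and q: "quasi_invariant (schur_measure \<rho>)" and S: "root_mass \<rho> S \<noteq> 0"
  shows "sqrt (enn2real (RN_deriv (schur_measure \<rho>) (translate (swap x y) (schur_measure \<rho>)) (cfg S)))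
    = root_mass \<rho> (decfg (act (swap x y) (cfg S))) / root_mass \<rho> S"
proof -
  let ?M = "schur_measure \<rho>" and ?N = "translate (swap x y) (schur_measure \<rho>)"
  let ?r = "RN_deriv ?M ?N"
  interpret sigma_finite_measure ?M by (rule sigma_finite_schur_measure[OF \<rho>])
  have ac: "absolutely_continuous ?M ?N" using q swap_finite_perms by (simp add: quasi_invariant_def)
  have d: "density ?M ?r = ?N"
    by (rule density_RN_deriv[OF ac]) (simp add: translate_def)
  have "emeasure ?N {cfg S} = (\<integral>\<^sup>+ x. ?r x * indicator {cfg S} x \<partial>?M)"
    by (subst d[symmetric], rule emeasure_density) auto
  also have "\<dots> = ?r (cfg S) * emeasure ?M {cfg S}"
    by (rule nn_integral_indicator_singleton) auto
  finally have eq: "ennreal ((root_mass \<rho> (decfg (act (swap x y) (cfg S))))\<^sup>2) = ?r (cfg S) * ennreal ((root_mass \<rho> S)\<^sup>2)"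
    by (simp add: emeasure_translate emeasure_config[OF \<rho>])
  have "(root_mass \<rho> (decfg (act (swap x y) (cfg S))))\<^sup>2 = enn2real (?r (cfg S)) * (root_mass \<rho> S)\<^sup>2"
    using arg_cong[OF eq, of enn2real] by (simp add: enn2real_mult)
  then have "enn2real (?r (cfg S)) = (root_mass \<rho> (decfg (act (swap x y) (cfg S))) / root_mass \<rho> S)\<^sup>2"
    using S by (simp add: field_simps power_divide)
  then show ?thesis using root_mass_nonneg[OF \<rho>] by simp
qed

section \<open>The representation on the Schur measure\<close>

text \<open>Moving a particle keeps the number of filled sites in a window that contains both places.\<close>

lemma neutral_move:
  assumes "\<sigma> \<in> neutral" "\<sigma> y" "\<not> (\<sigma>(y := False)) x"
  shows "(\<sigma>(y := False))(x := True) \<in> neutral"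
proof -
  obtain lam where lam: "lam \<in> partitions" "\<sigma> = maya lam" using assms(1) by blast
  obtain a where a: "x = hi a" by (rule half_int_cases)
  obtain b where b: "y = hi b" by (rule half_int_cases)
  define n where "n = part_length lam + nat (- a) + nat (- b)"
  have n: "part_length lam \<le> n" "- int n \<le> a" "- int n \<le> b" by (auto simp: n_def)
  let ?A = "occ_from n \<sigma>" and ?\<tau> = "(\<sigma>(y := False))(x := True)"
  have w: "window n n \<sigma>" unfolding lam(2) by (rule maya_window(1)[OF lam(1) n(1)])
  have A: "finite ?A" "card ?A = n" using w by (simp_all add: window_def)
  have bA: "b \<in> ?A" using assms(2) n b by (simp add: occ_from_def)
  have aA: "a \<notin> ?A - {b}" using assms(3) a b by (auto simp: occ_from_def split: if_splits)
  have o: "occ_from n ?\<tau> = insert a (?A - {b})"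
    unfolding a b using n occ_from_insert[of n a "\<sigma>(hi b := False)"] by (simp add: occ_from_remove)
  have "Suc (card (?A - {b})) = n" using card.remove[OF A(1) bA] A(2) by simp
  then have card: "card (insert a (?A - {b})) = n" using A(1) aA by simp
  have "window n n ?\<tau>"
    unfolding window_def o
  proof (intro conjI allI impI)
    show "?\<tau> (hi m)" if m: "m < - int n" for m
    proof -
      have "m \<noteq> b" "\<sigma> (hi m)" using m n(3) w unfolding window_def by auto
      then show ?thesis using b by simp
    qed
  qed (use A card in simp_all)
  then show ?thesis using window_maya by blast
qed

locale schur_car = car B for B :: "(half_int \<Rightarrow> complex) \<times> (half_int \<Rightarrow> complex) \<Rightarrow> 'c::cstar_algebra" +
  fixes \<rho> :: "(nat \<Rightarrow> real) \<times> (nat \<Rightarrow> real)"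
  assumes \<rho>: "\<rho> \<in> thoma_open" and quasi: "quasi_invariant (schur_measure \<rho>)"
begin

abbreviation M :: "config measure" where "M \<equiv> schur_measure \<rho>"
abbreviation r :: "half_int set \<Rightarrow> real" where "r \<equiv> root_mass \<rho>"
abbreviation Psi :: "half_int set \<Rightarrow> complex" where "Psi \<equiv> \<lambda>S. complex_of_real (r S)"

lemma r_neutral: "r S \<noteq> 0 \<longleftrightarrow> cfg S \<in> neutral"
  using root_mass_pos[OF \<rho> quasi, of "cfg S"] root_mass_outside[of S \<rho>] by auto

lemma r_finite: "r S \<noteq> 0 \<Longrightarrow> finite S"
  using neutral_decfg_finite[of "cfg S"] by (simp add: r_neutral)

lemma Psi_sqs: "sqs Psi" and Psi_norm: "sqnorm Psi = 1"
  using root_mass_unit_vector[OF \<rho>] by simp_all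

text \<open>Multiplication by the root of the mass identifies square-integrable functions with the
  square-summable families supported on neutral configurations.\<close>

definition vec :: "(config \<Rightarrow> complex) \<Rightarrow> half_int set \<Rightarrow> complex" where
  "vec h S = h (cfg S) * Psi S"

lemma L2_iff: "h \<in> L2 M \<longleftrightarrow> h \<in> borel_measurable borel \<and> sqs (vec h)"
proof -
  have "h \<in> borel_measurable M \<longleftrightarrow> h \<in> borel_measurable borel" 
    using measurable_cong_sets[of M borel borel "borel :: complex measure"] by simp
  moreover have "integrable M (\<lambda>\<sigma>. (cmod (h \<sigma>))\<^sup>2) \<longleftrightarrow> sqs (vec h)" if "h \<in> borel_measurable borel"
  proof -
    have "integrable M (\<lambda>\<sigma>. (cmod (h \<sigma>))\<^sup>2) \<longleftrightarrow> (\<lambda>S. norm ((r S)\<^sup>2 *\<^sub>R (cmod (h (cfg S)))\<^sup>2)) summable_on UNIV"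
      by (rule integral_schur_measure(1)[OF \<rho>]) (use that in measurable)
    also have "(\<lambda>S. norm ((r S)\<^sup>2 *\<^sub>R (cmod (h (cfg S)))\<^sup>2)) = (\<lambda>S. (cmod (vec h S))\<^sup>2)"
      by (simp add: vec_def norm_mult power_mult_distrib mult.commute fun_eq_iff)
    finally show ?thesis by (simp add: sqs_def)
  qed
  ultimately show ?thesis by (auto simp: L2_def)
qed

lemma L2_norm_vec:
  assumes "h \<in> L2 M"
  shows "L2_norm M h = sqrt (sqnorm (vec h))"
proof -
  have h: "h \<in> borel_measurable borel" "integrable M (\<lambda>\<sigma>. (cmod (h \<sigma>))\<^sup>2)"
    using assms L2_iff by (auto simp: L2_def)
  have "(LINT \<sigma>|M. (cmod (h \<sigma>))\<^sup>2) = (\<Sum>\<^sub>\<infinity>S. (r S)\<^sup>2 *\<^sub>R (cmod (h (cfg S)))\<^sup>2)"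
    by (rule integral_schur_measure(2)[OF \<rho> _ h(2)]) (use h(1) in measurable)
  also have "\<dots> = sqnorm (vec h)"
    by (simp add: sqnorm_def vec_def norm_mult power_mult_distrib mult.commute)
  finally show ?thesis by (simp add: L2_norm_def)
qed

lemma L2_inner_vec:
  assumes "h \<in> L2 M" "k \<in> L2 M"
  shows "L2_inner M h k = ip (vec h) (vec k)"
proof -
  have h: "h \<in> borel_measurable borel" "sqs (vec h)" and k: "k \<in> borel_measurable borel" "sqs (vec k)"
    using assms L2_iff by auto
  have eq: "(r S)\<^sup>2 *\<^sub>R (cnj (h (cfg S)) * k (cfg S)) = cnj (vec h S) * vec k S" for S
    by (simp add: vec_def scaleR_conv_of_real power2_eq_square mult_ac)
  have m: "(\<lambda>\<sigma>. cnj (h \<sigma>) * k \<sigma>) \<in> borel_measurable borel" 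
    by (intro borel_measurable_times borel_measurable_continuous_on[OF continuous_on_cnj[OF continuous_on_id] h(1)] k(1))
  have "integrable M (\<lambda>\<sigma>. cnj (h \<sigma>) * k \<sigma>)"
    unfolding integral_schur_measure(1)[OF \<rho> m] eq
    using sqs_mult_summable[of "\<lambda>S. cnj (vec h S)" "vec k"] h k by simp
  then have "L2_inner M h k = (\<Sum>\<^sub>\<infinity>S. (r S)\<^sup>2 *\<^sub>R (cnj (h (cfg S)) * k (cfg S)))"
    unfolding L2_inner_def by (rule integral_schur_measure(2)[OF \<rho> m])
  then show ?thesis unfolding eq ip_def .
qed

lemma L2_eq_vec: "L2_eq M h k \<longleftrightarrow> vec h = vec k"
  unfolding L2_eq_def AE_schur_measure_iff[OF \<rho>] by (auto simp: vec_def fun_eq_iff)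

text \<open>The Fock representation transported to functions. Off the atoms the value 0 is a choice within
  an almost everywhere class.\<close>

definition rep :: "'c \<Rightarrow> (config \<Rightarrow> complex) \<Rightarrow> config \<Rightarrow> complex" where
  "rep a h \<sigma> = (if r (decfg \<sigma>) \<noteq> 0 then op a (vec h) (decfg \<sigma>) / Psi (decfg \<sigma>) else 0)"

lemma vec_rep: "vec (rep a h) S = (if r S \<noteq> 0 then op a (vec h) S else 0)"
  by (simp add: vec_def rep_def)

lemma rep_L2: "h \<in> L2 M \<Longrightarrow> rep a h \<in> L2 M"
proof -
  assume h: "h \<in> L2 M"
  have "rep a h \<in> borel_measurable borel"
  proof (rule measurable_discrete_difference[OF _ countable_neutral])
    show "(\<lambda>_. 0) \<in> borel_measurable borel" by simp
    show "0 = rep a h \<sigma>" if "\<sigma> \<notin> neutral" for \<sigma>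
      using that r_neutral[of "decfg \<sigma>"] by (simp add: rep_def)
  qed simp_all
  moreover have "sqs (vec (rep a h))"
    using sqs_restrict[OF op_sqs, of "vec h" "\<lambda>S. r S \<noteq> 0" a] h by (simp add: L2_iff vec_rep[abs_def])
  ultimately show ?thesis by (simp add: L2_iff)
qed

text \<open>Since all neutral configurations have positive mass, the support of \<open>r\<close> is the
  charge 0 sector.\<close>

definition charge_preserving :: "'c set" where
  "charge_preserving = {a. \<forall>S T. r T \<noteq> 0 \<longrightarrow> r S = 0 \<longrightarrow> melem a S T = 0}"

lemma charge_preserving_algebra: "is_closed_subalgebra charge_preserving"
  unfolding is_closed_subalgebra_def
proof (intro conjI ballI allI)
  show "closed charge_preserving"
  proof (unfold closed_sequential_limits, intro allI impI)
    fix s a assume s: "(\<forall>n. s n \<in> charge_preserving) \<and> s \<longlonglongrightarrow> a"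
    show "a \<in> charge_preserving"
      unfolding charge_preserving_def
    proof (intro CollectI allI impI)
      fix S T assume ST: "r T \<noteq> 0" "r S = 0"
      have "cmod (melem a S T) \<le> norm (a - s n)" for n
      proof -
        have "melem (s n) S T = 0" using s ST by (simp add: charge_preserving_def)
        then have "melem a S T = melem (a - s n) S T" by (simp add: melem_diff)
        then show ?thesis using melem_bound[of "a - s n" S T] by simp
      qed
      moreover have "(\<lambda>n. norm (a - s n)) \<longlonglongrightarrow> norm (a - a)" using s by (intro tendsto_intros) simp
      ultimately have "cmod (melem a S T) \<le> norm (a - a)" by (intro LIMSEQ_le_const) auto
      then show "melem a S T = 0" by simp
    qed
  qed
  show "1 \<in> charge_preserving"
    unfolding charge_preserving_def
  proof (intro CollectI allI impI)
    fix S T assume "r T \<noteq> 0" "r S = 0"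
    then show "melem 1 S T = 0" using melem_one[OF r_finite, of T S] by auto
  qed
  fix a c assume ac: "a \<in> charge_preserving" "c \<in> charge_preserving"
  show "a + c \<in> charge_preserving" using ac by (simp add: charge_preserving_def melem_add)
  show "a * c \<in> charge_preserving"
    unfolding charge_preserving_def
  proof (intro CollectI allI impI)
    fix S T assume ST: "r T \<noteq> 0" "r S = 0"
    have "melem a S R * melem c R T = 0" for R
    proof (cases "r R = 0")
      case True
      then show ?thesis using ac(2) ST(1) by (simp add: charge_preserving_def)
    next
      case False
      then show ?thesis using ac(1) ST(2) by (simp add: charge_preserving_def)
    qed
    then show "melem (a * c) S T = 0" unfolding melem_mult by (simp only: infsum_0_simp)
  qed
next
  fix a z assume "a \<in> charge_preserving"
  then show "z *\<^sub>C a \<in> charge_preserving" by (simp add: charge_preserving_def melem_scaleC)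
qed

lemma hop_charge_preserving: "cre B x * ann B y \<in> charge_preserving"
  unfolding charge_preserving_def
proof (intro CollectI allI impI)
  fix S T assume ST: "r T \<noteq> 0" "r S = 0"
  have "melem (cre B x) S R * melem (ann B y) R T = 0" for R
  proof (rule ccontr)
    assume "melem (cre B x) S R * melem (ann B y) R T \<noteq> 0"
    then have c: "\<not> cfg R x" "S = flip R x" "cfg T y" "R = flip T y"
      by (auto simp: melem_cre melem_ann split: if_splits)
    have R: "cfg R = (cfg T)(y := False)" using c(3,4) by (simp add: cfg_flip)
    have S: "cfg S = (cfg R)(x := True)" using c(1,2) by (simp add: cfg_flip)
    have "cfg S \<in> neutral"
      unfolding S R by (rule neutral_move) (use ST(1) c(1,3) R r_neutral[of T] in simp_all)
    then show False using ST(2) r_neutral[of S] by simp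
  qed
  then show "melem (cre B x * ann B y) S T = 0" unfolding melem_mult by (simp only: infsum_0_simp)
qed

lemma A_charge_preserving: "a \<in> A_algebra B \<Longrightarrow> a \<in> charge_preserving"
  unfolding A_algebra_def closed_subalgebra_generated_def
  using charge_preserving_algebra hop_charge_preserving by blast

lemma op_preserves:
  assumes "a \<in> A_algebra B" "\<And>S. r S = 0 \<Longrightarrow> k S = 0" "r S = 0"
  shows "op a k S = 0"
proof -
  have "melem a S T * k T = 0" for T
    using A_charge_preserving[OF assms(1)] assms(2)[of T] assms(3) by (auto simp: charge_preserving_def)
  then show ?thesis unfolding mop_def by (simp only: infsum_0_simp)
qed

lemma vec_zero: "r S = 0 \<Longrightarrow> vec h S = 0"
  by (simp add: vec_def)

lemma vec_rep_A: "a \<in> A_algebra B \<Longrightarrow> vec (rep a h) = op a (vec h)"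
  by (rule ext) (auto simp: vec_rep op_preserves vec_zero)

lemma vec_lincomb: "vec (\<lambda>\<sigma>. c * h \<sigma> + d * k \<sigma>) = (\<lambda>S. c * vec h S + d * vec k S)"
  by (simp add: vec_def fun_eq_iff algebra_simps)

lemma A_add: "a \<in> A_algebra B \<Longrightarrow> c \<in> A_algebra B \<Longrightarrow> a + c \<in> A_algebra B"
  and A_mult: "a \<in> A_algebra B \<Longrightarrow> c \<in> A_algebra B \<Longrightarrow> a * c \<in> A_algebra B"
  and A_scaleC: "a \<in> A_algebra B \<Longrightarrow> z *\<^sub>C a \<in> A_algebra B"
  and A_one: "1 \<in> A_algebra B"
  unfolding A_algebra_def closed_subalgebra_generated_def is_closed_subalgebra_def by blast+

lemma rep_bounded: "bounded_operator_L2 M (rep a)"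
  unfolding bounded_operator_L2_def
proof (intro conjI ballI allI impI)
  fix h assume h: "h \<in> L2 M"
  then show "rep a h \<in> L2 M" by (rule rep_L2)
  fix k assume k: "k \<in> L2 M"
  have hk: "sqs (vec h)" "sqs (vec k)" using h k L2_iff by auto
  show "L2_eq M (rep a h) (rep a k)" if "L2_eq M h k"
  proof -
    have eq: "vec h = vec k" using that by (simp only: L2_eq_vec)
    have "rep a h = rep a k" by (rule ext) (simp only: rep_def eq)
    then show ?thesis by (simp only: L2_eq_vec)
  qed
  fix c d
  show "L2_eq M (rep a (\<lambda>\<sigma>. c * h \<sigma> + d * k \<sigma>)) (\<lambda>\<sigma>. c * rep a h \<sigma> + d * rep a k \<sigma>)"
    unfolding L2_eq_vec vec_lincomb
    by (rule ext) (simp add: vec_rep vec_lincomb mop_linear[OF bmat_melem hk])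
next
  show "\<exists>C. \<forall>h\<in>L2 M. L2_norm M (rep a h) \<le> C * L2_norm M h"
  proof (intro exI ballI)
    fix h assume h: "h \<in> L2 M"
    then have s: "sqs (vec h)" by (simp add: L2_iff)
    have "sqnorm (vec (rep a h)) \<le> sqnorm (op a (vec h))"
      unfolding sqnorm_def
    proof (rule infsum_mono)
      show "(\<lambda>S. (cmod (vec (rep a h) S))\<^sup>2) summable_on UNIV" using rep_L2[OF h] by (simp add: L2_iff sqs_def)
      show "(\<lambda>S. (cmod (op a (vec h) S))\<^sup>2) summable_on UNIV" using op_sqs[OF s] by (simp add: sqs_def)
    qed (simp add: vec_rep)
    also have "\<dots> \<le> (norm a)\<^sup>2 * sqnorm (vec h)" by (rule op_bound[OF s])
    finally have "sqrt (sqnorm (vec (rep a h))) \<le> sqrt ((norm a)\<^sup>2 * sqnorm (vec h))" by simp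
    then show "L2_norm M (rep a h) \<le> norm a * L2_norm M h"
      by (simp add: L2_norm_vec h rep_L2 real_sqrt_mult)
  qed
qed

lemma rep_representation: "representation_L2 (A_algebra B) M rep"
  unfolding representation_L2_def
proof (intro conjI ballI allI)
  fix h assume "h \<in> L2 M"
  have "op 1 (vec h) S = vec h S" for S
    using r_finite[of S] vec_zero[of S h] by (auto simp: op_one)
  then show "L2_eq M (rep 1 h) h" unfolding L2_eq_vec vec_rep_A[OF A_one] by blast
next
  fix a c h assume ac: "a \<in> A_algebra B" "c \<in> A_algebra B" and h: "h \<in> L2 M"
  have s: "sqs (vec h)" using h by (simp add: L2_iff)
  have "vec (\<lambda>\<sigma>. rep a h \<sigma> + rep c h \<sigma>) = (\<lambda>S. vec (rep a h) S + vec (rep c h) S)"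
    using vec_lincomb[of 1 "rep a h" 1 "rep c h"] by simp
  then show "L2_eq M (rep (a + c) h) (\<lambda>\<sigma>. rep a h \<sigma> + rep c h \<sigma>)"
    unfolding L2_eq_vec using ac by (simp add: vec_rep_A A_add op_add[OF s] fun_eq_iff)
  show "L2_eq M (rep (a * c) h) (rep a (rep c h))"
    unfolding L2_eq_vec using ac by (simp add: vec_rep_A A_mult op_mult[OF s])
next
  fix a z h assume a: "a \<in> A_algebra B" and h: "h \<in> L2 M"
  have s: "sqs (vec h)" using h by (simp add: L2_iff)
  have "vec (\<lambda>\<sigma>. z * rep a h \<sigma>) = (\<lambda>S. z * vec (rep a h) S)" by (simp add: vec_def fun_eq_iff)
  then show "L2_eq M (rep (z *\<^sub>C a) h) (\<lambda>\<sigma>. z * rep a h \<sigma>)"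
    unfolding L2_eq_vec using a by (simp add: vec_rep_A A_scaleC op_scaleC[OF s] fun_eq_iff)
next
  fix a h k assume a: "a \<in> A_algebra B" and h: "h \<in> L2 M" and k: "k \<in> L2 M"
  have s: "sqs (vec h)" "sqs (vec k)" using h k by (simp_all add: L2_iff)
  have "L2_inner M h (rep (adj a) k) = ip (vec h) (vec (rep (adj a) k))"
    by (rule L2_inner_vec[OF h rep_L2[OF k]])
  also have "\<dots> = ip (vec h) (op (adj a) (vec k))"
    unfolding ip_def by (rule infsum_cong) (simp add: vec_rep vec_zero)
  also have "\<dots> = ip (op a (vec h)) (vec k)" by (subst op_adj[OF s(2,1)]) (simp add: adj_adj)
  also have "\<dots> = L2_inner M (rep a h) k"
    by (simp add: L2_inner_vec[OF rep_L2[OF h] k] vec_rep_A[OF a])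
  finally show "L2_inner M h (rep (adj a) k) = L2_inner M (rep a h) k" .
qed (rule rep_bounded)

section \<open>The generators act as in the group representation\<close>

definition sgn_at :: "half_int set \<Rightarrow> half_int \<Rightarrow> complex" where
  "sgn_at S x = (if cfg S x then -1 else 1)"

lemma op_scaleR: "sqs k \<Longrightarrow> op (c *\<^sub>R a) k S = complex_of_real c * op a k S"
  unfolding scaleR_scaleC by (rule op_scaleC)

lemma op_diff: "sqs k \<Longrightarrow> op (a - c) k S = op a k S - op c k S"
  using op_add[of k a "(-1) *\<^sub>C c" S] op_scaleC[of k "-1" c S] by (simp add: scaleC_minus_left)

lemma above_square: "above x \<sigma> * (above x \<sigma> * z) = z"
  by (simp add: above_def flip: power_mult_distrib mult.assoc)

lemma op_number:
  assumes "sqs k"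
  shows "op (cre B x * ann B x) k S = (if finite S \<and> cfg S x then k S else 0)"
proof -
  have "cfg (flip S x) x = (\<not> cfg S x)" by (simp add: cfg_flip)
  then show ?thesis unfolding op_mult[OF assms] by (simp add: op_cre op_ann above_flip above_square)
qed

lemma op_eta:
  assumes "sqs k"
  shows "op (eta B x) k S = (if finite S then sgn_at S x * k S else 0)"
proof -
  have "eta B x = 1 - 2 *\<^sub>R (cre B x * ann B x)" by (simp add: eta_def scaleR_conv_of_real)
  then show ?thesis
    using assms by (simp add: op_diff op_one op_scaleR op_number sgn_at_def)
qed

lemma op_prod_eta:
  assumes "sqs k" "finite S"
  shows "op (prod_list (map (eta B) zs)) k S = prod_list (map (sgn_at S) zs) * k S"
proof (induction zs)
  case Nil
  then show ?case using assms by (simp add: op_one)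
next
  case (Cons z zs)
  then show ?case using assms by (simp add: op_mult op_eta op_sqs mult.assoc)
qed

lemma finite_between: "finite {x<..<y :: half_int}"
  using half_int_interval_finite[of x y] by (simp add: greaterThanLessThan_def greaterThan_def lessThan_def Int_def)

lemma op_eta_between:
  assumes "sqs k" "finite S"
  shows "op (eta_between B x y) k S = (-1) ^ card {z. x < z \<and> z < y \<and> cfg S z} * k S"
proof -
  have "prod_list (map (sgn_at S) (sorted_list_of_set {x<..<y})) = (\<Prod>z\<in>{x<..<y}. sgn_at S z)"
    using finite_between[of x y] by (subst prod.distinct_set_conv_list[symmetric]) simp_all
  also have "\<dots> = (\<Prod>z\<in>{z \<in> {x<..<y}. cfg S z}. -1)"
    unfolding sgn_at_def by (rule prod.mono_neutral_cong_right) (auto simp: finite_between)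
  also have "\<dots> = (-1) ^ card {z. x < z \<and> z < y \<and> cfg S z}" by (simp add: conj_assoc)
  finally show ?thesis unfolding eta_between_def by (simp add: op_prod_eta assms)
qed

lemma above_between:
  assumes "finite S" "x < y"
  shows "above x (cfg S) = (-1) ^ card {z. x < z \<and> z < y \<and> cfg S z} * (if cfg S y then -1 else 1) * above y (cfg S)"
proof -
  let ?I = "{z. x < z \<and> z < y \<and> cfg S z}" and ?Y = "if cfg S y then {y} else {}" and ?U = "{z. y < z \<and> cfg S z}"
  have fin: "finite ?I" "finite ?U" "finite ?Y"
    using finite_above[OF assms(1)] finite_subset[of ?I "{z. x < z \<and> cfg S z}"] by auto
  have "z \<in> {z. x < z \<and> cfg S z} \<longleftrightarrow> z \<in> ?I \<union> (?Y \<union> ?U)" for z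
    using assms(2) by (cases z y rule: linorder_cases) auto
  then have "{z. x < z \<and> cfg S z} = ?I \<union> (?Y \<union> ?U)" by blast
  moreover have "card (?I \<union> (?Y \<union> ?U)) = card ?I + (card ?Y + card ?U)"
    using fin by (subst card_Un_disjoint, auto split: if_splits)+
  ultimately have "card {z. x < z \<and> cfg S z} = card ?I + (card ?Y + card ?U)" by simp
  then show ?thesis by (simp add: above_def power_add)
qed

lemma op_hop:
  assumes k: "sqs k" and S: "finite S" and xy: "x < y"
  shows "op (cre B x * ann B y + cre B y * ann B x) k S =
    (if cfg S x \<noteq> cfg S y then (-1) ^ card {z. x < z \<and> z < y \<and> cfg S z} * k (flip (flip S x) y) else 0)"
proof -
  have neq: "x \<noteq> y" using xy by simp
  have comm: "flip (flip S y) x = flip (flip S x) y" using neq by (auto simp: flip_def)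
  have c: "cfg (flip S x) y = cfg S y" "cfg (flip S y) x = cfg S x" "cfg (flip S y) y = (\<not> cfg S y)"
    using neq by (simp_all add: cfg_flip)
  have a1: "above y (cfg (flip S x)) = above y (cfg S)"
  proof -
    have "{z. y < z \<and> cfg (flip S x) z} = {z. y < z \<and> cfg S z}" using xy by (auto simp: cfg_flip)
    then show ?thesis by (simp add: above_def)
  qed
  let ?e = "(-1) ^ card {z. x < z \<and> z < y \<and> cfg S z} :: complex"
  have ax: "above x (cfg S) = ?e * (if cfg S y then -1 else 1) * above y (cfg S)"
    by (rule above_between[OF S xy])
  have "{z. x < z \<and> z < y \<and> cfg (flip S y) z} = {z. x < z \<and> z < y \<and> cfg S z}" by (auto simp: cfg_flip)
  then have ax': "above x (cfg (flip S y)) = ?e * (if cfg S y then 1 else -1) * above y (cfg S)"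
    using above_between[of "flip S y" x y] S xy by (simp add: c above_flip)
  have 1: "op (cre B x * ann B y) k S = (if cfg S x \<and> \<not> cfg S y then ?e * k (flip (flip S x) y) else 0)"
    unfolding op_mult[OF k] op_cre op_ann using S by (simp add: c a1 ax above_square)
  have 2: "op (cre B y * ann B x) k S = (if cfg S y \<and> \<not> cfg S x then ?e * k (flip (flip S x) y) else 0)"
    unfolding op_mult[OF k] op_cre op_ann using S by (simp add: c ax' comm above_square mult.left_commute[of "above y (cfg S)"])
  show ?thesis unfolding op_add[OF k] 1 2 by auto
qed

lemma cfg_flip_flip:
  assumes "x \<noteq> y" "cfg S x \<noteq> cfg S y"
  shows "cfg (flip (flip S x) y) = act (swap x y) (cfg S)"
proof
  fix z
  show "cfg (flip (flip S x) y) z = act (swap x y) (cfg S) z"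
    using assms by (auto simp: cfg_flip act_swap Transposition.transpose_def)
qed

text \<open>If the sites x and y agree, the hopping term vanishes and the first summand is the identity. If
  they differ, the first summand vanishes and the hopping term is multiplied by its own
  Jordan-Wigner sign, that of the sites strictly between, so that exactly the exchange of the two
  sites remains.\<close>

lemma op_p_transp:
  assumes k: "sqs k" and S: "finite S" and xy: "x < y"
  shows "op (p_transp B x y) k S = k (decfg (act (swap x y) (cfg S)))"
proof -
  let ?H = "cre B x * ann B y + cre B y * ann B x"
  let ?e = "(-1) ^ card {z. x < z \<and> z < y \<and> cfg S z} :: complex"
  let ?s = "sgn_at S x * sgn_at S y"
  have "op (p_transp B x y) k S = 1/2 * (k S + ?s * k S) +
      1/2 * (op ?H k S + ?s * op ?H k S + (?e * op ?H k S - ?s * (?e * op ?H k S)))"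
    unfolding p_transp_def using k S
    by (simp add: op_add op_scaleR op_mult op_one op_eta op_diff op_eta_between op_sqs mult.assoc del: scaleR_add_right)
  also have "\<dots> = k (decfg (act (swap x y) (cfg S)))"
  proof (cases "cfg S x = cfg S y")
    case True
    have "act (swap x y) (cfg S) = cfg S"
      using True by (auto simp: act_swap Transposition.transpose_def fun_eq_iff)
    moreover have "?s = 1" using True by (simp add: sgn_at_def)
    ultimately show ?thesis using True by (simp add: op_hop[OF k S xy])
  next
    case False
    have "decfg (act (swap x y) (cfg S)) = flip (flip S x) y"
      using cfg_flip_flip[of x y S] False xy by (metis cfg_decfg(2) less_irrefl)
    moreover have "?s = -1" using False by (simp add: sgn_at_def)
    moreover have "?e * (?e * z) = z" for z by (simp flip: power_mult_distrib mult.assoc)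
    ultimately show ?thesis using False by (simp add: op_hop[OF k S xy])
  qed
  finally show ?thesis .
qed

text \<open>Multiplication with the square root of the Radon-Nikodym derivative replaces the root of the
  mass at a configuration by the one at its image, so under \<open>vec\<close> the group acts by
  permuting coordinates, as \<open>p_transp\<close> does.\<close>

lemma rep_TM_factor: "TM_factor B M rep"
  unfolding TM_factor_def
proof (intro conjI allI ballI impI)
  show "representation_L2 (A_algebra B) M rep" by (rule rep_representation)
next
  fix x h assume "h \<in> L2 M"
  then have s: "sqs (vec h)" by (simp add: L2_iff)
  show "L2_eq M (rep (p_eps B x) h) (TM_fun (d_fun x) h)"
    unfolding L2_eq_vec
  proof
    fix S
    show "vec (rep (p_eps B x) h) S = vec (TM_fun (d_fun x) h) S"
      unfolding vec_rep p_eps_def op_eta[OF s] using r_finite[of S]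
      by (simp add: vec_def TM_fun_def d_fun_def occ_def sgn_at_def)
  qed
next
  fix x y :: half_int and h assume xy: "x < y" and "h \<in> L2 M"
  then have s: "sqs (vec h)" by (simp add: L2_iff)
  show "L2_eq M (rep (p_transp B x y) h) (TM_perm M (swap x y) h)"
    unfolding L2_eq_vec
  proof
    fix S
    show "vec (rep (p_transp B x y) h) S = vec (TM_perm M (swap x y) h) S"
    proof (cases "r S = 0")
      case False
      have "vec (rep (p_transp B x y) h) S = vec h (decfg (act (swap x y) (cfg S)))"
        using False r_finite[of S] by (simp add: vec_rep op_p_transp[OF s _ xy])
      also have "\<dots> = vec (TM_perm M (swap x y) h) S"
        using False by (simp add: vec_def TM_perm_def RN_deriv_swap[OF \<rho> quasi False])
      finally show ?thesis .
    qed (simp add: vec_def vec_rep)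
  qed
qed

text \<open>The constant function 1 corresponds to the vector of root masses.\<close>

lemma phi_M_rep:
  assumes "a \<in> A_algebra B"
  shows "phi_M M rep a = vstate Psi a"
proof -
  have one: "vec (\<lambda>_. 1) = Psi" by (simp add: vec_def fun_eq_iff)
  have "(\<lambda>_. 1) \<in> L2 M" by (simp add: L2_iff one Psi_sqs)
  then show ?thesis
    unfolding phi_M_def vstate_def
    by (subst L2_inner_vec) (simp_all add: rep_L2 one vec_rep_A[OF assms])
qed

end

section \<open>Quasi-freeness\<close>

definition ih :: "half_int \<Rightarrow> int" where "ih = inv_into UNIV hi"

lemma ih_hi [simp]: "ih (hi m) = m"
  unfolding ih_def by (rule inv_into_f_f) (auto intro: injI)

definition up_vec :: "(nat \<Rightarrow> real) \<Rightarrow> int \<Rightarrow> half_int \<Rightarrow> complex" where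
  "up_vec a m x = complex_of_real (zero_ext a (ih x - m))"

definition down_vec :: "(nat \<Rightarrow> real) \<Rightarrow> int \<Rightarrow> half_int \<Rightarrow> complex" where
  "down_vec a m x = complex_of_real (zero_ext a (m - ih x))"

lemma up_vec_hi: "up_vec a m (hi (m + int k)) = complex_of_real (a k)"
  by (simp add: up_vec_def zero_ext_def)

lemma down_vec_hi: "down_vec a m (hi (m - int k)) = complex_of_real (a k)"
  by (simp add: down_vec_def zero_ext_def)

lemma up_vec_outside: "x \<notin> range (\<lambda>k. hi (m + int k)) \<Longrightarrow> up_vec a m x = 0"
proof -
  assume x: "x \<notin> range (\<lambda>k. hi (m + int k))"
  obtain n where n: "x = hi n" by (rule half_int_cases)
  have "n < m"
  proof (rule ccontr)
    assume "\<not> n < m"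
    then have "x = hi (m + int (nat (n - m)))" using n by simp
    then show False using x by blast
  qed
  then show ?thesis by (simp add: up_vec_def zero_ext_def n)
qed

lemma down_vec_outside: "x \<notin> range (\<lambda>k. hi (m - int k)) \<Longrightarrow> down_vec a m x = 0"
proof -
  assume x: "x \<notin> range (\<lambda>k. hi (m - int k))"
  obtain n where n: "x = hi n" by (rule half_int_cases)
  have "m < n"
  proof (rule ccontr)
    assume "\<not> m < n"
    then have "x = hi (m - int (nat (m - n)))" using n by simp
    then show False using x by blast
  qed
  then show ?thesis by (simp add: down_vec_def zero_ext_def n)
qed

lemma inj_sites: "inj (\<lambda>k. hi (m + int k))" "inj (\<lambda>k. hi (m - int k))"
  by (auto intro!: injI)

lemma summable_square:
  fixes a :: "nat \<Rightarrow> real"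
  assumes "summable (\<lambda>k. \<bar>a k\<bar>)"
  shows "(\<lambda>k. (a k)\<^sup>2) summable_on UNIV"
proof -
  have s: "(\<lambda>k. \<bar>a k\<bar>) summable_on UNIV"
    by (rule norm_summable_imp_summable_on) (use assms in simp)
  have le: "\<bar>a k\<bar> \<le> (\<Sum>\<^sub>\<infinity>k. \<bar>a k\<bar>)" for k
    using finite_sum_le_infsum[OF s, of "{k}"] by simp
  show ?thesis
  proof (rule summable_on_comparison_test)
    show "(\<lambda>k. (\<Sum>\<^sub>\<infinity>k. \<bar>a k\<bar>) * \<bar>a k\<bar>) summable_on UNIV" by (rule summable_on_cmult_right[OF s])
    show "(a k)\<^sup>2 \<le> (\<Sum>\<^sub>\<infinity>k. \<bar>a k\<bar>) * \<bar>a k\<bar>" for k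
      using mult_right_mono[OF le[of k], of "\<bar>a k\<bar>"] by (simp add: power2_eq_square)
  qed simp
qed

lemma up_vec_sqs:
  assumes "summable (\<lambda>k. \<bar>a k\<bar>)"
  shows "sqs (up_vec a m)"
proof -
  let ?s = "\<lambda>k. hi (m + int k)"
  have "((\<lambda>x. (cmod (up_vec a m x))\<^sup>2) \<circ> ?s) summable_on UNIV"
    using summable_square[OF assms] by (simp add: o_def up_vec_hi)
  then have "(\<lambda>x. (cmod (up_vec a m x))\<^sup>2) summable_on range ?s"
    using summable_on_reindex[OF inj_sites(1)[of m]] by blast
  also have "?this \<longleftrightarrow> (\<lambda>x. (cmod (up_vec a m x))\<^sup>2) summable_on UNIV"
    by (rule summable_on_cong_neutral) (auto simp: up_vec_outside)
  finally show ?thesis by (simp add: sqs_def)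
qed

lemma down_vec_sqs:
  assumes "summable (\<lambda>k. \<bar>a k\<bar>)"
  shows "sqs (down_vec a m)"
proof -
  let ?s = "\<lambda>k. hi (m - int k)"
  have "((\<lambda>x. (cmod (down_vec a m x))\<^sup>2) \<circ> ?s) summable_on UNIV"
    using summable_square[OF assms] by (simp add: o_def down_vec_hi)
  then have "(\<lambda>x. (cmod (down_vec a m x))\<^sup>2) summable_on range ?s"
    using summable_on_reindex[OF inj_sites(2)[of m]] by blast
  also have "?this \<longleftrightarrow> (\<lambda>x. (cmod (down_vec a m x))\<^sup>2) summable_on UNIV"
    by (rule summable_on_cong_neutral) (auto simp: down_vec_outside)
  finally show ?thesis by (simp add: sqs_def)
qed

lemma up_vec_infsum: "(\<Sum>\<^sub>\<infinity>x. up_vec a m x * F x) = conv_up a (\<lambda>y. F (hi y)) m"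
proof -
  let ?s = "\<lambda>k. hi (m + int k)"
  have "(\<Sum>\<^sub>\<infinity>x. up_vec a m x * F x) = (\<Sum>\<^sub>\<infinity>x\<in>range ?s. up_vec a m x * F x)"
    by (rule infsum_cong_neutral) (auto simp: up_vec_outside)
  also have "\<dots> = (\<Sum>\<^sub>\<infinity>k. up_vec a m (?s k) * F (?s k))"
    by (subst infsum_reindex[OF inj_sites(1)]) (simp add: o_def)
  finally show ?thesis by (simp add: up_vec_hi conv_up_def)
qed

lemma down_vec_infsum: "(\<Sum>\<^sub>\<infinity>x. down_vec a m x * F x) = conv_down a (\<lambda>y. F (hi y)) m"
proof -
  let ?s = "\<lambda>k. hi (m - int k)"
  have "(\<Sum>\<^sub>\<infinity>x. down_vec a m x * F x) = (\<Sum>\<^sub>\<infinity>x\<in>range ?s. down_vec a m x * F x)"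
    by (rule infsum_cong_neutral) (auto simp: down_vec_outside)
  also have "\<dots> = (\<Sum>\<^sub>\<infinity>k. down_vec a m (?s k) * F (?s k))"
    by (subst infsum_reindex[OF inj_sites(2)]) (simp add: o_def)
  finally show ?thesis by (simp add: down_vec_hi conv_down_def)
qed

text \<open>Bounded functionals that are linear over the complex scalars of the algebra.\<close>

definition cfunctional :: "('c::cstar_algebra \<Rightarrow> complex) \<Rightarrow> bool" where
  "cfunctional L \<longleftrightarrow> (\<forall>a c. L (a + c) = L a + L c) \<and> (\<forall>z a. L (z *\<^sub>C a) = z * L a) \<and>
     (\<exists>C. \<forall>a. cmod (L a) \<le> C * norm a)"

lemma cfunctional_bounded_linear: "cfunctional L \<Longrightarrow> bounded_linear L"
proof -
  assume L: "cfunctional L"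
  then obtain C where "\<And>a. cmod (L a) \<le> C * norm a" by (auto simp: cfunctional_def)
  then show ?thesis using L
    by (intro bounded_linear_intro[of L C]) (simp_all add: cfunctional_def scaleR_scaleC scaleR_conv_of_real mult.commute)
qed

lemma cfunctional_right: "cfunctional L \<Longrightarrow> cfunctional (\<lambda>a. L (a * c))"
proof -
  assume L: "cfunctional L"
  then obtain C where C: "\<And>a. cmod (L a) \<le> C * norm a" by (auto simp: cfunctional_def)
  have C0: "0 \<le> C" using order_trans[OF norm_ge_zero C[of 1]] by simp
  have "cmod (L (a * c)) \<le> (C * norm c) * norm a" for a
    using order_trans[OF C[of "a * c"] mult_left_mono[OF norm_mult_ineq C0]] by (simp add: mult_ac)
  then show ?thesis using L unfolding cfunctional_def by (auto simp: distrib_right mult_scaleC_left)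
qed

lemma cfunctional_add: "cfunctional L \<Longrightarrow> cfunctional L' \<Longrightarrow> cfunctional (\<lambda>a. L a + L' a)"
proof -
  assume L: "cfunctional L" "cfunctional L'"
  then obtain C C' where "\<And>a. cmod (L a) \<le> C * norm a" "\<And>a. cmod (L' a) \<le> C' * norm a"
    unfolding cfunctional_def by blast
  then have "cmod (L a + L' a) \<le> (C + C') * norm a" for a
    using norm_triangle_mono[of "L a" "C * norm a" "L' a" "C' * norm a"] by (simp add: distrib_right)
  then have "\<exists>K. \<forall>a. cmod (L a + L' a) \<le> K * norm a" by blast
  then show ?thesis using L unfolding cfunctional_def by (simp add: distrib_left)
qed

lemma cfunctional_mult: "cfunctional L \<Longrightarrow> cfunctional (\<lambda>a. w * L a)"
proof -
  assume L: "cfunctional L"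
  then obtain C where C: "\<And>a. cmod (L a) \<le> C * norm a" by (auto simp: cfunctional_def)
  have "cmod (w * L a) \<le> (cmod w * C) * norm a" for a
    using mult_left_mono[OF C[of a], of "cmod w"] by (simp add: norm_mult mult.assoc)
  then have "\<exists>K. \<forall>a. cmod (w * L a) \<le> K * norm a" by blast
  then show ?thesis using L unfolding cfunctional_def by (simp add: distrib_left)
qed

lemma cfunctional_zero: "cfunctional (\<lambda>a. 0)"
  unfolding cfunctional_def by (auto intro: exI[of _ 0])

lemma cfunctional_sum: "(\<And>i. i \<in> I \<Longrightarrow> cfunctional (L i)) \<Longrightarrow> cfunctional (\<lambda>a. \<Sum>i\<in>I. L i a)"
  by (induction I rule: infinite_finite_induct) (simp_all add: cfunctional_zero cfunctional_add)

context car
begin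

lemma functional_left:
  assumes "cfunctional L" "sqs p"
  shows "L (B (p, \<lambda>_. 0)) = (\<Sum>\<^sub>\<infinity>x. p x * L (cre B x))"
proof -
  have "((\<lambda>x. L (p x *\<^sub>C cre B x)) has_sum L (B (p, \<lambda>_. 0))) UNIV"
    by (rule has_sum_bounded_linear[OF cfunctional_bounded_linear[OF assms(1)] B_left_has_sum[OF assms(2)]])
  then show ?thesis using assms(1) by (simp add: cfunctional_def infsumI)
qed

lemma functional_right:
  assumes "cfunctional L" "sqs p"
  shows "L (B (\<lambda>_. 0, p)) = (\<Sum>\<^sub>\<infinity>x. p x * L (ann B x))"
proof -
  have "((\<lambda>x. L (p x *\<^sub>C ann B x)) has_sum L (B (\<lambda>_. 0, p))) UNIV"
    by (rule has_sum_bounded_linear[OF cfunctional_bounded_linear[OF assms(1)] B_right_has_sum[OF assms(2)]])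
  then show ?thesis using assms(1) by (simp add: cfunctional_def infsumI)
qed

lemma norm_cre: "norm (cre B x) \<le> 1"
proof -
  have "sqnorm (basis_vec x) = 1" using ip_self_sqs[OF basis_sqs[of x]] by (simp add: ip_basis)
  then show ?thesis using norm_B_left[OF basis_sqs[of x]] by (simp add: cre_def)
qed

lemma norm_ann: "norm (ann B x) \<le> 1"
  using norm_cre[of x] norm_adj[of "cre B x"] by (simp add: adj_cre)

text \<open>The vectors in the hypotheses span a dense subspace of the one-particle space. In dual form: the
  values of L at the creation operators form a bounded sequence, to which
  \<open>bounded_sequence_vanishes\<close> applies, and likewise for the annihilation operators.\<close>

lemma functional_vanishes:
  assumes L: "cfunctional L" and h: "summable (\<lambda>k. \<bar>h k\<bar>)" and g: "summable (\<lambda>k. \<bar>g k\<bar>)"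
    and hg: "\<And>n. (\<Sum>k\<le>n. h k * g (n - k)) = (if n = 0 then 1 else 0)"
    and 1: "\<And>m. m < 0 \<Longrightarrow> L (B (up_vec h m, \<lambda>_. 0)) = 0"
    and 2: "\<And>m. 0 \<le> m \<Longrightarrow> L (B (\<lambda>_. 0, down_vec g m)) = 0"
    and 3: "\<And>m. m < 0 \<Longrightarrow> L (B (\<lambda>_. 0, up_vec h m)) = 0"
    and 4: "\<And>m. 0 \<le> m \<Longrightarrow> L (B (down_vec g m, \<lambda>_. 0)) = 0"
    and f: "f \<in> K_space"
  shows "L (B f) = 0"
proof -
  obtain C where C: "\<And>a. cmod (L a) \<le> C * norm a" using L by (auto simp: cfunctional_def)
  have C0: "0 \<le> C" using order_trans[OF norm_ge_zero C[of 1]] by simp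
  have bc: "cmod (L (cre B (hi y))) \<le> C" "cmod (L (ann B (hi y))) \<le> C" for y
    using order_trans[OF C mult_left_mono[OF norm_cre C0]] order_trans[OF C mult_left_mono[OF norm_ann C0]] by simp_all
  have "L (cre B (hi y)) = 0" for y
  proof (rule bounded_sequence_vanishes[OF h g bc(1) hg])
    show "conv_up h (\<lambda>y. L (cre B (hi y))) m = 0" if "m < 0" for m
      using 1[OF that] functional_left[OF L up_vec_sqs[OF h], of m] by (simp add: up_vec_infsum)
    show "conv_down g (\<lambda>y. L (cre B (hi y))) m = 0" if "0 \<le> m" for m
      using 4[OF that] functional_left[OF L down_vec_sqs[OF g], of m] by (simp add: down_vec_infsum)
  qed
  then have cre: "L (cre B x) = 0" for x by (metis half_int_cases)
  have "L (ann B (hi y)) = 0" for y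
  proof (rule bounded_sequence_vanishes[OF h g bc(2) hg])
    show "conv_up h (\<lambda>y. L (ann B (hi y))) m = 0" if "m < 0" for m
      using 3[OF that] functional_right[OF L up_vec_sqs[OF h], of m] by (simp add: up_vec_infsum)
    show "conv_down g (\<lambda>y. L (ann B (hi y))) m = 0" if "0 \<le> m" for m
      using 2[OF that] functional_right[OF L down_vec_sqs[OF g], of m] by (simp add: down_vec_infsum)
  qed
  then have ann: "L (ann B x) = 0" for x by (metis half_int_cases)
  obtain p q where "f = (p, q)" by (cases f)
  with f have pq: "f = (p, q)" "sqs p" "sqs q" by (simp_all add: K_pair)
  have "L (B f) = L (B (p, \<lambda>_. 0)) + L (B (\<lambda>_. 0, q))"
    using L pq by (simp add: B_split cfunctional_def)
  then show ?thesis by (simp add: functional_left[OF L pq(2)] functional_right[OF L pq(3)] cre ann)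
qed

end

context schur_car
begin

abbreviation h :: "nat \<Rightarrow> real" where "h \<equiv> hcoef \<rho>"
abbreviation g :: "nat \<Rightarrow> real" where "g \<equiv> gcoef \<rho>"
abbreviation \<phi> :: "'c \<Rightarrow> complex" where "\<phi> \<equiv> vstate Psi"

lemma h_summable: "summable (\<lambda>k. \<bar>h k\<bar>)" and g_summable: "summable (\<lambda>k. \<bar>g k\<bar>)"
  using summable_of_summable_index coef_decay[OF \<rho>] by auto

lemma phi_state: "state \<phi>"
  by (rule vstate_state[OF Psi_sqs Psi_norm]) (use r_finite in force)

lemma phi_functional: "cfunctional \<phi>"
  unfolding cfunctional_def
  using vstate_add[OF Psi_sqs] vstate_scaleC[OF Psi_sqs] vstate_bound[OF Psi_sqs] Psi_norm
  by (auto intro!: exI[of _ 1])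

lemma coordinate_functional: "cfunctional (\<lambda>a. op a Psi S)"
  unfolding cfunctional_def
proof (intro conjI allI exI)
  fix a
  have "(cmod (op a Psi S))\<^sup>2 \<le> sqnorm (op a Psi)"
    using sum_le_sqnorm[OF op_sqs[OF Psi_sqs, of a], of "{S}"] by simp
  also have "\<dots> \<le> (norm a)\<^sup>2" using op_bound[OF Psi_sqs, of a] by (simp add: Psi_norm)
  finally show "cmod (op a Psi S) \<le> 1 * norm a" by (simp add: power2_le_iff_abs_le)
qed (simp_all add: op_add[OF Psi_sqs] op_scaleC[OF Psi_sqs])

text \<open>The components of the image are those of \<open>amp_creation_relation\<close>, up to
  normalization.\<close>

lemma kernel_up:
  assumes "m < 0"
  shows "op (B (up_vec h m, \<lambda>_. 0)) Psi S = 0"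
proof (cases "finite S")
  case True
  have "op (B (up_vec h m, \<lambda>_. 0)) Psi S = conv_up h (\<lambda>y. op (cre B (hi y)) Psi S) m"
    using functional_left[OF coordinate_functional up_vec_sqs[OF h_summable]] by (simp add: up_vec_infsum)
  also have "\<dots> = (\<Sum>\<^sub>\<infinity>k. (complex_of_real (h k) * (if cfg S (hi (m + int k))
      then above (hi (m + int k)) (cfg S) * complex_of_real (amp \<rho> ((cfg S)(hi (m + int k) := False))) else 0)) *
      complex_of_real (1 / sqrt (schur_norm \<rho>)))"
    unfolding conv_up_def
    by (rule infsum_cong) (simp add: op_cre True root_mass_def cfg_flip)
  also have "\<dots> = 0"
    by (subst infsum_cmult_left') (simp add: amp_creation_relation[OF assms])
  finally show ?thesis .
next
  case False
  have "op (B (up_vec h m, \<lambda>_. 0)) Psi S = conv_up h (\<lambda>y. op (cre B (hi y)) Psi S) m"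
    using functional_left[OF coordinate_functional up_vec_sqs[OF h_summable]] by (simp add: up_vec_infsum)
  then show ?thesis using False by (simp add: op_cre conv_up_def)
qed

text \<open>The components of the image are those of \<open>amp_annihilation_relation\<close>, up to
  normalization.\<close>

lemma kernel_down:
  assumes "0 \<le> m"
  shows "op (B (\<lambda>_. 0, down_vec g m)) Psi S = 0"
proof (cases "finite S")
  case True
  have "op (B (\<lambda>_. 0, down_vec g m)) Psi S = conv_down g (\<lambda>y. op (ann B (hi y)) Psi S) m"
    using functional_right[OF coordinate_functional down_vec_sqs[OF g_summable]] by (simp add: down_vec_infsum)
  also have "\<dots> = (\<Sum>\<^sub>\<infinity>k. (complex_of_real (g k) * (if \<not> cfg S (hi (m - int k))
      then above (hi (m - int k)) (cfg S) * complex_of_real (amp \<rho> ((cfg S)(hi (m - int k) := True))) else 0)) *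
      complex_of_real (1 / sqrt (schur_norm \<rho>)))"
    unfolding conv_down_def
    by (rule infsum_cong) (simp add: op_ann True root_mass_def cfg_flip)
  also have "\<dots> = 0"
    by (subst infsum_cmult_left') (simp only: amp_annihilation_relation[OF assms] mult_zero_left)
  finally show ?thesis .
next
  case False
  have "op (B (\<lambda>_. 0, down_vec g m)) Psi S = conv_down g (\<lambda>y. op (ann B (hi y)) Psi S) m"
    using functional_right[OF coordinate_functional down_vec_sqs[OF g_summable]] by (simp add: down_vec_infsum)
  then show ?thesis using False by (simp add: op_ann conv_down_def)
qed

text \<open>Both sides are bounded and linear in f, so their difference L need only be shown to vanish on
  the vectors of \<open>functional_vanishes\<close>. If \<open>B f\<close> annihilates the state
  vector, it can be anticommuted through the product to its right end, where it gives 0; the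
  scalars left behind are the two-point values. If \<open>B f\<close> is the adjoint of such an
  operator, it gives 0 at the left end, on both sides of the identity.\<close>

lemma wick_step:
  assumes f: "f \<in> K_space" and xs: "set xs \<subseteq> B ` K_space"
  shows "\<phi> (B f * prod_list xs) = (\<Sum>j<length xs. (-1) ^ j * \<phi> (B f * xs ! j) * \<phi> (prod_list (omit j xs)))"
proof -
  \<comment> \<open>The difference of the two sides as a functional of the first factor.\<close>
  define L where "L a = \<phi> (a * prod_list xs) + (\<Sum>j<length xs. (- ((-1) ^ j * \<phi> (prod_list (omit j xs)))) * \<phi> (a * xs ! j))" for a
  have L: "cfunctional L"
    unfolding L_def by (intro cfunctional_add cfunctional_sum cfunctional_mult cfunctional_right phi_functional)
  have eq: "L (B f) = \<phi> (B f * prod_list xs) - (\<Sum>j<length xs. (-1) ^ j * \<phi> (B f * xs ! j) * \<phi> (prod_list (omit j xs)))" for f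
    by (simp add: L_def sum_negf mult_ac)
  have kill_right: "L (B f) = 0" if fK: "f \<in> K_space" and ker: "\<And>S. op (B f) Psi S = 0" for f
  proof -
    have k: "\<phi> (c * B f) = 0" for c by (rule vstate_kernel[OF Psi_sqs ker])
    have ac: "B f * x + x * B f = \<phi> (B f * x) *\<^sub>C 1" if x: "x \<in> set xs" for x
    proof -
      obtain e where e: "e \<in> K_space" "x = B e" using x xs by blast
      have ac: "B f * x + x * B f = K_inner (Gam f) e *\<^sub>C 1" unfolding e(2) by (rule B_anticommute[OF fK e(1)])
      have "\<phi> (B f * x + x * B f) = \<phi> (B f * x)" using k by (simp add: vstate_add[OF Psi_sqs])
      moreover have "\<phi> (K_inner (Gam f) e *\<^sub>C 1) = K_inner (Gam f) e"
        using phi_state by (simp add: state_def)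
      ultimately show ?thesis using ac by simp
    qed
    have "\<phi> (B f * prod_list xs) = (\<Sum>j<length xs. ((-1) ^ j * \<phi> (B f * xs ! j)) * \<phi> (prod_list (omit j xs)))
      + (-1) ^ length xs * \<phi> (prod_list xs * B f)"
    proof -
      have sum: "\<phi> (sum F I) = (\<Sum>i\<in>I. \<phi> (F i))" for F and I :: "nat set"
        using cfunctional_bounded_linear[OF phi_functional] by (simp add: bounded_linear.linear linear_sum)
      show ?thesis
        by (subst anticommute_through[OF ac]) (simp_all add: vstate_add[OF Psi_sqs] vstate_scaleC[OF Psi_sqs] sum)
    qed
    then show ?thesis unfolding eq by (simp add: k)
  qed
  have kill_left: "L (B (Gam f)) = 0" if fK: "f \<in> K_space" and ker: "\<And>S. op (B f) Psi S = 0" for f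
  proof -
    have "\<phi> (B (Gam f) * c) = 0" for c
    proof -
      have "B (Gam f) * c = adj (adj c * B f)" using fK by (simp add: adj_mult adj_adj adj_B)
      then show ?thesis by (simp add: vstate_adj[OF Psi_sqs] vstate_kernel[OF Psi_sqs ker])
    qed
    then show ?thesis unfolding eq by simp
  qed
  have Gam_up: "Gam (up_vec h m, \<lambda>_. 0) = (\<lambda>_. 0, up_vec h m)" for m
    by (simp add: Gam_def conj_J_def up_vec_def[abs_def])
  have Gam_down: "Gam (\<lambda>_. 0, down_vec g m) = (down_vec g m, \<lambda>_. 0)" for m
    by (simp add: Gam_def conj_J_def down_vec_def[abs_def])
  have "L (B f) = 0"
  proof (rule functional_vanishes[OF L h_summable g_summable hg_inverse _ _ _ _ f])
    show "L (B (up_vec h m, \<lambda>_. 0)) = 0" if "m < 0" for m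
      by (rule kill_right) (simp_all add: K_pair zero_sqs up_vec_sqs h_summable kernel_up that)
    show "L (B (\<lambda>_. 0, down_vec g m)) = 0" if "0 \<le> m" for m
      by (rule kill_right) (simp_all add: K_pair zero_sqs down_vec_sqs g_summable kernel_down that)
    show "L (B (\<lambda>_. 0, up_vec h m)) = 0" if "m < 0" for m
      unfolding Gam_up[symmetric]
      by (rule kill_left) (simp_all add: K_pair zero_sqs up_vec_sqs h_summable kernel_up that)
    show "L (B (down_vec g m, \<lambda>_. 0)) = 0" if "0 \<le> m" for m
      unfolding Gam_down[symmetric]
      by (rule kill_left) (simp_all add: K_pair zero_sqs down_vec_sqs g_summable kernel_down that)
  qed
  then show ?thesis unfolding eq by simp
qed

lemma phi_quasi_free: "quasi_free_state B \<phi>"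
  unfolding quasi_free_state_def
proof (intro conjI allI impI phi_state)
  fix n and f :: "nat \<Rightarrow> (half_int \<Rightarrow> complex) \<times> (half_int \<Rightarrow> complex)"
  assume f: "\<forall>i. f i \<in> K_space"
  have "\<phi> 1 = 1" using phi_state by (simp add: state_def)
  then have "\<phi> (prod_list (map (\<lambda>i. B (f i)) [1..<2 * n + 2])) = 0 \<and>
    \<phi> (prod_list (map (\<lambda>i. B (f i)) [1..<2 * n + 1])) = pairing_sum n (\<lambda>i k. \<phi> (B (f i) * B (f k)))"
  proof (rule wick_pairing_sum)
    fix x xs assume "x \<in> B ` K_space" "set xs \<subseteq> B ` K_space"
    then show "\<phi> (x * prod_list xs) = (\<Sum>j<length xs. (-1) ^ j * \<phi> (x * xs ! j) * \<phi> (prod_list (omit j xs)))"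
      using wick_step by blast
  qed (use f in blast)
  then show "\<phi> (prod_list (map (\<lambda>i. B (f i)) [1..<2 * n + 2])) = 0"
    and "\<phi> (prod_list (map (\<lambda>i. B (f i)) [1..<2 * n + 1])) = (-1) ^ (n * (n - 1) div 2) *
      (\<Sum>\<sigma>\<in>pairing_perms n. of_int (sign \<sigma>) * (\<Prod>i=1..n. \<phi> (B (f (\<sigma> i)) * B (f (\<sigma> (i + n))))))"
    unfolding pairing_sum_def by blast+
qed

end

theorem theorem1p14:
  fixes B :: "(half_int \<Rightarrow> complex) \<times> (half_int \<Rightarrow> complex) \<Rightarrow> 'c::cstar_algebra"
    and \<rho> :: "(nat \<Rightarrow> real) \<times> (nat \<Rightarrow> real)"
  assumes "car_algebra B"
    and "\<rho> \<in> thoma_open"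
    and "quasi_invariant (schur_measure \<rho>)"
  shows "perfect B (schur_measure \<rho>)"
proof -
  interpret schur_car B \<rho>
    by (intro schur_car.intro car.intro schur_car_axioms.intro) (use assms in simp_all)
  show ?thesis
    unfolding perfect_def using rep_TM_factor phi_quasi_free phi_M_rep by blast
qed

end
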